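(* Let $0<\beta<\infty$ and let $m,n$ be positive integers. Let $\mathcal J$ be the $n\times n$ matrix from the $L\beta E_{(m,n)}$ ensemble, and let $l$ be a random variable independent of $\mathcal J$ distributed according to an absolutely continuous probability distribution $F(l)\,dl$ on $(0,+\infty)$. Put $\mathcal J_l=\mathcal J+i\,l\,I_{1\times1}$ and $a=|m-n|+1-2/\beta$. (i) If $m\ge n$, then the eigenvalues $\{z_1,\dots,z_n\}$ of $\mathcal J_l$ are distributed on $$\Big\{(z_j)_{j=1}^n\in(\mathbb C_+)^n:\ \sum_{j=1}^n\operatorname{Arg}z_j<\tfrac\pi2\Big\}$$ according to $$\frac{1}{q_{\beta,n,a}}\prod_{j,k=1}^n|z_j-\bar z_k|^{\frac\beta2-1}\prod_{j<k}|z_j-z_k|^2\,e^{-\frac12\sum_{j=1}^n\operatorname{Re}z_j}\Big(\operatorname{Re}\prod_{j=1}^nz_j\Big)^{\frac{\beta a}{2}}\frac{F(l)}{l^{\frac{\beta n}{2}-1}}\,d^2z_1\cdots d^2z_n,$$ where in this formula $l=\sum_{j=1}^n\operatorname{Im}z_j$ and $q_{\beta,n,a}=2^{n(\beta/2-1)}\,l_{\beta,n,a}\,c_{\beta,n}$. (ii) If $m\le n-1$, then the eigenvalues of $\mathcal J_l$ are $\{z_1,\dots,z_{m+1},0,\dots,0\}$ with $\{z_1,\dots,z_{m+1}\}=:\{r_1e^{i\theta_1},\dots,r_{m+1}e^{i\theta_{m+1}}\}$ distributed on $$\Big\{(z_j)_{j=1}^{m+1}\in(\mathbb C_+)^{m+1}:\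 \sum_{j=1}^{m+1}\operatorname{Arg}z_j=\tfrac\pi2\Big\}$$ according to $$\frac{1}{t_{\beta,m,n}}\prod_{j,k=1}^{m+1}|z_j-\bar z_k|^{\frac\beta2-1}\prod_{1\le j<k\le m+1}|z_j-z_k|^2\,e^{-\frac12\sum_{j=1}^{m+1}\operatorname{Re}z_j}\prod_{j=1}^{m+1}|z_j|^{\frac{\beta(n-m-1)}{2}}\frac{F(l)}{l^{\frac{\beta n}{2}-1}}\,dr_1\cdots dr_{m+1}\,d\theta_1\cdots d\theta_m,$$ where in this formula $l=\sum_{j=1}^{m+1}\operatorname{Im}z_j$, $\theta_{m+1}=\frac\pi2-\sum_{j=1}^m\theta_j$, and $t_{\beta,m,n}=(m+1)\,2^{(m+1)(\beta/2-1)}\,l_{\beta,m,a}\,d_{\beta,m,n}$. Here, for a positive integer $N$, $$l_{\beta,N,a}=2^{N(a\beta/2+1+(N-1)\beta/2)}\prod_{j=1}^N\frac{\Gamma(1+\beta j/2)\,\Gamma(1+\beta a/2+\beta(j-1)/2)}{\Gamma(1+\beta/2)},$$ $$c_{\beta,n}=\frac{\Gamma(\beta/2)^n}{\Gamma(\beta n/2)},\qquad d_{\beta,m,n}=\frac{\Gamma(\beta(n-m)/2)\,\Gamma(\beta/2)^m}{\Gamma(\beta n/2)}.$$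
   Context: $\mathbb C_+=\{z\in\mathbb C:\operatorname{Im}z>0\}$; $\operatorname{Arg}$ is the principal argument (so $\operatorname{Arg}z\in(0,\pi)$ for $z\in\mathbb C_+$); $d^2z$ is the 2-dimensional Lebesgue measure on $\mathbb C$. $I_{1\times1}$ is the $n\times n$ matrix with $(1,1)$-entry equal to $1$ and all other entries $0$. In $z_j=r_je^{i\theta_j}$, $r_j=|z_j|$ and $\theta_j=\operatorname{Arg}z_j$. For $k>0$, $\chi_k$ is the law on $(0,\infty)$ with density $\frac{2^{1-k/2}}{\Gamma(k/2)}x^{k-1}e^{-x^2/2}$. $L\beta E_{(m,n)}$ (Laguerre $\beta$-ensemble): the random $n\times n$ real symmetric tridiagonal matrix $\mathcal J=B^*B$, where $B$ is the $n\times n$ upper bidiagonal matrix with diagonal entries $x_1,\dots,x_n$, superdiagonal entries ($(j,j+1)$-entry) $y_1,\dots,y_{n-1}$, and zeros elsewhere, with all nonzero entries independent and: if $m\ge n$, $x_j\sim\chi_{\beta(m-j+1)}$ ($1\le j\le n$) and $y_j\sim\chi_{\beta(n-j)}$ ($1\le j\le n-1$); if $m\le n-1$, $x_j\sim\chi_{\beta(m-j+1)}$ for $1\le j\le m$, $x_j=0$ for $m+1\le j\le n$, $y_j\sim\chi_{\beta(n-j)}$ for $1\le j\le m$, $y_j=0$ for $m+1\le j\le n-1$. Conventions: statements hold with probability $1$. Eigenvalues are counted with algebraic multiplicity and are unordered, i.e. the (symmetric) density is that of the points $z_j$ listed in a uniformly random order. *)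

theory Defs
  imports
    "HOL-Probability.Probability"
    "HOL-Combinatorics.Multiset_Permutations"
    "Jordan_Normal_Form.Char_Poly"
begin

definition chi_density :: "real \<Rightarrow> real \<Rightarrow> real" where
  "chi_density k x =
     (if 0 < x then 2 powr (1 - k / 2) / Gamma (k / 2) * x powr (k - 1) * exp (- (x\<^sup>2) / 2) else 0)"

(* The sequences x and y are indexed from 1; matrix positions are indexed from 0. *)
definition upper_bidiagonal :: "nat \<Rightarrow> (nat \<Rightarrow> real) \<Rightarrow> (nat \<Rightarrow> real) \<Rightarrow> real mat" where
  "upper_bidiagonal n x y =
     mat n n (\<lambda>(i, k). if k = i then x (i + 1) else if k = i + 1 then y (i + 1) else 0)"

(* For m >= n the two ranges of random entries are 1..n and 1..n-1 and no entry x j or y j is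
   forced to vanish; for m <= n - 1 both ranges are 1..m and the remaining entries are 0. *)
definition laguerre_beta_ensemble ::
  "'w measure \<Rightarrow> real \<Rightarrow> nat \<Rightarrow> nat \<Rightarrow> ('w \<Rightarrow> real mat) \<Rightarrow> bool" where
  "laguerre_beta_ensemble M \<beta> m n J \<longleftrightarrow>
     (\<exists>x y :: nat \<Rightarrow> 'w \<Rightarrow> real.
        prob_space.indep_vars M (\<lambda>_. borel) (case_sum x y)
          ({1..min m n} <+> {1..min m (n - 1)}) \<and>
        (\<forall>j\<in>{1..min m n}.
           distributed M lborel (x j) (\<lambda>t. ennreal (chi_density (\<beta> * (real m - real j + 1)) t))) \<and>
        (\<forall>j\<in>{1..min m (n - 1)}.
           distributed M lborel (y j) (\<lambda>t. ennreal (chi_density (\<beta> * (real n - real j)) t))) \<and>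
        (\<forall>j\<in>{m + 1..n}. AE \<omega> in M. x j \<omega> = 0) \<and>
        (\<forall>j\<in>{m + 1..n - 1}. AE \<omega> in M. y j \<omega> = 0) \<and>
        (AE \<omega> in M. J \<omega> =
           transpose_mat (upper_bidiagonal n (\<lambda>j. x j \<omega>) (\<lambda>j. y j \<omega>)) *
           upper_bidiagonal n (\<lambda>j. x j \<omega>) (\<lambda>j. y j \<omega>)))"

definition rank_one_perturbation :: "nat \<Rightarrow> real mat \<Rightarrow> real \<Rightarrow> complex mat" where
  "rank_one_perturbation n A t =
     map_mat complex_of_real A +
     (\<i> * complex_of_real t) \<cdot>\<^sub>m mat n n (\<lambda>(i, k). if i = 0 \<and> k = 0 then 1 else 0)"

definition eigenvalues_mset :: "complex mat \<Rightarrow> complex multiset" where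
  "eigenvalues_mset A = proots (char_poly A)"

(* The points of the random multiset E, listed in a uniformly random order, form a random vector
   (z 1, ..., z N) with law \<mu>.  The integrand is the conditional probability, given E, that this
   vector lies in A.  For a non-measurable integrand the library integral is a lower integral;
   since the equation is required for A and for its complement, and \<mu> then has total mass 1 on
   a probability space, it forces the integrand to be measurable up to null sets. *)
definition random_order_law ::
  "'w measure \<Rightarrow> ('w \<Rightarrow> complex multiset) \<Rightarrow> nat \<Rightarrow> (nat \<Rightarrow> complex) measure \<Rightarrow> bool" where
  "random_order_law M E N \<mu> \<longleftrightarrow>
     sets \<mu> = sets (\<Pi>\<^sub>M j\<in>{1..N}. borel) \<and>
     (AE \<omega> in M. size (E \<omega>) = N) \<and>
     (\<forall>A\<in>sets (\<Pi>\<^sub>M j\<in>{1..N}. borel).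
        (\<integral>\<^sup>+ \<omega>. emeasure (measure_pmf (pmf_of_set (permutations_of_multiset (E \<omega>))))
                    {zs. (\<lambda>j\<in>{1..N}. zs ! (j - 1)) \<in> A} \<partial>M) = emeasure \<mu> A)"

definition param_a :: "real \<Rightarrow> nat \<Rightarrow> nat \<Rightarrow> real" where
  "param_a \<beta> m n = \<bar>real m - real n\<bar> + 1 - 2 / \<beta>"

definition l_const :: "real \<Rightarrow> nat \<Rightarrow> real \<Rightarrow> real" where
  "l_const \<beta> N a =
     2 powr (real N * (a * \<beta> / 2 + 1 + (real N - 1) * \<beta> / 2)) *
     (\<Prod>j = 1..N. Gamma (1 + \<beta> * real j / 2) * Gamma (1 + \<beta> * a / 2 + \<beta> * (real j - 1) / 2)
        / Gamma (1 + \<beta> / 2))"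

definition c_const :: "real \<Rightarrow> nat \<Rightarrow> real" where
  "c_const \<beta> n = Gamma (\<beta> / 2) ^ n / Gamma (\<beta> * real n / 2)"

definition d_const :: "real \<Rightarrow> nat \<Rightarrow> nat \<Rightarrow> real" where
  "d_const \<beta> m n =
     Gamma (\<beta> * (real n - real m) / 2) * Gamma (\<beta> / 2) ^ m / Gamma (\<beta> * real n / 2)"

definition q_const :: "real \<Rightarrow> nat \<Rightarrow> real \<Rightarrow> real" where
  "q_const \<beta> n a = 2 powr (real n * (\<beta> / 2 - 1)) * l_const \<beta> n a * c_const \<beta> n"

definition t_const :: "real \<Rightarrow> nat \<Rightarrow> nat \<Rightarrow> real" where
  "t_const \<beta> m n =
     (real m + 1) * 2 powr ((real m + 1) * (\<beta> / 2 - 1)) *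
     l_const \<beta> m (param_a \<beta> m n) * d_const \<beta> m n"

definition density_full :: "real \<Rightarrow> nat \<Rightarrow> real \<Rightarrow> (real \<Rightarrow> real) \<Rightarrow> (nat \<Rightarrow> complex) \<Rightarrow> real" where
  "density_full \<beta> n a F z =
     (let l = (\<Sum>j = 1..n. Im (z j)) in
        1 / q_const \<beta> n a *
        (\<Prod>j = 1..n. \<Prod>k = 1..n. cmod (z j - cnj (z k)) powr (\<beta> / 2 - 1)) *
        (\<Prod>k = 1..n. \<Prod>j = 1..<k. (cmod (z j - z k))\<^sup>2) *
        exp (- (1 / 2) * (\<Sum>j = 1..n. Re (z j))) *
        Re (\<Prod>j = 1..n. z j) powr (\<beta> * a / 2) *
        (F l / l powr (\<beta> * real n / 2 - 1)))"

definition domain_full :: "nat \<Rightarrow> (nat \<Rightarrow> complex) set" where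
  "domain_full n =
     {z. (\<forall>j\<in>{1..n}. 0 < Im (z j)) \<and> (\<Sum>j = 1..n. Arg (z j)) < pi / 2}"

definition law_full :: "real \<Rightarrow> nat \<Rightarrow> real \<Rightarrow> (real \<Rightarrow> real) \<Rightarrow> (nat \<Rightarrow> complex) measure" where
  "law_full \<beta> n a F =
     density (\<Pi>\<^sub>M j\<in>{1..n}. lborel)
       (\<lambda>z. ennreal (density_full \<beta> n a F z) * indicator (domain_full n) z)"

definition density_deficient ::
  "real \<Rightarrow> nat \<Rightarrow> nat \<Rightarrow> (real \<Rightarrow> real) \<Rightarrow> (nat \<Rightarrow> complex) \<Rightarrow> real" where
  "density_deficient \<beta> m n F z =
     (let l = (\<Sum>j = 1..m + 1. Im (z j)) in
        1 / t_const \<beta> m n *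
        (\<Prod>j = 1..m + 1. \<Prod>k = 1..m + 1. cmod (z j - cnj (z k)) powr (\<beta> / 2 - 1)) *
        (\<Prod>k = 1..m + 1. \<Prod>j = 1..<k. (cmod (z j - z k))\<^sup>2) *
        exp (- (1 / 2) * (\<Sum>j = 1..m + 1. Re (z j))) *
        (\<Prod>j = 1..m + 1. cmod (z j) powr (\<beta> * (real n - real m - 1) / 2)) *
        (F l / l powr (\<beta> * real n / 2 - 1)))"

definition complete_angles :: "nat \<Rightarrow> (nat \<Rightarrow> real) \<Rightarrow> nat \<Rightarrow> real" where
  "complete_angles m \<theta> = \<theta>(m + 1 := pi / 2 - (\<Sum>j = 1..m. \<theta> j))"

definition polar_point :: "nat \<Rightarrow> (nat \<Rightarrow> real) \<times> (nat \<Rightarrow> real) \<Rightarrow> nat \<Rightarrow> complex" where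
  "polar_point m = (\<lambda>(r, \<theta>). \<lambda>j\<in>{1..m + 1}. rcis (r j) (complete_angles m \<theta> j))"

(* The coordinates (r 1, ..., r (m+1), \<theta> 1, ..., \<theta> m) of the points of the upper half-plane whose
   arguments sum to pi/2: with these bounds r j is the modulus of z j and the angle is Arg (z j). *)
definition polar_domain :: "nat \<Rightarrow> ((nat \<Rightarrow> real) \<times> (nat \<Rightarrow> real)) set" where
  "polar_domain m =
     {(r, \<theta>). \<forall>j\<in>{1..m + 1}. 0 < r j \<and> 0 < complete_angles m \<theta> j \<and> complete_angles m \<theta> j < pi}"

(* The law lives on a hypersurface, so it is given as the image of a density in the coordinates. *)
definition law_deficient ::
  "real \<Rightarrow> nat \<Rightarrow> nat \<Rightarrow> (real \<Rightarrow> real) \<Rightarrow> (nat \<Rightarrow> complex) measure" where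
  "law_deficient \<beta> m n F =
     distr
       (density ((\<Pi>\<^sub>M j\<in>{1..m + 1}. lborel) \<Otimes>\<^sub>M (\<Pi>\<^sub>M j\<in>{1..m}. lborel))
          (\<lambda>p. ennreal (density_deficient \<beta> m n F (polar_point m p)) * indicator (polar_domain m) p))
       (\<Pi>\<^sub>M j\<in>{1..m + 1}. borel)
       (polar_point m)"

end

theory Submission
  imports Defs "HOL-Complex_Analysis.Conformal_Mappings"
begin

text \<open>The characteristic polynomial of the perturbed matrix is \<open>A - i l B\<close>, where \<open>A\<close> and \<open>B\<close> are the
monic real polynomials of the tridiagonal matrix and of its first truncation.  They satisfy
\<open>A = z B - x\<^sup>2 A'\<close> and \<open>B = A' - y\<^sup>2 B'\<close>, with \<open>A'\<close> and \<open>B'\<close> of one degree less; unrolling this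
recursion, the map from the matrix entries and \<open>l\<close> to the coefficients of the characteristic polynomial
becomes a product of one-variable substitutions, whose image is given by the positivity of all
\<open>x\<^sup>2\<close>, \<open>y\<^sup>2\<close> and \<open>l\<close> that the recursion recovers.  A Hermite-Biehler argument, in which one follows the
increasing function that maps a real \<open>t\<close> to the sum of the arguments of \<open>z\<^sub>j - t\<close>, shows that these conditions hold
exactly if the roots lie in the upper half-plane and their arguments sum to less than \<open>\<pi>/2\<close> (to
exactly \<open>\<pi>/2\<close> if the ensemble is rank deficient).

The map from the roots to the coefficients contributes the squared Vandermonde determinant.  At a
root \<open>z\<close>, the polynomial with the conjugate roots takes the value \<open>2 i l B(z)\<close>, so that the product of all
\<open>\<bar>z\<^sub>j - cnj z\<^sub>k\<bar>\<close> is a resultant of \<open>A\<close> and \<open>B\<close> up to a power of \<open>2 l\<close>, and the recursion evaluates it as a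
monomial in the matrix entries.  In the rank-deficient case the hypersurface is thickened by rotating
all roots by a common angle, and the formula for full dimension is applied to the thickening.\<close>

section \<open>Hermite-Biehler pairs and the sum of the arguments\<close>

text \<open>Eigenvalues carry no canonical order, whereas the coefficients of the characteristic
  polynomial are honest random variables. All laws are therefore compared by integrating arbitrary
  measurable functions of that polynomial; a random order of the roots is restored only at the end,
  from the symmetry of the claimed density under permutations. Such test functions also avoid
  inverse maps and high-dimensional Jacobian determinants: every change of variables is an iterated
  integral in which one coefficient, entry or root moves at a time. The Vandermonde factor arises by
  adding one root \<open>w\<close> at a time, where the fibres of \<open>w P(w)\<close> have as many
  points as the new degree; the product of these counts is the factorial that relates ordered to
  unordered roots. On the real line, up to signs and positive factors, the real and imaginary parts
  of the characteristic polynomial are the cosine and sine of the sum of the arguments. A sign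
  condition on \<open>A\<close> left of 0 is thus a bound on that sum, which is how the right angle
  enters.\<close>

abbreviation cpoly :: "real poly \<Rightarrow> complex poly" where
  "cpoly \<equiv> map_poly complex_of_real"

text \<open>A sum of principal arguments, not reduced modulo \<open>2 * pi\<close>: for roots in the
  upper half-plane it is a continuous lift of the argument of the product, as the intermediate value
  arguments below require.\<close>

definition sumarg :: "complex multiset \<Rightarrow> real \<Rightarrow> real" where
  "sumarg M t = (\<Sum>z\<in>#M. Arg (z - of_real t))"

lemma sumarg_simps [simp]:
  "sumarg {#} t = 0" "sumarg (add_mset z M) t = Arg (z - of_real t) + sumarg M t"
  by (auto simp: sumarg_def)

lemma prod_mset_polar:
  "(\<Prod>z\<in>#M. z - of_real t) = of_real (\<Prod>z\<in>#M. cmod (z - of_real t)) * cis (sumarg M t)"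
proof (induction M)
  case (add z M)
  have "z - of_real t = of_real (cmod (z - of_real t)) * cis (Arg (z - of_real t))"
    using rcis_cmod_Arg[of "z - of_real t"] by (simp add: rcis_def)
  then have "(\<Prod>w\<in>#add_mset z M. w - of_real t) =
      (of_real (cmod (z - of_real t)) * cis (Arg (z - of_real t))) *
      (of_real (\<Prod>z\<in>#M. cmod (z - of_real t)) * cis (sumarg M t))"
    by (simp only: image_mset_add_mset prod_mset.add_mset add.IH)
  then show ?case by (simp add: cis_mult[symmetric])
qed auto

text \<open>The product of one number with the conjugate of the other has imaginary part
  \<open>d * Im w > 0\<close>, so the sine of the difference of the arguments is positive. Both
  arguments lie between 0 and \<open>pi\<close>, so this sine decides their order.\<close>

lemma Arg_add_of_real_less:
  assumes "Im w > 0" "d > 0"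
  shows "Arg (w + of_real d) < Arg w"
proof -
  let ?a = "Arg w" and ?b = "Arg (w + of_real d)"
  have a: "0 < ?a" "?a < pi" "0 < ?b" "?b < pi"
    using assms Arg_lt_pi[of w] Arg_lt_pi[of "w + of_real d"] by auto
  have w: "w = of_real (cmod w) * cis ?a" "w + of_real d = of_real (cmod (w + of_real d)) * cis ?b"
    using rcis_cmod_Arg[of w] rcis_cmod_Arg[of "w + of_real d"] by (auto simp: rcis_def)
  define r where "r = cmod w * cmod (w + of_real d)"
  have r: "r > 0" using assms by (auto simp: r_def complex_eq_iff)
  have "w * cnj (w + of_real d) = of_real r * cis (?a - ?b)"
    by (subst w(1), subst w(2)) (simp add: r_def cis_cnj cis_divide[symmetric] divide_inverse)
  then have "Im (w * cnj (w + of_real d)) = Im (of_real r * cis (?a - ?b))" by (rule arg_cong)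
  moreover have "Im (w * cnj (w + of_real d)) = d * Im w"
    by (simp add: algebra_simps)
  ultimately have "r * sin (?a - ?b) = d * Im w" by simp
  then have "0 < r * sin (?a - ?b)"
    using assms by simp
  then have s: "0 < sin (?a - ?b)"
    using r by (simp add: zero_less_mult_iff)
  show ?thesis
  proof (rule ccontr)
    assume "\<not> ?thesis"
    then have "sin (?b - ?a) \<ge> 0" using a by (intro sin_ge_zero) auto
    moreover have "sin (?b - ?a) = - sin (?a - ?b)" by (metis minus_diff_eq sin_minus)
    ultimately show False using s by simp
  qed
qed

lemma sumarg_strict_mono:
  assumes "\<forall>z\<in>#M. Im z > 0" "M \<noteq> {#}" "s < t"
  shows "sumarg M s < sumarg M t"
  using assms
proof (induction M)
  case (add z M)
  have "Arg ((z - of_real t) + of_real (t - s)) < Arg (z - of_real t)"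
    using add.prems by (intro Arg_add_of_real_less) auto
  then have *: "Arg (z - of_real s) < Arg (z - of_real t)" by simp
  show ?case
  proof (cases "M = {#}")
    case False
    then show ?thesis using add * by simp
  qed (use * in auto)
qed auto

lemma sumarg_mono:
  assumes "\<forall>z\<in>#M. Im z > 0" "s \<le> t"
  shows "sumarg M s \<le> sumarg M t"
  using sumarg_strict_mono[OF assms(1), of s t] assms(2) by (cases "M = {#}"; cases "s = t") auto

lemma sumarg_pos:
  assumes "\<forall>z\<in>#M. Im z > 0" "M \<noteq> {#}"
  shows "sumarg M t > 0"
  using assms
proof (induction M)
  case (add z M)
  have "Arg (z - of_real t) > 0" using add.prems Arg_lt_pi[of "z - of_real t"] by auto
  then show ?case using add by (cases "M = {#}") auto
qed auto

lemma continuous_on_sumarg: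
  assumes "\<forall>z\<in>#M. Im z > 0"
  shows "continuous_on UNIV (sumarg M)"
  using assms unfolding sumarg_def [abs_def]
proof (induction M)
  case (add z M)
  have "continuous_on UNIV (\<lambda>t. Arg (z - of_real t))"
    using add.prems by (intro continuous_on_Arg' continuous_intros) (auto simp: complex_nonpos_Reals_iff)
  then show ?case using add by (simp add: continuous_on_add)
qed simp

text \<open>Far to the left every \<open>z - T\<close> points almost in the direction of the
  positive axis, so each argument can be made small; monotonicity allows one \<open>T\<close> for
  all of them.\<close>

lemma sumarg_small:
  assumes "\<forall>z\<in>#M. Im z > 0" "e > 0"
  shows "\<exists>T. sumarg M T < e"
  using assms
proof (induction M arbitrary: e)
  case (add z M)
  \<comment> \<open>The cap 1 keeps \<open>d\<close> below \<open>pi / 2\<close>, where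
    \<open>arctan\<close> inverts \<open>tan\<close>; \<open>T1\<close> is then the point at which
    \<open>z - T1\<close> has argument exactly \<open>d\<close>.\<close>
  define d where "d = min (e / 3) 1"
  have d: "0 < d" "d < pi / 2" "d \<le> e / 3" using add.prems pi_gt3 by (auto simp: d_def)
  have td: "tan d > 0" using d by (intro tan_gt_zero) auto
  define T1 where "T1 = Re z - Im z / tan d"
  have z: "Im z > 0" using add.prems by auto
  have "Arg (z - of_real T1) = arctan (Im z / (Im z / tan d))"
    using z td by (subst arg_conv_arctan) (auto simp: T1_def)
  also have "Im z / (Im z / tan d) = tan d" using z td by (simp add: field_simps)
  finally have 1: "Arg (z - of_real T1) = d" using d by (simp add: arctan_tan)
  obtain T2 where T2: "sumarg M T2 < e / 3" using add.IH[of "e/3"] add.prems by auto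
  define T where "T = min T1 T2"
  have "sumarg {#z#} T \<le> sumarg {#z#} T1" "sumarg M T \<le> sumarg M T2"
    using add.prems by (auto intro!: sumarg_mono simp: T_def simp del: sumarg_simps)
  then have "sumarg (add_mset z M) T < e" using 1 T2 d add.prems by (simp)
  then show ?case by blast
qed auto

text \<open>Near minus infinity the sum is below \<open>\<alpha> + pi / 2\<close>, and by continuity
  it would have to take that value, where the cosine vanishes, before exceeding it. The offset
  \<open>\<alpha>\<close> is there for polynomials whose leading coefficient is not real.\<close>

lemma sumarg_less_half_pi:
  assumes M: "\<forall>z\<in>#M. Im z > 0" and a: "- pi / 2 < \<alpha>"
    and c: "\<And>t. t < T \<Longrightarrow> cos (sumarg M t - \<alpha>) > 0" and t: "t < T"
  shows "sumarg M t - \<alpha> < pi / 2"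
proof (rule ccontr)
  assume "\<not> ?thesis"
  then have ge: "\<alpha> + pi / 2 \<le> sumarg M t" by simp
  obtain S where S: "sumarg M S < \<alpha> + pi / 2" using sumarg_small[OF M, of "\<alpha> + pi/2"] a by auto
  have "S < t" using sumarg_mono[OF M, of t S] ge S by (rule_tac ccontr) auto
  then obtain x where x: "S \<le> x" "x \<le> t" "sumarg M x = \<alpha> + pi / 2"
    using IVT'[of "sumarg M" S "\<alpha> + pi / 2" t] S ge
      continuous_on_subset[OF continuous_on_sumarg[OF M]] by auto
  then have "cos (sumarg M x - \<alpha>) = 0" by simp
  then show False using c[of x] x t by simp
qed

section \<open>Complex polynomials and their multisets of roots\<close>

lemma prod_mset_linear_factors:
  fixes M :: "complex multiset"
  shows "degree (\<Prod>z\<in>#M. [:-z, 1:]) = size M" "lead_coeff (\<Prod>z\<in>#M. [:-z, 1:]) = 1"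
    "size M = Suc k \<Longrightarrow> coeff (\<Prod>z\<in>#M. [:-z, 1:]) k = - \<Sum>\<^sub># M"
proof (induction M arbitrary: k)
  case (add z M)
  let ?q = "\<Prod>z\<in>#M. [:-z, 1:]"
  have q: "?q \<noteq> 0" using add.IH(2) by auto
  {
    case 1
    show ?case using q add.IH(1) by (simp add: degree_mult_eq del: mult_pCons_left)
  next
    case 2
    show ?case using add.IH(2) by (simp only: image_mset_add_mset prod_mset.add_mset lead_coeff_mult) simp
  next
    case 3
    have e: "(\<Prod>z\<in>#add_mset z M. [:-z, 1:]) = pCons 0 ?q - Polynomial.smult z ?q" by simp
    show ?case
    proof (cases k)
      case 0
      then have "M = {#}" using 3 by simp
      then show ?thesis using 0 by simp
    next
      case (Suc j)
      have "coeff ?q (Suc j) = 1" using add.IH(1,2) 3 Suc by simp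
      moreover have "coeff ?q j = - \<Sum>\<^sub># M" using add.IH(3) 3 Suc by simp
      ultimately show ?thesis unfolding e using Suc by (simp add: coeff_pCons)
    qed
  }
qed auto

lemma poly_prod_mset_linear:
  fixes M :: "complex multiset"
  shows "(-1) ^ size M * poly (\<Prod>z\<in>#M. [:-z, 1:]) x = (\<Prod>z\<in>#M. z - x)"
  by (induction M) (auto simp: algebra_simps)

lemma monic_eq_prod_proots:
  fixes p :: "complex poly"
  assumes "lead_coeff p = 1"
  shows "p = (\<Prod>z\<in>#proots p. [:-z, 1:])"
  using complex_poly_decompose_multiset[of p] assms by simp

lemma proots_prod_mset_linear:
  fixes M :: "complex multiset"
  shows "proots (\<Prod>z\<in>#M. [:-z, 1:]) = M"
proof (induction M)
  case (add z M)
  have "(\<Prod>z\<in>#M. [:-z, 1:]) \<noteq> 0" using prod_mset_linear_factors(2)[of M] by auto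
  then have "proots ([:-z, 1:] * (\<Prod>z\<in>#M. [:-z, 1:])) = proots [:-z, 1:] + M"
    using add.IH by (subst proots_mult) auto
  then show ?case by simp
qed simp

lemma monic_proots_iff:
  fixes p :: "complex poly"
  assumes "lead_coeff p = 1"
  shows "z \<in># proots p \<longleftrightarrow> poly p z = 0"
proof -
  have "p \<noteq> 0" using assms by auto
  then have "set_mset (proots p) = {x. poly p x = 0}" by (rule set_count_proots)
  then show ?thesis by blast
qed

section \<open>Hermite-Biehler pairs\<close>

text \<open>Says that \<open>A / B\<close> maps the upper half-plane into itself, with the
  denominator cleared. Together with conjugation the first clause excludes common zeros off the real
  line; the second excludes them on it.\<close>

definition hermite_biehler :: "real poly \<Rightarrow> real poly \<Rightarrow> bool" where
  "hermite_biehler A B \<longleftrightarrow> (\<forall>z. Im z > 0 \<longrightarrow> Im (poly (cpoly A) z * cnj (poly (cpoly B) z)) > 0) \<and>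
     (\<forall>t. \<not> (poly A t = 0 \<and> poly B t = 0))"

lemma cpoly_cnj: "poly (cpoly A) (cnj z) = cnj (poly (cpoly A) z)"
proof -
  have "map_poly cnj (cpoly A) = cpoly A"
    by (intro poly_eqI) (simp add: coeff_map_poly)
  then show ?thesis by (metis poly_cnj)
qed

lemma cpoly_eval_real: "poly (cpoly A) (of_real t) = of_real (poly A t)"
  by (rule of_real_hom.poly_map_poly)

lemma cpoly_minus [simp]: "cpoly (- A) = - cpoly A"
  by (intro poly_eqI) simp

lemma cpoly_diff [simp]: "cpoly (A - B) = cpoly A - cpoly B"
  by (intro poly_eqI) simp

lemma cpoly_add [simp]: "cpoly (A + B) = cpoly A + cpoly B"
  by (intro poly_eqI) simp

lemma cpoly_smult [simp]: "cpoly (Polynomial.smult c A) = Polynomial.smult (of_real c) (cpoly A)"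
  by (intro poly_eqI) simp

lemma cpoly_mult: "cpoly (A * B) = cpoly A * cpoly B"
  by (intro poly_eqI) (simp add: coeff_mult)

lemma cpoly_pCons [simp]: "cpoly (pCons c A) = pCons (of_real c) (cpoly A)"
  by (intro poly_eqI) (simp add: coeff_pCons split: nat.split)

text \<open>A root solves \<open>A / B = c\<close>. In the lower half-plane conjugation gives this
  quotient a negative imaginary part, and on the real line the real values of \<open>A\<close> and
  \<open>B\<close> would both have to vanish; only the upper half-plane is left.\<close>

lemma hermite_biehler_root:
  assumes "hermite_biehler A B" "Im c > 0" "poly (cpoly A - Polynomial.smult c (cpoly B)) z = 0"
  shows "Im z > 0"
proof (rule ccontr)
  assume "\<not> Im z > 0"
  let ?a = "poly (cpoly A) z" and ?b = "poly (cpoly B) z"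
  have e: "?a = c * ?b" using assms(3) by simp
  have ab: "Im (?a * cnj ?b) = Im c * (cmod ?b)\<^sup>2"
    unfolding e by (simp add: mult.assoc complex_norm_square[symmetric] del: of_real_power)
  consider "Im z = 0" | "Im z < 0" using \<open>\<not> Im z > 0\<close> by linarith
  then show False
  proof cases
    case 1
    then have "z = of_real (Re z)" by (simp add: complex_eq_iff)
    then obtain t where z: "z = of_real t" by blast
    have "of_real (poly A t) = c * of_real (poly B t)" using e z by (simp add: cpoly_eval_real)
    then have "Im (of_real (poly A t)) = Im (c * of_real (poly B t))" by simp
    then have "Im c * poly B t = 0" by simp
    then have "poly B t = 0" using assms by simp
    moreover have "poly A t = 0" using e z \<open>poly B t = 0\<close> by (simp add: cpoly_eval_real)
    ultimately show False using assms(1) unfolding hermite_biehler_def by blast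
  next
    case 2
    then have "Im (cnj z) > 0" by simp
    then have "Im (cnj ?a * ?b) > 0" using assms(1) unfolding hermite_biehler_def by (metis cpoly_cnj complex_cnj_cnj)
    moreover have "Im (cnj ?a * ?b) = - Im (?a * cnj ?b)" by simp
    moreover have "Im (?a * cnj ?b) \<ge> 0" unfolding ab using assms(2) by simp
    ultimately show False by linarith
  qed
qed

text \<open>Every root in the upper half-plane is closer to \<open>w\<close> than to its mirror
  image \<open>cnj w\<close>.\<close>

lemma prod_mset_norm_less:
  assumes "\<forall>z\<in>#M. Im z > 0" "M \<noteq> {#}" "Im w > 0"
  shows "cmod (\<Prod>z\<in>#M. w - z) < cmod (\<Prod>z\<in>#M. cnj w - z)"
  using assms
proof (induction M)
  case (add z M)
  have "(cmod (w - z))\<^sup>2 < (cmod (cnj w - z))\<^sup>2"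
  proof -
    have "Im w * Im z > 0" using add.prems by simp
    then show ?thesis unfolding cmod_power2 by (simp add: power2_eq_square algebra_simps)
  qed
  then have lt: "cmod (w - z) < cmod (cnj w - z)" by (simp add: power2_less_imp_less)
  show ?case
  proof (cases "M = {#}")
    case False
    then have "cmod (\<Prod>z\<in>#M. w - z) < cmod (\<Prod>z\<in>#M. cnj w - z)" using add by auto
    with lt show ?thesis by (simp add: norm_mult mult_strict_mono')
  qed (use lt in simp)
qed auto

lemma poly_prod_mset_linear': "poly (\<Prod>z\<in>#M. [:-z, 1:]) x = (\<Prod>z\<in>#M. x - z)" for x :: complex
  by (induction M) (auto simp: algebra_simps)

text \<open>With \<open>a\<close> and \<open>b\<close> the values of \<open>A\<close> and
  \<open>Q\<close> at \<open>z\<close>, the moduli of \<open>p\<close> at \<open>z\<close> and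
  \<open>cnj z\<close> are those of \<open>a + \<i> b\<close> and \<open>cnj a + \<i> cnj b\<close>;
  comparing their squares leaves exactly the sign of \<open>Im (a * cnj b)\<close>. The second
  member is \<open>- Q\<close> because \<open>p\<close> is then \<open>A - \<i> B\<close>.\<close>

lemma hermite_biehler_of_roots:
  assumes p: "p = cpoly A + Polynomial.smult \<i> (cpoly Q)" and m: "lead_coeff p = 1" "degree p \<noteq> 0"
    and r: "\<forall>z\<in>#proots p. Im z > 0"
  shows "hermite_biehler A (- Q)"
  unfolding hermite_biehler_def
proof (intro conjI allI impI notI)
  fix z :: complex assume z: "Im z > 0"
  let ?a = "poly (cpoly A) z" and ?b = "poly (cpoly Q) z"
  have "proots p \<noteq> {#}" using m size_proots_complex[of p] by auto
  then have "cmod (poly p z) < cmod (poly p (cnj z))"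
    using prod_mset_norm_less[OF r _ z] monic_eq_prod_proots[OF m(1)] by (metis poly_prod_mset_linear')
  moreover have "poly p z = ?a + \<i> * ?b" "poly p (cnj z) = cnj ?a + \<i> * cnj ?b"
    unfolding p by (simp_all add: cpoly_cnj)
  ultimately have "(cmod (?a + \<i> * ?b))\<^sup>2 < (cmod (cnj ?a + \<i> * cnj ?b))\<^sup>2"
    by (simp add: power_strict_mono)
  then have "Im ?a * Re ?b < Re ?a * Im ?b"
    unfolding cmod_power2 by (simp add: power2_eq_square algebra_simps)
  then show "Im (?a * cnj (poly (cpoly (- Q)) z)) > 0"
    by (simp add: algebra_simps)
next
  fix t assume t: "poly A t = 0 \<and> poly (- Q) t = 0"
  have "poly p (of_real t) = 0" unfolding p using t by (simp add: cpoly_eval_real)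
  moreover have "p \<noteq> 0" using m by auto
  ultimately have "of_real t \<in># proots p" by simp
  then show False using r by fastforce
qed

lemma Im_sum_mset_pos:
  fixes M :: "complex multiset"
  assumes "\<forall>z\<in>#M. Im z > 0" "M \<noteq> {#}"
  shows "Im (\<Sum>\<^sub># M) > 0"
  using assms
proof (induction M)
  case (add z M)
  then show ?case by (cases "M = {#}") auto
qed auto

lemma hermite_biehler_smult: "hermite_biehler A B \<Longrightarrow> c > 0 \<Longrightarrow> hermite_biehler A (Polynomial.smult c B)"
  unfolding hermite_biehler_def by (simp add: mult.left_commute[of _ "of_real c"])

text \<open>The roots of \<open>A - \<i> B\<close> lie in the upper half-plane, and by the
  subleading coefficient their imaginary parts sum to \<open>coeff B k\<close>.\<close>

lemma hermite_biehler_shift: "hermite_biehler A B \<Longrightarrow> lead_coeff A = 1 \<Longrightarrow> degree A = Suc k \<Longrightarrow> degree B \<le> k \<Longrightarrow> coeff B k > 0"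
proof -
  assume H: "hermite_biehler A B" and A: "lead_coeff A = 1" "degree A = Suc k" and B: "degree B \<le> k"
  define p where "p = cpoly A - Polynomial.smult \<i> (cpoly B)"
  have cp: "coeff p (Suc k) = 1" using A B by (simp add: p_def coeff_eq_0)
  have "degree p \<le> Suc k" unfolding p_def using A B by (intro degree_diff_le) (auto intro: order.trans[OF degree_smult_le])
  then have d: "degree p = Suc k" using cp by (intro antisym le_degree) auto
  have m: "lead_coeff p = 1" using cp d by simp
  have r: "\<forall>z\<in>#proots p. Im z > 0"
    using hermite_biehler_root[OF H, of \<i>] monic_proots_iff[OF m] unfolding p_def by simp
  have sz: "size (proots p) = Suc k" using d by (simp add: size_proots_complex)
  have "coeff p k = - \<Sum>\<^sub># (proots p)"
    using prod_mset_linear_factors(3)[OF sz] monic_eq_prod_proots[OF m] by simp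
  moreover have "Im (coeff p k) = - coeff B k" by (simp add: p_def)
  ultimately show ?thesis using Im_sum_mset_pos[OF r] sz by force
qed

text \<open>Freezing \<open>c = A(w) / B(w)\<close> makes \<open>w\<close> one of the roots of
  \<open>A - c B\<close>. All of them lie in the upper half-plane and their imaginary parts sum to
  \<open>Im c\<close>; as the degree is at least 2, a further root makes \<open>Im c > Im w\<close>
  strict. This takes the place of a partial fraction expansion of \<open>A / B\<close>.\<close>

lemma hermite_biehler_Im_quotient:
  assumes H: "hermite_biehler A B" and A: "lead_coeff A = 1" "degree A = Suc (Suc k)"
    and B: "lead_coeff B = 1" "degree B = Suc k" and w: "Im w > 0"
  shows "Im (poly (cpoly A) w * cnj (poly (cpoly B) w)) > Im w * (cmod (poly (cpoly B) w))\<^sup>2"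
proof -
  let ?a = "poly (cpoly A) w" and ?b = "poly (cpoly B) w"
  have pos: "Im (?a * cnj ?b) > 0" using H w unfolding hermite_biehler_def by blast
  then have b: "?b \<noteq> 0" by auto
  define c where "c = ?a / ?b"
  have "?a * cnj ?b = c * (of_real ((cmod ?b)\<^sup>2))"
    using b by (simp add: c_def complex_norm_square field_simps del: of_real_power)
  then have cb: "Im (?a * cnj ?b) = Im c * (cmod ?b)\<^sup>2" by (simp del: of_real_power)
  then have c: "Im c > 0" using pos by (simp add: zero_less_mult_iff)
  define p where "p = cpoly A - Polynomial.smult c (cpoly B)"
  have cp: "coeff p (Suc (Suc k)) = 1" using A B by (simp add: p_def coeff_eq_0)
  have "degree p \<le> Suc (Suc k)" unfolding p_def using A B by (intro degree_diff_le) (auto intro: order.trans[OF degree_smult_le])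
  then have d: "degree p = Suc (Suc k)" using cp by (intro antisym le_degree) auto
  have m: "lead_coeff p = 1" using cp d by simp
  have r: "\<forall>z\<in>#proots p. Im z > 0"
    using hermite_biehler_root[OF H c] monic_proots_iff[OF m] unfolding p_def by simp
  have sz: "size (proots p) = Suc (Suc k)" using d by (simp add: size_proots_complex)
  have "poly p w = 0" using b by (simp add: p_def c_def)
  then have "w \<in># proots p" using monic_proots_iff[OF m] by simp
  then obtain M where M: "proots p = add_mset w M" by (metis insert_DiffM)
  have "coeff p (Suc k) = - \<Sum>\<^sub># (proots p)"
    using prod_mset_linear_factors(3)[OF sz] monic_eq_prod_proots[OF m] by simp
  moreover have "Im (coeff p (Suc k)) = - Im c" using B by (simp add: p_def)
  ultimately have "Im c = Im w + Im (\<Sum>\<^sub># M)" unfolding M by simp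
  moreover have "M \<noteq> {#}" "\<forall>z\<in>#M. Im z > 0" using sz r M by auto
  ultimately have "Im c > Im w" using Im_sum_mset_pos[of M] by simp
  then show ?thesis unfolding cb using b by simp
qed

lemma prod_mset_norm_pos:
  assumes "\<forall>z\<in>#M. Im z > 0"
  shows "(\<Prod>z\<in>#M. cmod (z - of_real t)) > 0"
  using assms
proof (induction M)
  case (add z M)
  then have "z - of_real t \<noteq> 0" by (auto simp: complex_eq_iff)
  then show ?case using add by simp
qed simp

lemma monic_poly_polar:
  fixes p :: "complex poly"
  assumes "lead_coeff p = 1" "degree p = n"
  shows "(-1) ^ n * poly p (of_real t) =
    of_real (\<Prod>z\<in>#proots p. cmod (z - of_real t)) * cis (sumarg (proots p) t)"
proof -
  have "size (proots p) = n" using assms by (simp add: size_proots_complex)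
  then have "(-1) ^ n * poly (\<Prod>z\<in>#proots p. [:-z, 1:]) (of_real t) = (\<Prod>z\<in>#proots p. z - of_real t)"
    using poly_prod_mset_linear[of "proots p" "of_real t"] by simp
  then show ?thesis using monic_eq_prod_proots[OF assms(1)] prod_mset_polar[of t "proots p"] by simp
qed

text \<open>On the real line \<open>(-1) ^ Suc k\<close> times \<open>A - \<i> l B\<close> has phase
  \<open>sumarg M t\<close>, so \<open>A\<close> and \<open>B\<close> are read off from its cosine
  and sine. The sign of \<open>A\<close> left of 0 keeps the sum of the arguments below
  \<open>pi / 2\<close> there, hence at most \<open>pi / 2\<close> at 0, with equality exactly when
  the cosine, and so \<open>A\<close>, vanishes at 0. For \<open>t \<le> 0\<close> the sine is then
  positive.\<close>

lemma hermite_biehler_real_part: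
  assumes H: "hermite_biehler A B" and A: "lead_coeff A = 1" "degree A = Suc k" and B: "degree B \<le> k"
    and s: "\<And>t. t < 0 \<Longrightarrow> (-1) ^ Suc k * poly A t > 0"
  shows "\<And>t. t \<le> 0 \<Longrightarrow> (-1) ^ k * poly B t > 0" "(-1) ^ Suc k * poly A 0 \<ge> 0"
    "\<And>l. l > 0 \<Longrightarrow> sumarg (proots (cpoly A - Polynomial.smult (\<i> * of_real l) (cpoly B))) 0 \<le> pi / 2"
    "\<And>l. l > 0 \<Longrightarrow> sumarg (proots (cpoly A - Polynomial.smult (\<i> * of_real l) (cpoly B))) 0 = pi / 2 \<longleftrightarrow> poly A 0 = 0"
proof -
  {
    fix l :: real assume l: "l > 0"
    define p where "p = cpoly A - Polynomial.smult (\<i> * of_real l) (cpoly B)"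
    have cp: "coeff p (Suc k) = 1" using A B by (simp add: p_def coeff_eq_0)
    have "degree p \<le> Suc k" unfolding p_def using A B by (intro degree_diff_le) (auto intro: order.trans[OF degree_smult_le])
    then have d: "degree p = Suc k" using cp by (intro antisym le_degree) auto
    have m: "lead_coeff p = 1" using cp d by simp
    define M where "M = proots p"
    have r: "\<forall>z\<in>#M. Im z > 0"
      using hermite_biehler_root[OF H, of "\<i> * of_real l"] monic_proots_iff[OF m] l unfolding p_def M_def by simp
    have sz: "size M = Suc k" using d by (simp add: size_proots_complex M_def)
    define R where "R t = (\<Prod>z\<in>#M. cmod (z - of_real t))" for t
    have R: "R t > 0" for t unfolding R_def by (rule prod_mset_norm_pos[OF r])
    have "(-1) ^ Suc k * poly p (of_real t) = of_real (R t) * cis (sumarg M t)" for t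
      unfolding R_def M_def by (rule monic_poly_polar[OF m d])
    moreover have "(-1) ^ Suc k * poly p (of_real t) =
        Complex ((-1) ^ Suc k * poly A t) ((-1) ^ k * l * poly B t)" for t
      by (cases "even k") (simp_all add: p_def cpoly_eval_real complex_eq_iff)
    ultimately have *: "Complex ((-1) ^ Suc k * poly A t) ((-1) ^ k * l * poly B t) =
      of_real (R t) * cis (sumarg M t)" for t by simp
    have re: "(-1) ^ Suc k * poly A t = R t * cos (sumarg M t)"
      and im: "(-1) ^ k * l * poly B t = R t * sin (sumarg M t)" for t
      using arg_cong[OF *, of Re t] arg_cong[OF *, of Im t] by simp_all
    have "cos (sumarg M t - 0) > 0" if "t < 0" for t
      using s[OF that] R[of t] unfolding re by (simp add: zero_less_mult_iff)
    then have lt: "sumarg M t < pi / 2" if "t < 0" for t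
      using sumarg_less_half_pi[OF r, of 0 0 t] that by simp
    have le0: "sumarg M 0 \<le> pi / 2"
    proof (rule ccontr)
      assume c: "\<not> ?thesis"
      then obtain x where "-1 \<le> x" "x \<le> 0" "sumarg M x = pi / 2"
        using IVT'[of "sumarg M" "-1" "pi / 2" 0] lt[of "-1"]
          continuous_on_subset[OF continuous_on_sumarg[OF r]] by auto
      then show False using lt[of x] c by (cases "x = 0") auto
    qed
    have pos: "sumarg M t > 0" for t using sumarg_pos[OF r] sz by fastforce
    have B: "(-1) ^ k * poly B t > 0" if "t \<le> 0" for t
    proof -
      have "sumarg M t \<le> pi / 2" using that lt[of t] le0 by (cases "t = 0") auto
      then have "sumarg M t < pi" using pi_gt_zero by linarith
      then have "R t * sin (sumarg M t) > 0" using pos[of t] R[of t] by (simp add: sin_gt_zero)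
      then have "l * ((-1) ^ k * poly B t) > 0" using im[of t] by (simp add: mult_ac)
      then show ?thesis using l by (simp add: zero_less_mult_iff)
    qed
    have A0: "(-1) ^ Suc k * poly A 0 \<ge> 0"
      unfolding re using le0 pos[of 0] R[of 0] by (intro mult_nonneg_nonneg cos_ge_zero) auto
    have "sumarg M 0 = pi / 2 \<longleftrightarrow> cos (sumarg M 0) = 0"
    proof
      assume "cos (sumarg M 0) = 0"
      then show "sumarg M 0 = pi / 2" using le0 pos[of 0] cos_gt_zero[of "sumarg M 0"] by linarith
    next
      assume "sumarg M 0 = pi / 2"
      then show "cos (sumarg M 0) = 0" by (metis cos_pi_half)
    qed
    also have "\<dots> \<longleftrightarrow> poly A 0 = 0" using re[of 0] R[of 0] by auto
    finally have eq: "sumarg M 0 = pi / 2 \<longleftrightarrow> poly A 0 = 0" .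
    have "sumarg (proots (cpoly A - Polynomial.smult (\<i> * of_real l) (cpoly B))) 0 \<le> pi / 2 \<and>
      (sumarg (proots (cpoly A - Polynomial.smult (\<i> * of_real l) (cpoly B))) 0 = pi / 2 \<longleftrightarrow> poly A 0 = 0) \<and>
      (\<forall>t\<le>0. (-1) ^ k * poly B t > 0) \<and> (-1) ^ Suc k * poly A 0 \<ge> 0"
      using le0 eq B A0 unfolding M_def p_def by blast
  } note main = this
  show "(-1) ^ k * poly B t > 0" if "t \<le> 0" for t using main[of 1] that by simp
  show "(-1) ^ Suc k * poly A 0 \<ge> 0" using main[of 1] by simp
  show "sumarg (proots (cpoly A - Polynomial.smult (\<i> * of_real l) (cpoly B))) 0 \<le> pi / 2" if "l > 0" for l
    using main[OF that] by blast
  show "sumarg (proots (cpoly A - Polynomial.smult (\<i> * of_real l) (cpoly B))) 0 = pi / 2 \<longleftrightarrow> poly A 0 = 0"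
    if "l > 0" for l using main[OF that] by blast
qed

section \<open>Stieltjes pairs and the recursion between consecutive degrees\<close>

text \<open>Models the characteristic polynomials of a positive semidefinite Jacobi matrix and of
  its truncation: by the last clause \<open>A\<close> keeps on the negative axis the sign that it
  has near minus infinity, so it has no negative zeros.\<close>

definition stieltjes_pair :: "nat \<Rightarrow> real poly \<Rightarrow> real poly \<Rightarrow> bool" where
  "stieltjes_pair n A B \<longleftrightarrow> lead_coeff A = 1 \<and> degree A = n \<and> lead_coeff B = 1 \<and> degree B = n - 1 \<and>
     hermite_biehler A B \<and> (\<forall>t<0. (-1) ^ n * poly A t > 0)"

text \<open>\<open>D\<close> is the candidate for \<open>x\<^sup>2 A'\<close>. The bound
  \<open>Im (A / B) > Im z\<close> is the Hermite-Biehler property of \<open>(B, D)\<close>. The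
  signs of \<open>D\<close> need more: they come from comparing the phase of
  \<open>B - \<i> D\<close> near infinity with its phase at 0, where \<open>D\<close> equals
  \<open>- A\<close>.\<close>

lemma stieltjes_pair_step_down:
  assumes "stieltjes_pair (Suc (Suc k)) A B"
  defines "D \<equiv> pCons 0 B - A"
  shows "hermite_biehler B D" "degree D \<le> Suc k" "coeff D (Suc k) > 0" "\<And>t. t < 0 \<Longrightarrow> (-1) ^ Suc k * poly D t > 0"
proof -
  have A: "lead_coeff A = 1" "degree A = Suc (Suc k)" and B: "lead_coeff B = 1" "degree B = Suc k"
    and H: "hermite_biehler A B" and s: "\<And>t. t < 0 \<Longrightarrow> (-1) ^ Suc (Suc k) * poly A t > 0"
    using assms unfolding stieltjes_pair_def by auto
  have sB: "(-1) ^ Suc k * poly B t > 0" if "t \<le> 0" for t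
    using hermite_biehler_real_part(1)[OF H A(1,2) _ s that] B by simp
  have sA: "(-1) ^ Suc (Suc k) * poly A 0 \<ge> 0"
    using hermite_biehler_real_part(2)[OF H A(1,2) _ s] B by simp
  show HD: "hermite_biehler B D"
    unfolding hermite_biehler_def
  proof (intro conjI allI impI notI)
    fix z :: complex assume z: "Im z > 0"
    let ?a = "poly (cpoly A) z" and ?b = "poly (cpoly B) z"
    have "poly (cpoly D) z = z * ?b - ?a" by (simp add: D_def)
    then have "?b * cnj (poly (cpoly D) z) = cnj z * of_real ((cmod ?b)\<^sup>2) - cnj (?a * cnj ?b)"
      by (simp only: complex_norm_square complex_cnj_diff complex_cnj_mult complex_cnj_cnj) (simp only: algebra_simps)
    then have "Im (?b * cnj (poly (cpoly D) z)) = Im (?a * cnj ?b) - Im z * (cmod ?b)\<^sup>2"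
      by (simp del: of_real_power)
    then show "Im (?b * cnj (poly (cpoly D) z)) > 0"
      using hermite_biehler_Im_quotient[OF H A(1,2) B z] by simp
  next
    fix t assume t: "poly B t = 0 \<and> poly D t = 0"
    then have "poly A t = 0" by (auto simp: D_def)
    with t H show False unfolding hermite_biehler_def by blast
  qed
  have cD: "coeff D (Suc (Suc k)) = 0" using A B by (simp add: D_def)
  have "degree D \<le> Suc (Suc k)" unfolding D_def using A B
    by (intro degree_diff_le) (auto intro: order.trans[OF degree_pCons_le])
  then show dD: "degree D \<le> Suc k"
    using cD by (metis le_SucE leading_coeff_0_iff degree_0 le0)
  define v where "v = coeff D (Suc k)"
  \<comment> \<open>The leading coefficient \<open>1 - \<i> v\<close> of \<open>q\<close> has
    argument \<open>- \<alpha>\<close>; up to the sign \<open>(-1) ^ Suc k\<close>, the phase of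
    \<open>q\<close> on the real line is therefore the sum of the arguments minus
    \<open>\<alpha>\<close>.\<close>
  define \<alpha> where "\<alpha> = arctan v"
  have al: "- pi / 2 < \<alpha>" "\<alpha> < pi / 2" using arctan_bounded[of v] by (auto simp: \<alpha>_def)
  have cal: "cos \<alpha> > 0" using al by (simp add: cos_gt_zero_pi)
  have lead: "1 - \<i> * of_real v = of_real (1 / cos \<alpha>) * cis (- \<alpha>)"
    using cal tan_arctan[of v] unfolding \<alpha>_def[symmetric] by (simp add: complex_eq_iff tan_def)
  define q where "q = cpoly B - Polynomial.smult \<i> (cpoly D)"
  have cq: "coeff q (Suc k) = 1 - \<i> * of_real v" using B by (simp add: q_def v_def)
  have "degree q \<le> Suc k" unfolding q_def using B dD
    by (intro degree_diff_le) (auto intro: order.trans[OF degree_smult_le])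
  moreover have "coeff q (Suc k) \<noteq> 0" unfolding cq by (simp add: complex_eq_iff)
  ultimately have d: "degree q = Suc k" by (intro antisym le_degree) auto
  have q0: "q \<noteq> 0" using d by auto
  define M where "M = proots q"
  have r: "\<forall>z\<in>#M. Im z > 0"
    using hermite_biehler_root[OF HD, of \<i>] set_count_proots[OF q0] unfolding q_def M_def by auto
  have sz: "size M = Suc k" using d by (simp add: size_proots_complex M_def)
  define R where "R t = (1 / cos \<alpha>) * (\<Prod>z\<in>#M. cmod (z - of_real t))" for t
  have R: "R t > 0" for t
  proof -
    have "(\<Prod>z\<in>#M. cmod (z - of_real t)) > 0" by (rule prod_mset_norm_pos[OF r])
    then show ?thesis using cal by (simp add: R_def)
  qed
  have "q = Polynomial.smult (1 - \<i> * of_real v) (\<Prod>z\<in>#M. [:-z, 1:])"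
    using complex_poly_decompose_multiset[of q] d cq by (simp add: M_def)
  then have "(-1) ^ Suc k * poly q (of_real t) =
      (1 - \<i> * of_real v) * ((-1) ^ size M * poly (\<Prod>z\<in>#M. [:-z, 1:]) (of_real t))" for t
    unfolding sz by simp
  also have "\<dots> t = of_real (R t) * cis (sumarg M t - \<alpha>)" for t
    unfolding poly_prod_mset_linear prod_mset_polar lead
    by (simp add: R_def cis_mult[symmetric] diff_conv_add_uminus del: add_uminus_conv_diff)
  finally have e: "(-1) ^ Suc k * poly q (of_real t) = of_real (R t) * cis (sumarg M t - \<alpha>)" for t .
  have "(-1) ^ Suc k * poly q (of_real t) =
      Complex ((-1) ^ Suc k * poly B t) (- ((-1) ^ Suc k * poly D t))" for t
    by (cases "even k") (simp_all add: q_def cpoly_eval_real complex_eq_iff)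
  with e have *: "Complex ((-1) ^ Suc k * poly B t) (- ((-1) ^ Suc k * poly D t)) =
      of_real (R t) * cis (sumarg M t - \<alpha>)" for t by simp
  have re: "(-1) ^ Suc k * poly B t = R t * cos (sumarg M t - \<alpha>)"
    and im: "(-1) ^ Suc k * poly D t = - (R t * sin (sumarg M t - \<alpha>))" for t
    using arg_cong[OF *, of Re t] arg_cong[OF *, of Im t] by simp_all
  have c0: "cos (sumarg M t - \<alpha>) > 0" if "t \<le> 0" for t
    using sB[OF that] R[of t] unfolding re by (simp add: zero_less_mult_iff)
  then have lt: "sumarg M t - \<alpha> < pi / 2" if "t < 0" for t
    using sumarg_less_half_pi[OF r al(1), of 0 t] that by simp
  have pos: "sumarg M t > 0" for t using sumarg_pos[OF r] sz by fastforce
  have lt0: "sumarg M 0 - \<alpha> < pi / 2"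
  proof (rule ccontr)
    assume c: "\<not> ?thesis"
    then obtain x where x: "-1 \<le> x" "x \<le> 0" "sumarg M x = \<alpha> + pi / 2"
      using IVT'[of "sumarg M" "-1" "\<alpha> + pi / 2" 0] lt[of "-1"]
        continuous_on_subset[OF continuous_on_sumarg[OF r]] by auto
    then show False using c0[of x] by simp
  qed
  \<comment> \<open>Since \<open>D\<close> equals \<open>- A\<close> at 0, the sine of the phase is
    nonpositive there; with the bound \<open>lt0\<close> this forces
    \<open>0 < sumarg M 0 \<le> \<alpha>\<close>, and hence \<open>v > 0\<close>.\<close>
  have "(-1) ^ Suc k * poly D 0 \<ge> 0" using sA by (simp add: D_def)
  then have "R 0 * sin (sumarg M 0 - \<alpha>) \<le> 0" using im[of 0] by linarith
  then have "sin (sumarg M 0 - \<alpha>) \<le> 0" using R[of 0] by (simp add: mult_le_0_iff)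
  then have le: "sumarg M 0 \<le> \<alpha>"
    using sin_gt_zero[of "sumarg M 0 - \<alpha>"] lt0 pi_gt_zero by (rule_tac ccontr) auto
  then have "\<alpha> > 0" using pos[of 0] by simp
  then have "v > 0" by (simp add: \<alpha>_def)
  then show "coeff D (Suc k) > 0" by (simp add: v_def)
  show "(-1) ^ Suc k * poly D t > 0" if "t < 0" for t
  proof -
    have "sumarg M t < \<alpha>" using sumarg_strict_mono[OF r _ that] sz le by fastforce
    then have "sin (\<alpha> - sumarg M t) > 0" using pos[of t] al pi_gt_zero by (intro sin_gt_zero) auto
    then have "sin (sumarg M t - \<alpha>) < 0" by (metis minus_diff_eq sin_minus neg_less_0_iff_less)
    then show ?thesis unfolding im using R[of t] by (simp add: mult_pos_neg)
  qed
qed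

text \<open>Inverts the recursion of \<open>jacobi_pair\<close> below: \<open>v\<close> and \<open>u\<close> are the candidates for \<open>x\<^sup>2\<close> and \<open>y\<^sup>2\<close>.  The
  flag \<open>s\<close> is \<open>0\<close> for full rank and \<open>1\<close> if the innermost \<open>x\<close> vanishes.\<close>
fun stieltjes_signs :: "nat \<Rightarrow> nat \<Rightarrow> real poly \<Rightarrow> real poly \<Rightarrow> bool" where
  "stieltjes_signs s 0 A B \<longleftrightarrow> False"
| "stieltjes_signs s (Suc 0) A B \<longleftrightarrow> (if s = 0 then coeff A 0 < 0 else coeff A 0 = 0)"
| "stieltjes_signs s (Suc (Suc k)) A B \<longleftrightarrow>
     (let D = pCons 0 B - A; v = coeff D (Suc k); A' = Polynomial.smult (1 / v) D;
          E = A' - B; u = coeff E k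
      in v > 0 \<and> u > 0 \<and> stieltjes_signs s (Suc k) A' (Polynomial.smult (1 / u) E))"

text \<open>Both halves of the step are Moebius maps: \<open>B / A = 1 - u * (C / A)\<close>, and
  the new quotient is \<open>z - v * (A / B)\<close>. Positive \<open>u\<close> and \<open>v\<close>
  keep each quotient in the required half-plane. On the negative axis the signs alternate with the
  degree, so the summands never cancel.\<close>

lemma stieltjes_pair_step_up:
  assumes "stieltjes_pair (Suc k) A C" "u > 0" "v > 0"
  defines "B \<equiv> A - Polynomial.smult u C"
  shows "stieltjes_pair (Suc (Suc k)) (pCons 0 B - Polynomial.smult v A) B"
proof -
  have A: "lead_coeff A = 1" "degree A = Suc k" and C: "lead_coeff C = 1" "degree C = k"
    and H: "hermite_biehler A C" and s: "\<And>t. t < 0 \<Longrightarrow> (-1) ^ Suc k * poly A t > 0"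
    using assms unfolding stieltjes_pair_def by auto
  have sC: "(-1) ^ k * poly C t > 0" if "t \<le> 0" for t
    using hermite_biehler_real_part(1)[OF H A(1,2) _ s that] C by simp
  have cB: "coeff B (Suc k) = 1" using A C by (simp add: B_def coeff_eq_0)
  have "degree B \<le> Suc k" unfolding B_def using A C
    by (intro degree_diff_le) (auto intro: order.trans[OF degree_smult_le])
  then have dB: "degree B = Suc k" using cB by (intro antisym le_degree) auto
  define A1 where "A1 = pCons 0 B - Polynomial.smult v A"
  have cA1: "coeff A1 (Suc (Suc k)) = 1" using cB A by (simp add: A1_def coeff_eq_0)
  have "degree A1 \<le> Suc (Suc k)" unfolding A1_def using A dB
    by (intro degree_diff_le) (auto intro: order.trans[OF degree_smult_le] order.trans[OF degree_pCons_le])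
  then have dA1: "degree A1 = Suc (Suc k)" using cA1 by (intro antisym le_degree) auto
  have sB: "(-1) ^ Suc k * poly B t > 0" if "t < 0" for t
  proof -
    have "(-1) ^ Suc k * poly B t = (-1) ^ Suc k * poly A t + u * ((-1) ^ k * poly C t)"
      by (simp add: B_def algebra_simps)
    moreover have "u * ((-1) ^ k * poly C t) > 0" using sC[of t] that \<open>u > 0\<close> by (rule_tac mult_pos_pos) auto
    ultimately show ?thesis using s[OF that] by linarith
  qed
  have sA1: "(-1) ^ Suc (Suc k) * poly A1 t > 0" if "t < 0" for t
  proof -
    have "(-1) ^ Suc (Suc k) * poly A1 t = (- t) * ((-1) ^ Suc k * poly B t) + v * ((-1) ^ Suc k * poly A t)"
      by (simp add: A1_def algebra_simps)
    moreover have "(- t) * ((-1) ^ Suc k * poly B t) > 0" "v * ((-1) ^ Suc k * poly A t) > 0"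
      using mult_pos_pos[OF _ sB[OF that], of "-t"] mult_pos_pos[OF \<open>v > 0\<close> s[OF that]] that by simp_all
    ultimately show ?thesis by linarith
  qed
  have "hermite_biehler A1 B"
    unfolding hermite_biehler_def
  proof (intro conjI allI impI notI)
    fix z :: complex assume z: "Im z > 0"
    let ?a = "poly (cpoly A) z" and ?b = "poly (cpoly B) z" and ?c = "poly (cpoly C) z"
    have ac: "Im (?a * cnj ?c) > 0" using H z unfolding hermite_biehler_def by blast
    have b: "?b = ?a - of_real u * ?c" by (simp add: B_def)
    have "?a * cnj ?b = of_real ((cmod ?a)\<^sup>2) - of_real u * (?a * cnj ?c)"
      unfolding b by (simp add: complex_norm_square algebra_simps del: of_real_power)
    then have ab: "Im (?a * cnj ?b) = - u * Im (?a * cnj ?c)" by (simp del: of_real_power)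
    have "poly (cpoly A1) z = z * ?b - of_real v * ?a" by (simp add: A1_def)
    then have "poly (cpoly A1) z * cnj ?b = z * of_real ((cmod ?b)\<^sup>2) - of_real v * (?a * cnj ?b)"
      by (simp only: complex_norm_square) (simp only: algebra_simps)
    then have "Im (poly (cpoly A1) z * cnj ?b) = Im z * (cmod ?b)\<^sup>2 - v * Im (?a * cnj ?b)"
      by (simp del: of_real_power)
    also have "\<dots> = Im z * (cmod ?b)\<^sup>2 + v * u * Im (?a * cnj ?c)" unfolding ab by simp
    finally show "Im (poly (cpoly A1) z * cnj ?b) > 0"
      using z ac \<open>u > 0\<close> \<open>v > 0\<close> by (simp add: add_nonneg_pos)
  next
    fix t assume t: "poly A1 t = 0 \<and> poly B t = 0"
    then have "poly A t = 0" using \<open>v > 0\<close> by (auto simp: A1_def)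
    then have "poly C t = 0" using t \<open>u > 0\<close> by (simp add: B_def)
    with \<open>poly A t = 0\<close> H show False unfolding hermite_biehler_def by blast
  qed
  then show ?thesis using cA1 cB dA1 dB sA1 unfolding stieltjes_pair_def A1_def by simp
qed

text \<open>\<open>v\<close> and \<open>u\<close> are forced, as they have to make \<open>A'\<close>
  and \<open>C\<close> monic. The last two clauses provide the hypotheses for repeating the
  step.\<close>

lemma stieltjes_pair_step:
  assumes A: "lead_coeff A = 1" "degree A = Suc (Suc k)" and B: "lead_coeff B = 1" "degree B = Suc k"
  defines "D \<equiv> pCons 0 B - A"
  defines "v \<equiv> coeff D (Suc k)"
  defines "A' \<equiv> Polynomial.smult (1 / v) D"
  defines "u \<equiv> coeff (A' - B) k"
  defines "C \<equiv> Polynomial.smult (1 / u) (A' - B)"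
  shows "stieltjes_pair (Suc (Suc k)) A B \<longleftrightarrow> v > 0 \<and> u > 0 \<and> stieltjes_pair (Suc k) A' C"
    "v > 0 \<Longrightarrow> lead_coeff A' = 1 \<and> degree A' = Suc k"
    "v > 0 \<Longrightarrow> u > 0 \<Longrightarrow> lead_coeff C = 1 \<and> degree C = k"
proof -
  have cD: "coeff D (Suc (Suc k)) = 0" using A B by (simp add: D_def)
  have "degree D \<le> Suc (Suc k)" unfolding D_def using A B
    by (intro degree_diff_le) (auto intro: order.trans[OF degree_pCons_le])
  then have dD: "degree D \<le> Suc k"
    using cD by (metis le_SucE leading_coeff_0_iff degree_0 le0)
  have A': "coeff A' (Suc k) = 1" "degree A' = Suc k" if "v > 0"
  proof -
    show "coeff A' (Suc k) = 1" using that by (simp add: A'_def v_def)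
    then show "degree A' = Suc k" using dD that unfolding A'_def by (intro antisym le_degree) auto
  qed
  then show A'': "v > 0 \<Longrightarrow> lead_coeff A' = 1 \<and> degree A' = Suc k" by simp
  have dE: "degree (A' - B) \<le> k" if "v > 0"
  proof -
    have "degree (A' - B) \<le> Suc k" using A' that B by (intro degree_diff_le) auto
    moreover have "coeff (A' - B) (Suc k) = 0" using A' that B by simp
    ultimately show ?thesis by (metis le_SucE leading_coeff_0_iff degree_0 le0)
  qed
  have C: "coeff C k = 1" "degree C = k" if "v > 0" "u > 0"
  proof -
    show "coeff C k = 1" using that by (simp add: C_def u_def)
    then show "degree C = k" using dE that unfolding C_def by (intro antisym le_degree) auto
  qed
  then show C': "v > 0 \<Longrightarrow> u > 0 \<Longrightarrow> lead_coeff C = 1 \<and> degree C = k" by simp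
  show "stieltjes_pair (Suc (Suc k)) A B \<longleftrightarrow> v > 0 \<and> u > 0 \<and> stieltjes_pair (Suc k) A' C"
  proof
    assume S: "stieltjes_pair (Suc (Suc k)) A B"
    note down = stieltjes_pair_step_down[OF S, folded D_def]
    have v: "v > 0" using down by (simp add: v_def)
    have HA: "hermite_biehler B A'" unfolding A'_def using hermite_biehler_smult[OF down(1), of "1 / v"] v by simp
    \<comment> \<open>\<open>A' cnj (A' - B)\<close> and \<open>B cnj A'\<close> have the same
      imaginary part, so the second half of the step transfers the property without a new
      estimate.\<close>
    have HE: "hermite_biehler A' (A' - B)"
      unfolding hermite_biehler_def
    proof (intro conjI allI impI notI)
      fix z :: complex assume z: "Im z > 0"
      let ?a = "poly (cpoly A') z" and ?b = "poly (cpoly B) z"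
      have ac: "Im (?b * cnj ?a) > 0" using HA z unfolding hermite_biehler_def by blast
      have "?a * cnj (?a - ?b) = of_real ((cmod ?a)\<^sup>2) - cnj (?b * cnj ?a)"
        by (simp only: complex_norm_square complex_cnj_diff complex_cnj_mult complex_cnj_cnj) (simp only: algebra_simps)
      then have "Im (?a * cnj (?a - ?b)) = Im (of_real ((cmod ?a)\<^sup>2) - cnj (?b * cnj ?a))" by (rule arg_cong)
      then have "Im (?a * cnj (?a - ?b)) = Im (?b * cnj ?a)" by (simp only: minus_complex.sel complex_cnj Im_complex_of_real) simp
      then show "Im (poly (cpoly A') z * cnj (poly (cpoly (A' - B)) z)) > 0" using ac by simp
    next
      fix t assume "poly A' t = 0 \<and> poly (A' - B) t = 0"
      then show False using HA unfolding hermite_biehler_def by auto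
    qed
    have u: "u > 0" unfolding u_def
      using hermite_biehler_shift[OF HE _ _ dE[OF v], of] A''[OF v] by blast
    have "hermite_biehler A' C" unfolding C_def using hermite_biehler_smult[OF HE, of "1 / u"] u by simp
    moreover have "(-1) ^ Suc k * poly A' t > 0" if "t < 0" for t
    proof -
      have "(-1) ^ Suc k * poly A' t = (1 / v) * ((-1) ^ Suc k * poly D t)" by (simp add: A'_def)
      then show ?thesis using down(4)[OF that] v by (simp only: zero_less_mult_iff) simp
    qed
    ultimately show "v > 0 \<and> u > 0 \<and> stieltjes_pair (Suc k) A' C"
      using u v A''[OF v] C'[OF v u] unfolding stieltjes_pair_def by (metis diff_Suc_1)
  next
    assume *: "v > 0 \<and> u > 0 \<and> stieltjes_pair (Suc k) A' C"
    have "A' - Polynomial.smult u C = B" using * by (simp add: C_def)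
    moreover have "pCons 0 B - Polynomial.smult v A' = A" using * by (simp add: A'_def D_def)
    ultimately show "stieltjes_pair (Suc (Suc k)) A B" using stieltjes_pair_step_up[of k A' C u v] * by simp
  qed
qed

text \<open>The flag \<open>s\<close> survives the recursion because \<open>z B\<close> vanishes at
  0: \<open>A'\<close> vanishes there exactly if \<open>A\<close> does. In the base case
  \<open>A\<close> is \<open>z + a\<close>, and being negative left of 0 means
  \<open>a \<le> 0\<close>; the flag decides between \<open>a < 0\<close> and
  \<open>a = 0\<close>.\<close>

lemma stieltjes_signs_iff_stieltjes_pair:
  assumes "lead_coeff A = 1" "degree A = Suc k" "lead_coeff B = 1" "degree B = k"
  shows "stieltjes_signs s (Suc k) A B \<longleftrightarrow> stieltjes_pair (Suc k) A B \<and> (poly A 0 = 0 \<longleftrightarrow> s \<noteq> 0)"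
  using assms
proof (induction k arbitrary: A B)
  case 0
  obtain a q where Aq: "A = pCons a q" by (rule pCons_cases)
  then have q: "degree q = 0" "lead_coeff q = 1" using 0 by (auto simp: degree_pCons_eq_if split: if_splits)
  then obtain b where "q = [:b:]" by (metis degree_eq_zeroE)
  then have A: "A = [:a, 1:]" using Aq q by simp
  have B: "B = 1" using 0 by (metis degree_eq_zeroE coeff_pCons_0 one_pCons)
  have "stieltjes_pair (Suc 0) A B \<longleftrightarrow> (\<forall>t<0. a + t < 0)"
    by (auto simp: stieltjes_pair_def hermite_biehler_def A B)
  also have "\<dots> \<longleftrightarrow> a \<le> 0"
  proof
    assume "\<forall>t<0. a + t < 0"
    then show "a \<le> 0" by (cases "a > 0") (auto dest!: spec[of _ "- a / 2"])
  qed auto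
  finally show ?case by (auto simp: A)
next
  case (Suc k)
  define D where "D = pCons 0 B - A"
  define v where "v = coeff D (Suc k)"
  define A' where "A' = Polynomial.smult (1 / v) D"
  define u where "u = coeff (A' - B) k"
  define C where "C = Polynomial.smult (1 / u) (A' - B)"
  note st = stieltjes_pair_step[OF Suc.prems, folded D_def, folded v_def, folded A'_def, folded u_def, folded C_def]
  have "stieltjes_signs s (Suc (Suc k)) A B \<longleftrightarrow> v > 0 \<and> u > 0 \<and> stieltjes_signs s (Suc k) A' C"
    by (simp add: Let_def D_def v_def A'_def u_def C_def)
  also have "\<dots> \<longleftrightarrow> v > 0 \<and> u > 0 \<and> stieltjes_pair (Suc k) A' C \<and> (poly A' 0 = 0 \<longleftrightarrow> s \<noteq> 0)"
    using Suc.IH[of A' C] st(2,3) by blast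
  also have "\<dots> \<longleftrightarrow> v > 0 \<and> u > 0 \<and> stieltjes_pair (Suc k) A' C \<and> (poly A 0 = 0 \<longleftrightarrow> s \<noteq> 0)"
    by (auto simp: A'_def D_def)
  also have "\<dots> \<longleftrightarrow> stieltjes_pair (Suc (Suc k)) A B \<and> (poly A 0 = 0 \<longleftrightarrow> s \<noteq> 0)"
    using st(1) by blast
  finally show ?case .
qed

text \<open>By the subleading coefficient, \<open>l\<close> is the sum of the imaginary parts of the
  roots, and dividing \<open>- Q\<close> by it gives the monic \<open>B\<close>. From left to right,
  arguments summing to less than \<open>pi / 2\<close> for every \<open>t < 0\<close> give the sign
  of \<open>A\<close> there; from right to left, the phase at 0 is at most \<open>pi / 2\<close> and
  the flag says whether it is reached.\<close>

lemma roots_in_sector_iff: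
  fixes A Q :: "real poly"
  assumes A: "lead_coeff A = 1" "degree A = Suc k" and Q: "degree Q \<le> k"
  defines "M \<equiv> proots (cpoly A + Polynomial.smult \<i> (cpoly Q))"
  defines "l \<equiv> - coeff Q k"
  defines "B \<equiv> Polynomial.smult (- 1 / l) Q"
  shows "((\<forall>z\<in>#M. Im z > 0) \<and> sumarg M 0 \<le> pi / 2 \<and> (sumarg M 0 = pi / 2 \<longleftrightarrow> s \<noteq> 0)) \<longleftrightarrow>
    l > 0 \<and> stieltjes_signs s (Suc k) A B"
proof -
  define p where "p = cpoly A + Polynomial.smult \<i> (cpoly Q)"
  have cp: "coeff p (Suc k) = 1" using A Q by (simp add: p_def coeff_eq_0)
  have "degree p \<le> Suc k" unfolding p_def using A Q
    by (intro degree_add_le) (auto intro: order.trans[OF degree_smult_le])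
  then have d: "degree p = Suc k" using cp by (intro antisym le_degree) auto
  have m: "lead_coeff p = 1" using cp d by simp
  have B: "lead_coeff B = 1 \<and> degree B = k" if "l > 0"
  proof -
    have c: "coeff B k = 1" using that by (simp add: B_def l_def)
    then have "degree B = k" using Q that unfolding B_def by (intro antisym le_degree) auto
    then show ?thesis using c by simp
  qed
  have p_eq: "p = cpoly A - Polynomial.smult (\<i> * of_real l) (cpoly B)" if "l > 0"
    using that by (intro poly_eqI) (simp add: p_def B_def)
  show ?thesis
  proof
    assume L: "(\<forall>z\<in>#M. Im z > 0) \<and> sumarg M 0 \<le> pi / 2 \<and> (sumarg M 0 = pi / 2 \<longleftrightarrow> s \<noteq> 0)"
    then have r: "\<forall>z\<in>#M. Im z > 0" and le: "sumarg M 0 \<le> pi / 2" by auto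
    have H: "hermite_biehler A (- Q)" using hermite_biehler_of_roots[OF p_def m] d r unfolding M_def p_def by simp
    have l: "l > 0" using hermite_biehler_shift[OF H A] Q by (simp add: l_def)
    have hermite_biehler: "hermite_biehler A B" using hermite_biehler_smult[OF H, of "1 / l"] l by (simp add: B_def)
    have sz: "size M = Suc k" using d by (simp add: size_proots_complex M_def p_def)
    have sA: "(-1) ^ Suc k * poly A t > 0" if t: "t < 0" for t
    proof -
      define R where "R = (\<Prod>z\<in>#M. cmod (z - of_real t))"
      have R: "R > 0" unfolding R_def by (rule prod_mset_norm_pos[OF r])
      have "(-1) ^ Suc k * poly p (of_real t) = of_real R * cis (sumarg M t)"
        using monic_poly_polar[OF m d] unfolding R_def M_def p_def by simp
      then have "Re ((-1) ^ Suc k * poly p (of_real t)) = R * cos (sumarg M t)" by simp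
      moreover have "Re ((-1) ^ Suc k * poly p (of_real t)) = (-1) ^ Suc k * poly A t"
        by (cases "even k") (simp_all add: p_def cpoly_eval_real)
      moreover have "sumarg M t < pi / 2" "sumarg M t > 0"
        using sumarg_strict_mono[OF r _ t] sumarg_pos[OF r] sz le by fastforce+
      ultimately show ?thesis using R cos_gt_zero[of "sumarg M t"] by (metis mult_pos_pos)
    qed
    have "stieltjes_pair (Suc k) A B" using A B[OF l] hermite_biehler sA unfolding stieltjes_pair_def by (metis diff_Suc_1)
    moreover have "sumarg M 0 = pi / 2 \<longleftrightarrow> poly A 0 = 0"
      using hermite_biehler_real_part(4)[OF hermite_biehler A _ sA l] B[OF l] p_eq[OF l] unfolding M_def p_def by simp
    ultimately show "l > 0 \<and> stieltjes_signs s (Suc k) A B"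
      using stieltjes_signs_iff_stieltjes_pair[OF A] B[OF l] l L by blast
  next
    assume R: "l > 0 \<and> stieltjes_signs s (Suc k) A B"
    then have l: "l > 0" by blast
    then have S: "stieltjes_pair (Suc k) A B" "poly A 0 = 0 \<longleftrightarrow> s \<noteq> 0" using R stieltjes_signs_iff_stieltjes_pair[OF A] B[OF l] by blast+
    then have hermite_biehler: "hermite_biehler A B" and sA: "\<And>t. t < 0 \<Longrightarrow> (-1) ^ Suc k * poly A t > 0" unfolding stieltjes_pair_def by auto
    have r: "\<forall>z\<in>#M. Im z > 0"
    proof
      fix z assume "z \<in># M"
      then have "poly (cpoly A - Polynomial.smult (\<i> * of_real l) (cpoly B)) z = 0"
        using monic_proots_iff[OF m] p_eq[OF l] unfolding M_def p_def by simp
      then show "Im z > 0" using hermite_biehler_root[OF hermite_biehler, of "\<i> * of_real l" z] l by simp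
    qed
    moreover have "sumarg M 0 \<le> pi / 2" "sumarg M 0 = pi / 2 \<longleftrightarrow> poly A 0 = 0"
      using hermite_biehler_real_part(3,4)[OF hermite_biehler A _ sA l] B[OF l] p_eq[OF l] unfolding M_def p_def by simp_all
    ultimately show "(\<forall>z\<in>#M. Im z > 0) \<and> sumarg M 0 \<le> pi / 2 \<and> (sumarg M 0 = pi / 2 \<longleftrightarrow> s \<noteq> 0)"
      using S(2) by blast
  qed
qed

section \<open>Substitutions for polynomials with random coefficients\<close>

text \<open>The \<sigma>-algebra is generated by the coefficients, so the measurability of an
  operation is checked coefficient by coefficient, uniformly in the degree.\<close>

definition polyM :: "'a :: {real_normed_field, second_countable_topology} poly measure" where
  "polyM = vimage_algebra UNIV coeff (\<Pi>\<^sub>M i\<in>UNIV. borel)"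

lemma space_polyM [simp]: "space polyM = UNIV"
  by (simp add: polyM_def)

lemma measurable_coeff [measurable]: "(\<lambda>p. coeff p i) \<in> borel_measurable polyM"
proof -
  have "coeff \<in> polyM \<rightarrow>\<^sub>M (\<Pi>\<^sub>M i\<in>UNIV. borel :: 'a measure)"
    unfolding polyM_def by (intro measurable_vimage_algebra1) (auto simp: space_PiM)
  then show ?thesis by (rule measurable_compose) simp
qed

lemma measurable_polyM:
  assumes "\<And>i. (\<lambda>\<omega>. coeff (f \<omega>) i) \<in> borel_measurable N"
  shows "f \<in> N \<rightarrow>\<^sub>M polyM"
  unfolding polyM_def
proof (rule measurable_vimage_algebra2)
  show "(\<lambda>x. coeff (f x)) \<in> N \<rightarrow>\<^sub>M (\<Pi>\<^sub>M i\<in>UNIV. borel)"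
    using assms by (intro measurable_abs_UNIV)
qed auto

lemma measurable_coeff_compose [measurable (raw)]:
  "f \<in> N \<rightarrow>\<^sub>M polyM \<Longrightarrow> (\<lambda>\<omega>. coeff (f \<omega>) i) \<in> borel_measurable N"
  by (rule measurable_compose[OF _ measurable_coeff])

lemma measurable_poly_diff [measurable (raw)]:
  "f \<in> N \<rightarrow>\<^sub>M polyM \<Longrightarrow> g \<in> N \<rightarrow>\<^sub>M polyM \<Longrightarrow> (\<lambda>\<omega>. f \<omega> - g \<omega>) \<in> N \<rightarrow>\<^sub>M polyM"
  by (intro measurable_polyM) simp

lemma measurable_poly_add [measurable (raw)]:
  "f \<in> N \<rightarrow>\<^sub>M polyM \<Longrightarrow> g \<in> N \<rightarrow>\<^sub>M polyM \<Longrightarrow> (\<lambda>\<omega>. f \<omega> + g \<omega>) \<in> N \<rightarrow>\<^sub>M polyM"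
  by (intro measurable_polyM) simp

lemma measurable_poly_smult [measurable (raw)]:
  "f \<in> borel_measurable N \<Longrightarrow> g \<in> N \<rightarrow>\<^sub>M polyM \<Longrightarrow> (\<lambda>\<omega>. Polynomial.smult (f \<omega>) (g \<omega>)) \<in> N \<rightarrow>\<^sub>M polyM"
  by (intro measurable_polyM) simp

lemma measurable_pCons [measurable (raw)]:
  "f \<in> borel_measurable N \<Longrightarrow> g \<in> N \<rightarrow>\<^sub>M polyM \<Longrightarrow> (\<lambda>\<omega>. pCons (f \<omega>) (g \<omega>)) \<in> N \<rightarrow>\<^sub>M polyM"
  by (intro measurable_polyM) (auto simp: coeff_pCons split: nat.split)

lemma measurable_poly_mult [measurable (raw)]:
  "f \<in> N \<rightarrow>\<^sub>M polyM \<Longrightarrow> g \<in> N \<rightarrow>\<^sub>M polyM \<Longrightarrow> (\<lambda>\<omega>. f \<omega> * g \<omega>) \<in> N \<rightarrow>\<^sub>M polyM"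
  by (intro measurable_polyM) (simp add: coeff_mult)

lemma measurable_poly_prod [measurable (raw)]:
  "(\<And>i. i \<in> I \<Longrightarrow> f i \<in> N \<rightarrow>\<^sub>M polyM) \<Longrightarrow> (\<lambda>\<omega>. \<Prod>i\<in>I. f i \<omega>) \<in> N \<rightarrow>\<^sub>M polyM"
  by (induction I rule: infinite_finite_induct) auto

lemma measurable_cpoly [measurable (raw)]:
  "f \<in> N \<rightarrow>\<^sub>M polyM \<Longrightarrow> (\<lambda>\<omega>. map_poly complex_of_real (f \<omega>)) \<in> N \<rightarrow>\<^sub>M polyM"
  by (intro measurable_polyM) simp

section \<open>Monic polynomials parametrised by their coefficients\<close>

text \<open>Only the coefficients from \<open>s\<close> to \<open>k - 1\<close> are free. For
  \<open>s = 1\<close> and positive degree the vanishing constant term builds in the zero at the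
  origin that marks the rank-deficient case.\<close>

definition mpoly :: "nat \<Rightarrow> nat \<Rightarrow> (nat \<Rightarrow> 'a) \<Rightarrow> 'a :: {real_normed_field, second_countable_topology} poly" where
  "mpoly s k a = monom 1 k + (\<Sum>i\<in>{s..<k}. monom (a i) i)"

lemma coeff_mpoly: "coeff (mpoly s k a) i = (if i = k then 1 else if s \<le> i \<and> i < k then a i else 0)"
proof -
  have "(\<Sum>j\<in>{s..<k}. coeff (monom (a j) j) i) = (\<Sum>j\<in>{s..<k}. if j = i then a i else 0)"
    by (intro sum.cong) (auto simp: coeff_monom)
  then show ?thesis by (auto simp: mpoly_def coeff_sum)
qed

lemma degree_mpoly [simp]: "degree (mpoly s k a) = k"
proof (rule antisym)
  show "degree (mpoly s k a) \<le> k" by (intro degree_le) (auto simp: coeff_mpoly)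
  show "k \<le> degree (mpoly s k a)" by (intro le_degree) (simp add: coeff_mpoly)
qed

lemma lead_coeff_mpoly: "lead_coeff (mpoly s k a) = 1"
  by (simp add: coeff_mpoly)

lemma mpoly_nonzero [simp]: "mpoly s k a \<noteq> 0"
  using lead_coeff_mpoly[of s k a] by (metis leading_coeff_0_iff zero_neq_one)

lemma measurable_mpoly:
  assumes "f \<in> N \<rightarrow>\<^sub>M (\<Pi>\<^sub>M i\<in>I. lborel)" "{s..<k} \<subseteq> I"
  shows "(\<lambda>\<omega>. mpoly s k (f \<omega>)) \<in> N \<rightarrow>\<^sub>M polyM"
proof (rule measurable_polyM)
  fix i
  have "(\<lambda>\<omega>. f \<omega> i) \<in> borel_measurable N" if "i \<in> I"
    using measurable_compose[OF assms(1) measurable_component_singleton[OF that]] by simp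
  then show "(\<lambda>\<omega>. coeff (mpoly s k (f \<omega>)) i) \<in> borel_measurable N"
    using assms(2) by (cases "i = k"; cases "s \<le> i"; cases "i < k") (auto simp: coeff_mpoly subset_eq)
qed

lemma measurable_mpoly' [measurable]: "mpoly s k \<in> (\<Pi>\<^sub>M i\<in>{s..<k}. lborel) \<rightarrow>\<^sub>M polyM"
  by (rule measurable_mpoly[of "\<lambda>x. x" _ "{s..<k}"]) auto

section \<open>Coordinatewise substitutions in product integrals\<close>

lemmas sigma_finite_lborel = lborel.sigma_finite_measure_axioms

lemma sigma_finite_PiM_lborel: "finite I \<Longrightarrow> sigma_finite_measure (\<Pi>\<^sub>M i\<in>I. lborel :: 'a :: euclidean_space measure)"
proof -
  assume "finite I"
  interpret finite_product_sigma_finite "\<lambda>_. lborel :: 'a measure" I by standard fact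
  show ?thesis by (rule sigma_finite_measure_axioms)
qed

lemma nn_integral_swap:
  assumes "sigma_finite_measure M" "sigma_finite_measure N" "case_prod f \<in> borel_measurable (M \<Otimes>\<^sub>M N)"
  shows "(\<integral>\<^sup>+x. \<integral>\<^sup>+y. f x y \<partial>N \<partial>M) = (\<integral>\<^sup>+y. \<integral>\<^sup>+x. f x y \<partial>M \<partial>N)"
  using pair_sigma_finite.Fubini'[OF pair_sigma_finite.intro[OF assms(1,2)] assms(3)] by simp

text \<open>A product measure is determined by its values on boxes, and on boxes the image measure
  factors because weight and map act on each coordinate separately.\<close>

lemma nn_integral_PiM_substitution:
  fixes M :: "'i \<Rightarrow> 'a measure" and N :: "'i \<Rightarrow> 'b measure"
  assumes sfM: "\<And>i. sigma_finite_measure (M i)" and sfN: "\<And>i. sigma_finite_measure (N i)" and I: "finite I"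
    and T[measurable]: "\<And>i. i \<in> I \<Longrightarrow> T i \<in> N i \<rightarrow>\<^sub>M M i"
    and w[measurable]: "\<And>i. i \<in> I \<Longrightarrow> w i \<in> borel_measurable (N i)"
    and sub: "\<And>i f. i \<in> I \<Longrightarrow> f \<in> borel_measurable (M i) \<Longrightarrow> (\<integral>\<^sup>+x. f x \<partial>M i) = (\<integral>\<^sup>+y. w i y * f (T i y) \<partial>N i)"
    and F: "F \<in> borel_measurable (PiM I M)"
  shows "(\<integral>\<^sup>+x. F x \<partial>PiM I M) = (\<integral>\<^sup>+y. (\<Prod>i\<in>I. w i (y i)) * F (\<lambda>i\<in>I. T i (y i)) \<partial>PiM I N)"
proof -
  interpret M: product_sigma_finite M by (rule product_sigma_finite.intro) (rule sfM)
  interpret N: product_sigma_finite N by (rule product_sigma_finite.intro) (rule sfN)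
  define T' where "T' y = (\<lambda>i\<in>I. T i (y i))" for y
  define W where "W y = (\<Prod>i\<in>I. w i (y i))" for y
  have T'[measurable]: "T' \<in> PiM I N \<rightarrow>\<^sub>M PiM I M" unfolding T'_def by measurable
  have W[measurable]: "W \<in> borel_measurable (PiM I N)" unfolding W_def by measurable
  define Q where "Q = distr (density (PiM I N) W) (PiM I M) T'"
  have "PiM I M = Q"
  proof (rule M.PiM_eqI[symmetric, OF I])
    show "sets Q = sets (PiM I M)" by (simp add: Q_def)
    fix A assume A: "\<And>i. i \<in> I \<Longrightarrow> A i \<in> sets (M i)"
    then have PA: "Pi\<^sub>E I A \<in> sets (PiM I M)" using I by (intro sets_PiM_I_finite) auto
    have "emeasure Q (Pi\<^sub>E I A) = (\<integral>\<^sup>+y. W y * indicator (Pi\<^sub>E I A) (T' y) \<partial>PiM I N)"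
      unfolding Q_def using PA
      by (subst emeasure_distr) (auto simp: emeasure_density measurable_sets[OF T'] intro!: nn_integral_cong split: split_indicator)
    also have "\<dots> = (\<integral>\<^sup>+y. (\<Prod>i\<in>I. w i (y i) * indicator (A i) (T i (y i))) \<partial>PiM I N)"
    proof (rule nn_integral_cong)
      fix y
      have "indicator (Pi\<^sub>E I A) (T' y) = (\<Prod>i\<in>I. indicator (A i) (T i (y i)) :: ennreal)"
      proof (cases "\<forall>i\<in>I. T i (y i) \<in> A i")
        case False
        then have "(\<Prod>i\<in>I. indicator (A i) (T i (y i)) :: ennreal) = 0"
          using I False by (intro prod_zero) (auto simp: indicator_def)
        then show ?thesis using False by (auto simp: T'_def PiE_def Pi_def split: split_indicator)
      qed (auto simp: T'_def)
      then show "W y * indicator (Pi\<^sub>E I A) (T' y) = (\<Prod>i\<in>I. w i (y i) * indicator (A i) (T i (y i)))"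
        by (simp add: W_def prod.distrib)
    qed
    also have "\<dots> = (\<Prod>i\<in>I. \<integral>\<^sup>+y. w i y * indicator (A i) (T i y) \<partial>N i)"
      using A by (intro N.product_nn_integral_prod[OF I]) auto
    also have "\<dots> = (\<Prod>i\<in>I. emeasure (M i) (A i))"
      using A by (intro prod.cong refl) (simp add: sub[symmetric])
    finally show "emeasure Q (Pi\<^sub>E I A) = (\<Prod>i\<in>I. emeasure (M i) (A i))" .
  qed
  then have "(\<integral>\<^sup>+x. F x \<partial>PiM I M) = (\<integral>\<^sup>+x. F x \<partial>Q)" by simp
  also have "\<dots> = (\<integral>\<^sup>+y. F (T' y) \<partial>density (PiM I N) W)"
    unfolding Q_def using F by (subst nn_integral_distr) auto
  also have "\<dots> = (\<integral>\<^sup>+y. W y * F (T' y) \<partial>PiM I N)"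
    using F by (subst nn_integral_density) auto
  finally show ?thesis unfolding T'_def W_def .
qed

text \<open>The same comparison on boxes when each coordinate is replaced by a pair. It serves both
  for polar coordinates and for the splitting into real and imaginary parts.\<close>

lemma nn_integral_PiM_substitution2:
  fixes M :: "'i \<Rightarrow> 'a measure" and A :: "'i \<Rightarrow> 'b measure" and B :: "'i \<Rightarrow> 'c measure"
  assumes sfM: "\<And>i. sigma_finite_measure (M i)" and sfA: "\<And>i. sigma_finite_measure (A i)"
    and sfB: "\<And>i. sigma_finite_measure (B i)" and I: "finite I"
    and T[measurable]: "\<And>i. i \<in> I \<Longrightarrow> case_prod (T i) \<in> A i \<Otimes>\<^sub>M B i \<rightarrow>\<^sub>M M i"
    and w[measurable]: "\<And>i. i \<in> I \<Longrightarrow> case_prod (w i) \<in> borel_measurable (A i \<Otimes>\<^sub>M B i)"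
    and sub: "\<And>i f. i \<in> I \<Longrightarrow> f \<in> borel_measurable (M i) \<Longrightarrow>
      (\<integral>\<^sup>+x. f x \<partial>M i) = (\<integral>\<^sup>+x. \<integral>\<^sup>+y. w i x y * f (T i x y) \<partial>B i \<partial>A i)"
    and F: "F \<in> borel_measurable (PiM I M)"
  shows "(\<integral>\<^sup>+x. F x \<partial>PiM I M) =
    (\<integral>\<^sup>+x. \<integral>\<^sup>+y. (\<Prod>i\<in>I. w i (x i) (y i)) * F (\<lambda>i\<in>I. T i (x i) (y i)) \<partial>PiM I B \<partial>PiM I A)"
proof -
  interpret M: product_sigma_finite M by (rule product_sigma_finite.intro) (rule sfM)
  interpret A: product_sigma_finite A by (rule product_sigma_finite.intro) (rule sfA)
  interpret B: product_sigma_finite B by (rule product_sigma_finite.intro) (rule sfB)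
  interpret IB: finite_product_sigma_finite B I by standard fact
  define T' where "T' p = (\<lambda>i\<in>I. T i (fst p i) (snd p i))" for p
  define W where "W p = (\<Prod>i\<in>I. w i (fst p i) (snd p i))" for p
  have Ti[measurable]: "(\<lambda>p. T i (fst p i) (snd p i)) \<in> PiM I A \<Otimes>\<^sub>M PiM I B \<rightarrow>\<^sub>M M i" if "i \<in> I" for i
    using that by measurable
  have wi[measurable]: "(\<lambda>p. w i (fst p i) (snd p i)) \<in> borel_measurable (PiM I A \<Otimes>\<^sub>M PiM I B)" if "i \<in> I" for i
    using that by measurable
  have T'[measurable]: "T' \<in> PiM I A \<Otimes>\<^sub>M PiM I B \<rightarrow>\<^sub>M PiM I M" unfolding T'_def by measurable
  have W[measurable]: "W \<in> borel_measurable (PiM I A \<Otimes>\<^sub>M PiM I B)" unfolding W_def by measurable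
  define Q where "Q = distr (density (PiM I A \<Otimes>\<^sub>M PiM I B) W) (PiM I M) T'"
  have "PiM I M = Q"
  proof (rule M.PiM_eqI[symmetric, OF I])
    show "sets Q = sets (PiM I M)" by (simp add: Q_def)
    fix E assume E: "\<And>i. i \<in> I \<Longrightarrow> E i \<in> sets (M i)"
    then have PE: "Pi\<^sub>E I E \<in> sets (PiM I M)" using I by (intro sets_PiM_I_finite) auto
    have Em: "(\<lambda>p. w i (fst p) (snd p) * indicator (E i) (T i (fst p) (snd p))) \<in> borel_measurable (A i \<Otimes>\<^sub>M B i)"
      if "i \<in> I" for i using that E[OF that] by measurable
    have Em2: "(\<lambda>y. w i x y * indicator (E i) (T i x y)) \<in> borel_measurable (B i)"
      if "i \<in> I" "x \<in> space (A i)" for i x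
      using measurable_compose[OF measurable_Pair1'[OF that(2)] Em[OF that(1)]] by simp
    have Em3: "(\<lambda>x. \<integral>\<^sup>+y. w i x y * indicator (E i) (T i x y) \<partial>B i) \<in> borel_measurable (A i)"
      if "i \<in> I" for i
      using sigma_finite_measure.borel_measurable_nn_integral_fst[OF sfB Em[OF that]] by simp
    have "emeasure Q (Pi\<^sub>E I E) = (\<integral>\<^sup>+p. W p * indicator (Pi\<^sub>E I E) (T' p) \<partial>(PiM I A \<Otimes>\<^sub>M PiM I B))"
      unfolding Q_def using PE
      by (subst emeasure_distr) (auto simp: emeasure_density measurable_sets[OF T'] intro!: nn_integral_cong split: split_indicator)
    also have "\<dots> = (\<integral>\<^sup>+p. (\<Prod>i\<in>I. w i (fst p i) (snd p i) * indicator (E i) (T i (fst p i) (snd p i))) \<partial>(PiM I A \<Otimes>\<^sub>M PiM I B))"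
    proof (rule nn_integral_cong)
      fix p
      have "indicator (Pi\<^sub>E I E) (T' p) = (\<Prod>i\<in>I. indicator (E i) (T i (fst p i) (snd p i)) :: ennreal)"
      proof (cases "\<forall>i\<in>I. T i (fst p i) (snd p i) \<in> E i")
        case False
        then have "(\<Prod>i\<in>I. indicator (E i) (T i (fst p i) (snd p i)) :: ennreal) = 0"
          using I False by (intro prod_zero) (auto simp: indicator_def)
        then show ?thesis using False by (auto simp: T'_def PiE_def Pi_def split: split_indicator)
      qed (auto simp: T'_def)
      then show "W p * indicator (Pi\<^sub>E I E) (T' p) = (\<Prod>i\<in>I. w i (fst p i) (snd p i) * indicator (E i) (T i (fst p i) (snd p i)))"
        by (simp add: W_def prod.distrib)
    qed
    also have "\<dots> = (\<integral>\<^sup>+x. \<integral>\<^sup>+y. (\<Prod>i\<in>I. w i (x i) (y i) * indicator (E i) (T i (x i) (y i))) \<partial>PiM I B \<partial>PiM I A)"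
      using E by (subst IB.nn_integral_fst[symmetric]) auto
    also have "\<dots> = (\<integral>\<^sup>+x. (\<Prod>i\<in>I. \<integral>\<^sup>+y. w i (x i) y * indicator (E i) (T i (x i) y) \<partial>B i) \<partial>PiM I A)"
      by (intro nn_integral_cong B.product_nn_integral_prod[OF I] Em2) (auto simp: space_PiM)
    also have "\<dots> = (\<Prod>i\<in>I. \<integral>\<^sup>+x. \<integral>\<^sup>+y. w i x y * indicator (E i) (T i x y) \<partial>B i \<partial>A i)"
      by (intro A.product_nn_integral_prod[OF I] Em3)
    also have "\<dots> = (\<Prod>i\<in>I. emeasure (M i) (E i))"
      using E by (intro prod.cong refl) (simp add: sub[symmetric])
    finally show "emeasure Q (Pi\<^sub>E I E) = (\<Prod>i\<in>I. emeasure (M i) (E i))" .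
  qed
  then have "(\<integral>\<^sup>+x. F x \<partial>PiM I M) = (\<integral>\<^sup>+x. F x \<partial>Q)" by simp
  also have "\<dots> = (\<integral>\<^sup>+y. F (T' y) \<partial>density (PiM I A \<Otimes>\<^sub>M PiM I B) W)"
    unfolding Q_def using F by (subst nn_integral_distr) auto
  also have "\<dots> = (\<integral>\<^sup>+y. W y * F (T' y) \<partial>(PiM I A \<Otimes>\<^sub>M PiM I B))"
    using F by (subst nn_integral_density) auto
  also have "\<dots> = (\<integral>\<^sup>+x. \<integral>\<^sup>+y. W (x, y) * F (T' (x, y)) \<partial>PiM I B \<partial>PiM I A)"
    using F by (subst IB.nn_integral_fst[symmetric]) auto
  finally show ?thesis unfolding T'_def W_def by simp
qed

abbreviation LL :: "'i set \<Rightarrow> ('i \<Rightarrow> real) measure" where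
  "LL I \<equiv> (\<Pi>\<^sub>M i\<in>I. lborel)"

text \<open>\<open>v\<close> is the difference of the subleading coefficients of \<open>R\<close>
  and of the given polynomial. For fixed \<open>v\<close> the remaining \<open>k - s\<close> free
  coefficients are translated and scaled by \<open>- v\<close>, whence the Jacobian
  \<open>v ^ (k - s)\<close>.\<close>

lemma nn_integral_mpoly_step:
  fixes g :: "real poly \<Rightarrow> ennreal"
  assumes g[measurable]: "g \<in> borel_measurable polyM" and sk: "s \<le> k"
    and R: "lead_coeff R = 1" "degree R = Suc k" "\<And>i. i < s \<Longrightarrow> coeff R i = 0"
  shows "(\<integral>\<^sup>+a. indicator {0<..} (coeff R k - a k) * g (mpoly s (Suc k) a) \<partial>(\<Pi>\<^sub>M i\<in>{s..<Suc k}. lborel)) =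
    (\<integral>\<^sup>+v. indicator {0<..} v * (\<integral>\<^sup>+a. ennreal (v ^ (k - s)) * g (R - Polynomial.smult v (mpoly s k a)) \<partial>(\<Pi>\<^sub>M i\<in>{s..<k}. lborel)) \<partial>lborel)"
proof -
  interpret product_sigma_finite "\<lambda>_::nat. lborel :: real measure" by standard
  have ins: "{s..<Suc k} = insert k {s..<k}" using sk by auto
  let ?I = "{s..<k}"
  have upd[measurable]: "(\<lambda>x. x(k := y)) \<in> LL ?I \<rightarrow>\<^sub>M LL (insert k ?I)" for y :: real
    by (rule measurable_fun_upd[where J = ?I]) auto
  have m1[measurable]: "mpoly s (Suc k) \<in> LL (insert k ?I) \<rightarrow>\<^sub>M (polyM :: real poly measure)"
    by (rule measurable_mpoly[of "\<lambda>x. x" _ "insert k ?I"]) (use sk in auto)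
  have ak[measurable]: "(\<lambda>a. a k) \<in> borel_measurable (LL (insert k ?I))"
    using measurable_component_singleton[of k "insert k ?I" "\<lambda>_. lborel :: real measure"] by simp
  define h where "h y = (\<integral>\<^sup>+x. g (mpoly s (Suc k) (x(k := y))) \<partial>LL ?I)" for y
  interpret PI: sigma_finite_measure "LL ?I" by (rule sigma_finite_PiM_lborel) simp
  have upd2: "(\<lambda>p. (snd p)(k := fst p)) \<in> lborel \<Otimes>\<^sub>M LL ?I \<rightarrow>\<^sub>M LL (insert k ?I)"
    by (rule measurable_fun_upd[where J = ?I]) auto
  have "(\<lambda>p. g (mpoly s (Suc k) ((snd p)(k := fst p)))) \<in> borel_measurable (lborel \<Otimes>\<^sub>M LL ?I)"
    using measurable_compose[OF upd2 measurable_compose[OF m1 g]] .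
  then have [measurable]: "h \<in> borel_measurable lborel" unfolding h_def
    by (intro PI.borel_measurable_nn_integral) (simp add: case_prod_beta)
  have "(\<integral>\<^sup>+a. indicator {0<..} (coeff R k - a k) * g (mpoly s (Suc k) a) \<partial>(\<Pi>\<^sub>M i\<in>{s..<Suc k}. lborel)) =
    (\<integral>\<^sup>+y. \<integral>\<^sup>+x. indicator {0<..} (coeff R k - y) * g (mpoly s (Suc k) (x(k := y))) \<partial>LL ?I \<partial>lborel)"
    unfolding ins by (subst product_nn_integral_insert_rev) auto
  also have "\<dots> = (\<integral>\<^sup>+y. indicator {0<..} (coeff R k - y) * h y \<partial>lborel)"
    unfolding h_def by (intro nn_integral_cong nn_integral_cmult) (auto intro!: measurable_compose[OF measurable_compose[OF upd m1] g])
  also have "\<dots> = (\<integral>\<^sup>+v. indicator {0<..} v * h (coeff R k - v) \<partial>lborel)"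
    by (subst nn_integral_real_affine[where c = "-1" and t = "coeff R k"]) auto
  also have "\<dots> = (\<integral>\<^sup>+v. indicator {0<..} v * (\<integral>\<^sup>+a. ennreal (v ^ (k - s)) * g (R - Polynomial.smult v (mpoly s k a)) \<partial>(\<Pi>\<^sub>M i\<in>{s..<k}. lborel)) \<partial>lborel)"
  proof (rule nn_integral_cong)
    fix v :: real
    have "h (coeff R k - v) = (\<integral>\<^sup>+a. ennreal (v ^ (k - s)) * g (R - Polynomial.smult v (mpoly s k a)) \<partial>LL ?I)"
      if v: "v > 0"
    proof -
      have "h (coeff R k - v) = (\<integral>\<^sup>+a. (\<Prod>i\<in>?I. ennreal v) *
          g (mpoly s (Suc k) ((\<lambda>i\<in>?I. coeff R i - v * a i)(k := coeff R k - v))) \<partial>LL ?I)"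
        unfolding h_def
      proof (rule nn_integral_PiM_substitution)
        show "(\<integral>\<^sup>+x. f x \<partial>lborel) = (\<integral>\<^sup>+y. ennreal v * f (coeff R i - v * y) \<partial>lborel)"
          if f: "f \<in> borel_measurable lborel" for f and i
          using f v by (subst nn_integral_real_affine[where c = "-v" and t = "coeff R i"]) (auto simp: nn_integral_cmult)
      qed (auto simp: sigma_finite_lborel intro!: measurable_compose[OF measurable_compose[OF upd m1] g])
      also have "\<dots> = (\<integral>\<^sup>+a. ennreal (v ^ (k - s)) * g (R - Polynomial.smult v (mpoly s k a)) \<partial>LL ?I)"
      proof (rule nn_integral_cong)
        fix a
        have "mpoly s (Suc k) ((\<lambda>i\<in>?I. coeff R i - v * a i)(k := coeff R k - v)) = R - Polynomial.smult v (mpoly s k a)"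
        proof (rule poly_eqI)
          fix i
          have "coeff R i = 0" if "i > Suc k" using R(2) that by (intro coeff_eq_0) simp
          then show "coeff (mpoly s (Suc k) ((\<lambda>i\<in>?I. coeff R i - v * a i)(k := coeff R k - v))) i =
            coeff (R - Polynomial.smult v (mpoly s k a)) i"
            using R sk by (auto simp: coeff_mpoly)
        qed
        moreover have "(\<Prod>i\<in>?I. ennreal v) = ennreal (v ^ (k - s))"
          using v by (simp add: ennreal_power)
        ultimately show "(\<Prod>i\<in>?I. ennreal v) * g (mpoly s (Suc k) ((\<lambda>i\<in>?I. coeff R i - v * a i)(k := coeff R k - v))) =
          ennreal (v ^ (k - s)) * g (R - Polynomial.smult v (mpoly s k a))" by simp
      qed
      finally show ?thesis .
    qed
    then show "indicator {0<..} v * h (coeff R k - v) = indicator {0<..} v *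
      (\<integral>\<^sup>+a. ennreal (v ^ (k - s)) * g (R - Polynomial.smult v (mpoly s k a)) \<partial>(\<Pi>\<^sub>M i\<in>{s..<k}. lborel))"
      by (auto split: split_indicator)
  qed
  finally show ?thesis .
qed

section \<open>Jacobi coordinates\<close>

text \<open>For \<open>s = 0\<close> the components are the characteristic polynomials of the Gram
  matrix of the bidiagonal matrix with diagonal \<open>x i, ..., x (i + k)\<close>, and of this Gram
  matrix without its first row and column. Its diagonal mixes consecutive entries,
  \<open>(x (j + 1))\<^sup>2 + (y j)\<^sup>2\<close>, which is why a step has two halves. The value
  \<open>s = 1\<close> stands for an innermost \<open>x\<close> equal to 0.\<close>

fun jacobi_pair :: "nat \<Rightarrow> nat \<Rightarrow> nat \<Rightarrow> (nat \<Rightarrow> real) \<Rightarrow> (nat \<Rightarrow> real) \<Rightarrow> real poly \<times> real poly" where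
  "jacobi_pair s i 0 x y = ([:- (if s = 0 then (x i)\<^sup>2 else 0), 1:], 1)"
| "jacobi_pair s i (Suc k) x y =
     (let A = fst (jacobi_pair s (Suc i) k x y); B = A - Polynomial.smult ((y i)\<^sup>2) (snd (jacobi_pair s (Suc i) k x y))
      in (pCons 0 B - Polynomial.smult ((x i)\<^sup>2) A, B))"

definition polA :: "nat \<Rightarrow> nat \<Rightarrow> nat \<Rightarrow> (nat \<Rightarrow> real) \<Rightarrow> (nat \<Rightarrow> real) \<Rightarrow> real poly" where
  "polA s i k x y = fst (jacobi_pair s i k x y)"

definition polB :: "nat \<Rightarrow> nat \<Rightarrow> nat \<Rightarrow> (nat \<Rightarrow> real) \<Rightarrow> (nat \<Rightarrow> real) \<Rightarrow> real poly" where
  "polB s i k x y = snd (jacobi_pair s i k x y)"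

lemma polAB_0: "polA s i 0 x y = [:- (if s = 0 then (x i)\<^sup>2 else 0), 1:]" "polB s i 0 x y = 1"
  by (auto simp: polA_def polB_def)

lemma polB_Suc: "polB s i (Suc k) x y = polA s (Suc i) k x y - Polynomial.smult ((y i)\<^sup>2) (polB s (Suc i) k x y)"
  by (simp add: polA_def polB_def Let_def)

lemma polA_Suc: "polA s i (Suc k) x y = pCons 0 (polB s i (Suc k) x y) - Polynomial.smult ((x i)\<^sup>2) (polA s (Suc i) k x y)"
  by (simp add: polA_def polB_def Let_def)

lemma polAB_monic:
  "degree (polA s i k x y) = Suc k" "coeff (polA s i k x y) (Suc k) = 1"
  "degree (polB s i k x y) = k" "coeff (polB s i k x y) k = 1"
proof -
  have "degree (polA s i k x y) = Suc k \<and> coeff (polA s i k x y) (Suc k) = 1 \<and>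
    degree (polB s i k x y) = k \<and> coeff (polB s i k x y) k = 1"
  proof (induction k arbitrary: i)
    case (Suc k)
    note IH = Suc.IH[of "Suc i"]
    have B1: "coeff (polB s i (Suc k) x y) (Suc k) = 1" using IH by (simp add: polB_Suc coeff_eq_0)
    have "degree (polB s i (Suc k) x y) \<le> Suc k" using IH unfolding polB_Suc
      by (intro degree_diff_le) (auto intro: order.trans[OF degree_smult_le])
    then have B2: "degree (polB s i (Suc k) x y) = Suc k" using B1 by (intro antisym le_degree) auto
    have A1: "coeff (polA s i (Suc k) x y) (Suc (Suc k)) = 1" using IH B1 by (simp add: polA_Suc coeff_eq_0)
    have "degree (polA s i (Suc k) x y) \<le> Suc (Suc k)" using IH B2 unfolding polA_Suc
      by (intro degree_diff_le) (auto intro: order.trans[OF degree_smult_le] order.trans[OF degree_pCons_le])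
    then have A2: "degree (polA s i (Suc k) x y) = Suc (Suc k)" using A1 by (intro antisym le_degree) auto
    show ?case using A1 A2 B1 B2 by blast
  qed (auto simp: polAB_0)
  then show "degree (polA s i k x y) = Suc k" "coeff (polA s i k x y) (Suc k) = 1"
    "degree (polB s i k x y) = k" "coeff (polB s i k x y) k = 1" by auto
qed

text \<open>Measurability is asked only of the entries that occur; for \<open>s = 1\<close> the
  range of \<open>x\<close> is one shorter.\<close>

lemma measurable_polAB:
  assumes "\<And>j. i \<le> j \<Longrightarrow> j < i + Suc k - s \<Longrightarrow> (\<lambda>\<omega>. f \<omega> j) \<in> borel_measurable N"
    and "\<And>j. i \<le> j \<Longrightarrow> j < i + k \<Longrightarrow> (\<lambda>\<omega>. g \<omega> j) \<in> borel_measurable N" and "s \<le> 1"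
  shows "(\<lambda>\<omega>. polA s i k (f \<omega>) (g \<omega>)) \<in> N \<rightarrow>\<^sub>M polyM" "(\<lambda>\<omega>. polB s i k (f \<omega>) (g \<omega>)) \<in> N \<rightarrow>\<^sub>M polyM"
proof -
  have "(\<lambda>\<omega>. polA s i k (f \<omega>) (g \<omega>)) \<in> N \<rightarrow>\<^sub>M polyM \<and> (\<lambda>\<omega>. polB s i k (f \<omega>) (g \<omega>)) \<in> N \<rightarrow>\<^sub>M polyM"
    using assms(1,2)
  proof (induction k arbitrary: i)
    case 0
    have "(\<lambda>\<omega>. [:- (if s = 0 then (f \<omega> i)\<^sup>2 else 0), 1:]) \<in> N \<rightarrow>\<^sub>M polyM"
    proof (cases "s = 0")
      case True
      then have [measurable]: "(\<lambda>\<omega>. f \<omega> i) \<in> borel_measurable N" using 0(1)[of i] by simp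
      show ?thesis by (intro measurable_polyM) (auto simp: coeff_pCons split: nat.split)
    qed (auto intro!: measurable_polyM)
    then show ?case by (auto simp: polAB_0 intro!: measurable_polyM)
  next
    case (Suc k)
    have IH: "(\<lambda>\<omega>. polA s (Suc i) k (f \<omega>) (g \<omega>)) \<in> N \<rightarrow>\<^sub>M polyM" "(\<lambda>\<omega>. polB s (Suc i) k (f \<omega>) (g \<omega>)) \<in> N \<rightarrow>\<^sub>M polyM"
      using Suc.IH[of "Suc i"] Suc.prems by auto
    note [measurable] = IH
    have [measurable]: "(\<lambda>\<omega>. f \<omega> i) \<in> borel_measurable N" "(\<lambda>\<omega>. g \<omega> i) \<in> borel_measurable N"
      using Suc.prems(1)[of i] Suc.prems(2)[of i] \<open>s \<le> 1\<close> by auto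
    show ?case unfolding polA_Suc polB_Suc by measurable
  qed
  then show "(\<lambda>\<omega>. polA s i k (f \<omega>) (g \<omega>)) \<in> N \<rightarrow>\<^sub>M polyM" "(\<lambda>\<omega>. polB s i k (f \<omega>) (g \<omega>)) \<in> N \<rightarrow>\<^sub>M polyM"
    by auto
qed

lemma polAB_cong:
  assumes "\<And>j. i \<le> j \<Longrightarrow> j < i + Suc k - s \<Longrightarrow> x j = x' j" "\<And>j. i \<le> j \<Longrightarrow> j < i + k \<Longrightarrow> y j = y' j" "s \<le> 1"
  shows "polA s i k x y = polA s i k x' y'" "polB s i k x y = polB s i k x' y'"
proof -
  have "polA s i k x y = polA s i k x' y' \<and> polB s i k x y = polB s i k x' y'"
    using assms(1,2)
  proof (induction k arbitrary: i)
    case (Suc k)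
    have "polA s (Suc i) k x y = polA s (Suc i) k x' y' \<and> polB s (Suc i) k x y = polB s (Suc i) k x' y'"
      by (rule Suc.IH) (use Suc.prems in auto)
    then show ?case using Suc.prems(1)[of i] Suc.prems(2)[of i] \<open>s \<le> 1\<close> by (simp add: polA_Suc polB_Suc)
  qed (use assms in \<open>auto simp: polAB_0\<close>)
  then show "polA s i k x y = polA s i k x' y'" "polB s i k x y = polB s i k x' y'" by auto
qed

section \<open>Integration over pairs of polynomials in the variables of the recursion\<close>

lemma measurable_stieltjes_signs [measurable (raw)]:
  assumes "f \<in> N \<rightarrow>\<^sub>M polyM" "g \<in> N \<rightarrow>\<^sub>M polyM"
  shows "Measurable.pred N (\<lambda>\<omega>. stieltjes_signs s k (f \<omega>) (g \<omega>))"
  using assms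
proof (induction k arbitrary: f g)
  case (Suc k)
  note [measurable] = Suc.prems
  show ?case
  proof (cases k)
    case 0
    then show ?thesis by simp
  next
    case (Suc j)
    define D where "D \<omega> = pCons 0 (g \<omega>) - f \<omega>" for \<omega>
    define A' where "A' \<omega> = Polynomial.smult (1 / coeff (D \<omega>) (Suc j)) (D \<omega>)" for \<omega>
    define E where "E \<omega> = A' \<omega> - g \<omega>" for \<omega>
    define C where "C \<omega> = Polynomial.smult (1 / coeff (E \<omega>) j) (E \<omega>)" for \<omega>
    have D[measurable]: "D \<in> N \<rightarrow>\<^sub>M polyM" unfolding D_def by measurable
    have A'[measurable]: "A' \<in> N \<rightarrow>\<^sub>M polyM" unfolding A'_def by measurable
    have E[measurable]: "E \<in> N \<rightarrow>\<^sub>M polyM" unfolding E_def by measurable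
    have C[measurable]: "C \<in> N \<rightarrow>\<^sub>M polyM" unfolding C_def by measurable
    have [measurable]: "Measurable.pred N (\<lambda>\<omega>. stieltjes_signs s (Suc j) (A' \<omega>) (C \<omega>))"
      using Suc.IH[OF A' C] Suc by simp
    have "(\<lambda>\<omega>. stieltjes_signs s (Suc k) (f \<omega>) (g \<omega>)) =
      (\<lambda>\<omega>. coeff (D \<omega>) (Suc j) > 0 \<and> coeff (E \<omega>) j > 0 \<and> stieltjes_signs s (Suc j) (A' \<omega>) (C \<omega>))"
      by (simp add: Suc Let_def D_def A'_def E_def C_def)
    then show ?thesis by simp
  qed
qed simp

text \<open>The substitution is made on the interval from 0 to \<open>n\<close>, with image cut off
  at \<open>n\<^sup>2\<close>; the two measures agree on all truncated sets and hence in the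
  limit.\<close>

lemma nn_integral_square_substitution:
  fixes f :: "real \<Rightarrow> ennreal"
  assumes f[measurable]: "f \<in> borel_measurable borel"
  shows "(\<integral>\<^sup>+v. indicator {0<..} v * f v \<partial>lborel) = (\<integral>\<^sup>+x. indicator {0<..} x * (ennreal (2 * x) * f (x\<^sup>2)) \<partial>lborel)"
proof -
  define N1 where "N1 = density lborel (\<lambda>v::real. indicator {0<..} v :: ennreal)"
  define D where "D = density lborel (\<lambda>x::real. indicator {0<..} x * ennreal (2 * x))"
  define N2 where "N2 = distr D borel (\<lambda>x. x\<^sup>2)"
  have sqD: "(\<lambda>x. x\<^sup>2) \<in> D \<rightarrow>\<^sub>M borel" unfolding D_def by measurable
  have b: "emeasure N1 (E \<inter> {..(real n)\<^sup>2}) = emeasure N2 (E \<inter> {..(real n)\<^sup>2})" if E[measurable]: "E \<in> sets borel" for E n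
  proof -
    have "emeasure N1 (E \<inter> {..(real n)\<^sup>2}) = (\<integral>\<^sup>+v. indicator {0<..} v * indicator (E \<inter> {..(real n)\<^sup>2}) v \<partial>lborel)"
      unfolding N1_def by (subst emeasure_density) auto
    also have "\<dots> = (\<integral>\<^sup>+v. ennreal (indicat_real E v) * indicator {(0::real)\<^sup>2..(real n)\<^sup>2} v \<partial>lborel)"
      using AE_lborel_singleton[of 0]
      by (intro nn_integral_cong_AE) (auto elim!: eventually_mono split: split_indicator)
    also have "\<dots> = (\<integral>\<^sup>+v. ennreal (indicat_real E v * indicator {(0::real)\<^sup>2..(real n)\<^sup>2} v) \<partial>lborel)"
      by (intro nn_integral_cong) (auto split: split_indicator)
    also have "\<dots> = (\<integral>\<^sup>+x. ennreal (indicat_real E (x\<^sup>2) * (2 * x) * indicator {0..real n} x) \<partial>lborel)"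
    proof (rule nn_integral_substitution)
      show "set_borel_measurable borel {(0::real)\<^sup>2..(real n)\<^sup>2} (indicat_real E)"
        unfolding set_borel_measurable_def by measurable
    qed (auto intro!: derivative_eq_intros continuous_intros)
    also have "\<dots> = (\<integral>\<^sup>+x. indicator {0<..} x * ennreal (2 * x) * indicator ((\<lambda>x. x\<^sup>2) -` (E \<inter> {..(real n)\<^sup>2})) x \<partial>lborel)"
      by (intro nn_integral_cong) (auto simp: abs_le_square_iff[symmetric] power_mono split: split_indicator intro: power2_le_imp_le)
    also have "\<dots> = emeasure D ((\<lambda>x. x\<^sup>2) -` (E \<inter> {..(real n)\<^sup>2}))"
      unfolding D_def by (subst emeasure_density) (auto intro!: measurable_sets_borel[where f = "\<lambda>x. x\<^sup>2"])
    also have "\<dots> = emeasure N2 (E \<inter> {..(real n)\<^sup>2})"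
      unfolding N2_def by (subst emeasure_distr[OF sqD]) (auto simp: D_def)
    finally show ?thesis .
  qed
  have "N1 = N2"
  proof (rule measure_eqI)
    show "sets N1 = sets N2" by (simp add: N1_def N2_def)
    fix E assume "E \<in> sets N1"
    then have E[measurable]: "E \<in> sets borel" by (simp add: N1_def)
    define X where "X n = E \<inter> {..(real n)\<^sup>2}" for n
    have X: "range X \<subseteq> sets N1" "range X \<subseteq> sets N2" by (auto simp: X_def N1_def N2_def)
    have inc: "incseq X" by (auto simp: X_def incseq_def intro: order.trans power_mono)
    have U: "(\<Union>n. X n) = E"
    proof -
      have "\<exists>n. v \<le> (real n)\<^sup>2" for v :: real
      proof -
        obtain n where "max v 1 \<le> real n" using real_arch_simple by blast
        then have n: "v \<le> real n" "1 \<le> real n" by auto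
        then have "real n \<le> (real n)\<^sup>2" by (simp add: power2_eq_square)
        then show ?thesis using n by (meson order.trans)
      qed
      then show ?thesis by (auto simp: X_def)
    qed
    have "emeasure N1 (X n) = emeasure N2 (X n)" for n unfolding X_def by (rule b) (rule E)
    then show "emeasure N1 E = emeasure N2 E"
      using SUP_emeasure_incseq[OF X(1) inc] SUP_emeasure_incseq[OF X(2) inc] unfolding U by simp
  qed
  then have "integral\<^sup>N N1 f = integral\<^sup>N N2 f" by simp
  moreover have "integral\<^sup>N N1 f = (\<integral>\<^sup>+v. indicator {0<..} v * f v \<partial>lborel)"
    unfolding N1_def by (subst nn_integral_density) auto
  moreover have "integral\<^sup>N N2 f = (\<integral>\<^sup>+x. f (x\<^sup>2) \<partial>D)"
    unfolding N2_def by (subst nn_integral_distr[OF sqD]) auto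
  moreover have "(\<integral>\<^sup>+x. f (x\<^sup>2) \<partial>D) = (\<integral>\<^sup>+x. indicator {0<..} x * (ennreal (2 * x) * f (x\<^sup>2)) \<partial>lborel)"
    unfolding D_def by (subst nn_integral_density) (auto simp: mult.assoc)
  ultimately show ?thesis by simp
qed

text \<open>The Jacobians of the map from \<open>(x, y)\<close> to the coefficients of \<open>(polA, polB)\<close>.\<close>
definition Wx :: "nat \<Rightarrow> nat \<Rightarrow> nat \<Rightarrow> (nat \<Rightarrow> real) \<Rightarrow> ennreal" where
  "Wx s i k x = (\<Prod>j\<in>{i..<i + Suc k - s}. indicator {0<..} (x j) * ennreal (2 * x j ^ (2 * (k + i - s - j) + 1)))"

definition Wy :: "nat \<Rightarrow> nat \<Rightarrow> (nat \<Rightarrow> real) \<Rightarrow> ennreal" where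
  "Wy i k y = (\<Prod>j\<in>{i..<i + k}. indicator {0<..} (y j) * ennreal (2 * y j ^ (2 * (k + i - 1 - j) + 1)))"

lemma measurable_Wx [measurable]: "Wx s i k \<in> borel_measurable (LL {i..<i + Suc k - s})"
  unfolding Wx_def by measurable

lemma measurable_Wy [measurable]: "Wy i k \<in> borel_measurable (LL {i..<i + k})"
  unfolding Wy_def by measurable

lemma measurable_polAB' [measurable]:
  assumes "s \<le> 1"
  shows "(\<lambda>p. polA s i k (fst p) (snd p)) \<in> LL {i..<i + Suc k - s} \<Otimes>\<^sub>M LL {i..<i + k} \<rightarrow>\<^sub>M polyM"
    "(\<lambda>p. polB s i k (fst p) (snd p)) \<in> LL {i..<i + Suc k - s} \<Otimes>\<^sub>M LL {i..<i + k} \<rightarrow>\<^sub>M polyM"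
proof -
  have 1: "(\<lambda>p. fst p j) \<in> borel_measurable (LL {i..<i + Suc k - s} \<Otimes>\<^sub>M LL {i..<i + k})" if "i \<le> j" "j < i + Suc k - s" for j
    using measurable_compose[OF measurable_fst measurable_component_singleton[of j "{i..<i + Suc k - s}"]] that by simp
  have 2: "(\<lambda>p. snd p j) \<in> borel_measurable (LL {i..<i + Suc k - s} \<Otimes>\<^sub>M LL {i..<i + k})" if "i \<le> j" "j < i + k" for j
    using measurable_compose[OF measurable_snd measurable_component_singleton[of j "{i..<i + k}"]] that by simp
  show "(\<lambda>p. polA s i k (fst p) (snd p)) \<in> LL {i..<i + Suc k - s} \<Otimes>\<^sub>M LL {i..<i + k} \<rightarrow>\<^sub>M polyM"
    "(\<lambda>p. polB s i k (fst p) (snd p)) \<in> LL {i..<i + Suc k - s} \<Otimes>\<^sub>M LL {i..<i + k} \<rightarrow>\<^sub>M polyM"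
    using measurable_polAB[of i k s fst _ snd] 1 2 assms by auto
qed

lemma stieltjes_signs_step:
  assumes "lead_coeff A = 1" "degree A = Suc k" "v > 0"
  shows "stieltjes_signs s (Suc (Suc k)) (pCons 0 B - Polynomial.smult v A) B \<longleftrightarrow>
    (0 < coeff (A - B) k \<and> stieltjes_signs s (Suc k) A (Polynomial.smult (1 / coeff (A - B) k) (A - B)))"
  using assms by (simp add: Let_def)

lemma stieltjes_signs_step2:
  assumes "coeff C k = 1" "u > 0" "degree A = Suc k" "lead_coeff A = 1"
  shows "(0 < coeff (A - (A - Polynomial.smult u C)) k \<and>
      stieltjes_signs s (Suc k) A (Polynomial.smult (1 / coeff (A - (A - Polynomial.smult u C)) k) (A - (A - Polynomial.smult u C)))) \<longleftrightarrow>
    stieltjes_signs s (Suc k) A C"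
  using assms by simp

lemma measurable_case_prod_compose:
  assumes "case_prod G \<in> borel_measurable (M \<Otimes>\<^sub>M M')" "f \<in> N \<rightarrow>\<^sub>M M" "g \<in> N \<rightarrow>\<^sub>M M'"
  shows "(\<lambda>\<omega>. G (f \<omega>) (g \<omega>)) \<in> borel_measurable N"
  using measurable_compose[OF measurable_Pair[OF assms(2,3)] assms(1)] by simp

text \<open>The order of integration carries the argument. For fixed \<open>B\<close>, writing
  \<open>A = z B - v A'\<close> trades the coefficients of \<open>A\<close> for \<open>v\<close> and
  those of \<open>A'\<close>; for fixed \<open>A'\<close>, writing \<open>B = A' - u C\<close> then
  trades \<open>B\<close> for \<open>u\<close> and \<open>C\<close>. The exponents
  \<open>Suc k - s\<close> and \<open>k\<close> count the free coefficients of \<open>A'\<close> and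
  of \<open>C\<close>.\<close>

lemma nn_integral_stieltjes_signs_step:
  fixes G :: "real poly \<Rightarrow> real poly \<Rightarrow> ennreal"
  assumes G: "case_prod G \<in> borel_measurable (polyM \<Otimes>\<^sub>M polyM)" and s: "s \<le> 1"
  shows "(\<integral>\<^sup>+a. \<integral>\<^sup>+b. (if stieltjes_signs s (Suc (Suc k)) (mpoly s (Suc (Suc k)) a) (mpoly 0 (Suc k) b)
        then G (mpoly s (Suc (Suc k)) a) (mpoly 0 (Suc k) b) else 0) \<partial>LL {0..<Suc k} \<partial>LL {s..<Suc (Suc k)}) =
    (\<integral>\<^sup>+v. \<integral>\<^sup>+u. indicator {0<..} v * ennreal (v ^ (Suc k - s)) * (indicator {0<..} u * ennreal (u ^ k)) *
      (\<integral>\<^sup>+a. \<integral>\<^sup>+c. (if stieltjes_signs s (Suc k) (mpoly s (Suc k) a) (mpoly 0 k c)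
         then (let A = mpoly s (Suc k) a; B = A - Polynomial.smult u (mpoly 0 k c) in G (pCons 0 B - Polynomial.smult v A) B)
         else 0) \<partial>LL {0..<k} \<partial>LL {s..<Suc k}) \<partial>lborel \<partial>lborel)"
proof -
  let ?n = "Suc k"
  let ?w = "\<lambda>v. indicator {0<..} v * ennreal (v ^ (?n - s))"
  let ?u = "\<lambda>u. indicator {0<..} u * ennreal (u ^ k)"
  let ?P = "mpoly s ?n :: _ \<Rightarrow> real poly" and ?Q = "mpoly 0 k :: _ \<Rightarrow> real poly" and ?Q' = "mpoly 0 ?n :: _ \<Rightarrow> real poly"
  note Gm[measurable (raw)] = measurable_case_prod_compose[OF G]
  have sf: "sigma_finite_measure (LL {a..<b})" for a b :: nat by (rule sigma_finite_PiM_lborel) simp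
  interpret sfa: sigma_finite_measure "LL {s..<Suc k}" by (rule sf)
  interpret sfb: sigma_finite_measure "LL {0..<Suc k}" by (rule sf)
  interpret sfc: sigma_finite_measure "LL {0..<k}" by (rule sf)
  \<comment> \<open>The integrand at three stages: in terms of \<open>A\<close> and
    \<open>B\<close>; of \<open>v\<close>, \<open>A'\<close> and \<open>B\<close>; of
    \<open>v\<close>, \<open>u\<close>, \<open>A'\<close> and \<open>C\<close>.\<close>
  define \<gamma> where "\<gamma> B A = (if stieltjes_signs s (Suc ?n) A B then G A B else 0)" for A B
  define \<gamma>2 where "\<gamma>2 v A B = (if 0 < coeff (A - B) k \<and> stieltjes_signs s ?n A (Polynomial.smult (1 / coeff (A - B) k) (A - B))
    then G (pCons 0 B - Polynomial.smult v A) B else 0)" for v A B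
  define \<gamma>3 where "\<gamma>3 v u A C = (if stieltjes_signs s ?n A C then (let B = A - Polynomial.smult u C in
    G (pCons 0 B - Polynomial.smult v A) B) else 0)" for v u A C
  have \<gamma>m[measurable (raw)]: "(\<lambda>\<omega>. \<gamma> (f \<omega>) (g \<omega>)) \<in> borel_measurable N"
    if [measurable]: "f \<in> N \<rightarrow>\<^sub>M polyM" "g \<in> N \<rightarrow>\<^sub>M polyM" for f g N
    unfolding \<gamma>_def by measurable
  have \<gamma>2m[measurable (raw)]: "(\<lambda>\<omega>. \<gamma>2 (h \<omega>) (f \<omega>) (g \<omega>)) \<in> borel_measurable N"
    if [measurable]: "f \<in> N \<rightarrow>\<^sub>M polyM" "g \<in> N \<rightarrow>\<^sub>M polyM" "h \<in> borel_measurable N" for f g h N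
    unfolding \<gamma>2_def by measurable
  have \<gamma>3m[measurable (raw)]: "(\<lambda>\<omega>. \<gamma>3 (h \<omega>) (h' \<omega>) (f \<omega>) (g \<omega>)) \<in> borel_measurable N"
    if [measurable]: "f \<in> N \<rightarrow>\<^sub>M polyM" "g \<in> N \<rightarrow>\<^sub>M polyM" "h \<in> borel_measurable N" "h' \<in> borel_measurable N" for f g h h' N
    unfolding \<gamma>3_def Let_def by measurable
  have "(\<integral>\<^sup>+a. \<integral>\<^sup>+b. \<gamma> (?Q' b) (mpoly s (Suc ?n) a) \<partial>LL {0..<?n} \<partial>LL {s..<Suc ?n}) =
    (\<integral>\<^sup>+b. \<integral>\<^sup>+a. \<gamma> (?Q' b) (mpoly s (Suc ?n) a) \<partial>LL {s..<Suc ?n} \<partial>LL {0..<?n})"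
    by (rule nn_integral_swap[OF sf sf]) measurable
  also have "\<dots> = (\<integral>\<^sup>+b. \<integral>\<^sup>+v. \<integral>\<^sup>+a. ?w v * \<gamma>2 v (?P a) (?Q' b) \<partial>LL {s..<?n} \<partial>lborel \<partial>LL {0..<?n})"
  proof (rule nn_integral_cong)
    fix b :: "nat \<Rightarrow> real"
    let ?B = "?Q' b"
    let ?R = "pCons 0 ?B"
    have "(\<integral>\<^sup>+a. \<gamma> ?B (mpoly s (Suc ?n) a) \<partial>LL {s..<Suc ?n}) =
      (\<integral>\<^sup>+a. indicator {0<..} (coeff ?R ?n - a ?n) * \<gamma> ?B (mpoly s (Suc ?n) a) \<partial>LL {s..<Suc ?n})"
    proof (rule nn_integral_cong)
      fix a :: "nat \<Rightarrow> real"
      \<comment> \<open>Positivity of \<open>v\<close> is part of \<open>stieltjes_signs\<close>, so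
        the indicator demanded by \<open>nn_integral_mpoly_step\<close> can be inserted.\<close>
      have "coeff (mpoly s (Suc ?n) a) ?n = a ?n" using s by (simp add: coeff_mpoly)
      then have "\<gamma> ?B (mpoly s (Suc ?n) a) = 0" if "\<not> coeff ?R ?n - a ?n > 0"
        using that by (simp add: \<gamma>_def Let_def)
      then show "\<gamma> ?B (mpoly s (Suc ?n) a) = indicator {0<..} (coeff ?R ?n - a ?n) * \<gamma> ?B (mpoly s (Suc ?n) a)"
        by (auto split: split_indicator)
    qed
    also have "\<dots> = (\<integral>\<^sup>+v. indicator {0<..} v * (\<integral>\<^sup>+a. ennreal (v ^ (?n - s)) * \<gamma> ?B (?R - Polynomial.smult v (?P a)) \<partial>LL {s..<?n}) \<partial>lborel)"
    proof (rule nn_integral_mpoly_step)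
      show "lead_coeff ?R = 1" by (simp add: coeff_mpoly)
      show "degree ?R = Suc ?n" by (subst degree_pCons_eq) auto
      show "coeff ?R i = 0" if "i < s" for i using that s by (cases i) auto
    qed (use s in \<open>auto intro!: \<gamma>m\<close>)
    also have "\<dots> = (\<integral>\<^sup>+v. \<integral>\<^sup>+a. ?w v * \<gamma>2 v (?P a) ?B \<partial>LL {s..<?n} \<partial>lborel)"
    proof (rule nn_integral_cong)
      fix v :: real
      have "indicator {0<..} v * (\<integral>\<^sup>+a. ennreal (v ^ (?n - s)) * \<gamma> ?B (?R - Polynomial.smult v (?P a)) \<partial>LL {s..<?n}) =
        (\<integral>\<^sup>+a. indicator {0<..} v * (ennreal (v ^ (?n - s)) * \<gamma> ?B (?R - Polynomial.smult v (?P a))) \<partial>LL {s..<?n})"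
        by (rule nn_integral_cmult[symmetric]) measurable
      also have "\<dots> = (\<integral>\<^sup>+a. ?w v * \<gamma>2 v (?P a) ?B \<partial>LL {s..<?n})"
      proof (rule nn_integral_cong)
        fix a :: "nat \<Rightarrow> real"
        have "\<gamma> ?B (?R - Polynomial.smult v (?P a)) = \<gamma>2 v (?P a) ?B" if "v > 0"
          by (simp only: \<gamma>_def \<gamma>2_def stieltjes_signs_step[OF lead_coeff_mpoly degree_mpoly that])
        then show "indicator {0<..} v * (ennreal (v ^ (?n - s)) * \<gamma> ?B (?R - Polynomial.smult v (?P a))) =
          ?w v * \<gamma>2 v (?P a) ?B" by (auto split: split_indicator)
      qed
      finally show "indicator {0<..} v * (\<integral>\<^sup>+a. ennreal (v ^ (?n - s)) * \<gamma> ?B (?R - Polynomial.smult v (?P a)) \<partial>LL {s..<?n}) =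
        (\<integral>\<^sup>+a. ?w v * \<gamma>2 v (?P a) ?B \<partial>LL {s..<?n})" .
    qed
    finally show "(\<integral>\<^sup>+a. \<gamma> ?B (mpoly s (Suc ?n) a) \<partial>LL {s..<Suc ?n}) =
      (\<integral>\<^sup>+v. \<integral>\<^sup>+a. ?w v * \<gamma>2 v (?P a) ?B \<partial>LL {s..<?n} \<partial>lborel)" .
  qed
  also have "\<dots> = (\<integral>\<^sup>+v. \<integral>\<^sup>+b. \<integral>\<^sup>+a. ?w v * \<gamma>2 v (?P a) (?Q' b) \<partial>LL {s..<?n} \<partial>LL {0..<?n} \<partial>lborel)"
    by (rule nn_integral_swap[OF sf sigma_finite_lborel]) measurable
  also have "\<dots> = (\<integral>\<^sup>+v. \<integral>\<^sup>+a. \<integral>\<^sup>+b. ?w v * \<gamma>2 v (?P a) (?Q' b) \<partial>LL {0..<?n} \<partial>LL {s..<?n} \<partial>lborel)"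
    by (intro nn_integral_cong nn_integral_swap[OF sf sf]) measurable
  also have "\<dots> = (\<integral>\<^sup>+v. \<integral>\<^sup>+a. \<integral>\<^sup>+u. ?w v * ?u u *
      (\<integral>\<^sup>+c. \<gamma>3 v u (?P a) (?Q c) \<partial>LL {0..<k}) \<partial>lborel \<partial>LL {s..<?n} \<partial>lborel)"
  proof (intro nn_integral_cong)
    fix v :: real and a :: "nat \<Rightarrow> real"
    let ?A = "?P a"
    have "(\<integral>\<^sup>+b. \<gamma>2 v ?A (?Q' b) \<partial>LL {0..<?n}) =
      (\<integral>\<^sup>+b. indicator {0<..} (coeff ?A k - b k) * \<gamma>2 v ?A (?Q' b) \<partial>LL {0..<?n})"
    proof (rule nn_integral_cong)
      fix b :: "nat \<Rightarrow> real"
      have "coeff (?Q' b) k = b k" by (simp add: coeff_mpoly)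
      then have "\<gamma>2 v ?A (?Q' b) = 0" if "\<not> coeff ?A k - b k > 0"
        using that by (simp add: \<gamma>2_def)
      then show "\<gamma>2 v ?A (?Q' b) = indicator {0<..} (coeff ?A k - b k) * \<gamma>2 v ?A (?Q' b)"
        by (auto split: split_indicator)
    qed
    also have "\<dots> = (\<integral>\<^sup>+u. indicator {0<..} u * (\<integral>\<^sup>+c. ennreal (u ^ (k - 0)) * \<gamma>2 v ?A (?A - Polynomial.smult u (?Q c)) \<partial>LL {0..<k}) \<partial>lborel)"
      by (rule nn_integral_mpoly_step) (auto simp: coeff_mpoly intro!: \<gamma>2m)
    also have "\<dots> = (\<integral>\<^sup>+u. ?u u * (\<integral>\<^sup>+c. \<gamma>3 v u ?A (?Q c) \<partial>LL {0..<k}) \<partial>lborel)"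
    proof (rule nn_integral_cong)
      fix u :: real
      have "(\<integral>\<^sup>+c. ennreal (u ^ (k - 0)) * \<gamma>2 v ?A (?A - Polynomial.smult u (?Q c)) \<partial>LL {0..<k}) =
        ennreal (u ^ k) * (\<integral>\<^sup>+c. \<gamma>3 v u ?A (?Q c) \<partial>LL {0..<k})" if "u > 0"
      proof -
        have "\<gamma>2 v ?A (?A - Polynomial.smult u (?Q c)) = \<gamma>3 v u ?A (?Q c)" for c
          unfolding \<gamma>2_def \<gamma>3_def Let_def
          by (subst stieltjes_signs_step2[OF _ that degree_mpoly lead_coeff_mpoly]) (auto simp: coeff_mpoly)
        then show ?thesis by (simp add: nn_integral_cmult)
      qed
      then show "indicator {0<..} u * (\<integral>\<^sup>+c. ennreal (u ^ (k - 0)) * \<gamma>2 v ?A (?A - Polynomial.smult u (?Q c)) \<partial>LL {0..<k}) =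
        ?u u * (\<integral>\<^sup>+c. \<gamma>3 v u ?A (?Q c) \<partial>LL {0..<k})" by (auto split: split_indicator)
    qed
    finally have e: "(\<integral>\<^sup>+b. \<gamma>2 v ?A (?Q' b) \<partial>LL {0..<?n}) =
      (\<integral>\<^sup>+u. ?u u * (\<integral>\<^sup>+c. \<gamma>3 v u ?A (?Q c) \<partial>LL {0..<k}) \<partial>lborel)" .
    have "(\<integral>\<^sup>+b. ?w v * \<gamma>2 v ?A (?Q' b) \<partial>LL {0..<?n}) =
       ?w v * (\<integral>\<^sup>+b. \<gamma>2 v ?A (?Q' b) \<partial>LL {0..<?n})"
      by (rule nn_integral_cmult) measurable
    also have "\<dots> = (\<integral>\<^sup>+u. ?w v * (?u u *
      (\<integral>\<^sup>+c. \<gamma>3 v u ?A (?Q c) \<partial>LL {0..<k})) \<partial>lborel)"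
      unfolding e by (rule nn_integral_cmult[symmetric]) measurable
    finally show "(\<integral>\<^sup>+b. ?w v * \<gamma>2 v ?A (?Q' b) \<partial>LL {0..<?n}) =
      (\<integral>\<^sup>+u. ?w v * ?u u *
      (\<integral>\<^sup>+c. \<gamma>3 v u ?A (?Q c) \<partial>LL {0..<k}) \<partial>lborel)" by (simp only: mult.assoc)
  qed
  also have "\<dots> = (\<integral>\<^sup>+v. \<integral>\<^sup>+u. \<integral>\<^sup>+a. ?w v * ?u u *
      (\<integral>\<^sup>+c. \<gamma>3 v u (?P a) (?Q c) \<partial>LL {0..<k}) \<partial>LL {s..<?n} \<partial>lborel \<partial>lborel)"
    by (intro nn_integral_cong nn_integral_swap[OF sf sigma_finite_lborel]) measurable
  also have "\<dots> = (\<integral>\<^sup>+v. \<integral>\<^sup>+u. ?w v * ?u u *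
      (\<integral>\<^sup>+a. \<integral>\<^sup>+c. \<gamma>3 v u (?P a) (?Q c) \<partial>LL {0..<k} \<partial>LL {s..<?n}) \<partial>lborel \<partial>lborel)"
    by (intro nn_integral_cong nn_integral_cmult) measurable
  finally show ?thesis unfolding \<gamma>_def \<gamma>3_def Let_def .
qed

text \<open>Each induction step peels off \<open>x i\<close> and \<open>y i\<close> and composes
  \<open>G\<close> with one step of the recursion; hence both \<open>i\<close> and \<open>G\<close>
  vary. Substituting squares for \<open>v\<close> and \<open>u\<close> turns their powers into the
  odd powers of the entries in \<open>Wx\<close> and \<open>Wy\<close>.\<close>

lemma nn_integral_jacobi_coordinates:
  fixes G :: "real poly \<Rightarrow> real poly \<Rightarrow> ennreal"
  assumes G: "case_prod G \<in> borel_measurable (polyM \<Otimes>\<^sub>M polyM)" and s: "s \<le> 1"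
  shows "(\<integral>\<^sup>+a. \<integral>\<^sup>+b. (if stieltjes_signs s (Suc k) (mpoly s (Suc k) a) (mpoly 0 k b)
        then G (mpoly s (Suc k) a) (mpoly 0 k b) else 0) \<partial>LL {0..<k} \<partial>LL {s..<Suc k}) =
    (\<integral>\<^sup>+x. \<integral>\<^sup>+y. Wx s i k x * Wy i k y * G (polA s i k x y) (polB s i k x y) \<partial>LL {i..<i + k} \<partial>LL {i..<i + Suc k - s})"
  using G
proof (induction k arbitrary: i G)
  case 0
  note Gm[measurable (raw)] = measurable_case_prod_compose[OF 0]
  interpret product_sigma_finite "\<lambda>_::nat. lborel :: real measure" by standard
  have e: "mpoly 0 0 b = (1 :: real poly)" for b by (simp add: mpoly_def)
  have PE: "(\<integral>\<^sup>+b. f b \<partial>LL {0..<0}) = f (\<lambda>_. undefined)" "(\<integral>\<^sup>+b. f b \<partial>LL {i..<i + 0}) = f (\<lambda>_. undefined)" for f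
    by (simp_all add: nn_integral_count_space_finite PiM_empty)
  show ?case
  proof (cases "s = 0")
    case True
    have s0: "{s..<Suc 0} = {0}" "{i..<i + Suc 0 - s} = {i}" using True by auto
    have m: "mpoly s (Suc 0) a = [:a 0, 1:]" for a :: "nat \<Rightarrow> real"
      by (intro poly_eqI) (auto simp: coeff_mpoly coeff_pCons True split: nat.split)
    define f where "f v = G [:v, 1:] 1" for v
    have [measurable]: "f \<in> borel_measurable borel" unfolding f_def
      by (intro Gm measurable_polyM) (auto simp: coeff_pCons split: nat.split)
    have "(\<integral>\<^sup>+a. (if a 0 < 0 then f (a 0) else 0) \<partial>LL {0::nat}) = (\<integral>\<^sup>+v. (if v < 0 then f v else 0) \<partial>lborel)"
      by (rule product_nn_integral_singleton) measurable
    also have "\<dots> = (\<integral>\<^sup>+v. indicator {0<..} v * f (- v) \<partial>lborel)"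
      by (subst nn_integral_real_affine[where c = "-1" and t = 0]) (auto intro!: nn_integral_cong)
    also have "\<dots> = (\<integral>\<^sup>+x. indicator {0<..} x * (ennreal (2 * x) * f (- (x\<^sup>2))) \<partial>lborel)"
      by (rule nn_integral_square_substitution) measurable
    also have "\<dots> = (\<integral>\<^sup>+x. indicator {0<..} (x i) * (ennreal (2 * x i) * f (- ((x i)\<^sup>2))) \<partial>LL {i})"
      by (rule product_nn_integral_singleton[symmetric]) measurable
    finally show ?thesis
      unfolding s0 PE e m polAB_0 by (simp add: f_def Wx_def Wy_def s0 True mult.assoc cong: if_cong)
  next
    case False
    \<comment> \<open>With the innermost \<open>x\<close> absent the only pair is
      \<open>(z, 1)\<close>, and both sides are integrals over a one-point space.\<close>
    then have s1: "s = 1" using s by simp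
    have m: "mpoly s (Suc 0) a = [:0, 1:]" for a :: "nat \<Rightarrow> real"
      by (intro poly_eqI) (auto simp: coeff_mpoly coeff_pCons s1 split: nat.split)
    have "(\<integral>\<^sup>+a. f a \<partial>LL {s..<Suc 0}) = f (\<lambda>_. undefined)" "(\<integral>\<^sup>+a. f a \<partial>LL {i..<i + Suc 0 - s}) = f (\<lambda>_. undefined)" for f
      using s1 by (simp_all add: nn_integral_count_space_finite PiM_empty)
    then show ?thesis unfolding PE e m polAB_0 by (simp add: Wx_def Wy_def s1)
  qed
next
  case (Suc k)
  let ?n = "Suc k"
  let ?a = "\<lambda>\<xi>. indicator {0<..} \<xi> * ennreal (2 * \<xi> ^ (2 * (?n - s) + 1))"
  let ?b = "\<lambda>\<eta>. indicator {0<..} \<eta> * ennreal (2 * \<eta> ^ (2 * k + 1))"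
  let ?A = "polA s (Suc i) k"
  let ?B = "polB s (Suc i) k"
  let ?X = "Wx s (Suc i) k"
  let ?Y = "Wy (Suc i) k"
  note Gm[measurable (raw)] = measurable_case_prod_compose[OF Suc.prems]
  have sf: "sigma_finite_measure (LL {a..<b})" for a b :: nat by (rule sigma_finite_PiM_lborel) simp
  interpret product_sigma_finite "\<lambda>_::nat. lborel :: real measure" by standard
  define X' where "X' = {Suc i..<Suc i + ?n - s}"
  define Y' where "Y' = {Suc i..<Suc i + k}"
  interpret sx: sigma_finite_measure "LL X'" unfolding X'_def by (rule sf)
  interpret sy: sigma_finite_measure "LL Y'" unfolding Y'_def by (rule sf)
  define H where "H v u A C = (let B = A - Polynomial.smult u C in G (pCons 0 B - Polynomial.smult v A) B)" for v u A C
  have Hm[measurable (raw)]: "(\<lambda>\<omega>. H (h \<omega>) (h' \<omega>) (f \<omega>) (g \<omega>)) \<in> borel_measurable N"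
    if [measurable]: "f \<in> N \<rightarrow>\<^sub>M polyM" "g \<in> N \<rightarrow>\<^sub>M polyM" "h \<in> borel_measurable N" "h' \<in> borel_measurable N" for f g h h' N
    unfolding H_def Let_def by measurable
  note [measurable] = measurable_polAB'[OF s, of "Suc i" k, folded X'_def Y'_def]
  have [measurable]: "?X \<in> borel_measurable (LL X')" "?Y \<in> borel_measurable (LL Y')"
    unfolding X'_def Y'_def by measurable
  have [measurable (raw)]: "(\<lambda>\<omega>. ?A (f \<omega>) (g \<omega>)) \<in> N \<rightarrow>\<^sub>M polyM" "(\<lambda>\<omega>. ?B (f \<omega>) (g \<omega>)) \<in> N \<rightarrow>\<^sub>M polyM"
    if "f \<in> N \<rightarrow>\<^sub>M LL X'" "g \<in> N \<rightarrow>\<^sub>M LL Y'" for f g N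
    using measurable_compose[OF measurable_Pair[OF that] measurable_polAB'(1)[OF s, of "Suc i" k, folded X'_def Y'_def]]
      measurable_compose[OF measurable_Pair[OF that] measurable_polAB'(2)[OF s, of "Suc i" k, folded X'_def Y'_def]] by simp_all
  define K where "K v u = (\<integral>\<^sup>+x. \<integral>\<^sup>+y. ?X x * ?Y y * H v u (?A x y) (?B x y) \<partial>LL Y' \<partial>LL X')" for v u
  have Km[measurable (raw)]: "(\<lambda>\<omega>. K (h \<omega>) (h' \<omega>)) \<in> borel_measurable N"
    if [measurable]: "h \<in> borel_measurable N" "h' \<in> borel_measurable N" for h h' N
    unfolding K_def by measurable
  have "(\<integral>\<^sup>+a. \<integral>\<^sup>+b. (if stieltjes_signs s (Suc ?n) (mpoly s (Suc ?n) a) (mpoly 0 ?n b)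
        then G (mpoly s (Suc ?n) a) (mpoly 0 ?n b) else 0) \<partial>LL {0..<?n} \<partial>LL {s..<Suc ?n}) =
    (\<integral>\<^sup>+v. \<integral>\<^sup>+u. indicator {0<..} v * ennreal (v ^ (?n - s)) * (indicator {0<..} u * ennreal (u ^ k)) * K v u \<partial>lborel \<partial>lborel)"
    unfolding nn_integral_stieltjes_signs_step[OF Suc.prems s] K_def X'_def Y'_def
  proof (intro nn_integral_cong arg_cong2[where f = "(*)"] refl)
    fix v u :: real
    have "case_prod (H v u) \<in> borel_measurable (polyM \<Otimes>\<^sub>M polyM)" unfolding case_prod_beta by measurable
    from Suc.IH[OF this, of "Suc i"]
    show "(\<integral>\<^sup>+a. \<integral>\<^sup>+c. (if stieltjes_signs s (Suc k) (mpoly s (Suc k) a) (mpoly 0 k c)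
         then (let A = mpoly s (Suc k) a; B = A - Polynomial.smult u (mpoly 0 k c) in G (pCons 0 B - Polynomial.smult v A) B)
         else 0) \<partial>LL {0..<k} \<partial>LL {s..<Suc k}) =
      (\<integral>\<^sup>+x. \<integral>\<^sup>+y. ?X x * ?Y y * H v u (?A x y) (?B x y)
        \<partial>LL {Suc i..<Suc i + k} \<partial>LL {Suc i..<Suc i + ?n - s})"
      unfolding H_def Let_def .
  qed
  also have "\<dots> = (\<integral>\<^sup>+v. indicator {0<..} v * (\<integral>\<^sup>+u. indicator {0<..} u * (ennreal (v ^ (?n - s)) * ennreal (u ^ k) * K v u) \<partial>lborel) \<partial>lborel)"
    by (subst nn_integral_cmult[symmetric]) (auto intro!: nn_integral_cong simp: mult_ac)
  also have "\<dots> = (\<integral>\<^sup>+v. indicator {0<..} v * (\<integral>\<^sup>+\<eta>. indicator {0<..} \<eta> * (ennreal (2 * \<eta>) * (ennreal (v ^ (?n - s)) * ennreal ((\<eta>\<^sup>2) ^ k) * K v (\<eta>\<^sup>2))) \<partial>lborel) \<partial>lborel)"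
    by (intro nn_integral_cong arg_cong2[where f = "(*)"] refl nn_integral_square_substitution) measurable
  also have "\<dots> = (\<integral>\<^sup>+\<xi>. indicator {0<..} \<xi> * (ennreal (2 * \<xi>) * (\<integral>\<^sup>+\<eta>. indicator {0<..} \<eta> * (ennreal (2 * \<eta>) *
      (ennreal ((\<xi>\<^sup>2) ^ (?n - s)) * ennreal ((\<eta>\<^sup>2) ^ k) * K (\<xi>\<^sup>2) (\<eta>\<^sup>2))) \<partial>lborel)) \<partial>lborel)"
    by (rule nn_integral_square_substitution) measurable
  also have "\<dots> = (\<integral>\<^sup>+\<xi>. \<integral>\<^sup>+\<eta>. ?a \<xi> * ?b \<eta> *
      K (\<xi>\<^sup>2) (\<eta>\<^sup>2) \<partial>lborel \<partial>lborel)"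
  proof (rule nn_integral_cong)
    fix \<xi> :: real
    have "indicator {0<..} \<xi> * (ennreal (2 * \<xi>) * (\<integral>\<^sup>+\<eta>. indicator {0<..} \<eta> * (ennreal (2 * \<eta>) *
      (ennreal ((\<xi>\<^sup>2) ^ (?n - s)) * ennreal ((\<eta>\<^sup>2) ^ k) * K (\<xi>\<^sup>2) (\<eta>\<^sup>2))) \<partial>lborel)) =
      (\<integral>\<^sup>+\<eta>. indicator {0<..} \<xi> * (ennreal (2 * \<xi>) * (indicator {0<..} \<eta> * (ennreal (2 * \<eta>) *
      (ennreal ((\<xi>\<^sup>2) ^ (?n - s)) * ennreal ((\<eta>\<^sup>2) ^ k) * K (\<xi>\<^sup>2) (\<eta>\<^sup>2))))) \<partial>lborel)"
      by (subst nn_integral_cmult[symmetric], measurable, subst nn_integral_cmult[symmetric], measurable)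
    also have "\<dots> = (\<integral>\<^sup>+\<eta>. ?a \<xi> * ?b \<eta> *
      K (\<xi>\<^sup>2) (\<eta>\<^sup>2) \<partial>lborel)"
    proof (rule nn_integral_cong)
      fix \<eta> :: real
      have "ennreal (2 * \<xi>) * (ennreal (2 * \<eta>) * (ennreal ((\<xi>\<^sup>2) ^ (?n - s)) * ennreal ((\<eta>\<^sup>2) ^ k) * K (\<xi>\<^sup>2) (\<eta>\<^sup>2))) =
        ennreal (2 * \<xi> ^ (2 * (?n - s) + 1)) * ennreal (2 * \<eta> ^ (2 * k + 1)) * K (\<xi>\<^sup>2) (\<eta>\<^sup>2)" if "\<xi> > 0" "\<eta> > 0"
      proof -
        have "ennreal (2 * \<xi> ^ (2 * (?n - s) + 1)) = ennreal (2 * \<xi>) * ennreal ((\<xi>\<^sup>2) ^ (?n - s))"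
          "ennreal (2 * \<eta> ^ (2 * k + 1)) = ennreal (2 * \<eta>) * ennreal ((\<eta>\<^sup>2) ^ k)"
          using that by (simp_all add: ennreal_mult[symmetric] power_add power_mult[symmetric] mult_ac)
        then show ?thesis by (simp only: mult_ac)
      qed
      then show "indicator {0<..} \<xi> * (ennreal (2 * \<xi>) * (indicator {0<..} \<eta> * (ennreal (2 * \<eta>) *
          (ennreal ((\<xi>\<^sup>2) ^ (?n - s)) * ennreal ((\<eta>\<^sup>2) ^ k) * K (\<xi>\<^sup>2) (\<eta>\<^sup>2))))) =
        ?a \<xi> * ?b \<eta> *
          K (\<xi>\<^sup>2) (\<eta>\<^sup>2)" by (simp only: indicator_def) (auto simp: mult_ac)
    qed
    finally show "indicator {0<..} \<xi> * (ennreal (2 * \<xi>) * (\<integral>\<^sup>+\<eta>. indicator {0<..} \<eta> * (ennreal (2 * \<eta>) *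
      (ennreal ((\<xi>\<^sup>2) ^ (?n - s)) * ennreal ((\<eta>\<^sup>2) ^ k) * K (\<xi>\<^sup>2) (\<eta>\<^sup>2))) \<partial>lborel)) =
      (\<integral>\<^sup>+\<eta>. ?a \<xi> * ?b \<eta> *
      K (\<xi>\<^sup>2) (\<eta>\<^sup>2) \<partial>lborel)" .
  qed
  also have "\<dots> = (\<integral>\<^sup>+\<xi>. \<integral>\<^sup>+\<eta>. \<integral>\<^sup>+x. \<integral>\<^sup>+y. ?a \<xi> *
      ?b \<eta> *
      (?X x * ?Y y * H (\<xi>\<^sup>2) (\<eta>\<^sup>2) (?A x y) (?B x y)) \<partial>LL Y' \<partial>LL X' \<partial>lborel \<partial>lborel)"
    unfolding K_def
    by (intro nn_integral_cong, subst nn_integral_cmult[symmetric], measurable, intro nn_integral_cong, subst nn_integral_cmult[symmetric], measurable)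
  also have "\<dots> = (\<integral>\<^sup>+\<xi>. \<integral>\<^sup>+x. \<integral>\<^sup>+\<eta>. \<integral>\<^sup>+y. ?a \<xi> *
      ?b \<eta> *
      (?X x * ?Y y * H (\<xi>\<^sup>2) (\<eta>\<^sup>2) (?A x y) (?B x y)) \<partial>LL Y' \<partial>lborel \<partial>LL X' \<partial>lborel)"
    by (intro nn_integral_cong nn_integral_swap[OF sigma_finite_lborel sx.sigma_finite_measure_axioms]) measurable
  also have "\<dots> = (\<integral>\<^sup>+\<xi>. \<integral>\<^sup>+x. \<integral>\<^sup>+\<eta>. \<integral>\<^sup>+y. Wx s i ?n (x(i := \<xi>)) * Wy i ?n (y(i := \<eta>)) *
      G (polA s i ?n (x(i := \<xi>)) (y(i := \<eta>))) (polB s i ?n (x(i := \<xi>)) (y(i := \<eta>))) \<partial>LL Y' \<partial>lborel \<partial>LL X' \<partial>lborel)"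
  proof (intro nn_integral_cong)
    fix \<xi> \<eta> :: real and x y :: "nat \<Rightarrow> real"
    \<comment> \<open>The inner polynomials do not see the index \<open>i\<close>, so the outer
      variables can be stored there and the iterated integrals recombine into product
      integrals.\<close>
    have i1: "{i..<i + Suc ?n - s} = insert i {Suc i..<Suc i + Suc k - s}" using s by auto
    have i2: "{i..<i + Suc k} = insert i {Suc i..<Suc i + k}" by auto
    have "Wx s i ?n (x(i := \<xi>)) = ?a \<xi> * ?X x"
      unfolding Wx_def i1 by (subst prod.insert) (auto intro!: prod.cong arg_cong2[where f = "(*)"])
    moreover have "Wy i ?n (y(i := \<eta>)) = ?b \<eta> * ?Y y"
      unfolding Wy_def i2 by (subst prod.insert) (auto intro!: prod.cong arg_cong2[where f = "(*)"])
    moreover have "?A (x(i := \<xi>)) (y(i := \<eta>)) = ?A x y"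
      "?B (x(i := \<xi>)) (y(i := \<eta>)) = ?B x y"
      by (rule polAB_cong; use s in auto)+
    then have "G (polA s i ?n (x(i := \<xi>)) (y(i := \<eta>))) (polB s i ?n (x(i := \<xi>)) (y(i := \<eta>))) =
      H (\<xi>\<^sup>2) (\<eta>\<^sup>2) (?A x y) (?B x y)"
      by (simp add: polA_Suc polB_Suc H_def Let_def)
    ultimately show "?a \<xi> *
      ?b \<eta> *
      (?X x * ?Y y * H (\<xi>\<^sup>2) (\<eta>\<^sup>2) (?A x y) (?B x y)) =
      Wx s i ?n (x(i := \<xi>)) * Wy i ?n (y(i := \<eta>)) *
      G (polA s i ?n (x(i := \<xi>)) (y(i := \<eta>))) (polB s i ?n (x(i := \<xi>)) (y(i := \<eta>)))" by (simp only: mult_ac)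
  qed
  also have "\<dots> = (\<integral>\<^sup>+x. \<integral>\<^sup>+y. Wx s i ?n x * Wy i ?n y * G (polA s i ?n x y) (polB s i ?n x y) \<partial>LL {i..<i + ?n} \<partial>LL {i..<i + Suc ?n - s})"
  proof -
    have i1: "{i..<i + Suc ?n - s} = insert i X'" using s by (auto simp: X'_def)
    have i2: "{i..<i + ?n} = insert i Y'" by (auto simp: Y'_def)
    have nX: "i \<notin> X'" "finite X'" and nY: "i \<notin> Y'" "finite Y'" by (auto simp: X'_def Y'_def)
    have W: "Wx s i ?n \<in> borel_measurable (LL (insert i X'))" "Wy i ?n \<in> borel_measurable (LL (insert i Y'))"
      unfolding i1[symmetric] i2[symmetric] by measurable
    note P = measurable_polAB'[OF s, of i ?n, unfolded i1 i2]
    define \<Phi> where "\<Phi> x y = Wx s i ?n x * Wy i ?n y * G (polA s i ?n x y) (polB s i ?n x y)" for x y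
    have \<Phi>: "case_prod \<Phi> \<in> borel_measurable (LL (insert i X') \<Otimes>\<^sub>M LL (insert i Y'))"
      unfolding \<Phi>_def case_prod_beta
      by (intro borel_measurable_times_ennreal measurable_compose[OF measurable_fst W(1)]
        measurable_compose[OF measurable_snd W(2)] measurable_case_prod_compose[OF Suc.prems] P)
    interpret sy2: sigma_finite_measure "LL (insert i Y')" unfolding i2[symmetric] by (rule sf)
    have \<Phi>2: "(\<lambda>x. \<integral>\<^sup>+y. \<Phi> x y \<partial>LL (insert i Y')) \<in> borel_measurable (LL (insert i X'))"
      using sy2.borel_measurable_nn_integral_fst[OF \<Phi>] by simp
    have "(\<integral>\<^sup>+y. \<Phi> (x(i := \<xi>)) y \<partial>LL (insert i Y')) = (\<integral>\<^sup>+\<eta>. \<integral>\<^sup>+y. \<Phi> (x(i := \<xi>)) (y(i := \<eta>)) \<partial>LL Y' \<partial>lborel)"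
      if "x \<in> space (LL X')" for x \<xi>
    proof (rule product_nn_integral_insert_rev[OF nY(2,1)])
      have "x(i := \<xi>) \<in> space (LL (insert i X'))" using that by (auto simp: space_PiM PiE_def extensional_def)
      from measurable_compose[OF measurable_Pair1'[OF this] \<Phi>]
      show "\<Phi> (x(i := \<xi>)) \<in> borel_measurable (LL (insert i Y'))" by simp
    qed
    then show ?thesis unfolding i1 i2 \<Phi>_def[symmetric]
      by (subst product_nn_integral_insert_rev[OF nX(2,1) \<Phi>2]) (auto intro!: nn_integral_cong)
  qed
  finally show ?case .
qed

section \<open>Change of variables in the complex plane\<close>

text \<open>Jacobian determinants are taken over \<open>real^2\<close>; this identification
  preserves Lebesgue measure and carries them to the complex plane.\<close>

definition complex_of_vec :: "real^2 \<Rightarrow> complex" where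
  "complex_of_vec v = Complex (vec_nth v 1) (vec_nth v 2)"

definition vec_of_complex :: "complex \<Rightarrow> real^2" where
  "vec_of_complex z = (\<chi> i. if i = 1 then Re z else Im z)"

lemma complex_of_vec_vec_of_complex [simp]: "complex_of_vec (vec_of_complex z) = z"
  by (simp add: complex_of_vec_def vec_of_complex_def)

lemma vec_of_complex_complex_of_vec [simp]: "vec_of_complex (complex_of_vec v) = v"
  by (simp add: complex_of_vec_def vec_of_complex_def Finite_Cartesian_Product.vec_eq_iff forall_2)

lemma linear_complex_of_vec: "linear complex_of_vec" and linear_vec_of_complex: "linear vec_of_complex"
  by (auto intro!: linearI simp: complex_of_vec_def vec_of_complex_def Finite_Cartesian_Product.vec_eq_iff complex_eq_iff)

lemma complex_of_vec_has_derivative: "(complex_of_vec has_derivative complex_of_vec) F"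
  by (auto intro!: bounded_linear_imp_has_derivative linear_conv_bounded_linear[THEN iffD1] linear_complex_of_vec)

lemma vec_of_complex_has_derivative: "(vec_of_complex has_derivative vec_of_complex) F"
  by (auto intro!: bounded_linear_imp_has_derivative linear_conv_bounded_linear[THEN iffD1] linear_vec_of_complex)

lemma measurable_complex_of_vec [measurable]: "complex_of_vec \<in> borel_measurable borel"
  and measurable_vec_of_complex [measurable]: "vec_of_complex \<in> borel_measurable borel"
  by (auto intro!: borel_measurable_continuous_onI linear_continuous_on linear_conv_bounded_linear[THEN iffD1] linear_complex_of_vec linear_vec_of_complex)

lemma lborel_complex_complex_of_vec: "lborel = distr lborel borel complex_of_vec"
proof (rule lborel_eqI)
  fix l u :: complex assume lu: "\<And>b. b \<in> Basis \<Longrightarrow> l \<bullet> b \<le> u \<bullet> b"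
  have le: "Re l \<le> Re u" "Im l \<le> Im u" using lu[of 1] lu[of \<i>] by (auto simp: Basis_complex_def)
  have "complex_of_vec -` box l u \<inter> space lborel = box (vec_of_complex l) (vec_of_complex u)"
    by (auto simp: complex_of_vec_def vec_of_complex_def forall_2 in_box_complex_iff mem_box_cart)
  then have "emeasure (distr lborel borel complex_of_vec) (box l u) = emeasure lborel (box (vec_of_complex l) (vec_of_complex u))"
    by (subst emeasure_distr) auto
  also have "\<dots> = ennreal (measure lborel (cbox (vec_of_complex l) (vec_of_complex u)))"
    by (simp add: emeasure_lborel_cbox_eq emeasure_lborel_box_eq measure_def)
  also have "measure lborel (cbox (vec_of_complex l) (vec_of_complex u)) = (\<Prod>i\<in>UNIV. vec_nth (vec_of_complex u) i - vec_nth (vec_of_complex l) i)"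
    using le by (intro content_cbox_cart) (auto simp: interval_ne_empty_cart vec_of_complex_def)
  also have "\<dots> = (\<Prod>b\<in>Basis. (u - l) \<bullet> b)"
    by (simp add: UNIV_2 vec_of_complex_def Basis_complex_def)
  finally show "emeasure (distr lborel borel complex_of_vec) (box l u) = (\<Prod>b\<in>Basis. (u - l) \<bullet> b)" .
qed simp

text \<open>Cauchy-Riemann: multiplication by \<open>c\<close> is a rotation followed by scaling by
  \<open>cmod c\<close>.\<close>

lemma det_complex_mult: "Determinants.det (matrix (\<lambda>v. vec_of_complex (c * complex_of_vec v))) = (cmod c)\<^sup>2"
  by (simp add: det_2 matrix_def vec_of_complex_def complex_of_vec_def axis_def cmod_power2) (simp add: power2_eq_square)

text \<open>Boundedness makes the measure of the image finite, so the change of variables for the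
  real-valued \<open>measure\<close> can be read as one for \<open>emeasure\<close>.\<close>

lemma emeasure_differentiable_image_complex:
  assumes S: "S \<in> sets borel" and inj: "inj_on f S"
    and f: "\<And>z. z \<in> S \<Longrightarrow> (f has_derivative f' z) (at z within S)"
    and J: "\<And>z. z \<in> S \<Longrightarrow> \<bar>Determinants.det (matrix (\<lambda>v. vec_of_complex (f' z (complex_of_vec v))))\<bar> = J z"
    and im: "f ` S \<in> sets borel" "bounded (f ` S)" and [measurable]: "J \<in> borel_measurable borel"
  shows "emeasure lborel (f ` S) = (\<integral>\<^sup>+ z. indicator S z * ennreal (J z) \<partial>lborel)"
proof -
  define T where "T = complex_of_vec -` S"
  have J0: "J z \<ge> 0" if "z \<in> S" for z using J[OF that] by linarith
  define g where "g = vec_of_complex \<circ> f \<circ> complex_of_vec"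
  have T[measurable]: "T \<in> sets borel" unfolding T_def using S measurable_sets_borel[OF measurable_complex_of_vec] by blast
  have cT: "complex_of_vec ` T = S" unfolding T_def by (auto simp: image_iff) (metis complex_of_vec_vec_of_complex)
  have gT: "g ` T = vec_of_complex ` f ` S" unfolding g_def cT[symmetric] by auto
  have r2im: "vec_of_complex ` X = complex_of_vec -` X" for X by (auto simp: image_iff) (metis complex_of_vec_vec_of_complex vec_of_complex_complex_of_vec)+
  have gTb: "g ` T \<in> sets borel" unfolding gT r2im using im(1) measurable_sets_borel[OF measurable_complex_of_vec] by blast
  have bT: "bounded (g ` T)" unfolding gT using im(2) linear_vec_of_complex by (simp add: bounded_linear_image linear_conv_bounded_linear)
  have lm: "g ` T \<in> lmeasurable" using gTb bT by (intro bounded_set_imp_lmeasurable) auto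
  have der: "(g has_derivative (\<lambda>v. vec_of_complex (f' (complex_of_vec x) (complex_of_vec v)))) (at x within T)" if "x \<in> T" for x
  proof -
    have "(f has_derivative f' (complex_of_vec x)) (at (complex_of_vec x) within complex_of_vec ` T)"
      using f[of "complex_of_vec x"] that unfolding cT by (simp add: T_def)
    then have "(f \<circ> complex_of_vec has_derivative (f' (complex_of_vec x) \<circ> complex_of_vec)) (at x within T)"
      using complex_of_vec_has_derivative by (rule diff_chain_within[rotated])
    then have "(vec_of_complex \<circ> (f \<circ> complex_of_vec) has_derivative vec_of_complex \<circ> (f' (complex_of_vec x) \<circ> complex_of_vec)) (at x within T)"
      by (rule diff_chain_within) (rule vec_of_complex_has_derivative)
    then show ?thesis by (simp add: g_def o_def)
  qed
  have ginj: "inj_on g T"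
    using inj unfolding inj_on_def g_def T_def by (metis complex_of_vec_vec_of_complex comp_apply vec_of_complex_complex_of_vec vimage_eq)
  have "((\<lambda>x. \<bar>Determinants.det (matrix (\<lambda>v. vec_of_complex (f' (complex_of_vec x) (complex_of_vec v))))\<bar>) has_integral measure lebesgue (g ` T)) T"
    using has_measure_differentiable_image[OF _ der ginj, of "measure lebesgue (g ` T)"] lm T by simp
  then have "((\<lambda>x. J (complex_of_vec x)) has_integral measure lebesgue (g ` T)) T"
    by (rule has_integral_eq[rotated]) (use J in \<open>simp add: T_def\<close>)
  then have "integral\<^sup>N lborel (\<lambda>x. indicator T x * J (complex_of_vec x)) = ennreal (measure lebesgue (g ` T))"
    using J by (intro nn_integral_has_integral_lebesgue) (auto simp: T_def simp flip: J)
  also have "ennreal (measure lebesgue (g ` T)) = emeasure lborel (g ` T)"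
    using gTb emeasure_bounded_finite[OF bT] by (simp add: emeasure_eq_ennreal_measure less_top)
  also have "\<dots> = emeasure lborel (f ` S)"
    unfolding gT r2im lborel_complex_complex_of_vec using im by (simp add: emeasure_distr)
  finally have e1: "emeasure lborel (f ` S) = (\<integral>\<^sup>+x. ennreal (indicator T x * J (complex_of_vec x)) \<partial>lborel)" by simp
  have "(\<integral>\<^sup>+ z. indicator S z * ennreal (J z) \<partial>distr lborel borel complex_of_vec) =
    (\<integral>\<^sup>+x. ennreal (indicator T x * J (complex_of_vec x)) \<partial>lborel)"
    using S J0 by (subst nn_integral_distr) (auto simp: T_def ennreal_mult ennreal_indicator intro!: nn_integral_cong split: split_indicator)
  then show ?thesis using e1 unfolding lborel_complex_complex_of_vec[symmetric] by simp
qed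

text \<open>Both sides integrate \<open>h\<close> against a measure on the target. The two measures
  agree on bounded Borel sets by the formula for the measure of an image, and balls exhaust the
  plane.\<close>

lemma nn_integral_differentiable_inj:
  assumes S[measurable]: "S \<in> sets borel" and inj: "inj_on f S"
    and f: "\<And>z. z \<in> S \<Longrightarrow> (f has_derivative f' z) (at z within S)"
    and J: "\<And>z. z \<in> S \<Longrightarrow> \<bar>Determinants.det (matrix (\<lambda>v. vec_of_complex (f' z (complex_of_vec v))))\<bar> = J z"
    and [measurable]: "J \<in> borel_measurable borel" "f \<in> borel_measurable borel" and im[measurable]: "f ` S \<in> sets borel"
    and h[measurable]: "h \<in> borel_measurable borel"
  shows "(\<integral>\<^sup>+ w. indicator (f ` S) w * h w \<partial>lborel) =
    (\<integral>\<^sup>+ z. indicator S z * (ennreal (J z) * h (f z)) \<partial>lborel)"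
proof -
  define N1 where "N1 = density lborel (\<lambda>w. indicator (f ` S) w :: ennreal)"
  define D where "D = density lborel (\<lambda>z. indicator S z * ennreal (J z))"
  define N2 where "N2 = distr D borel f"
  have fD: "f \<in> D \<rightarrow>\<^sub>M borel" unfolding D_def by measurable
  have b: "emeasure N1 E = emeasure N2 E" if E[measurable]: "E \<in> sets borel" and bE: "bounded E" for E
  proof -
    have i: "f ` (S \<inter> f -` E) = f ` S \<inter> E" by auto
    have fE[measurable]: "f -` E \<in> sets borel" using measurable_sets_borel[OF \<open>f \<in> borel_measurable borel\<close> E] .
    have "emeasure N1 E = (\<integral>\<^sup>+w. indicator (f ` S) w * indicator E w \<partial>lborel)"
      unfolding N1_def by (subst emeasure_density) auto
    also have "\<dots> = (\<integral>\<^sup>+w. indicator (f ` S \<inter> E) w \<partial>lborel)"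
      by (intro nn_integral_cong) (auto split: split_indicator)
    also have "\<dots> = emeasure lborel (f ` S \<inter> E)"
      using im E by (intro nn_integral_indicator) auto
    also have "\<dots> = (\<integral>\<^sup>+ z. indicator (S \<inter> f -` E) z * ennreal (J z) \<partial>lborel)"
      unfolding i[symmetric]
    proof (rule emeasure_differentiable_image_complex)
      show "inj_on f (S \<inter> f -` E)" using inj by (rule inj_on_subset) auto
      show "(f has_derivative f' z) (at z within S \<inter> f -` E)" if "z \<in> S \<inter> f -` E" for z
        using f[of z] that by (auto intro: has_derivative_subset)
      show "\<bar>Determinants.det (matrix (\<lambda>v. vec_of_complex (f' z (complex_of_vec v))))\<bar> = J z" if "z \<in> S \<inter> f -` E" for z
        using J[of z] that by auto
      show "bounded (f ` (S \<inter> f -` E))" by (rule bounded_subset[OF bE]) auto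
    qed (use i in auto)
    also have "\<dots> = emeasure D (f -` E)"
      by (auto simp: D_def emeasure_density intro!: nn_integral_cong split: split_indicator)
    also have "\<dots> = emeasure N2 E"
      unfolding N2_def by (subst emeasure_distr[OF fD]) (auto simp: D_def)
    finally show ?thesis .
  qed
  have "N1 = N2"
  proof (rule measure_eqI)
    show "sets N1 = sets N2" by (simp add: N1_def N2_def)
    fix E assume "E \<in> sets N1"
    then have E[measurable]: "E \<in> sets borel" by (simp add: N1_def)
    define X where "X n = E \<inter> cball 0 (real n)" for n
    have X: "range X \<subseteq> sets N1" "range X \<subseteq> sets N2" by (auto simp: X_def N1_def N2_def)
    have inc: "incseq X" by (auto simp: X_def incseq_def)
    have U: "(\<Union>n. X n) = E" using real_arch_simple by (auto simp: X_def)
    have "emeasure N1 (X n) = emeasure N2 (X n)" for n by (rule b) (auto simp: X_def)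
    then show "emeasure N1 E = emeasure N2 E"
      using SUP_emeasure_incseq[OF X(1) inc] SUP_emeasure_incseq[OF X(2) inc] unfolding U by simp
  qed
  then have "integral\<^sup>N N1 h = integral\<^sup>N N2 h" by simp
  moreover have "integral\<^sup>N N1 h = (\<integral>\<^sup>+ w. indicator (f ` S) w * h w \<partial>lborel)"
    unfolding N1_def by (subst nn_integral_density) auto
  moreover have "integral\<^sup>N N2 h = (\<integral>\<^sup>+ z. h (f z) \<partial>D)"
    unfolding N2_def by (subst nn_integral_distr[OF fD]) auto
  moreover have "(\<integral>\<^sup>+ z. h (f z) \<partial>D) = (\<integral>\<^sup>+ z. indicator S z * (ennreal (J z) * h (f z)) \<partial>lborel)"
    unfolding D_def by (subst nn_integral_density) (auto simp: mult.assoc)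
  ultimately show ?thesis by simp
qed

text \<open>A continuous image of a Borel set need not be Borel. Here the set is a countable union
  of compact sets, and compactness passes to images.\<close>

lemma borel_image_open_Int_closed:
  fixes f :: "complex \<Rightarrow> complex"
  assumes "open S" "closed C" "continuous_on S f"
  shows "f ` (S \<inter> C) \<in> sets borel"
proof -
  obtain F :: "nat \<Rightarrow> complex set" where F: "\<And>n. compact (F n)" "\<Union>(range F) = S" "\<And>n. F n \<subseteq> S"
    using open_Union_compact_subsets[OF assms(1)] by metis
  have "f ` (S \<inter> C) = (\<Union>n. f ` (F n \<inter> C))" unfolding F(2)[symmetric] by auto
  moreover have "compact (f ` (F n \<inter> C))" for n
    using F assms by (intro compact_continuous_image compact_Int_closed) (auto intro: continuous_on_subset)
  then have "f ` (F n \<inter> C) \<in> sets borel" for n by (simp add: borel_compact)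
  ultimately show ?thesis by auto
qed

text \<open>Away from the finitely many zeros of the derivative, countably many open sets on which
  \<open>R\<close> is injective cover the plane. On disjoint pieces of them the real Jacobian is the
  squared modulus of the derivative, and almost every value \<open>c\<close> is taken exactly
  \<open>degree R\<close> times because \<open>R - c\<close> has only simple roots.\<close>

lemma nn_integral_poly_fibres:
  fixes R :: "complex poly"
  assumes deg: "degree R \<noteq> 0" and h[measurable]: "h \<in> borel_measurable borel"
  shows "(\<integral>\<^sup>+ w. ennreal ((cmod (poly (pderiv R) w))\<^sup>2) * h (poly R w) \<partial>lborel) =
    of_nat (degree R) * (\<integral>\<^sup>+ c. h c \<partial>lborel)"
proof -
  define S where "S = {w. poly (pderiv R) w \<noteq> 0}"
  have pd: "pderiv R \<noteq> 0" using deg by (simp add: pderiv_eq_0_iff)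
  have fin: "finite (- S)" using poly_roots_finite[OF pd] by (simp add: S_def Compl_eq)
  have opS: "open S" using finite_imp_closed[OF fin] by (simp add: open_closed)
  have hol: "poly R holomorphic_on X" for X by (intro holomorphic_intros)
  have deriv: "deriv (poly R) w = poly (pderiv R) w" for w by (intro DERIV_imp_deriv poly_DERIV)
  define \<F> where "\<F> = {U. open U \<and> U \<subseteq> S \<and> inj_on (poly R) U}"
  have U\<F>: "\<Union>\<F> = S"
  proof
    show "S \<subseteq> \<Union>\<F>"
    proof
      fix w assume w: "w \<in> S"
      then obtain r where "r > 0" "ball w r \<subseteq> S" "inj_on (poly R) (ball w r)"
        using has_complex_derivative_locally_injective[OF hol w opS] by (auto simp: deriv S_def)
      then show "w \<in> \<Union>\<F>" by (auto simp: \<F>_def intro!: exI[of _ "ball w r"])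
    qed
  qed (auto simp: \<F>_def)
  obtain \<G> where G: "\<G> \<subseteq> \<F>" "countable \<G>" "\<Union>\<G> = \<Union>\<F>"
    using Lindelof[of \<F>] by (auto simp: \<F>_def)
  have "{} \<in> \<F>" by (auto simp: \<F>_def)
  define A where "A = from_nat_into (insert {} \<G>)"
  have rA: "range A = insert {} \<G>" unfolding A_def using G by (intro range_from_nat_into) auto
  then have A\<F>: "A n \<in> \<F>" for n using G \<open>{} \<in> \<F>\<close> by (metis insert_iff rangeI subsetD)
  have UA: "(\<Union>n. A n) = S" using rA G U\<F> by auto
  define B where "B = disjointed A"
  have UB: "(\<Union>n. B n) = S" unfolding B_def UN_disjointed_eq UA ..
  have disj: "disjoint_family B" unfolding B_def by (rule disjoint_family_disjointed)
  have BA: "B n \<subseteq> A n" for n unfolding B_def by (rule disjointed_subset)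
  have Aop: "open (A n)" "A n \<subseteq> S" "inj_on (poly R) (A n)" for n using A\<F>[of n] by (auto simp: \<F>_def)
  \<comment> \<open>Each piece is an open set minus finitely many open sets, hence of the shape for
    which images are Borel.\<close>
  have Beq: "B n = A n \<inter> - (\<Union>i<n. A i)" for n unfolding B_def disjointed_def by (auto simp: atLeast0LessThan)
  have Bm[measurable]: "B n \<in> sets borel" for n unfolding Beq using Aop(1) by (intro sets.Int) (auto intro!: borel_open borel_closed)
  have injB: "inj_on (poly R) (B n)" for n using Aop(3)[of n] BA by (rule inj_on_subset)
  have imB[measurable]: "poly R ` B n \<in> sets borel" for n
    unfolding Beq using Aop(1) by (intro borel_image_open_Int_closed continuous_intros) auto
  have pm[measurable]: "poly Q \<in> borel_measurable borel" for Q :: "complex poly"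
    by (intro borel_measurable_continuous_onI continuous_intros)
  have piece: "(\<integral>\<^sup>+ w. indicator (poly R ` B n) w * h w \<partial>lborel) =
      (\<integral>\<^sup>+ z. indicator (B n) z * (ennreal ((cmod (poly (pderiv R) z))\<^sup>2) * h (poly R z)) \<partial>lborel)" for n
  proof (rule nn_integral_differentiable_inj[where f' = "\<lambda>z. (*) (poly (pderiv R) z)", OF Bm injB])
    show "(poly R has_derivative (*) (poly (pderiv R) z)) (at z within B n)" for z
      using poly_DERIV[of R z] by (auto simp: has_field_derivative_def intro: has_derivative_at_withinI)
  qed (auto simp: det_complex_mult)
  have "AE w in lborel. w \<notin> - S" using fin by (intro AE_not_in finite_imp_null_set_lborel)
  then have "(\<integral>\<^sup>+ w. ennreal ((cmod (poly (pderiv R) w))\<^sup>2) * h (poly R w) \<partial>lborel) =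
    (\<integral>\<^sup>+ w. (\<Sum>n. indicator (B n) w) * (ennreal ((cmod (poly (pderiv R) w))\<^sup>2) * h (poly R w)) \<partial>lborel)"
    by (intro nn_integral_cong_AE) (auto simp: suminf_indicator[OF disj] UB)
  also have "\<dots> = (\<integral>\<^sup>+ w. (\<Sum>n. indicator (B n) w * (ennreal ((cmod (poly (pderiv R) w))\<^sup>2) * h (poly R w))) \<partial>lborel)"
    by (intro nn_integral_cong) (simp only: ennreal_suminf_multc)
  also have "\<dots> = (\<Sum>n. \<integral>\<^sup>+ w. indicator (B n) w * (ennreal ((cmod (poly (pderiv R) w))\<^sup>2) * h (poly R w)) \<partial>lborel)"
    by (intro nn_integral_suminf) auto
  also have "\<dots> = (\<Sum>n. \<integral>\<^sup>+ w. indicator (poly R ` B n) w * h w \<partial>lborel)" by (simp only: piece)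
  also have "\<dots> = (\<integral>\<^sup>+ w. (\<Sum>n. indicator (poly R ` B n) w * h w) \<partial>lborel)"
    by (intro nn_integral_suminf[symmetric]) auto
  also have "\<dots> = (\<integral>\<^sup>+ w. of_nat (degree R) * h w \<partial>lborel)"
  proof (rule nn_integral_cong_AE)
    have "AE w in lborel. w \<notin> poly R ` (- S)" using fin by (intro AE_not_in finite_imp_null_set_lborel) auto
    then show "AE w in lborel. (\<Sum>n. indicator (poly R ` B n) w * h w) = of_nat (degree R) * h w"
    proof eventually_elim
      \<comment> \<open>Such a \<open>c\<close> is not a critical value: its fibre \<open>Z\<close>
        has \<open>degree R\<close> points, and each of them lies in exactly one piece.\<close>
      fix c assume c: "c \<notin> poly R ` (- S)"
      define Z where "Z = {w. poly R w = c}"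
      let ?p = "R - [:c:]"
      have dp: "degree ?p = degree R" using degree_add_eq_left[of "- [:c:]" R] deg unfolding diff_conv_add_uminus by simp
      have Zp: "Z = {w. poly ?p w = 0}" by (auto simp: Z_def)
      have p0: "?p \<noteq> 0" using dp deg by auto
      have "rsquarefree ?p" unfolding rsquarefree_roots using c by (auto simp: S_def pderiv_diff)
      then have cZ: "card Z = degree R" unfolding Zp using rsquarefree_card_degree[OF p0] dp by simp
      have finZ: "finite Z" unfolding Zp using poly_roots_finite[OF p0] .
      have ZS: "Z \<subseteq> S" using c by (auto simp: Z_def)
      have ind: "indicator (poly R ` B n) c = (\<Sum>w\<in>Z. indicator (B n) w :: ennreal)" for n
      proof (cases "c \<in> poly R ` B n")
        case True
        then obtain w where w: "w \<in> B n" "c = poly R w" by auto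
        have "(\<Sum>w\<in>Z. indicator (B n) w :: ennreal) = (\<Sum>v\<in>{w}. indicator (B n) v)"
          using w injB[of n] finZ by (intro sum.mono_neutral_right) (auto simp: Z_def inj_on_def split: split_indicator)
        then show ?thesis using True w by simp
      next
        case False
        then have "(\<Sum>w\<in>Z. indicator (B n) w :: ennreal) = 0" by (intro sum.neutral) (auto simp: Z_def split: split_indicator)
        then show ?thesis using False by simp
      qed
      have "(\<Sum>n. indicator (poly R ` B n) c :: ennreal) = (\<Sum>w\<in>Z. \<Sum>n. indicator (B n) w)"
        unfolding ind by (intro suminf_sum) auto
      also have "\<dots> = (\<Sum>w\<in>Z. 1)"
        by (intro sum.cong refl) (use ZS in \<open>auto simp: suminf_indicator[OF disj] UB\<close>)
      finally have "(\<Sum>n. indicator (poly R ` B n) c :: ennreal) = of_nat (degree R)" using cZ by simp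
      then show "(\<Sum>n. indicator (poly R ` B n) c * h c) = of_nat (degree R) * h c"
        by (simp only: ennreal_suminf_multc)
    qed
  qed
  also have "\<dots> = of_nat (degree R) * (\<integral>\<^sup>+ c. h c \<partial>lborel)" by (rule nn_integral_cmult) auto
  finally show ?thesis .
qed

section \<open>Cartesian and polar coordinates in the plane\<close>

lemma lborel_complex_prod: "(lborel :: complex measure) = distr (lborel \<Otimes>\<^sub>M lborel) borel (\<lambda>(x, y). Complex x y)"
proof (rule lborel_eqI)
  interpret pair_sigma_finite "lborel :: real measure" "lborel :: real measure" ..
  have [measurable]: "(\<lambda>(x, y). Complex x y) \<in> borel \<Otimes>\<^sub>M borel \<rightarrow>\<^sub>M (borel :: complex measure)"
    unfolding Complex_eq case_prod_beta by measurable
  fix l u :: complex assume lu: "\<And>b. b \<in> Basis \<Longrightarrow> l \<bullet> b \<le> u \<bullet> b"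
  have le: "Re l \<le> Re u" "Im l \<le> Im u" using lu[of 1] lu[of \<i>] by (auto simp: Basis_complex_def)
  have "(\<lambda>(x, y). Complex x y) -` box l u \<inter> space (lborel \<Otimes>\<^sub>M lborel) = {Re l<..<Re u} \<times> {Im l<..<Im u}"
    by (auto simp: in_box_complex_iff space_pair_measure)
  then have "emeasure (distr (lborel \<Otimes>\<^sub>M lborel) borel (\<lambda>(x, y). Complex x y)) (box l u) =
      emeasure (lborel \<Otimes>\<^sub>M lborel) ({Re l<..<Re u} \<times> {Im l<..<Im u})"
    by (subst emeasure_distr) auto
  also have "\<dots> = ennreal (Re u - Re l) * ennreal (Im u - Im l)"
    using le by (subst lborel.emeasure_pair_measure_Times) auto
  finally show "emeasure (distr (lborel \<Otimes>\<^sub>M lborel) borel (\<lambda>(x, y). Complex x y)) (box l u) = (\<Prod>b\<in>Basis. (u - l) \<bullet> b)"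
    using le by (simp add: Basis_complex_def ennreal_mult)
qed simp

lemma nn_integral_complex:
  assumes [measurable]: "f \<in> borel_measurable borel"
  shows "(\<integral>\<^sup>+ z. f z \<partial>lborel) = (\<integral>\<^sup>+ x. \<integral>\<^sup>+ y. f (Complex x y) \<partial>lborel \<partial>lborel)"
proof -
  have [measurable]: "(\<lambda>(x, y). Complex x y) \<in> borel \<Otimes>\<^sub>M borel \<rightarrow>\<^sub>M (borel :: complex measure)"
    unfolding Complex_eq case_prod_beta by measurable
  have "(\<integral>\<^sup>+ z. f z \<partial>lborel) = (\<integral>\<^sup>+ p. f (case p of (x, y) \<Rightarrow> Complex x y) \<partial>(lborel \<Otimes>\<^sub>M lborel))"
    by (subst lborel_complex_prod) (subst nn_integral_distr, auto)
  also have "\<dots> = (\<integral>\<^sup>+ x. \<integral>\<^sup>+ y. f (Complex x y) \<partial>lborel \<partial>lborel)"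
    by (subst lborel.nn_integral_fst[symmetric]) auto
  finally show ?thesis .
qed

lemma nn_integral_complex_polar:
  assumes [measurable]: "f \<in> borel_measurable borel"
  shows "(\<integral>\<^sup>+ z. f z \<partial>lborel) =
    (\<integral>\<^sup>+ r. \<integral>\<^sup>+ t. ennreal r * indicator {0<..} r * indicator {-pi<..<pi} t * f (rcis r t) \<partial>lborel \<partial>lborel)"
proof -
  \<comment> \<open>The strip of radii and angles is itself viewed as a subset of the complex plane,
    so that the planar change of variables applies to \<open>g\<close>.\<close>
  define S where "S = {z. Re z > 0 \<and> - pi < Im z \<and> Im z < pi}"
  define g where "g = (\<lambda>z. rcis (Re z) (Im z))"
  have Sop: "open S" unfolding S_def by (intro open_Collect_conj open_Collect_less continuous_intros)
  have [measurable]: "S \<in> sets borel" using Sop by simp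
  have gc: "continuous_on X g" for X unfolding g_def rcis_def cis_conv_exp by (intro continuous_intros)
  have [measurable]: "g \<in> borel_measurable borel" by (intro borel_measurable_continuous_onI gc)
  have [measurable]: "g ` S \<in> sets borel" using borel_image_open_Int_closed[OF Sop closed_UNIV gc] by simp
  have inj: "inj_on g S"
  proof (rule inj_onI)
    fix z w assume zw: "z \<in> S" "w \<in> S" "g z = g w"
    have "Re z = Re w" using arg_cong[OF zw(3), of cmod] zw(1,2) by (simp add: g_def S_def)
    moreover have "Arg (rcis r t) = t" if "r > 0" "-pi < t" "t < pi" for r t
      using that by (intro Arg_unique[of r]) (auto simp: rcis_def cis_conv_exp)
    then have "Im z = Im w" using arg_cong[OF zw(3), of Arg] zw(1,2) by (simp add: g_def S_def)
    ultimately show "z = w" by (simp add: complex_eq_iff)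
  qed
  have im: "- (\<real>\<^sub>\<le>\<^sub>0) \<subseteq> g ` S"
  proof
    fix z :: complex assume z: "z \<in> - \<real>\<^sub>\<le>\<^sub>0"
    then have "z \<noteq> 0" by auto
    have "Arg z \<noteq> pi" using z Arg_eq_pi[of z] by (auto simp: complex_nonpos_Reals_iff)
    then have "Complex (cmod z) (Arg z) \<in> S" using \<open>z \<noteq> 0\<close> mpi_less_Arg[of z] Arg_le_pi[of z] by (auto simp: S_def)
    moreover have "g (Complex (cmod z) (Arg z)) = z" by (simp add: g_def rcis_cmod_Arg)
    ultimately show "z \<in> g ` S" by (metis imageI)
  qed
  define D where "D = (\<lambda>z h. cis (Im z) * Complex (Re h) (Re z * Im h))"
  have der: "(g has_derivative D z) (at z within S)" for z
  proof -
    have e: "((\<lambda>z. exp (\<i> * of_real (Im z))) has_derivative (\<lambda>h. exp (\<i> * of_real (Im z)) * (\<i> * of_real (Im h)))) (at z within S)"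
      by (rule has_derivative_compose[OF _ DERIV_exp[unfolded has_field_derivative_def]])
        (auto intro!: derivative_eq_intros)
    have "((\<lambda>z. of_real (Re z) * exp (\<i> * of_real (Im z))) has_derivative
       (\<lambda>h. of_real (Re z) * (exp (\<i> * of_real (Im z)) * (\<i> * of_real (Im h))) + of_real (Re h) * exp (\<i> * of_real (Im z)))) (at z within S)"
      by (intro has_derivative_mult e has_derivative_of_real has_derivative_Re has_derivative_ident)
    moreover have "g = (\<lambda>z. of_real (Re z) * exp (\<i> * of_real (Im z)))" by (simp add: g_def rcis_def cis_conv_exp)
    moreover have "D z = (\<lambda>h. of_real (Re z) * (exp (\<i> * of_real (Im z)) * (\<i> * of_real (Im h))) + of_real (Re h) * exp (\<i> * of_real (Im z)))"
      by (simp add: D_def fun_eq_iff cis_conv_exp Complex_eq algebra_simps)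
    ultimately show ?thesis by simp
  qed
  have J: "\<bar>Determinants.det (matrix (\<lambda>v. vec_of_complex (D z (complex_of_vec v))))\<bar> = \<bar>Re z\<bar>" for z
  proof -
    have "Determinants.det (matrix (\<lambda>v. vec_of_complex (D z (complex_of_vec v)))) = Re z * ((cos (Im z))\<^sup>2 + (sin (Im z))\<^sup>2)"
      by (simp add: det_2 matrix_def vec_of_complex_def complex_of_vec_def axis_def D_def power2_eq_square algebra_simps)
        (metis distrib_left mult.right_neutral sin_cos_squared_add3)
    then show ?thesis by simp
  qed
  \<comment> \<open>The half-line missed by the open interval of angles is a null set.\<close>
  have "AE z in lborel. z \<notin> (\<real>\<^sub>\<le>\<^sub>0 :: complex set)"
  proof (rule AE_not_in)
    have "negligible {z::complex. z \<bullet> \<i> = 0}" by (rule negligible_standard_hyperplane) (simp add: Basis_complex_def)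
    moreover have "\<real>\<^sub>\<le>\<^sub>0 \<subseteq> {z::complex. z \<bullet> \<i> = 0}" by (auto simp: complex_nonpos_Reals_iff)
    ultimately have "negligible (\<real>\<^sub>\<le>\<^sub>0 :: complex set)" by (rule negligible_subset)
    then show "\<real>\<^sub>\<le>\<^sub>0 \<in> null_sets (lborel :: complex measure)"
      by (simp add: negligible_iff_null_sets null_sets_completion_iff closed_nonpos_Reals_complex borel_closed)
  qed
  then have "(\<integral>\<^sup>+ z. f z \<partial>lborel) = (\<integral>\<^sup>+ z. indicator (g ` S) z * f z \<partial>lborel)"
    using im by (intro nn_integral_cong_AE) (auto split: split_indicator)
  also have "\<dots> = (\<integral>\<^sup>+ z. indicator S z * (ennreal \<bar>Re z\<bar> * f (g z)) \<partial>lborel)"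
    by (rule nn_integral_differentiable_inj[where f' = D]) (auto simp: inj der J)
  also have "\<dots> = (\<integral>\<^sup>+ r. \<integral>\<^sup>+ t. indicator S (Complex r t) * (ennreal \<bar>r\<bar> * f (rcis r t)) \<partial>lborel \<partial>lborel)"
    by (subst nn_integral_complex, measurable) (simp add: g_def)
  also have "\<dots> = (\<integral>\<^sup>+ r. \<integral>\<^sup>+ t. ennreal r * indicator {0<..} r * indicator {-pi<..<pi} t * f (rcis r t) \<partial>lborel \<partial>lborel)"
    by (intro nn_integral_cong) (auto simp: S_def split: split_indicator)
  finally show ?thesis .
qed

section \<open>From roots to coefficients\<close>

text \<open>No bound on the degree is at hand, so evaluation is the pointwise limit of truncated
  sums; for each polynomial these are eventually constant.\<close>

lemma measurable_poly_eval [measurable (raw)]: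
  assumes f: "f \<in> N \<rightarrow>\<^sub>M polyM" and [measurable]: "g \<in> borel_measurable N"
  shows "(\<lambda>\<omega>. poly (f \<omega>) (g \<omega>)) \<in> borel_measurable N"
proof (rule borel_measurable_LIMSEQ_metric)
  note [measurable] = f
  show "(\<lambda>\<omega>. \<Sum>i\<le>n. coeff (f \<omega>) i * g \<omega> ^ i) \<in> borel_measurable N" for n by measurable
  fix \<omega>
  have "\<forall>\<^sub>F n in sequentially. (\<Sum>i\<le>n. coeff (f \<omega>) i * g \<omega> ^ i) = poly (f \<omega>) (g \<omega>)"
  proof (rule eventually_sequentiallyI)
    fix n assume "degree (f \<omega>) \<le> n"
    then have "(\<Sum>i\<le>degree (f \<omega>). coeff (f \<omega>) i * g \<omega> ^ i) = (\<Sum>i\<le>n. coeff (f \<omega>) i * g \<omega> ^ i)"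
      by (intro sum.mono_neutral_left) (auto simp: coeff_eq_0)
    then show "(\<Sum>i\<le>n. coeff (f \<omega>) i * g \<omega> ^ i) = poly (f \<omega>) (g \<omega>)" by (simp add: poly_altdef)
  qed
  then show "(\<lambda>n. \<Sum>i\<le>n. coeff (f \<omega>) i * g \<omega> ^ i) \<longlonglongrightarrow> poly (f \<omega>) (g \<omega>)"
    by (rule tendsto_eventually)
qed

lemma measurable_pderiv [measurable (raw)]: "f \<in> N \<rightarrow>\<^sub>M polyM \<Longrightarrow> (\<lambda>\<omega>. pderiv (f \<omega>)) \<in> N \<rightarrow>\<^sub>M polyM"
  by (intro measurable_polyM) (simp add: coeff_pderiv)

abbreviation CC :: "nat set \<Rightarrow> (nat \<Rightarrow> complex) measure" where
  "CC I \<equiv> (\<Pi>\<^sub>M i\<in>I. lborel)"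

section \<open>Product integrals over complex coefficients\<close>

lemma nn_integral_PiM_reindex:
  fixes N :: "'a measure" and f :: "'i \<Rightarrow> 'j"
  assumes sf: "sigma_finite_measure N" and I: "finite I" and bij: "bij_betw f I J"
    and F: "F \<in> borel_measurable (\<Pi>\<^sub>M j\<in>J. N)"
  shows "(\<integral>\<^sup>+x. F x \<partial>(\<Pi>\<^sub>M j\<in>J. N)) = (\<integral>\<^sup>+y. F (\<lambda>j\<in>J. y (inv_into I f j)) \<partial>(\<Pi>\<^sub>M i\<in>I. N))"
proof -
  interpret product_sigma_finite "\<lambda>_::'i. N" by (rule product_sigma_finite.intro) (rule sf)
  interpret J: product_sigma_finite "\<lambda>_::'j. N" by (rule product_sigma_finite.intro) (rule sf)
  have J: "finite J" using bij I bij_betw_finite by blast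
  define T where "T y = (\<lambda>j\<in>J. y (inv_into I f j))" for y :: "_ \<Rightarrow> 'a"
  have inv: "inv_into I f j \<in> I" if "j \<in> J" for j using bij that by (metis bij_betw_imp_surj_on inv_into_into)
  have T[measurable]: "T \<in> (\<Pi>\<^sub>M i\<in>I. N) \<rightarrow>\<^sub>M (\<Pi>\<^sub>M j\<in>J. N)" unfolding T_def
    by (intro measurable_restrict measurable_component_singleton inv)
  have "(\<Pi>\<^sub>M j\<in>J. N) = distr (\<Pi>\<^sub>M i\<in>I. N) (\<Pi>\<^sub>M j\<in>J. N) T"
  proof (rule J.PiM_eqI[symmetric, OF J])
    fix A assume A: "\<And>i. i \<in> J \<Longrightarrow> A i \<in> sets N"
    have "T -` Pi\<^sub>E J A \<inter> space (\<Pi>\<^sub>M i\<in>I. N) = Pi\<^sub>E I (\<lambda>i. A (f i))"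
    proof (intro equalityI subsetI)
      fix y assume y: "y \<in> T -` Pi\<^sub>E J A \<inter> space (\<Pi>\<^sub>M i\<in>I. N)"
      have "y i \<in> A (f i)" if "i \<in> I" for i
      proof -
        have "f i \<in> J" "inv_into I f (f i) = i" using bij that by (auto simp: bij_betw_def)
        then have "T y (f i) = y i" by (simp add: T_def)
        moreover have "T y (f i) \<in> A (f i)" using y \<open>f i \<in> J\<close> by auto
        ultimately show ?thesis by simp
      qed
      then show "y \<in> Pi\<^sub>E I (\<lambda>i. A (f i))" using y by (auto simp: space_PiM PiE_def)
    next
      fix y assume y: "y \<in> Pi\<^sub>E I (\<lambda>i. A (f i))"
      have "y (inv_into I f j) \<in> A j" if "j \<in> J" for j
        using y inv[OF that] bij that by (metis PiE_mem bij_betw_inv_into_right)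
      moreover have "y \<in> space (\<Pi>\<^sub>M i\<in>I. N)"
      proof -
        have "A (f i) \<subseteq> space N" if "i \<in> I" for i
          using A[of "f i"] bij that sets.sets_into_space by (auto simp: bij_betw_def)
        then show ?thesis using y by (fastforce simp: space_PiM PiE_def Pi_def)
      qed
      ultimately show "y \<in> T -` Pi\<^sub>E J A \<inter> space (\<Pi>\<^sub>M i\<in>I. N)" by (auto simp: T_def)
    qed
    then have "emeasure (distr (\<Pi>\<^sub>M i\<in>I. N) (\<Pi>\<^sub>M j\<in>J. N) T) (Pi\<^sub>E J A) = emeasure (\<Pi>\<^sub>M i\<in>I. N) (Pi\<^sub>E I (\<lambda>i. A (f i)))"
      using A J by (subst emeasure_distr) (auto intro!: sets_PiM_I_finite)
    also have "\<dots> = (\<Prod>i\<in>I. emeasure N (A (f i)))"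
      using A bij I by (intro emeasure_PiM) (auto simp: bij_betw_def)
    also have "\<dots> = (\<Prod>j\<in>J. emeasure N (A j))"
      using bij by (rule prod.reindex_bij_betw)
    finally show "emeasure (distr (\<Pi>\<^sub>M i\<in>I. N) (\<Pi>\<^sub>M j\<in>J. N) T) (Pi\<^sub>E J A) = (\<Prod>j\<in>J. emeasure N (A j))" .
  qed simp
  then have "(\<integral>\<^sup>+x. F x \<partial>(\<Pi>\<^sub>M j\<in>J. N)) = (\<integral>\<^sup>+x. F x \<partial>distr (\<Pi>\<^sub>M i\<in>I. N) (\<Pi>\<^sub>M j\<in>J. N) T)" by simp
  also have "\<dots> = (\<integral>\<^sup>+y. F (T y) \<partial>(\<Pi>\<^sub>M i\<in>I. N))" using F by (subst nn_integral_distr) auto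
  finally show ?thesis unfolding T_def .
qed

lemma nn_integral_lborel_translate:
  fixes f :: "'a::euclidean_space \<Rightarrow> ennreal"
  assumes [measurable]: "f \<in> borel_measurable borel"
  shows "(\<integral>\<^sup>+x. f (x + c) \<partial>lborel) = (\<integral>\<^sup>+x. f x \<partial>lborel)"
proof -
  have "(\<integral>\<^sup>+x. f x \<partial>lborel) = (\<integral>\<^sup>+x. f x \<partial>distr lborel borel ((+) c))" by (simp add: lborel_distr_plus)
  also have "\<dots> = (\<integral>\<^sup>+x. f (x + c) \<partial>lborel)" by (subst nn_integral_distr) (auto simp: add.commute)
  finally show ?thesis by simp
qed

text \<open>Each coordinate is translated by an amount that depends only on the next one. The
  boundary value \<open>t\<close> varies in the induction because, once the top coordinate
  \<open>c\<close> is split off, \<open>c\<close> is the boundary value for the rest.\<close>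

lemma nn_integral_unitriangular:
  fixes w :: complex
  assumes "F \<in> borel_measurable (CC {0..<n})"
  shows "(\<integral>\<^sup>+q. F (\<lambda>i\<in>{0..<n}. q i - w * (if Suc i = n then t else q (Suc i))) \<partial>CC {0..<n}) = (\<integral>\<^sup>+q. F q \<partial>CC {0..<n})"
  using assms
proof (induction n arbitrary: F t)
  case 0
  have "(\<integral>\<^sup>+b. f b \<partial>CC {0..<0}) = f (\<lambda>_. undefined)" for f
    by (simp add: nn_integral_count_space_finite PiM_empty)
  then show ?case by (simp only:) (simp add: restrict_def)
next
  case (Suc n)
  interpret product_sigma_finite "\<lambda>_::nat. lborel :: complex measure" by standard
  interpret sn: sigma_finite_measure "CC {0..<n}" by (rule sigma_finite_PiM_lborel) simp
  note F = Suc.prems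
  have ins: "{0..<Suc n} = insert n {0..<n}" by auto
  have upd: "(\<lambda>p. (snd p)(n := fst p)) \<in> borel \<Otimes>\<^sub>M CC {0..<n} \<rightarrow>\<^sub>M CC {0..<Suc n}"
    unfolding ins by (rule measurable_fun_upd[where J = "{0..<n}"]) auto
  have F2: "(\<lambda>p. F ((snd p)(n := fst p))) \<in> borel_measurable (borel \<Otimes>\<^sub>M CC {0..<n})"
    using measurable_compose[OF upd F] .
  have F3: "(\<lambda>q. F (q(n := c))) \<in> borel_measurable (CC {0..<n})" for c
    using measurable_compose[OF measurable_Pair1'[of c borel] F2] by simp
  define k where "k c = (\<integral>\<^sup>+q. F (q(n := c)) \<partial>CC {0..<n})" for c
  have k: "k \<in> borel_measurable borel" unfolding k_def
    by (rule sn.borel_measurable_nn_integral) (use F2 in \<open>simp add: case_prod_beta\<close>)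
  define T where "T q = (\<lambda>i\<in>{0..<Suc n}. q i - w * (if Suc i = Suc n then t else q (Suc i)))" for q :: "nat \<Rightarrow> complex"
  have T: "T \<in> CC {0..<Suc n} \<rightarrow>\<^sub>M CC {0..<Suc n}" unfolding T_def
  proof (rule measurable_restrict)
    fix i assume i: "i \<in> {0..<Suc n}"
    have mi[measurable]: "(\<lambda>q. q i) \<in> borel_measurable (CC {0..<Suc n})"
      using measurable_component_singleton[OF i, of "\<lambda>_. lborel :: complex measure"] by simp
    have [measurable]: "(\<lambda>q. q (Suc i)) \<in> borel_measurable (CC {0..<Suc n})" if "i \<noteq> n"
      using measurable_component_singleton[of "Suc i" "{0..<Suc n}" "\<lambda>_. lborel :: complex measure"] i that by simp
    show "(\<lambda>q. q i - w * (if Suc i = Suc n then t else q (Suc i))) \<in> CC {0..<Suc n} \<rightarrow>\<^sub>M lborel"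
    proof (cases "i = n")
      case True
      then show ?thesis using mi by (simp add: borel_measurable_diff)
    qed auto
  qed
  have "(\<integral>\<^sup>+q. F (T q) \<partial>CC {0..<Suc n}) = (\<integral>\<^sup>+c. \<integral>\<^sup>+q. F (T (q(n := c))) \<partial>CC {0..<n} \<partial>lborel)"
    using measurable_compose[OF T F] unfolding ins by (subst product_nn_integral_insert_rev) auto
  also have "\<dots> = (\<integral>\<^sup>+c. k (c - w * t) \<partial>lborel)"
  proof (rule nn_integral_cong)
    fix c
    have e: "T (q(n := c)) = (\<lambda>i\<in>{0..<n}. q i - w * (if Suc i = n then c else q (Suc i)))(n := c - w * t)" for q
      by (auto simp: T_def fun_eq_iff)
    show "(\<integral>\<^sup>+q. F (T (q(n := c))) \<partial>CC {0..<n}) = k (c - w * t)"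
      unfolding e k_def by (rule Suc.IH[OF F3])
  qed
  also have "\<dots> = (\<integral>\<^sup>+c. k c \<partial>lborel)"
    using nn_integral_lborel_translate[OF k, of "- w * t"] by simp
  also have "\<dots> = (\<integral>\<^sup>+q. F q \<partial>CC {0..<Suc n})"
    using F unfolding k_def ins by (subst product_nn_integral_insert_rev) auto
  finally show ?case unfolding T_def .
qed

text \<open>Splits off the constant coefficient by an index shift and places its integral innermost,
  since it is the coefficient that a root traverses when the others are held fixed.\<close>

lemma nn_integral_mpoly_pCons:
  fixes G :: "complex poly \<Rightarrow> ennreal"
  assumes G[measurable]: "G \<in> borel_measurable polyM"
  shows "(\<integral>\<^sup>+p. G (mpoly 0 (Suc n) p) \<partial>CC {0..<Suc n}) = (\<integral>\<^sup>+q. \<integral>\<^sup>+c. G (pCons c (mpoly 0 n q)) \<partial>lborel \<partial>CC {0..<n})"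
proof -
  interpret product_sigma_finite "\<lambda>_::nat. lborel :: complex measure" by standard
  interpret sn: sigma_finite_measure "CC {0..<n}" by (rule sigma_finite_PiM_lborel) simp
  have ins: "{0..<Suc n} = insert 0 {1..<Suc n}" by auto
  have bij: "bij_betw Suc {0..<n} {1..<Suc n}" by (auto simp: bij_betw_def image_Suc_atLeastLessThan)
  have inv: "inv_into {0..<n} Suc (Suc i) = i" if "i < n" for i using that by (intro inv_into_f_eq) auto
  note G' = measurable_compose[OF measurable_mpoly'[of 0 "Suc n"] G]
  have upd: "(\<lambda>p. (snd p)(0 := fst p)) \<in> borel \<Otimes>\<^sub>M CC {1..<Suc n} \<rightarrow>\<^sub>M CC {0..<Suc n}"
    unfolding ins by (rule measurable_fun_upd[where J = "{1..<Suc n}"]) auto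
  have F2: "(\<lambda>p. G (mpoly 0 (Suc n) ((snd p)(0 := fst p)))) \<in> borel_measurable (borel \<Otimes>\<^sub>M CC {1..<Suc n})"
    using measurable_compose[OF upd G'] .
  have F3: "(\<lambda>q. G (mpoly 0 (Suc n) (q(0 := c)))) \<in> borel_measurable (CC {1..<Suc n})" for c
    using measurable_compose[OF measurable_Pair1'[of c borel] F2] by simp
  have "(\<integral>\<^sup>+p. G (mpoly 0 (Suc n) p) \<partial>CC {0..<Suc n}) =
    (\<integral>\<^sup>+c. \<integral>\<^sup>+q. G (mpoly 0 (Suc n) (q(0 := c))) \<partial>CC {1..<Suc n} \<partial>lborel)"
    using G' unfolding ins by (subst product_nn_integral_insert_rev) auto
  also have "\<dots> = (\<integral>\<^sup>+c. \<integral>\<^sup>+q. G (pCons c (mpoly 0 n q)) \<partial>CC {0..<n} \<partial>lborel)"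
  proof (rule nn_integral_cong)
    fix c
    have "(\<integral>\<^sup>+q. G (mpoly 0 (Suc n) (q(0 := c))) \<partial>CC {1..<Suc n}) =
      (\<integral>\<^sup>+q. G (mpoly 0 (Suc n) ((\<lambda>j\<in>{1..<Suc n}. q (inv_into {0..<n} Suc j))(0 := c))) \<partial>CC {0..<n})"
      by (rule nn_integral_PiM_reindex[OF sigma_finite_lborel _ bij F3]) simp
    also have "\<dots> = (\<integral>\<^sup>+q. G (pCons c (mpoly 0 n q)) \<partial>CC {0..<n})"
      by (intro nn_integral_cong arg_cong[where f = G] poly_eqI)
        (auto simp: coeff_mpoly coeff_pCons inv split: nat.split)
    finally show "(\<integral>\<^sup>+q. G (mpoly 0 (Suc n) (q(0 := c))) \<partial>CC {1..<Suc n}) =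
      (\<integral>\<^sup>+q. G (pCons c (mpoly 0 n q)) \<partial>CC {0..<n})" .
  qed
  also have "\<dots> = (\<integral>\<^sup>+q. \<integral>\<^sup>+c. G (pCons c (mpoly 0 n q)) \<partial>lborel \<partial>CC {0..<n})"
    by (intro nn_integral_swap sigma_finite_lborel sn.sigma_finite_measure_axioms) measurable
  finally show ?thesis .
qed

section \<open>Roots, coefficients and the Vandermonde factor\<close>

definition rootpoly :: "nat \<Rightarrow> (nat \<Rightarrow> complex) \<Rightarrow> complex poly" where
  "rootpoly n z = (\<Prod>j\<in>{1..n}. [:- z j, 1:])"

text \<open>The squared modulus of the Vandermonde determinant: the real Jacobian of the holomorphic
  map from roots to coefficients.\<close>

definition vandermonde :: "nat \<Rightarrow> (nat \<Rightarrow> complex) \<Rightarrow> real" where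
  "vandermonde n z = (\<Prod>k = 1..n. \<Prod>j = 1..<k. (cmod (z j - z k))\<^sup>2)"

lemma measurable_CC_component: "j \<in> I \<Longrightarrow> (\<lambda>z. z j) \<in> borel_measurable (CC I)"
  using measurable_component_singleton[of j I "\<lambda>_. lborel :: complex measure"] by simp

lemma measurable_rootpoly [measurable]: "rootpoly n \<in> CC {1..n} \<rightarrow>\<^sub>M polyM"
  unfolding rootpoly_def
proof (rule measurable_poly_prod)
  fix i assume i: "i \<in> {1..n}"
  note [measurable] = measurable_CC_component[OF i]
  show "(\<lambda>x. [:- x i, 1:]) \<in> CC {1..n} \<rightarrow>\<^sub>M polyM"
    by measurable
qed

lemma measurable_vandermonde [measurable]: "vandermonde n \<in> borel_measurable (CC {1..n})"
  unfolding vandermonde_def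
proof (intro borel_measurable_prod)
  fix i j assume "i \<in> {1..n}" "j \<in> {1..<i}"
  then have [measurable]: "(\<lambda>z. z i) \<in> borel_measurable (CC {1..n})" "(\<lambda>z. z j) \<in> borel_measurable (CC {1..n})"
    by (auto intro!: measurable_CC_component)
  show "(\<lambda>x. (cmod (x j - x i))\<^sup>2) \<in> borel_measurable (CC {1..n})" by measurable
qed

lemma vandermonde_nonneg: "vandermonde n z \<ge> 0"
  unfolding vandermonde_def by (intro prod_nonneg) simp

lemma rootpoly_monic: "degree (rootpoly n z) = n" "lead_coeff (rootpoly n z) = 1" "rootpoly n z \<noteq> 0"
proof -
  have l: "lead_coeff (rootpoly n z) = 1" unfolding rootpoly_def by (simp add: lead_coeff_prod)
  then show "lead_coeff (rootpoly n z) = 1" "rootpoly n z \<noteq> 0" by auto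
  show "degree (rootpoly n z) = n" unfolding rootpoly_def by (subst degree_prod_eq_sum_degree) auto
qed

lemma rootpoly_vandermonde_Suc:
  "rootpoly (Suc n) (z(Suc n := w)) = [:- w, 1:] * rootpoly n z"
  "vandermonde (Suc n) (z(Suc n := w)) = vandermonde n z * (cmod (poly (rootpoly n z) w))\<^sup>2"
proof -
  have "(\<Prod>j = 1..n. [:- (z(Suc n := w)) j, 1:]) = (\<Prod>j = 1..n. [:- z j, 1:])"
    by (intro prod.cong) auto
  then show "rootpoly (Suc n) (z(Suc n := w)) = [:- w, 1:] * rootpoly n z"
    by (simp add: rootpoly_def mult.commute del: fun_upd_apply mult_pCons_left mult_pCons_right) simp
  have "(\<Prod>k = 1..n. \<Prod>j = 1..<k. (cmod ((z(Suc n := w)) j - (z(Suc n := w)) k))\<^sup>2) = vandermonde n z"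
    unfolding vandermonde_def by (intro prod.cong) auto
  moreover have "(\<Prod>j = 1..<Suc n. (cmod ((z(Suc n := w)) j - w))\<^sup>2) = (cmod (poly (rootpoly n z) w))\<^sup>2"
    by (auto simp: rootpoly_def poly_prod prod_norm[symmetric] prod_power_distrib atLeastLessThanSuc_atLeastAtMost
      norm_minus_commute intro!: prod.cong)
  ultimately show "vandermonde (Suc n) (z(Suc n := w)) = vandermonde n z * (cmod (poly (rootpoly n z) w))\<^sup>2"
    by (simp add: vandermonde_def)
qed

text \<open>The polynomial is written both as \<open>(z - w) * Q\<close>, with \<open>w\<close> the
  last root, and as \<open>z P\<close> plus a constant. For fixed \<open>w\<close> the passage from
  \<open>Q\<close> to \<open>P\<close> is unitriangular, the constant is \<open>- w P(w)\<close>,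
  and \<open>Q(w)\<close>, whose squared modulus is the new Vandermonde factor, is the derivative of
  \<open>z P\<close> at \<open>w\<close>. For fixed \<open>P\<close> the integral over
  \<open>w\<close> is then the fibre formula for \<open>z P\<close>, whose degree
  \<open>Suc n\<close> extends the factorial.\<close>

theorem nn_integral_roots_coefficients:
  fixes G :: "complex poly \<Rightarrow> ennreal"
  assumes "G \<in> borel_measurable polyM"
  shows "(\<integral>\<^sup>+z. ennreal (vandermonde n z) * G (rootpoly n z) \<partial>CC {1..n}) =
    ennreal (fact n) * (\<integral>\<^sup>+p. G (mpoly 0 n p) \<partial>CC {0..<n})"
  using assms
proof (induction n arbitrary: G)
  case 0
  have "(\<integral>\<^sup>+b. f b \<partial>CC {}) = f (\<lambda>_. undefined)" for f
    by (simp add: nn_integral_count_space_finite PiM_empty)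
  then show ?case by (simp add: vandermonde_def rootpoly_def mpoly_def)
next
  case (Suc n)
  interpret product_sigma_finite "\<lambda>_::nat. lborel :: complex measure" by standard
  interpret sn: sigma_finite_measure "CC {0..<n}" by (rule sigma_finite_PiM_lborel) simp
  note G[measurable] = Suc.prems
  have ins: "{1..Suc n} = insert (Suc n) {1..n}" by auto
  have m: "(\<lambda>z. ennreal (vandermonde (Suc n) z) * G (rootpoly (Suc n) z)) \<in> borel_measurable (CC (insert (Suc n) {1..n}))"
    unfolding ins[symmetric] by measurable
  \<comment> \<open>The integrand in the variables \<open>w\<close> and \<open>P\<close>;
    \<open>pCons 0 P\<close> is \<open>z P\<close>.\<close>
  define h where "h w P = ennreal ((cmod (poly (pderiv (pCons 0 P)) w))\<^sup>2) * G (pCons (- poly (pCons 0 P) w) P)" for w P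
  have hm[measurable (raw)]: "(\<lambda>\<omega>. h (f \<omega>) (g \<omega>)) \<in> borel_measurable N"
    if [measurable]: "f \<in> borel_measurable N" "g \<in> N \<rightarrow>\<^sub>M polyM" for f g N
    unfolding h_def by measurable
  have "(\<integral>\<^sup>+z. ennreal (vandermonde (Suc n) z) * G (rootpoly (Suc n) z) \<partial>CC {1..Suc n}) =
    (\<integral>\<^sup>+w. \<integral>\<^sup>+z. ennreal (vandermonde n z) * (ennreal ((cmod (poly (rootpoly n z) w))\<^sup>2) * G ([:- w, 1:] * rootpoly n z)) \<partial>CC {1..n} \<partial>lborel)"
    unfolding ins by (subst product_nn_integral_insert_rev[OF _ _ m])
      (simp_all add: rootpoly_vandermonde_Suc ennreal_mult vandermonde_nonneg mult.assoc del: mult_pCons_left)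
  also have "\<dots> = (\<integral>\<^sup>+w. ennreal (fact n) * (\<integral>\<^sup>+q. ennreal ((cmod (poly (mpoly 0 n q) w))\<^sup>2) * G ([:- w, 1:] * mpoly 0 n q) \<partial>CC {0..<n}) \<partial>lborel)"
    by (intro nn_integral_cong Suc.IH) measurable
  also have "\<dots> = (\<integral>\<^sup>+w. ennreal (fact n) * (\<integral>\<^sup>+q. h w (mpoly 0 n q) \<partial>CC {0..<n}) \<partial>lborel)"
  proof (rule nn_integral_cong, rule arg_cong2[where f = "(*)"], rule refl)
    fix w :: complex
    \<comment> \<open>Coefficient \<open>i\<close> of \<open>P\<close> is coefficient
      \<open>Suc i\<close> of \<open>(z - w) * Q\<close>; the value 1 at the end is the leading
      coefficient of \<open>Q\<close>.\<close>
    define T where "T q = (\<lambda>i\<in>{0..<n}. q i - w * (if Suc i = n then 1 else q (Suc i)))" for q :: "nat \<Rightarrow> complex"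
    have "ennreal ((cmod (poly (mpoly 0 n q) w))\<^sup>2) * G ([:- w, 1:] * mpoly 0 n q) = h w (mpoly 0 n (T q))" for q
    proof -
      let ?Q = "mpoly 0 n q" and ?P = "mpoly 0 n (T q)"
      let ?p = "[:- w, 1:] * ?Q"
      have c: "coeff ?p (Suc i) = coeff ?P i" for i
        by (cases "i < n"; cases "i = n") (auto simp: coeff_mpoly T_def)
      have e: "?p = pCons (coeff ?p 0) ?P"
      proof (rule poly_eqI)
        fix i show "coeff ?p i = coeff (pCons (coeff ?p 0) ?P) i"
          using c by (cases i) (simp_all del: mult_pCons_left)
      qed
      have "poly ?p w = 0" by simp
      then have "coeff ?p 0 = - poly (pCons 0 ?P) w"
        by (subst (asm) e) (simp add: add_eq_0_iff del: mult_pCons_left)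
      then have e2: "?p = pCons (- poly (pCons 0 ?P) w) ?P" using e by simp
      have "poly ?Q w = poly (pderiv ?p) w" by (simp add: pderiv_mult pderiv_pCons del: mult_pCons_left)
      also have "\<dots> = poly (pderiv (pCons 0 ?P)) w"
        by (subst e2) (simp add: pderiv_pCons)
      finally show ?thesis unfolding h_def using e2 by (simp del: mult_pCons_left)
    qed
    then have "(\<integral>\<^sup>+q. ennreal ((cmod (poly (mpoly 0 n q) w))\<^sup>2) * G ([:- w, 1:] * mpoly 0 n q) \<partial>CC {0..<n}) =
      (\<integral>\<^sup>+q. h w (mpoly 0 n (T q)) \<partial>CC {0..<n})" by simp
    also have "\<dots> = (\<integral>\<^sup>+q. h w (mpoly 0 n q) \<partial>CC {0..<n})"
      unfolding T_def by (rule nn_integral_unitriangular) measurable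
    finally show "(\<integral>\<^sup>+q. ennreal ((cmod (poly (mpoly 0 n q) w))\<^sup>2) * G ([:- w, 1:] * mpoly 0 n q) \<partial>CC {0..<n}) =
      (\<integral>\<^sup>+q. h w (mpoly 0 n q) \<partial>CC {0..<n})" .
  qed
  also have "\<dots> = ennreal (fact n) * (\<integral>\<^sup>+w. \<integral>\<^sup>+q. h w (mpoly 0 n q) \<partial>CC {0..<n} \<partial>lborel)"
    by (rule nn_integral_cmult) measurable
  also have "(\<integral>\<^sup>+w. \<integral>\<^sup>+q. h w (mpoly 0 n q) \<partial>CC {0..<n} \<partial>lborel) = (\<integral>\<^sup>+q. \<integral>\<^sup>+w. h w (mpoly 0 n q) \<partial>lborel \<partial>CC {0..<n})"
    by (intro nn_integral_swap sigma_finite_lborel sn.sigma_finite_measure_axioms) measurable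
  also have "\<dots> = (\<integral>\<^sup>+q. of_nat (Suc n) * (\<integral>\<^sup>+c. G (pCons (- c) (mpoly 0 n q)) \<partial>lborel) \<partial>CC {0..<n})"
  proof (rule nn_integral_cong)
    fix q :: "nat \<Rightarrow> complex"
    have d: "degree (pCons 0 (mpoly 0 n q)) = Suc n" by simp
    show "(\<integral>\<^sup>+w. h w (mpoly 0 n q) \<partial>lborel) = of_nat (Suc n) * (\<integral>\<^sup>+c. G (pCons (- c) (mpoly 0 n q)) \<partial>lborel)"
      unfolding h_def d[symmetric] by (rule nn_integral_poly_fibres) (simp, measurable)
  qed
  also have "\<dots> = of_nat (Suc n) * (\<integral>\<^sup>+q. \<integral>\<^sup>+c. G (pCons (- c) (mpoly 0 n q)) \<partial>lborel \<partial>CC {0..<n})"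
    by (rule nn_integral_cmult) measurable
  also have "(\<integral>\<^sup>+q. \<integral>\<^sup>+c. G (pCons (- c) (mpoly 0 n q)) \<partial>lborel \<partial>CC {0..<n}) =
    (\<integral>\<^sup>+q. \<integral>\<^sup>+c. G (pCons c (mpoly 0 n q)) \<partial>lborel \<partial>CC {0..<n})"
  proof (rule nn_integral_cong)
    fix q :: "nat \<Rightarrow> complex"
    have "(\<integral>\<^sup>+c. G (pCons c (mpoly 0 n q)) \<partial>lborel) = (\<integral>\<^sup>+c. G (pCons c (mpoly 0 n q)) \<partial>distr lborel borel uminus)"
      using lborel_affine[of "-1" "0 :: complex"] by (simp add: density_1)
    also have "\<dots> = (\<integral>\<^sup>+c. G (pCons (- c) (mpoly 0 n q)) \<partial>lborel)"
      by (subst nn_integral_distr) auto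
    finally show "(\<integral>\<^sup>+c. G (pCons (- c) (mpoly 0 n q)) \<partial>lborel) = (\<integral>\<^sup>+c. G (pCons c (mpoly 0 n q)) \<partial>lborel)" ..
  qed
  also have "\<dots> = (\<integral>\<^sup>+p. G (mpoly 0 (Suc n) p) \<partial>CC {0..<Suc n})"
    by (rule nn_integral_mpoly_pCons[symmetric]) measurable
  finally have "(\<integral>\<^sup>+z. ennreal (vandermonde (Suc n) z) * G (rootpoly (Suc n) z) \<partial>CC {1..Suc n}) =
    ennreal (fact n) * (of_nat (Suc n) * (\<integral>\<^sup>+p. G (mpoly 0 (Suc n) p) \<partial>CC {0..<Suc n}))" .
  moreover have "ennreal (fact (Suc n)) = ennreal (fact n) * of_nat (Suc n)"
  proof -
    have "(fact (Suc n) :: real) = fact n * real (Suc n)" by simp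
    then show ?thesis by (simp only: ennreal_mult fact_ge_zero of_nat_0_le_iff ennreal_of_nat_eq_real_of_nat)
  qed
  ultimately show ?case by (simp only: mult.assoc)
qed

section \<open>Uniformly ordered roots\<close>

text \<open>The existential over \<open>K\<close> is uncountable. On the intersection with a ball,
  compactness turns the existence of a zero into a vanishing infimum, and continuity lets a
  countable dense set detect that infimum; balls with integer radii then exhaust
  \<open>K\<close>.\<close>

lemma measurable_ex_zero:
  fixes g :: "'w \<Rightarrow> 'b::euclidean_space \<Rightarrow> complex"
  assumes m[measurable]: "\<And>z. (\<lambda>\<omega>. g \<omega> z) \<in> borel_measurable N" and c: "\<And>\<omega>. continuous_on UNIV (g \<omega>)" and K: "closed K"
  shows "Measurable.pred N (\<lambda>\<omega>. \<exists>z\<in>K. g \<omega> z = 0)"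
proof -
  have "\<exists>D. countable D \<and> D \<subseteq> K \<inter> cball 0 (real n) \<and> K \<inter> cball 0 (real n) \<subseteq> closure D" for n
    using separable[of "K \<inter> cball 0 (real n)"] by metis
  then obtain D where D: "\<And>n. countable (D n)" "\<And>n. D n \<subseteq> K \<inter> cball 0 (real n)" "\<And>n. K \<inter> cball 0 (real n) \<subseteq> closure (D n)"
    by metis
  have "(\<exists>z\<in>K. g \<omega> z = 0) \<longleftrightarrow> (\<exists>n. \<forall>k. \<exists>d\<in>D n. cmod (g \<omega> d) < 1 / real (Suc k))" for \<omega>
  proof
    assume "\<exists>z\<in>K. g \<omega> z = 0"
    then obtain z where z: "z \<in> K" "g \<omega> z = 0" by blast
    obtain n where "norm z \<le> real n" using real_arch_simple by blast
    then have zc: "z \<in> closure (D n)" using z D(3)[of n] by auto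
    have "\<exists>d\<in>D n. cmod (g \<omega> d) < 1 / real (Suc k)" for k
    proof -
      obtain e where e: "e > 0" "\<And>x. dist x z < e \<Longrightarrow> dist (g \<omega> x) (g \<omega> z) < 1 / real (Suc k)"
        using c[of \<omega>] unfolding continuous_on_iff by (metis UNIV_I of_nat_0_less_iff zero_less_Suc zero_less_divide_1_iff)
      then obtain d where "d \<in> D n" "dist d z < e" using zc unfolding closure_approachable by blast
      then show ?thesis using e(2)[of d] z by (auto simp: dist_norm)
    qed
    then show "\<exists>n. \<forall>k. \<exists>d\<in>D n. cmod (g \<omega> d) < 1 / real (Suc k)" by blast
  next
    assume "\<exists>n. \<forall>k. \<exists>d\<in>D n. cmod (g \<omega> d) < 1 / real (Suc k)"
    then obtain n where n: "\<And>k. \<exists>d\<in>D n. cmod (g \<omega> d) < 1 / real (Suc k)" by blast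
    have "compact (K \<inter> cball 0 (real n))" using K by (simp add: closed_Int_compact)
    moreover have "K \<inter> cball 0 (real n) \<noteq> {}" using n[of 0] D(2)[of n] by auto
    moreover have "continuous_on (K \<inter> cball 0 (real n)) (\<lambda>z. cmod (g \<omega> z))"
      using c[of \<omega>] by (intro continuous_on_norm) (rule continuous_on_subset, auto)
    ultimately obtain z where z: "z \<in> K \<inter> cball 0 (real n)" "\<And>y. y \<in> K \<inter> cball 0 (real n) \<Longrightarrow> cmod (g \<omega> z) \<le> cmod (g \<omega> y)"
      using continuous_attains_inf by metis
    have "g \<omega> z = 0"
    proof (rule ccontr)
      assume "g \<omega> z \<noteq> 0"
      then obtain k where "1 / real (Suc k) < cmod (g \<omega> z)"
        using nat_approx_posE[of "cmod (g \<omega> z)"] by auto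
      moreover obtain d where "d \<in> D n" "cmod (g \<omega> d) < 1 / real (Suc k)" using n by blast
      ultimately show False using z(2)[of d] D(2)[of n] by force
    qed
    then show "\<exists>z\<in>K. g \<omega> z = 0" using z by blast
  qed
  moreover have "Measurable.pred N (\<lambda>\<omega>. \<exists>n. \<forall>k. \<exists>d\<in>D n. cmod (g \<omega> d) < 1 / real (Suc k))"
  proof (intro pred_intros_countable)
    fix n k
    show "Measurable.pred N (\<lambda>\<omega>. \<exists>d\<in>D n. cmod (g \<omega> d) < 1 / real (Suc k))"
      unfolding pred_def by (rule sets.sets_Collect_countable_Ex'[OF _ D(1)]) measurable
  qed
  ultimately show ?thesis by simp
qed

text \<open>The root that is smallest in the lexicographic order: a choice that depends measurably on the
  coefficients.\<close>
definition sel_root :: "complex poly \<Rightarrow> complex" where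
  "sel_root p = (let S = {z. poly p z = 0}; s = Min (Re ` S) in Complex s (Min (Im ` {z\<in>S. Re z = s})))"

text \<open>The lexicographic choice is made so that the sublevel sets of real and imaginary part
  become statements about a zero in a closed set, the form that \<open>measurable_ex_zero\<close>
  handles.\<close>

lemma sel_root:
  assumes "degree p \<noteq> 0"
  shows "poly p (sel_root p) = 0"
    "Re (sel_root p) \<le> a \<longleftrightarrow> (\<exists>z\<in>{z. Re z \<le> a}. poly p z = 0)"
    "Im (sel_root p) \<le> a \<longleftrightarrow> (\<exists>y\<in>{..a}. poly p (Complex (Re (sel_root p)) y) = 0)"
proof -
  define S where "S = {z. poly p z = 0}"
  define s where "s = Min (Re ` S)"
  define T where "T = {z\<in>S. Re z = s}"
  have p0: "p \<noteq> 0" using assms by auto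
  have S: "finite S" "S \<noteq> {}" unfolding S_def using poly_roots_finite[OF p0]
    Fundamental_Theorem_Algebra.fundamental_theorem_of_algebra[of p] assms by (auto simp: constant_degree)
  have "s \<in> Re ` S" unfolding s_def using S by (intro Min_in) auto
  then have T: "finite T" "T \<noteq> {}" using S by (auto simp: T_def)
  have sel: "sel_root p = Complex s (Min (Im ` T))" by (simp add: sel_root_def S_def s_def T_def Let_def)
  have "Min (Im ` T) \<in> Im ` T" using T by (intro Min_in) auto
  then obtain z where "z \<in> T" "Im z = Min (Im ` T)" by auto
  then have "sel_root p = z" unfolding sel by (auto simp: T_def complex_eq_iff)
  then show "poly p (sel_root p) = 0" using \<open>z \<in> T\<close> by (auto simp: T_def S_def)
  have "Re (sel_root p) \<le> a \<longleftrightarrow> (\<exists>z\<in>S. Re z \<le> a)" unfolding sel s_def using S by (simp add: Min_le_iff)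
  then show "Re (sel_root p) \<le> a \<longleftrightarrow> (\<exists>z\<in>{z. Re z \<le> a}. poly p z = 0)" by (auto simp: S_def)
  have "Im (sel_root p) \<le> a \<longleftrightarrow> (\<exists>z\<in>T. Im z \<le> a)" unfolding sel using T by (simp add: Min_le_iff)
  also have "\<dots> \<longleftrightarrow> (\<exists>y\<in>{..a}. poly p (Complex s y) = 0)"
  proof
    assume "\<exists>z\<in>T. Im z \<le> a"
    then obtain z where "z \<in> T" "Im z \<le> a" by blast
    then show "\<exists>y\<in>{..a}. poly p (Complex s y) = 0" by (intro bexI[of _ "Im z"]) (auto simp: T_def S_def)
  next
    assume "\<exists>y\<in>{..a}. poly p (Complex s y) = 0"
    then obtain y where "y \<le> a" "poly p (Complex s y) = 0" by blast
    then show "\<exists>z\<in>T. Im z \<le> a" by (intro bexI[of _ "Complex s y"]) (auto simp: T_def S_def)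
  qed
  finally show "Im (sel_root p) \<le> a \<longleftrightarrow> (\<exists>y\<in>{..a}. poly p (Complex (Re (sel_root p)) y) = 0)"
    by (simp add: sel)
qed

lemma measurable_sel_root:
  assumes f[measurable]: "f \<in> N \<rightarrow>\<^sub>M polyM" and d: "\<And>\<omega>. degree (f \<omega>) \<noteq> 0"
  shows "(\<lambda>\<omega>. sel_root (f \<omega>)) \<in> borel_measurable N"
proof -
  have 1[measurable]: "(\<lambda>\<omega>. Re (sel_root (f \<omega>))) \<in> borel_measurable N"
  proof (subst borel_measurable_iff_le, intro allI)
    fix a
    have "Measurable.pred N (\<lambda>\<omega>. \<exists>z\<in>{z. Re z \<le> a}. poly (f \<omega>) z = 0)"
      by (rule measurable_ex_zero) (auto intro!: continuous_intros closed_halfspace_Re_le)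
    then show "{w \<in> space N. Re (sel_root (f w)) \<le> a} \<in> sets N"
      unfolding sel_root(2)[OF d] by (simp add: pred_def)
  qed
  have 2[measurable]: "(\<lambda>\<omega>. Im (sel_root (f \<omega>))) \<in> borel_measurable N"
  proof (subst borel_measurable_iff_le, intro allI)
    fix a
    have [measurable]: "(\<lambda>\<omega>. Complex (Re (sel_root (f \<omega>))) y) \<in> borel_measurable N" for y
      unfolding Complex_eq by measurable
    have "Measurable.pred N (\<lambda>\<omega>. \<exists>y\<in>{..a}. poly (f \<omega>) (Complex (Re (sel_root (f \<omega>))) y) = 0)"
      by (rule measurable_ex_zero) (auto intro!: continuous_intros simp: Complex_eq)
    then show "{w \<in> space N. Im (sel_root (f w)) \<le> a} \<in> sets N"
      unfolding sel_root(3)[OF d] by (simp add: pred_def)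
  qed
  have "(\<lambda>\<omega>. sel_root (f \<omega>)) = (\<lambda>\<omega>. of_real (Re (sel_root (f \<omega>))) + \<i> * of_real (Im (sel_root (f \<omega>))))"
    by (simp add: complex_eq[symmetric])
  then show ?thesis by (simp only:) measurable
qed

text \<open>Each coefficient of the quotient is computed from the next higher one, so the induction
  descends from the degree bound.\<close>

lemma measurable_synthetic_div:
  assumes f[measurable]: "f \<in> N \<rightarrow>\<^sub>M polyM" and g[measurable]: "g \<in> borel_measurable N" and d: "\<And>\<omega>. degree (f \<omega>) \<le> n"
  shows "(\<lambda>\<omega>. synthetic_div (f \<omega>) (g \<omega>)) \<in> N \<rightarrow>\<^sub>M polyM"
proof (rule measurable_polyM)
  fix i
  show "(\<lambda>\<omega>. coeff (synthetic_div (f \<omega>) (g \<omega>)) i) \<in> borel_measurable N"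
  proof (cases "i \<le> n")
    case True
    then show ?thesis
    proof (induction rule: inc_induct)
      case base
      have "coeff (synthetic_div (f \<omega>) (g \<omega>)) n = 0" for \<omega>
      proof (cases "degree (f \<omega>) = 0")
        case True
        then have "synthetic_div (f \<omega>) (g \<omega>) = 0" by (simp add: synthetic_div_eq_0_iff)
        then show ?thesis by simp
      next
        case False
        then show ?thesis using d[of \<omega>] by (intro coeff_eq_0) (simp add: degree_synthetic_div)
      qed
      then show ?case by simp
    next
      case (step i)
      note [measurable] = step.IH
      have "coeff (f \<omega>) (Suc i) + g \<omega> * coeff (synthetic_div (f \<omega>) (g \<omega>)) (Suc i) = coeff (synthetic_div (f \<omega>) (g \<omega>)) i" for \<omega>
        using arg_cong[OF synthetic_div_correct[of "f \<omega>" "g \<omega>"], of "\<lambda>p. coeff p (Suc i)"] by simp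
      then have "(\<lambda>\<omega>. coeff (synthetic_div (f \<omega>) (g \<omega>)) i) = (\<lambda>\<omega>. coeff (f \<omega>) (Suc i) + g \<omega> * coeff (synthetic_div (f \<omega>) (g \<omega>)) (Suc i))"
        by simp
      then show ?case by simp
    qed
  next
    case False
    then have "coeff (synthetic_div (f \<omega>) (g \<omega>)) i = 0" for \<omega>
      using d[of \<omega>] by (intro coeff_eq_0) (auto simp: degree_synthetic_div)
    then show ?thesis by simp
  qed
qed

text \<open>Positions are filled from index \<open>n\<close> downwards; each chosen root is divided
  out, so that multiplicities are respected.\<close>

fun root_fun :: "nat \<Rightarrow> complex poly \<Rightarrow> nat \<Rightarrow> complex" where
  "root_fun 0 p j = 0"
| "root_fun (Suc n) p j = (if j = Suc n then sel_root p else root_fun n (synthetic_div p (sel_root p)) j)"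

lemma rootpoly_Suc: "rootpoly (Suc n) z = [:- z (Suc n), 1:] * rootpoly n z"
  by (simp add: rootpoly_def mult.commute del: mult_pCons_left mult_pCons_right)

lemma rootpoly_cong: "(\<And>j. 1 \<le> j \<Longrightarrow> j \<le> n \<Longrightarrow> z j = z' j) \<Longrightarrow> rootpoly n z = rootpoly n z'"
  unfolding rootpoly_def by (intro prod.cong) auto

lemma synthetic_div_monic:
  fixes p :: "complex poly"
  assumes "poly p r = 0" "degree p = Suc n" "lead_coeff p = 1"
  shows "p = [:- r, 1:] * synthetic_div p r" "degree (synthetic_div p r) = n" "lead_coeff (synthetic_div p r) = 1"
proof -
  show e: "p = [:- r, 1:] * synthetic_div p r" using synthetic_div_correct'[of r p] assms(1) by simp
  show "degree (synthetic_div p r) = n" using assms by (simp add: degree_synthetic_div)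
  have "lead_coeff ([:- r, 1:] * synthetic_div p r) = lead_coeff (synthetic_div p r)"
    by (simp only: lead_coeff_mult) simp
  then show "lead_coeff (synthetic_div p r) = 1" using e assms by metis
qed

lemma rootpoly_root_fun:
  assumes "degree p = n" "lead_coeff p = 1"
  shows "rootpoly n (root_fun n p) = p"
  using assms
proof (induction n arbitrary: p)
  case 0
  then obtain a where "p = [:a:]" by (metis degree_eq_zeroE)
  then show ?case using 0 by (simp add: rootpoly_def one_pCons)
next
  case (Suc n)
  let ?r = "sel_root p"
  have r: "poly p ?r = 0" using sel_root(1) Suc.prems by simp
  note sd = synthetic_div_monic[OF r Suc.prems]
  have "rootpoly n (root_fun (Suc n) p) = rootpoly n (root_fun n (synthetic_div p ?r))"
    by (rule rootpoly_cong) auto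
  also have "\<dots> = synthetic_div p ?r" by (rule Suc.IH[OF sd(2,3)])
  finally have e: "rootpoly n (root_fun (Suc n) p) = synthetic_div p ?r" .
  have "root_fun (Suc n) p (Suc n) = ?r" by simp
  then show ?case using sd(1) unfolding rootpoly_Suc e by metis
qed

lemma measurable_root_fun:
  assumes "f \<in> N \<rightarrow>\<^sub>M polyM" "\<And>\<omega>. degree (f \<omega>) = n" "\<And>\<omega>. lead_coeff (f \<omega>) = 1"
  shows "(\<lambda>\<omega>. root_fun n (f \<omega>) j) \<in> borel_measurable N"
  using assms
proof (induction n arbitrary: f)
  case (Suc n)
  have s: "(\<lambda>\<omega>. sel_root (f \<omega>)) \<in> borel_measurable N"
    by (rule measurable_sel_root) (use Suc.prems in auto)
  have r: "poly (f \<omega>) (sel_root (f \<omega>)) = 0" for \<omega> using sel_root(1) Suc.prems by simp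
  note sd = synthetic_div_monic[OF r Suc.prems(2,3)]
  have "(\<lambda>\<omega>. root_fun n (synthetic_div (f \<omega>) (sel_root (f \<omega>))) j) \<in> borel_measurable N"
    by (rule Suc.IH[OF measurable_synthetic_div[OF Suc.prems(1) s, of "Suc n"]]) (use Suc.prems sd in auto)
  then show ?case using s by (cases "j = Suc n") auto
qed simp

lemma proots_rootpoly: "proots (rootpoly n z) = image_mset z (mset_set {1..n})"
proof -
  have "rootpoly n z = (\<Prod>x\<in>#image_mset z (mset_set {1..n}). [:- x, 1:])"
    unfolding rootpoly_def prod_unfold_prod_mset by (simp add: image_mset.compositionality o_def)
  then show ?thesis by (simp only: proots_prod_mset_linear)
qed

text \<open>Listing \<open>z\<close> along a permutation maps the permutations onto the arrangements
  of the multiset. With repeated values this map is not injective, but all its fibres have the same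
  size: composing with a permutation that realises a given arrangement carries the fibre over the
  original listing onto the fibre over that arrangement. The uniform law on permutations is
  therefore mapped to the uniform law on arrangements.\<close>

lemma emeasure_permutations_of_multiset:
  fixes z :: "nat \<Rightarrow> complex" and n :: nat
  defines "E \<equiv> image_mset z (mset_set {1..n})"
  shows "emeasure (measure_pmf (pmf_of_set (permutations_of_multiset E))) {zs. (\<lambda>j\<in>{1..n}. zs ! (j - 1)) \<in> A} =
    (\<Sum>\<sigma> | \<sigma> permutes {1..n}. indicator A (\<lambda>j\<in>{1..n}. z (\<sigma> j))) / ennreal (fact n)"
proof -
  define P where "P = {\<sigma>. \<sigma> permutes {1..n}}"
  define U where "U = [1..<Suc n]"
  have mU: "mset U = mset_set {1..n}"
    unfolding U_def mset_upt by (simp only: atLeastLessThanSuc_atLeastAtMost)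
  have lU: "length U = n" and nU: "i < n \<Longrightarrow> U ! i = Suc i" for i unfolding U_def by (auto simp del: upt_Suc)
  have sU: "set U = {1..n}" unfolding U_def by auto
  define L where "L \<sigma> = map (\<lambda>j. z (\<sigma> j)) U" for \<sigma> :: "nat \<Rightarrow> nat"
  define S where "S = permutations_of_multiset E"
  have P: "finite P" "P \<noteq> {}" "card P = fact n" unfolding P_def
    by (auto simp: finite_permutations card_permutations intro: permutes_id)
  have S: "finite S" "S \<noteq> {}" unfolding S_def by auto
  have mL: "mset (L \<sigma>) = image_mset (\<lambda>j. z (\<sigma> j)) (mset_set {1..n})" for \<sigma>
    unfolding L_def by (simp only: mset_map mU)
  have LS: "L \<sigma> \<in> S" if "\<sigma> \<in> P" for \<sigma>
  proof -
    have "image_mset \<sigma> (mset_set {1..n}) = mset_set {1..n}" using that unfolding P_def by (simp add: permutes_image_mset)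
    then have "image_mset (\<lambda>j. z (\<sigma> j)) (mset_set {1..n}) = E"
      unfolding E_def using image_mset.compositionality[of z \<sigma> "mset_set {1..n}"] by (simp add: o_def)
    then show ?thesis unfolding S_def permutations_of_multiset_def using mL by simp
  qed
  define c where "c = card {\<sigma>\<in>P. L \<sigma> = L id}"
  have fibre: "card {\<sigma>\<in>P. L \<sigma> = ys} = c" if ys: "ys \<in> S" for ys
  proof -
    have my: "mset ys = E" using ys by (simp add: S_def permutations_of_multiset_def)
    then have ly: "length ys = n" by (metis E_def size_mset size_image_mset size_mset_set card_atLeastAtMost diff_Suc_1)
    have "map (\<lambda>j. ys ! (j - 1)) U = ys" using ly by (intro nth_equalityI) (auto simp: lU nU)
    then have "mset (map (\<lambda>j. ys ! (j - 1)) U) = E" using my by simp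
    then have ie: "image_mset (\<lambda>j. ys ! (j - 1)) (mset_set {1..n}) = image_mset z (mset_set {1..n})"
      unfolding E_def by (simp only: mset_map mU)
    then obtain \<tau> where \<tau>: "\<tau> permutes {1..n}" "\<And>j. j \<in> {1..n} \<Longrightarrow> ys ! (j - 1) = z (\<tau> j)"
      using image_mset_eq_implies_permutes[OF _ ie] by (metis finite_atLeastAtMost)
    have yL: "L \<tau> = ys" using ly \<tau>(2) unfolding L_def by (intro nth_equalityI) (auto simp: lU nU \<tau>(2)[symmetric])
    have eqL: "L \<sigma> = L \<sigma>' \<longleftrightarrow> (\<forall>j\<in>{1..n}. z (\<sigma> j) = z (\<sigma>' j))" for \<sigma> \<sigma>' unfolding L_def by (auto simp: sU)
    have "bij_betw (\<lambda>\<sigma>. \<sigma> \<circ> \<tau>) {\<sigma>\<in>P. L \<sigma> = L id} {\<sigma>\<in>P. L \<sigma> = ys}"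
    proof (rule bij_betwI[where g = "\<lambda>\<sigma>. \<sigma> \<circ> Hilbert_Choice.inv \<tau>"])
      let ?i = "Hilbert_Choice.inv \<tau>"
      have ti: "?i permutes {1..n}" using \<tau>(1) by (rule permutes_inv)
      show "(\<lambda>\<sigma>. \<sigma> \<circ> \<tau>) \<in> {\<sigma>\<in>P. L \<sigma> = L id} \<rightarrow> {\<sigma>\<in>P. L \<sigma> = ys}"
      proof
        fix \<sigma> assume s: "\<sigma> \<in> {\<sigma>\<in>P. L \<sigma> = L id}"
        then have "L (\<sigma> \<circ> \<tau>) = L \<tau>" using permutes_in_image[OF \<tau>(1)] unfolding eqL by simp
        then show "\<sigma> \<circ> \<tau> \<in> {\<sigma>\<in>P. L \<sigma> = ys}" using s \<tau>(1) yL by (simp add: P_def permutes_compose)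
      qed
      show "(\<lambda>\<sigma>. \<sigma> \<circ> ?i) \<in> {\<sigma>\<in>P. L \<sigma> = ys} \<rightarrow> {\<sigma>\<in>P. L \<sigma> = L id}"
      proof
        fix \<sigma> assume s: "\<sigma> \<in> {\<sigma>\<in>P. L \<sigma> = ys}"
        then have "L \<sigma> = L \<tau>" using yL by simp
        then have "L (\<sigma> \<circ> ?i) = L id"
          using permutes_in_image[OF ti] permutes_inverses(1)[OF \<tau>(1)] unfolding eqL by simp
        then show "\<sigma> \<circ> ?i \<in> {\<sigma>\<in>P. L \<sigma> = L id}" using s ti by (simp add: P_def permutes_compose)
      qed
      show "(\<sigma> \<circ> \<tau>) \<circ> ?i = \<sigma>" "(\<sigma> \<circ> ?i) \<circ> \<tau> = \<sigma>" for \<sigma>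
        by (simp_all only: comp_assoc permutes_inv_o[OF \<tau>(1)] comp_id)
    qed
    then have "card {\<sigma>\<in>P. L \<sigma> = L id} = card {\<sigma>\<in>P. L \<sigma> = ys}" by (rule bij_betw_same_card)
    then show ?thesis by (simp add: c_def)
  qed
  have fibres: "card {\<sigma>\<in>P. L \<sigma> \<in> B} = card (S \<inter> B) * c" for B
  proof -
    have "{\<sigma>\<in>P. L \<sigma> \<in> B} = (\<Union>ys\<in>S \<inter> B. {\<sigma>\<in>P. L \<sigma> = ys})" using LS by auto
    moreover have "card (\<Union>ys\<in>S \<inter> B. {\<sigma>\<in>P. L \<sigma> = ys}) = (\<Sum>ys\<in>S \<inter> B. card {\<sigma>\<in>P. L \<sigma> = ys})"
      using P S by (intro card_UN_disjoint) auto
    ultimately show ?thesis using fibre by simp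
  qed
  have cardP: "card P = card S * c" using fibres[of UNIV] by simp
  define B where "B = {zs. (\<lambda>j\<in>{1..n}. zs ! (j - 1)) \<in> A}"
  have LB: "L \<sigma> \<in> B \<longleftrightarrow> (\<lambda>j\<in>{1..n}. z (\<sigma> j)) \<in> A" for \<sigma>
  proof -
    have "(\<lambda>j\<in>{1..n}. L \<sigma> ! (j - 1)) = (\<lambda>j\<in>{1..n}. z (\<sigma> j))"
      by (intro restrict_ext) (auto simp: L_def lU nU)
    then show ?thesis by (simp add: B_def)
  qed
  have c0: "c \<noteq> 0" using cardP P by (metis card_0_eq mult_0_right)
  have "emeasure (measure_pmf (pmf_of_set S)) B = ennreal (real (card (S \<inter> B)) / real (card S))"
    using S by (simp add: emeasure_pmf_of_set measure_pmf.emeasure_eq_measure measure_pmf_of_set)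
  also have "real (card (S \<inter> B)) / real (card S) = real (card {\<sigma>\<in>P. L \<sigma> \<in> B}) / fact n"
  proof -
    have "(fact n :: real) = real (card S) * real c" using cardP P(3) by (metis of_nat_fact of_nat_mult)
    then show ?thesis using c0 fibres[of B] by simp
  qed
  also have "real (card {\<sigma>\<in>P. L \<sigma> \<in> B}) = (\<Sum>\<sigma>\<in>P. indicator A (\<lambda>j\<in>{1..n}. z (\<sigma> j)))"
    unfolding LB using P by (simp add: indicator_def sum.If_cases Int_def)
  also have "ennreal ((\<Sum>\<sigma>\<in>P. indicator A (\<lambda>j\<in>{1..n}. z (\<sigma> j))) / fact n) =
    (\<Sum>\<sigma>\<in>P. indicator A (\<lambda>j\<in>{1..n}. z (\<sigma> j))) / ennreal (fact n)"
    by (subst divide_ennreal[symmetric]) (auto intro!: sum_nonneg simp: sum_ennreal[symmetric] ennreal_indicator)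
  finally show ?thesis unfolding S_def P_def B_def .
qed

text \<open>Extends the choice of roots to all polynomials, whatever their degree and leading
  coefficient, without changing it on monic ones of degree \<open>n\<close>.\<close>

definition make_monic :: "nat \<Rightarrow> complex poly \<Rightarrow> complex poly" where
  "make_monic n p = mpoly 0 n (coeff p)"

lemma make_monic_id: "degree p = n \<Longrightarrow> lead_coeff p = 1 \<Longrightarrow> make_monic n p = p"
  unfolding make_monic_def by (intro poly_eqI) (auto simp: coeff_mpoly coeff_eq_0)

lemma measurable_make_monic [measurable]: "make_monic n \<in> polyM \<rightarrow>\<^sub>M polyM"
  unfolding make_monic_def by (rule measurable_polyM) (simp add: coeff_mpoly)

lemma measurable_root_fun_monic [measurable]: "(\<lambda>p. root_fun n (make_monic n p) j) \<in> borel_measurable polyM"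
  by (rule measurable_root_fun) (auto simp: make_monic_def coeff_mpoly measurable_make_monic[unfolded make_monic_def])

definition root_vec :: "nat \<Rightarrow> complex poly \<Rightarrow> nat \<Rightarrow> complex" where
  "root_vec n p = (\<lambda>j\<in>{1..n}. root_fun n (make_monic n p) j)"

lemma measurable_root_vec [measurable]: "root_vec n \<in> polyM \<rightarrow>\<^sub>M CC {1..n}"
  unfolding root_vec_def by measurable

lemma rootpoly_root_vec: "degree p = n \<Longrightarrow> lead_coeff p = 1 \<Longrightarrow> rootpoly n (root_vec n p) = p"
  using rootpoly_root_fun[of p n] rootpoly_cong[of n "root_vec n p" "root_fun n p"]
  by (simp add: root_vec_def make_monic_id)

text \<open>The measure of a Borel set under a uniformly random ordering of the roots is itself a Borel
  function of the coefficients, so the two hypotheses determine the law of the randomly ordered roots.\<close>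
lemma random_order_lawI:
  assumes sets: "sets \<mu> = sets (\<Pi>\<^sub>M j\<in>{1..n}. borel)"
    and p: "\<And>\<omega>. degree (p \<omega>) = n" "\<And>\<omega>. lead_coeff (p \<omega>) = 1"
    and E: "AE \<omega> in M. E \<omega> = proots (p \<omega>)"
    and law: "\<And>G. G \<in> borel_measurable polyM \<Longrightarrow> (\<integral>\<^sup>+\<omega>. G (p \<omega>) \<partial>M) = (\<integral>\<^sup>+z. G (rootpoly n z) \<partial>\<mu>)"
    and exch: "\<And>\<sigma> A. \<sigma> permutes {1..n} \<Longrightarrow> A \<in> sets (\<Pi>\<^sub>M j\<in>{1..n}. borel) \<Longrightarrow>
      (\<integral>\<^sup>+z. indicator A (\<lambda>j\<in>{1..n}. z (\<sigma> j)) \<partial>\<mu>) = emeasure \<mu> A"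
  shows "random_order_law M E n \<mu>"
  unfolding random_order_law_def
proof (intro conjI ballI)
  show "sets \<mu> = sets (\<Pi>\<^sub>M j\<in>{1..n}. borel)" by (rule sets)
  have "size (proots (p \<omega>)) = n" for \<omega> using p by (simp add: size_proots_complex)
  then show "AE \<omega> in M. size (E \<omega>) = n" using E by (auto elim!: eventually_mono)
  fix A :: "(nat \<Rightarrow> complex) set" assume A[measurable]: "A \<in> sets (\<Pi>\<^sub>M j\<in>{1..n}. borel)"
  define Q where "Q E = emeasure (measure_pmf (pmf_of_set (permutations_of_multiset E))) {zs. (\<lambda>j\<in>{1..n}. zs ! (j - 1)) \<in> A}" for E
  define S where "S z = (\<Sum>\<sigma> | \<sigma> permutes {1..n}. indicator A (\<lambda>j\<in>{1..n}. z (\<sigma> j))) / ennreal (fact n)" for z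
  have QS: "Q (proots (rootpoly n z)) = S z" for z
    unfolding Q_def S_def proots_rootpoly by (rule emeasure_permutations_of_multiset)
  have perm: "(\<lambda>z. \<lambda>j\<in>{1..n}. z (\<sigma> j)) \<in> (\<Pi>\<^sub>M j\<in>{1..n}. borel) \<rightarrow>\<^sub>M (\<Pi>\<^sub>M j\<in>{1..n}. borel :: complex measure)"
    if "\<sigma> permutes {1..n}" for \<sigma>
    by (intro measurable_restrict measurable_component_singleton) (use permutes_in_image[OF that] in blast)
  have ind[measurable]: "(\<lambda>z. indicator A (\<lambda>j\<in>{1..n}. z (\<sigma> j)) :: ennreal) \<in> borel_measurable (\<Pi>\<^sub>M j\<in>{1..n}. borel)"
    if "\<sigma> permutes {1..n}" for \<sigma>
    using measurable_compose[OF perm[OF that] borel_measurable_indicator[OF A]] .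
  have S[measurable]: "S \<in> borel_measurable (\<Pi>\<^sub>M j\<in>{1..n}. borel)"
    unfolding S_def by (intro borel_measurable_divide_ennreal borel_measurable_sum measurable_const ind)
      (simp_all only: mem_Collect_eq space_borel UNIV_I)
  define G where "G p = S (root_vec n p)" for p
  have rv: "root_vec n \<in> polyM \<rightarrow>\<^sub>M (\<Pi>\<^sub>M j\<in>{1..n}. borel)"
    using measurable_root_vec[of n] by (simp cong: measurable_cong_sets sets_PiM_cong)
  have G: "G \<in> borel_measurable polyM" unfolding G_def using measurable_compose[OF rv S] .
  have QG: "Q (proots q) = G q" if "degree q = n" "lead_coeff q = 1" for q
    using QS[of "root_vec n q"] rootpoly_root_vec[OF that] by (simp add: G_def)
  have "(\<integral>\<^sup>+\<omega>. Q (E \<omega>) \<partial>M) = (\<integral>\<^sup>+\<omega>. G (p \<omega>) \<partial>M)"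
    using E by (intro nn_integral_cong_AE) (auto elim!: eventually_mono simp: QG[OF p])
  also have "\<dots> = (\<integral>\<^sup>+z. G (rootpoly n z) \<partial>\<mu>)" by (rule law[OF G])
  also have "\<dots> = (\<integral>\<^sup>+z. S z \<partial>\<mu>)"
    using QG[OF rootpoly_monic(1,2)] QS by (intro nn_integral_cong) simp
  also have "\<dots> = (\<Sum>\<sigma> | \<sigma> permutes {1..n}. \<integral>\<^sup>+z. indicator A (\<lambda>j\<in>{1..n}. z (\<sigma> j)) \<partial>\<mu>) / ennreal (fact n)"
  proof -
    have m: "(\<lambda>z. indicator A (\<lambda>j\<in>{1..n}. z (\<sigma> j)) :: ennreal) \<in> borel_measurable \<mu>" if "\<sigma> permutes {1..n}" for \<sigma>
      using ind[OF that] by (simp cong: measurable_cong_sets add: sets)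
    have "(\<integral>\<^sup>+z. S z \<partial>\<mu>) = (\<integral>\<^sup>+z. (\<Sum>\<sigma> | \<sigma> permutes {1..n}. indicator A (\<lambda>j\<in>{1..n}. z (\<sigma> j))) \<partial>\<mu>) / ennreal (fact n)"
      unfolding S_def by (intro nn_integral_divide borel_measurable_sum m) (simp only: mem_Collect_eq)
    then show ?thesis by (subst (asm) nn_integral_sum, intro m, simp only: mem_Collect_eq)
  qed
  also have "\<dots> = (\<Sum>\<sigma> | \<sigma> permutes {1..n}. emeasure \<mu> A) / ennreal (fact n)"
    using exch A by simp
  also have "\<dots> = emeasure \<mu> A"
  proof -
    have c: "card {\<sigma>. \<sigma> permutes {1..n}} = fact n" by (simp add: card_permutations)
    have "emeasure \<mu> A * ennreal (fact n) / ennreal (fact n) = emeasure \<mu> A"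
      by (rule mult_divide_eq_ennreal) auto
    then show ?thesis using c by (simp add: mult.commute ennreal_of_nat_eq_real_of_nat)
  qed
  finally show "(\<integral>\<^sup>+\<omega>. emeasure (measure_pmf (pmf_of_set (permutations_of_multiset (E \<omega>))))
      {zs. (\<lambda>j\<in>{1..n}. zs ! (j - 1)) \<in> A} \<partial>M) = emeasure \<mu> A" unfolding Q_def .
qed

section \<open>The characteristic polynomial of the perturbation\<close>

definition tridiag :: "nat \<Rightarrow> (nat \<Rightarrow> 'a) \<Rightarrow> (nat \<Rightarrow> 'a) \<Rightarrow> 'a :: comm_ring_1 mat" where
  "tridiag n d e = mat n n (\<lambda>(i, k). if k = i then d i else if k = Suc i then e i else if i = Suc k then e k else 0)"

lemma tridiag_carrier [simp]: "tridiag n d e \<in> carrier_mat n n"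
  by (simp add: tridiag_def)

text \<open>Laplace expansion along the first row, and of the remaining minor along its first
  column: the three-term recursion of continuants.\<close>

lemma det_tridiag:
  "Determinant.det (tridiag (Suc (Suc n)) d e) =
    d 0 * Determinant.det (tridiag (Suc n) (\<lambda>j. d (Suc j)) (\<lambda>j. e (Suc j))) -
    e 0 * e 0 * Determinant.det (tridiag n (\<lambda>j. d (Suc (Suc j))) (\<lambda>j. e (Suc (Suc j))))"
proof -
  let ?T = "tridiag (Suc (Suc n)) d e"
  let ?M = "mat_delete ?T 0 (Suc 0)"
  have M: "?M \<in> carrier_mat (Suc n) (Suc n)" by (simp add: mat_delete_def tridiag_def)
  have M00: "mat_delete ?T 0 0 = tridiag (Suc n) (\<lambda>j. d (Suc j)) (\<lambda>j. e (Suc j))"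
    by (rule eq_matI) (auto simp: mat_delete_def tridiag_def)
  have MM: "mat_delete ?M 0 0 = tridiag n (\<lambda>j. d (Suc (Suc j))) (\<lambda>j. e (Suc (Suc j)))"
    by (rule eq_matI) (auto simp: mat_delete_def tridiag_def)
  have "Determinant.det ?M = (\<Sum>i<Suc n. ?M $$ (i, 0) * cofactor ?M i 0)"
    by (rule laplace_expansion_column[OF M]) simp
  also have "\<dots> = ?M $$ (0, 0) * cofactor ?M 0 0 + (\<Sum>i<n. ?M $$ (Suc i, 0) * cofactor ?M (Suc i) 0)"
    by (simp only: sum.lessThan_Suc_shift)
  also have "(\<Sum>i<n. ?M $$ (Suc i, 0) * cofactor ?M (Suc i) 0) = 0"
    by (intro sum.neutral) (auto simp: mat_delete_def tridiag_def)
  also have "?M $$ (0, 0) = e 0" by (simp add: mat_delete_def tridiag_def)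
  also have "cofactor ?M 0 0 = Determinant.det (mat_delete ?M 0 0)" by (simp add: cofactor_def)
  finally have dM: "Determinant.det ?M = e 0 * Determinant.det (tridiag n (\<lambda>j. d (Suc (Suc j))) (\<lambda>j. e (Suc (Suc j))))"
    by (simp only: MM add_0_right)
  have "Determinant.det ?T = (\<Sum>j<Suc (Suc n). ?T $$ (0, j) * cofactor ?T 0 j)"
    by (rule laplace_expansion_row) auto
  also have "\<dots> = ?T $$ (0, 0) * cofactor ?T 0 0 + (?T $$ (0, Suc 0) * cofactor ?T 0 (Suc 0) +
    (\<Sum>j<n. ?T $$ (0, Suc (Suc j)) * cofactor ?T 0 (Suc (Suc j))))"
    by (simp only: sum.lessThan_Suc_shift)
  also have "(\<Sum>j<n. ?T $$ (0, Suc (Suc j)) * cofactor ?T 0 (Suc (Suc j))) = 0"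
    by (intro sum.neutral) (auto simp: tridiag_def)
  also have "?T $$ (0, 0) = d 0" by (simp add: tridiag_def)
  also have "?T $$ (0, Suc 0) = e 0" by (simp add: tridiag_def)
  also have "cofactor ?T 0 0 = Determinant.det (mat_delete ?T 0 0)" by (simp add: cofactor_def)
  also have "cofactor ?T 0 (Suc 0) = - Determinant.det ?M" by (simp add: cofactor_def)
  finally show ?thesis unfolding M00 dM by (simp add: mult.assoc)
qed

text \<open>\<open>c\<close> is what the corner entry receives beyond \<open>(x i)\<^sup>2\<close>:
  the perturbation \<open>\<i> * l\<close> at the outset, the square of the preceding
  \<open>y\<close> inside the recursion.\<close>

definition jac_det :: "(nat \<Rightarrow> real) \<Rightarrow> (nat \<Rightarrow> real) \<Rightarrow> nat \<Rightarrow> nat \<Rightarrow> complex \<Rightarrow> complex poly" where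
  "jac_det x y i n c = Determinant.det (tridiag n
     (\<lambda>j. [:- (of_real ((x (i + j))\<^sup>2) + (if j = 0 then c else of_real ((y (i + j - 1))\<^sup>2))), 1:])
     (\<lambda>j. [:- of_real (x (i + j) * y (i + j)):]))"

lemma jac_det_Suc:
  "jac_det x y i (Suc (Suc n)) c =
    [:- (of_real ((x i)\<^sup>2) + c), 1:] * jac_det x y (Suc i) (Suc n) (of_real ((y i)\<^sup>2)) -
    Polynomial.smult (of_real ((x i)\<^sup>2 * (y i)\<^sup>2)) (jac_det x y (Suc (Suc i)) n (of_real ((y (Suc i))\<^sup>2)))"
proof -
  have 1: "tridiag (Suc n) (\<lambda>j. [:- (of_real ((x (i + Suc j))\<^sup>2) + (if Suc j = 0 then c else of_real ((y (i + Suc j - 1))\<^sup>2))), 1:])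
      (\<lambda>j. [:- of_real (x (i + Suc j) * y (i + Suc j)):]) =
    tridiag (Suc n) (\<lambda>j. [:- (of_real ((x (Suc i + j))\<^sup>2) + (if j = 0 then of_real ((y i)\<^sup>2) else of_real ((y (Suc i + j - 1))\<^sup>2))), 1:])
      (\<lambda>j. [:- complex_of_real (x (Suc i + j) * y (Suc i + j)):])"
    by (intro arg_cong2[where f = "tridiag (Suc n)"] ext) auto
  have 2: "tridiag n (\<lambda>j. [:- (of_real ((x (i + Suc (Suc j)))\<^sup>2) + (if Suc (Suc j) = 0 then c else of_real ((y (i + Suc (Suc j) - 1))\<^sup>2))), 1:])
      (\<lambda>j. [:- of_real (x (i + Suc (Suc j)) * y (i + Suc (Suc j))):]) =
    tridiag n (\<lambda>j. [:- (of_real ((x (Suc (Suc i) + j))\<^sup>2) + (if j = 0 then of_real ((y (Suc i))\<^sup>2) else of_real ((y (Suc (Suc i) + j - 1))\<^sup>2))), 1:])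
      (\<lambda>j. [:- complex_of_real (x (Suc (Suc i) + j) * y (Suc (Suc i) + j)):])"
    by (intro arg_cong2[where f = "tridiag n"] ext) auto
  show ?thesis
    unfolding jac_det_def det_tridiag 1 2
    by (simp add: power2_eq_square mult_ac del: of_real_power)
qed

text \<open>The determinant is affine in the corner term \<open>c\<close>, with slope minus the
  determinant of the truncation. One induction proves both claims because the truncation is again
  such a determinant, with corner term \<open>(y i)\<^sup>2\<close>.\<close>

lemma jac_det_polAB:
  "jac_det x y i (Suc n) c = cpoly (polA 0 i n x y) - Polynomial.smult c (cpoly (polB 0 i n x y)) \<and>
   jac_det x y (Suc i) n (of_real ((y i)\<^sup>2)) = cpoly (polB 0 i n x y)"
proof (induction n arbitrary: i c)
  case 0
  have "Determinant.det (tridiag (Suc 0) d e) = d 0" for d e :: "nat \<Rightarrow> complex poly"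
    using Determinant.det_single[of "tridiag (Suc 0) d e"] by (simp add: tridiag_def)
  moreover have "Determinant.det (tridiag 0 d e) = 1" for d e :: "nat \<Rightarrow> complex poly"
    by (rule det_dim_zero) simp
  ultimately show ?case by (simp add: jac_det_def polAB_0 one_pCons)
next
  case (Suc n)
  have B: "jac_det x y (Suc i) (Suc n) (of_real ((y i)\<^sup>2)) = cpoly (polB 0 i (Suc n) x y)"
    using Suc.IH[of "Suc i" "of_real ((y i)\<^sup>2)"] by (simp add: polB_Suc)
  have B': "jac_det x y (Suc (Suc i)) n (of_real ((y (Suc i))\<^sup>2)) = cpoly (polB 0 (Suc i) n x y)"
    using Suc.IH[of "Suc i"] by blast
  have "jac_det x y i (Suc (Suc n)) c = cpoly (polA 0 i (Suc n) x y) - Polynomial.smult c (cpoly (polB 0 i (Suc n) x y))"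
    unfolding jac_det_Suc B B' polA_Suc
    by (rule poly_eqI) (simp add: polB_Suc coeff_pCons algebra_simps split: nat.split)
  with B show ?case by blast
qed

lemma gram_upper_bidiagonal_index:
  assumes "i < n" "k < n"
  shows "(transpose_mat (upper_bidiagonal n x y) * upper_bidiagonal n x y) $$ (i, k) =
    (if k = i then (x (Suc i))\<^sup>2 + (if i = 0 then 0 else (y i)\<^sup>2)
     else if k = Suc i then x (Suc i) * y (Suc i) else if i = Suc k then x (Suc k) * y (Suc k) else 0)"
proof -
  have "(transpose_mat (upper_bidiagonal n x y) * upper_bidiagonal n x y) $$ (i, k) =
    (\<Sum>r = 0..<n. (if i = r then x (r + 1) else if i = r + 1 then y (r + 1) else 0) *
      (if k = r then x (r + 1) else if k = r + 1 then y (r + 1) else 0))"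
    using assms by (simp add: upper_bidiagonal_def scalar_prod_def)
  also have "\<dots> = (\<Sum>r\<in>{r. r < n \<and> (i = r \<or> i = Suc r) \<and> (k = r \<or> k = Suc r)}. (if i = r then x (r + 1) else if i = r + 1 then y (r + 1) else 0) *
      (if k = r then x (r + 1) else if k = r + 1 then y (r + 1) else 0))"
    by (intro sum.mono_neutral_right) auto
  also have "\<dots> = (if k = i then (x (Suc i))\<^sup>2 + (if i = 0 then 0 else (y i)\<^sup>2)
     else if k = Suc i then x (Suc i) * y (Suc i) else if i = Suc k then x (Suc k) * y (Suc k) else 0)"
  proof -
    consider (a) "k = i" "i = 0" | (b) j where "k = i" "i = Suc j" | (c) "k = Suc i" | (d) "i = Suc k" | (e) "k \<noteq> i" "k \<noteq> Suc i" "i \<noteq> Suc k"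
      by (metis not0_implies_Suc)
    then show ?thesis
    proof cases
      case a
      then have "{r. r < n \<and> (i = r \<or> i = Suc r) \<and> (k = r \<or> k = Suc r)} = {0}" using assms by auto
      then show ?thesis using a by (simp add: power2_eq_square)
    next
      case b
      then have "{r. r < n \<and> (i = r \<or> i = Suc r) \<and> (k = r \<or> k = Suc r)} = {Suc j, j}" using assms by auto
      then show ?thesis using b by (simp add: power2_eq_square)
    next
      case c
      then have "{r. r < n \<and> (i = r \<or> i = Suc r) \<and> (k = r \<or> k = Suc r)} = {i}" using assms by auto
      then show ?thesis using c by simp
    next
      case d
      then have "{r. r < n \<and> (i = r \<or> i = Suc r) \<and> (k = r \<or> k = Suc r)} = {k}" using assms by auto
      then show ?thesis using d by (simp add: mult.commute)
    next
      case e
      then have S: "{r. r < n \<and> (i = r \<or> i = Suc r) \<and> (k = r \<or> k = Suc r)} = {}" by auto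
      show ?thesis unfolding S using e by simp
    qed
  qed
  finally show ?thesis .
qed

lemma char_poly_rank_one_perturbation:
  assumes "J = transpose_mat (upper_bidiagonal (Suc n) x y) * upper_bidiagonal (Suc n) x y"
  shows "char_poly (rank_one_perturbation (Suc n) J l) =
    cpoly (polA 0 1 n x y) - Polynomial.smult (\<i> * of_real l) (cpoly (polB 0 1 n x y))"
proof -
  have J: "J \<in> carrier_mat (Suc n) (Suc n)" unfolding assms
    by (rule mult_carrier_mat[of _ _ "Suc n"]) (simp_all add: upper_bidiagonal_def)
  have "char_poly_matrix (rank_one_perturbation (Suc n) J l) = tridiag (Suc n)
     (\<lambda>j. [:- (of_real ((x (1 + j))\<^sup>2) + (if j = 0 then \<i> * of_real l else of_real ((y (1 + j - 1))\<^sup>2))), 1:])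
     (\<lambda>j. [:- of_real (x (1 + j) * y (1 + j)):])"
  proof (rule eq_matI)
    fix i k assume "i < dim_row (tridiag (Suc n)
       (\<lambda>j. [:- (of_real ((x (1 + j))\<^sup>2) + (if j = 0 then \<i> * of_real l else of_real ((y (1 + j - 1))\<^sup>2))), 1:])
       (\<lambda>j. [:- complex_of_real (x (1 + j) * y (1 + j)):]))"
      "k < dim_col (tridiag (Suc n)
       (\<lambda>j. [:- (of_real ((x (1 + j))\<^sup>2) + (if j = 0 then \<i> * of_real l else of_real ((y (1 + j - 1))\<^sup>2))), 1:])
       (\<lambda>j. [:- complex_of_real (x (1 + j) * y (1 + j)):]))"
    then have ik: "i < Suc n" "k < Suc n" by (auto simp: tridiag_def)
    have JJ: "J $$ (i, k) = (if k = i then (x (Suc i))\<^sup>2 + (if i = 0 then 0 else (y i)\<^sup>2)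
     else if k = Suc i then x (Suc i) * y (Suc i) else if i = Suc k then x (Suc k) * y (Suc k) else 0)"
      unfolding assms by (rule gram_upper_bidiagonal_index[OF ik])
    show "char_poly_matrix (rank_one_perturbation (Suc n) J l) $$ (i, k) = tridiag (Suc n)
     (\<lambda>j. [:- (of_real ((x (1 + j))\<^sup>2) + (if j = 0 then \<i> * of_real l else of_real ((y (1 + j - 1))\<^sup>2))), 1:])
     (\<lambda>j. [:- of_real (x (1 + j) * y (1 + j)):]) $$ (i, k)"
      using ik J JJ by (auto simp: char_poly_matrix_def rank_one_perturbation_def tridiag_def)
  qed (use J in \<open>auto simp: char_poly_matrix_def rank_one_perturbation_def tridiag_def\<close>)
  then have "char_poly (rank_one_perturbation (Suc n) J l) = jac_det x y 1 (Suc n) (\<i> * of_real l)"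
    unfolding char_poly_def jac_det_def by simp
  then show ?thesis using jac_det_polAB by simp
qed

text \<open>Zeros at the end of the bidiagonal factor split off powers of \<open>z\<close>. One more
  \<open>x\<close> than \<open>y\<close> vanishes: the first vanishing \<open>x\<close> is the
  innermost entry that \<open>s = 1\<close> already sets to 0.\<close>

lemma polAB_zero_tail:
  assumes "\<And>j. i + k \<le> j \<Longrightarrow> j \<le> i + k + e \<Longrightarrow> x j = 0" "\<And>j. i + k \<le> j \<Longrightarrow> j < i + k + e \<Longrightarrow> y j = 0"
  shows "polA 0 i (k + e) x y = monom 1 e * polA 1 i k x y \<and> polB 0 i (k + e) x y = monom 1 e * polB 1 i k x y"
  using assms
proof (induction k arbitrary: i)
  case 0
  then show ?case
  proof (induction e arbitrary: i)
    case (Suc e)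
    have IH: "polA 0 (Suc i) e x y = monom 1 e * [:0, 1:]" "polB 0 (Suc i) e x y = monom 1 e"
      using Suc.IH[of "Suc i"] Suc.prems by (auto simp: polAB_0)
    have xy: "x i = 0" "y i = 0" using Suc.prems by auto
    show ?case using IH xy by (simp add: polA_Suc polB_Suc polAB_0 monom_Suc)
  qed (simp add: polAB_0)
next
  case (Suc k)
  have IH: "polA 0 (Suc i) (k + e) x y = monom 1 e * polA 1 (Suc i) k x y" "polB 0 (Suc i) (k + e) x y = monom 1 e * polB 1 (Suc i) k x y"
    using Suc.IH[of "Suc i"] Suc.prems by auto
  show ?case using IH by (simp add: polA_Suc polB_Suc algebra_simps smult_diff_right)
qed

section \<open>The law of the characteristic polynomial\<close>

text \<open>Recovers the entries of the bidiagonal factor from \<open>B\<^sup>T B\<close>.  Independence is assumed between \<open>l\<close>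
  and \<open>J\<close> only, so the entries are needed as functions of \<open>J\<close>.\<close>
fun recover :: "(nat \<times> nat \<Rightarrow> real) \<Rightarrow> nat \<Rightarrow> real \<times> real" where
  "recover v 0 = (0, 0)"
| "recover v (Suc j) = (let a = sqrt (v (j, j) - (snd (recover v j))\<^sup>2) in (a, v (j, Suc j) / a))"

text \<open>A Cholesky recursion from the upper left corner; the positivity of the \<open>x\<close>
  selects the square root and permits the division. The claim on \<open>y j\<close> is conditional
  because the last row has no entry to the right of the diagonal.\<close>

lemma recover_correct:
  assumes d: "\<And>i. i < j \<Longrightarrow> v (i, i) = (x (Suc i))\<^sup>2 + (if i = 0 then 0 else (y i)\<^sup>2)"
    and e: "\<And>i. Suc i < j \<Longrightarrow> v (i, Suc i) = x (Suc i) * y (Suc i)"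
    and x: "\<And>i. i < j \<Longrightarrow> x (Suc i) > 0" and j: "0 < j"
  shows "fst (recover v j) = x j" "v (j - 1, j) = x j * y j \<Longrightarrow> snd (recover v j) = y j"
proof -
  have "fst (recover v j) = x j \<and> (v (j - 1, j) = x j * y j \<longrightarrow> snd (recover v j) = y j)"
    using assms
  proof (induction j)
    case (Suc j)
    have "v (j, j) - (snd (recover v j))\<^sup>2 = (x (Suc j))\<^sup>2"
    proof (cases "j = 0")
      case True
      then show ?thesis using Suc.prems(1)[of 0] by simp
    next
      case False
      have "snd (recover v j) = y j"
        using Suc.IH Suc.prems(1-3) Suc.prems(2)[of "j - 1"] False by auto
      then show ?thesis using Suc.prems(1)[of j] False by simp
    qed
    moreover have "x (Suc j) > 0" using Suc.prems(3) by simp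
    ultimately show ?case by (simp add: Let_def)
  qed simp
  then show "fst (recover v j) = x j" "v (j - 1, j) = x j * y j \<Longrightarrow> snd (recover v j) = y j" by auto
qed

lemma measurable_recover:
  assumes "j < n \<or> j = n"
  shows "(\<lambda>v. fst (recover v j)) \<in> borel_measurable (\<Pi>\<^sub>M p\<in>{..<n} \<times> {..<n}. borel)"
    "j < n \<Longrightarrow> (\<lambda>v. snd (recover v j)) \<in> borel_measurable (\<Pi>\<^sub>M p\<in>{..<n} \<times> {..<n}. borel)"
proof -
  have "(\<lambda>v. fst (recover v j)) \<in> borel_measurable (\<Pi>\<^sub>M p\<in>{..<n} \<times> {..<n}. borel) \<and>
    (j < n \<longrightarrow> (\<lambda>v. snd (recover v j)) \<in> borel_measurable (\<Pi>\<^sub>M p\<in>{..<n} \<times> {..<n}. borel))"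
    using assms
  proof (induction j)
    case (Suc j)
    have c: "(\<lambda>v. v p) \<in> borel_measurable (\<Pi>\<^sub>M p\<in>{..<n} \<times> {..<n}. borel :: real measure)" if "p \<in> {..<n} \<times> {..<n}" for p
      using measurable_component_singleton[OF that, of "\<lambda>_. borel :: real measure"] by simp
    have [measurable]: "(\<lambda>v. snd (recover v j)) \<in> borel_measurable (\<Pi>\<^sub>M p\<in>{..<n} \<times> {..<n}. borel)" using Suc by auto
    have [measurable]: "(\<lambda>v. v (j, j)) \<in> borel_measurable (\<Pi>\<^sub>M p\<in>{..<n} \<times> {..<n}. borel :: real measure)"
      using Suc.prems by (intro c) auto
    have "(\<lambda>v. v (j, Suc j)) \<in> borel_measurable (\<Pi>\<^sub>M p\<in>{..<n} \<times> {..<n}. borel :: real measure)" if "Suc j < n"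
      using that by (intro c) auto
    then show ?case by (auto simp: Let_def)
  qed auto
  then show "(\<lambda>v. fst (recover v j)) \<in> borel_measurable (\<Pi>\<^sub>M p\<in>{..<n} \<times> {..<n}. borel)"
    "j < n \<Longrightarrow> (\<lambda>v. snd (recover v j)) \<in> borel_measurable (\<Pi>\<^sub>M p\<in>{..<n} \<times> {..<n}. borel)" by auto
qed

text \<open>For a function of an almost-sure copy \<open>g \<circ> X\<close> of \<open>Z\<close> only the independence of \<open>X\<close> is needed,
  so that \<open>Z\<close> need not itself be measurable with respect to \<open>X\<close>.\<close>
lemma (in prob_space) nn_integral_indep_AE_eq:
  assumes ind: "indep_set (sets (vimage_algebra (space M) X S)) (sets (vimage_algebra (space M) l T))"
    and X: "X \<in> space M \<rightarrow> space S" and l: "l \<in> space M \<rightarrow> space T"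
    and g: "g \<in> S \<rightarrow>\<^sub>M R" and Z: "AE \<omega> in M. Z \<omega> = g (X \<omega>)"
    and H: "case_prod H \<in> borel_measurable (R \<Otimes>\<^sub>M T)"
  shows "(\<integral>\<^sup>+\<omega>. H (Z \<omega>) (l \<omega>) \<partial>M) = (\<integral>\<^sup>+\<omega>. (\<integral>\<^sup>+t. H (Z \<omega>) t \<partial>distr M T l) \<partial>M)"
proof -
  have sX: "sets (vimage_algebra (space M) X S) = {X -` A \<inter> space M |A. A \<in> sets S}"
    and sl: "sets (vimage_algebra (space M) l T) = {l -` A \<inter> space M |A. A \<in> sets T}"
    using X l by (auto simp: sets_vimage_algebra2)
  have ev: "sets (vimage_algebra (space M) X S) \<subseteq> events" "sets (vimage_algebra (space M) l T) \<subseteq> events"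
    using ind unfolding indep_set_def indep_sets_def by (auto split: bool.splits)
  have rX[measurable]: "X \<in> M \<rightarrow>\<^sub>M S" using X ev(1) unfolding sX by (intro measurableI) auto
  have rl[measurable]: "l \<in> M \<rightarrow>\<^sub>M T" using l ev(2) unfolding sl by (intro measurableI) auto
  interpret dX: prob_space "distr M S X" by (rule prob_space_distr) (rule rX)
  interpret dl: prob_space "distr M T l" by (rule prob_space_distr) (rule rl)
  have d: "distr M S X \<Otimes>\<^sub>M distr M T l = distr M (S \<Otimes>\<^sub>M T) (\<lambda>\<omega>. (X \<omega>, l \<omega>))"
  proof (rule pair_measure_eqI[OF dX.sigma_finite_measure_axioms dl.sigma_finite_measure_axioms])
    show "sets (distr M S X \<Otimes>\<^sub>M distr M T l) = sets (distr M (S \<Otimes>\<^sub>M T) (\<lambda>\<omega>. (X \<omega>, l \<omega>)))"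
      by (simp cong: sets_pair_measure_cong)
    fix A B assume A: "A \<in> sets (distr M S X)" and B: "B \<in> sets (distr M T l)"
    then have jacobi_pair: "A \<in> sets S" "B \<in> sets T" by auto
    have "prob ((X -` A \<inter> space M) \<inter> (l -` B \<inter> space M)) = prob (X -` A \<inter> space M) * prob (l -` B \<inter> space M)"
      using jacobi_pair unfolding sX sl by (intro indep_setD[OF ind]) (auto simp: sX sl)
    moreover have "(\<lambda>\<omega>. (X \<omega>, l \<omega>)) -` (A \<times> B) \<inter> space M = (X -` A \<inter> space M) \<inter> (l -` B \<inter> space M)" by auto
    ultimately show "emeasure (distr M S X) A * emeasure (distr M T l) B = emeasure (distr M (S \<Otimes>\<^sub>M T) (\<lambda>\<omega>. (X \<omega>, l \<omega>))) (A \<times> B)"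
      using jacobi_pair by (simp add: emeasure_distr emeasure_eq_measure ennreal_mult[symmetric])
  qed
  have Hg: "(\<lambda>p. H (g (fst p)) (snd p)) \<in> borel_measurable (S \<Otimes>\<^sub>M T)"
    using measurable_compose[OF measurable_Pair[OF measurable_compose[OF measurable_fst g] measurable_snd] H] by simp
  have "(\<integral>\<^sup>+\<omega>. H (Z \<omega>) (l \<omega>) \<partial>M) = (\<integral>\<^sup>+\<omega>. H (g (X \<omega>)) (l \<omega>) \<partial>M)"
    using Z by (intro nn_integral_cong_AE) (auto elim!: eventually_mono)
  also have "\<dots> = (\<integral>\<^sup>+p. H (g (fst p)) (snd p) \<partial>distr M (S \<Otimes>\<^sub>M T) (\<lambda>\<omega>. (X \<omega>, l \<omega>)))"
    using Hg by (subst nn_integral_distr) auto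
  also have "\<dots> = (\<integral>\<^sup>+u. \<integral>\<^sup>+t. H (g u) t \<partial>distr M T l \<partial>distr M S X)"
    unfolding d[symmetric] using Hg by (subst dl.nn_integral_fst[symmetric]) (auto simp: measurable_cong_sets[OF sets_pair_measure_cong[OF sets_distr sets_distr] refl])
  also have "\<dots> = (\<integral>\<^sup>+\<omega>. \<integral>\<^sup>+t. H (g (X \<omega>)) t \<partial>distr M T l \<partial>M)"
  proof (rule nn_integral_distr[OF rX])
    have "(\<lambda>p. H (g (fst p)) (snd p)) \<in> borel_measurable (S \<Otimes>\<^sub>M distr M T l)"
      using Hg by (simp cong: measurable_cong_sets sets_pair_measure_cong)
    then show "(\<lambda>u. \<integral>\<^sup>+t. H (g u) t \<partial>distr M T l) \<in> borel_measurable (distr M S X)"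
      using dl.borel_measurable_nn_integral[of "\<lambda>u t. H (g u) t" S] by (simp add: case_prod_beta)
  qed
  also have "\<dots> = (\<integral>\<^sup>+\<omega>. (\<integral>\<^sup>+t. H (Z \<omega>) t \<partial>distr M T l) \<partial>M)"
    using Z by (intro nn_integral_cong_AE) (auto elim!: eventually_mono)
  finally show ?thesis .
qed

section \<open>Densities on finite products and the joint law of the entries\<close>

lemma nn_integral_PiM_density:
  fixes f :: "'i \<Rightarrow> real \<Rightarrow> ennreal"
  assumes I: "finite I" and f: "\<And>i. i \<in> I \<Longrightarrow> f i \<in> borel_measurable borel"
    and sf: "\<And>i. i \<in> I \<Longrightarrow> sigma_finite_measure (density lborel (f i))"
    and H: "H \<in> borel_measurable (LL I)"
  shows "(\<integral>\<^sup>+x. H x \<partial>(\<Pi>\<^sub>M i\<in>I. density lborel (f i))) = (\<integral>\<^sup>+x. (\<Prod>i\<in>I. f i (x i)) * H x \<partial>LL I)"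
proof -
  define N where "N i = (if i \<in> I then density lborel (f i) else lborel)" for i
  have "(\<Pi>\<^sub>M i\<in>I. density lborel (f i)) = PiM I N" by (rule PiM_cong) (auto simp: N_def)
  then have "(\<integral>\<^sup>+x. H x \<partial>(\<Pi>\<^sub>M i\<in>I. density lborel (f i))) = (\<integral>\<^sup>+x. H x \<partial>PiM I N)" by simp
  also have "\<dots> = (\<integral>\<^sup>+x. (\<Prod>i\<in>I. f i (x i)) * H (\<lambda>i\<in>I. x i) \<partial>LL I)"
  proof (rule nn_integral_PiM_substitution)
    show "sigma_finite_measure (N i)" for i using sf by (auto simp: N_def sigma_finite_lborel)
    show "(\<integral>\<^sup>+x. h x \<partial>N i) = (\<integral>\<^sup>+x. f i x * h x \<partial>lborel)" if "i \<in> I" "h \<in> borel_measurable (N i)" for i h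
      using that f by (auto simp: N_def nn_integral_density)
    have "sets (PiM I N) = sets (LL I)" by (rule sets_PiM_cong) (auto simp: N_def)
    then show "H \<in> borel_measurable (PiM I N)" using H by (simp cong: measurable_cong_sets)
  qed (use I f in \<open>auto simp: N_def sigma_finite_lborel\<close>)
  also have "\<dots> = (\<integral>\<^sup>+x. (\<Prod>i\<in>I. f i (x i)) * H x \<partial>LL I)"
    by (intro nn_integral_cong arg_cong2[where f = "(*)"] refl arg_cong[where f = H]) (auto simp: space_PiM PiE_restrict)
  finally show ?thesis .
qed

lemma nn_integral_PiM_Plus:
  fixes H :: "('i + 'j \<Rightarrow> real) \<Rightarrow> ennreal"
  assumes A: "finite A" and B: "finite B" and H: "H \<in> borel_measurable (LL (A <+> B))"
  shows "(\<integral>\<^sup>+z. H z \<partial>LL (A <+> B)) =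
    (\<integral>\<^sup>+x. \<integral>\<^sup>+y. H (\<lambda>t\<in>A <+> B. case_sum x y t) \<partial>LL B \<partial>LL A)"
proof -
  interpret product_sigma_finite "\<lambda>_::'i + 'j. lborel :: real measure" by standard
  have e: "A <+> B = Inl ` A \<union> Inr ` B" by (auto simp: Plus_def)
  have bA: "bij_betw Inl A (Inl ` A)" and bB: "bij_betw Inr B (Inr ` B)" by (auto simp: bij_betw_def)
  have iA: "inv_into A Inl (Inl i) = i" if "i \<in> A" for i using that by (intro inv_into_f_f) auto
  have iB: "inv_into B Inr (Inr i) = i" if "i \<in> B" for i using that by (intro inv_into_f_f) auto
  interpret SB: sigma_finite_measure "LL (Inr ` B)" by (rule sigma_finite_PiM_lborel) (use B in simp)
  let ?mg = "merge (Inl ` A) (Inr ` B)"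
  have Hm: "(\<lambda>p. H (?mg p)) \<in> borel_measurable (LL (Inl ` A) \<Otimes>\<^sub>M LL (Inr ` B))"
    using measurable_compose[OF measurable_merge H[unfolded e]] .
  have Hm2: "(\<lambda>v. H (?mg (u, v))) \<in> borel_measurable (LL (Inr ` B))"
    if "u \<in> space (LL (Inl ` A))" for u using measurable_compose[OF measurable_Pair1'[OF that] Hm] .
  have Hm3: "(\<lambda>u. \<integral>\<^sup>+v. H (?mg (u, v)) \<partial>LL (Inr ` B)) \<in> borel_measurable (LL (Inl ` A))"
    using SB.borel_measurable_nn_integral_fst[OF Hm] by simp
  have "(\<integral>\<^sup>+z. H z \<partial>LL (A <+> B)) = (\<integral>\<^sup>+u. \<integral>\<^sup>+v. H (?mg (u, v)) \<partial>LL (Inr ` B) \<partial>LL (Inl ` A))"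
    unfolding e by (rule product_nn_integral_fold) (use A B H e in auto)
  also have "\<dots> = (\<integral>\<^sup>+x. (\<integral>\<^sup>+v. H (?mg ((\<lambda>j\<in>Inl ` A. x (inv_into A Inl j)), v)) \<partial>LL (Inr ` B)) \<partial>LL A)"
    by (rule nn_integral_PiM_reindex[OF sigma_finite_lborel A bA Hm3])
  also have "\<dots> = (\<integral>\<^sup>+x. (\<integral>\<^sup>+y. H (?mg ((\<lambda>j\<in>Inl ` A. x (inv_into A Inl j)), (\<lambda>j\<in>Inr ` B. y (inv_into B Inr j)))) \<partial>LL B) \<partial>LL A)"
    by (intro nn_integral_cong nn_integral_PiM_reindex[OF sigma_finite_lborel B bB] Hm2) (auto simp: space_PiM)
  also have "\<dots> = (\<integral>\<^sup>+x. \<integral>\<^sup>+y. H (\<lambda>t\<in>A <+> B. case_sum x y t) \<partial>LL B \<partial>LL A)"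
    by (intro nn_integral_cong arg_cong[where f = H] ext) (auto simp: merge_def iA iB split: sum.split)
  finally show ?thesis .
qed

definition perturbed_poly :: "nat \<Rightarrow> nat \<Rightarrow> (nat \<Rightarrow> real) \<Rightarrow> (nat \<Rightarrow> real) \<Rightarrow> real \<Rightarrow> complex poly" where
  "perturbed_poly s k x y l = cpoly (polA s 1 k x y) - Polynomial.smult (\<i> * of_real l) (cpoly (polB s 1 k x y))"

lemma perturbed_poly_monic: "degree (perturbed_poly s k x y l) = Suc k" "lead_coeff (perturbed_poly s k x y l) = 1"
proof -
  have c: "coeff (perturbed_poly s k x y l) (Suc k) = 1"
    by (simp add: perturbed_poly_def polAB_monic coeff_eq_0)
  have "degree (perturbed_poly s k x y l) \<le> Suc k" unfolding perturbed_poly_def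
    by (intro degree_diff_le) (auto simp: polAB_monic intro: order.trans[OF degree_smult_le])
  then show d: "degree (perturbed_poly s k x y l) = Suc k" using c by (intro antisym le_degree) auto
  then show "lead_coeff (perturbed_poly s k x y l) = 1" using c by simp
qed

lemma perturbed_poly_cong:
  assumes "\<And>j. j \<in> {1..<1 + Suc k - s} \<Longrightarrow> x j = x' j" "\<And>j. j \<in> {1..<1 + k} \<Longrightarrow> y j = y' j" "s \<le> 1"
  shows "perturbed_poly s k x y l = perturbed_poly s k x' y' l"
proof -
  have "polA s 1 k x y = polA s 1 k x' y'" "polB s 1 k x y = polB s 1 k x' y'"
    by (rule polAB_cong; use assms in auto)+
  then show ?thesis by (simp add: perturbed_poly_def)
qed

lemma proots_monom_mult:
  fixes p :: "complex poly"
  assumes "p \<noteq> 0"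
  shows "proots (monom 1 e * p) = replicate_mset e 0 + proots p"
proof -
  have "monom 1 e = [:0, 1 :: complex:] ^ e" by (simp add: monom_altdef)
  then have "proots (monom 1 e :: complex poly) = repeat_mset e {#0#}"
    using proots_linear_factor[of "0 :: complex"] by (simp add: proots_power)
  moreover have "repeat_mset e {#0 :: complex#} = replicate_mset e 0" by (induction e) auto
  ultimately show ?thesis using assms by (subst proots_mult) (auto simp: monom_eq_0_iff)
qed

text \<open>\<open>s\<close> and \<open>k\<close> treat both cases at once: \<open>Suc k\<close> is
  the degree that is left when the forced zeros are split off. \<open>p\<close> is formed from the
  entries and \<open>l\<close> at every point of the probability space and so is monic everywhere,
  while its relation to \<open>J\<close> holds almost surely.\<close>

lemma ensemble_law:
  fixes M :: "'w measure" and J :: "'w \<Rightarrow> real mat" and l :: "'w \<Rightarrow> real" and F :: "real \<Rightarrow> real"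
  assumes "0 < m" "0 < n" "prob_space M" and ens: "laguerre_beta_ensemble M \<beta> m n J"
    and dl: "distributed M lborel l (\<lambda>t. ennreal (F t) * indicator {0<..} t)"
    and ind: "prob_space.indep_set M
           (sets (vimage_algebra (space M) (\<lambda>\<omega>. \<lambda>p\<in>{..<n} \<times> {..<n}. J \<omega> $$ p)
              (\<Pi>\<^sub>M p\<in>{..<n} \<times> {..<n}. borel)))
           (sets (vimage_algebra (space M) l borel))"
    and sk: "n \<le> m \<and> s = 0 \<and> Suc k = n \<or> m < n \<and> s = 1 \<and> k = m"
  defines "X \<equiv> {1..<1 + Suc k - s}" and "Y \<equiv> {1..<1 + k}"
  shows "\<exists>p. (\<forall>\<omega>. degree (p \<omega>) = Suc k \<and> lead_coeff (p \<omega>) = 1) \<and>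
    (AE \<omega> in M. eigenvalues_mset (rank_one_perturbation n (J \<omega>) (l \<omega>)) = proots (p \<omega>) + replicate_mset (n - Suc k) 0) \<and>
    (\<forall>G \<in> borel_measurable polyM. (\<integral>\<^sup>+\<omega>. G (p \<omega>) \<partial>M) =
      (\<integral>\<^sup>+x. \<integral>\<^sup>+y. \<integral>\<^sup>+t. (\<Prod>j\<in>X. ennreal (chi_density (\<beta> * (real m - real j + 1)) (x j))) *
         (\<Prod>j\<in>Y. ennreal (chi_density (\<beta> * (real n - real j)) (y j))) *
         (ennreal (F t) * indicator {0<..} t) * G (perturbed_poly s k x y t) \<partial>lborel \<partial>LL Y \<partial>LL X))"
proof -
  interpret prob_space M by fact
  let ?x = "\<lambda>u. \<Prod>j\<in>X. ennreal (chi_density (\<beta> * (real m - real j + 1)) (u j))"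
  let ?y = "\<lambda>v. \<Prod>j\<in>Y. ennreal (chi_density (\<beta> * (real n - real j)) (v j))"
  have s1: "s \<le> 1" using sk by auto
  have Xe: "X = {1..min m n}" and Ye: "Y = {1..min m (n - 1)}" using sk unfolding X_def Y_def by auto
  have YX: "Y \<subseteq> X" and Xn: "\<And>j. j \<in> X \<Longrightarrow> 0 < j \<and> j \<le> n" and Yn: "\<And>j. j \<in> Y \<Longrightarrow> 0 < j \<and> j < n"
    unfolding Xe Ye using \<open>0 < n\<close> by auto
  have fX: "finite X" and fY: "finite Y" by (auto simp: X_def Y_def)
  obtain x y :: "nat \<Rightarrow> 'w \<Rightarrow> real" where
    iv: "indep_vars (\<lambda>_. borel) (case_sum x y) (X <+> Y)"
    and dx: "\<And>j. j \<in> X \<Longrightarrow> distributed M lborel (x j) (\<lambda>t. ennreal (chi_density (\<beta> * (real m - real j + 1)) t))"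
    and dy: "\<And>j. j \<in> Y \<Longrightarrow> distributed M lborel (y j) (\<lambda>t. ennreal (chi_density (\<beta> * (real n - real j)) t))"
    and x0: "\<And>j. j \<in> {m + 1..n} \<Longrightarrow> AE \<omega> in M. x j \<omega> = 0"
    and y0: "\<And>j. j \<in> {m + 1..n - 1} \<Longrightarrow> AE \<omega> in M. y j \<omega> = 0"
    and J: "AE \<omega> in M. J \<omega> = transpose_mat (upper_bidiagonal n (\<lambda>j. x j \<omega>) (\<lambda>j. y j \<omega>)) *
           upper_bidiagonal n (\<lambda>j. x j \<omega>) (\<lambda>j. y j \<omega>)"
    using ens unfolding laguerre_beta_ensemble_def Xe Ye by blast
  define I where "I = X <+> Y"
  define f where "f = case_sum (\<lambda>j t. ennreal (chi_density (\<beta> * (real m - real j + 1)) t))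
    (\<lambda>j t. ennreal (chi_density (\<beta> * (real n - real j)) t))"
  have fm[measurable]: "f t \<in> borel_measurable borel" if "t \<in> I" for t
    using that distributed_borel_measurable[OF dx] distributed_borel_measurable[OF dy] by (auto simp: I_def f_def)
  have dist: "distr M borel (case_sum x y t) = density lborel (f t)" if "t \<in> I" for t
    using that distributed_distr_eq_density[OF dx] distributed_distr_eq_density[OF dy]
    by (auto simp: I_def f_def distr_cong[OF refl, of borel lborel, symmetric] cong: distr_cong)
  have rv: "random_variable borel (case_sum x y t)" if "t \<in> I" for t
    using that distributed_measurable[OF dx] distributed_measurable[OF dy] by (auto simp: I_def)
  have fI: "finite I" and Ine: "I \<noteq> {}" using fX fY Xe \<open>0 < m\<close> \<open>0 < n\<close> by (auto simp: I_def)
  \<comment> \<open>The chi-distributed entries gathered into one vector. Its law is a product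
    measure by independence, and \<open>ZH\<close> integrates against the product density.\<close>
  define Z where "Z \<omega> = (\<lambda>t\<in>I. case_sum x y t \<omega>)" for \<omega>
  have Zm: "Z \<in> M \<rightarrow>\<^sub>M (\<Pi>\<^sub>M t\<in>I. borel)" unfolding Z_def by (intro measurable_restrict rv)
  have Zlaw: "distr M (\<Pi>\<^sub>M t\<in>I. borel) Z = (\<Pi>\<^sub>M t\<in>I. density lborel (f t))"
    using iv unfolding indep_vars_iff_distr_eq_PiM'[OF Ine rv] I_def[symmetric] Z_def
    by (subst (asm) indep_vars_iff_distr_eq_PiM'[OF Ine rv]) (auto simp: dist cong: PiM_cong)
  have sfd: "sigma_finite_measure (density lborel (f t))" if "t \<in> I" for t
  proof -
    have "prob_space (density lborel (f t))" unfolding dist[OF that, symmetric] by (rule prob_space_distr[OF rv[OF that]])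
    then show ?thesis by (intro prob_space_imp_sigma_finite)
  qed
  have ZH: "(\<integral>\<^sup>+\<omega>. H (Z \<omega>) \<partial>M) = (\<integral>\<^sup>+u. \<integral>\<^sup>+v. (\<Prod>j\<in>X. f (Inl j) (u j)) * (\<Prod>j\<in>Y. f (Inr j) (v j)) * H (\<lambda>t\<in>I. case_sum u v t) \<partial>LL Y \<partial>LL X)"
    if H: "H \<in> borel_measurable (\<Pi>\<^sub>M t\<in>I. borel)" for H
  proof -
    have H': "H \<in> borel_measurable (LL I)"
      using H by (simp cong: measurable_cong_sets sets_PiM_cong)
    have "(\<lambda>z. z t) \<in> borel_measurable (LL I)" if "t \<in> I" for t
      using measurable_component_singleton[OF that, of "\<lambda>_. lborel :: real measure"] by simp
    then have fm2: "(\<lambda>z. (\<Prod>t\<in>I. f t (z t)) * H z) \<in> borel_measurable (LL I)"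
      using H' by (intro borel_measurable_times_ennreal borel_measurable_prod_ennreal) (auto intro: measurable_compose[OF _ fm])
    have "(\<integral>\<^sup>+\<omega>. H (Z \<omega>) \<partial>M) = (\<integral>\<^sup>+z. H z \<partial>distr M (\<Pi>\<^sub>M t\<in>I. borel) Z)"
      using H by (subst nn_integral_distr[OF Zm]) auto
    also have "\<dots> = (\<integral>\<^sup>+z. (\<Prod>t\<in>I. f t (z t)) * H z \<partial>LL I)"
      unfolding Zlaw by (rule nn_integral_PiM_density[OF fI fm sfd H'])
    also have "\<dots> = (\<integral>\<^sup>+u. \<integral>\<^sup>+v. (\<Prod>t\<in>I. f t ((\<lambda>t\<in>I. case_sum u v t) t)) * H (\<lambda>t\<in>I. case_sum u v t) \<partial>LL Y \<partial>LL X)"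
      using fm2 unfolding I_def by (intro nn_integral_PiM_Plus fX fY)
    also have "\<dots> = (\<integral>\<^sup>+u. \<integral>\<^sup>+v. (\<Prod>j\<in>X. f (Inl j) (u j)) * (\<Prod>j\<in>Y. f (Inr j) (v j)) * H (\<lambda>t\<in>I. case_sum u v t) \<partial>LL Y \<partial>LL X)"
    proof (intro nn_integral_cong arg_cong2[where f = "(*)"] refl)
      fix u v :: "nat \<Rightarrow> real"
      have "(\<Prod>t\<in>I. f t ((\<lambda>t\<in>I. case_sum u v t) t)) = (\<Prod>t\<in>I. f t (case_sum u v t))" by (intro prod.cong) auto
      then show "(\<Prod>t\<in>I. f t ((\<lambda>t\<in>I. case_sum u v t) t)) = (\<Prod>j\<in>X. f (Inl j) (u j)) * (\<Prod>j\<in>Y. f (Inr j) (v j))"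
        unfolding I_def by (simp add: prod.Plus[OF fX fY] o_def)
    qed
    finally show ?thesis .
  qed
  have "AE \<omega> in M. x j \<omega> > 0" if "j \<in> X" for j
    unfolding distributed_AE2[OF dx[OF that], of "\<lambda>t. 0 < t", simplified] by (simp add: chi_density_def)
  then have xpos: "AE \<omega> in M. \<forall>j\<in>X. x j \<omega> > 0" using fX by (simp add: AE_finite_all)
  define Jv where "Jv \<omega> = (\<lambda>p\<in>{..<n} \<times> {..<n}. J \<omega> $$ p)" for \<omega>
  define g where "g v = (\<lambda>t\<in>I. case t of Inl j \<Rightarrow> fst (recover v j) | Inr j \<Rightarrow> snd (recover v j))" for v
  have gm: "g \<in> (\<Pi>\<^sub>M p\<in>{..<n} \<times> {..<n}. borel) \<rightarrow>\<^sub>M (\<Pi>\<^sub>M t\<in>I. borel)"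
    unfolding g_def
  proof (intro measurable_restrict)
    fix t assume "t \<in> I"
    then show "(\<lambda>v. case t of Inl j \<Rightarrow> fst (recover v j) | Inr j \<Rightarrow> snd (recover v j)) \<in> borel_measurable (\<Pi>\<^sub>M p\<in>{..<n} \<times> {..<n}. borel)"
      using measurable_recover[of _ n] Xn Yn unfolding I_def by (auto simp: le_less)
  qed
  \<comment> \<open>Almost surely the \<open>x\<close> are positive, so the recovered entries are
    the original ones and \<open>Z\<close> is a function of \<open>J\<close> up to a null
    set.\<close>
  have Zg: "AE \<omega> in M. Z \<omega> = g (Jv \<omega>)"
    using J xpos
  proof eventually_elim
    case (elim \<omega>)
    have idx: "Jv \<omega> (i, i') = (if i' = i then (x (Suc i) \<omega>)\<^sup>2 + (if i = 0 then 0 else (y i \<omega>)\<^sup>2)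
      else if i' = Suc i then x (Suc i) \<omega> * y (Suc i) \<omega> else if i = Suc i' then x (Suc i') \<omega> * y (Suc i') \<omega> else 0)"
      if "i < n" "i' < n" for i i'
      unfolding Jv_def elim(1) using that gram_upper_bidiagonal_index[OF that, of "\<lambda>j. x j \<omega>" "\<lambda>j. y j \<omega>"] by simp
    have X': "Suc i \<in> X" if "i < j" "j \<in> X" for i j using that unfolding X_def by auto
    have rx: "fst (recover (Jv \<omega>) j) = x j \<omega>" if "j \<in> X" for j
      by (rule recover_correct(1)[where x = "\<lambda>j. x j \<omega>" and y = "\<lambda>j. y j \<omega>"])
        (use that idx Xn[OF that] X' elim(2) in auto)
    have ry: "snd (recover (Jv \<omega>) j) = y j \<omega>" if "j \<in> Y" for j
    proof (rule recover_correct(2)[where x = "\<lambda>j. x j \<omega>" and y = "\<lambda>j. y j \<omega>"])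
      show "Jv \<omega> (j - 1, j) = x j \<omega> * y j \<omega>" using idx[of "j - 1" j] Yn[OF that] by auto
    qed (use that idx Yn[OF that] YX X' elim(2) in auto)
    show "Z \<omega> = g (Jv \<omega>)" unfolding Z_def g_def
      by (intro restrict_ext) (auto simp: I_def rx ry)
  qed
  define p where "p \<omega> = perturbed_poly s k (\<lambda>j. x j \<omega>) (\<lambda>j. y j \<omega>) (l \<omega>)" for \<omega>
  have "\<forall>\<omega>. degree (p \<omega>) = Suc k \<and> lead_coeff (p \<omega>) = 1" unfolding p_def using perturbed_poly_monic by blast
  moreover have "AE \<omega> in M. eigenvalues_mset (rank_one_perturbation n (J \<omega>) (l \<omega>)) = proots (p \<omega>) + replicate_mset (n - Suc k) 0"
  proof -
    have "AE \<omega> in M. \<forall>j\<in>{m + 1..n}. x j \<omega> = 0" using x0 by (simp add: AE_finite_all)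
    moreover have "AE \<omega> in M. \<forall>j\<in>{m + 1..n - 1}. y j \<omega> = 0" using y0 by (simp add: AE_finite_all)
    ultimately show ?thesis using J
    proof eventually_elim
      case (elim \<omega>)
      obtain n' where n': "n = Suc n'" using \<open>0 < n\<close> by (cases n) auto
      let ?x = "\<lambda>j. x j \<omega>" and ?y = "\<lambda>j. y j \<omega>"
      have cp: "char_poly (rank_one_perturbation n (J \<omega>) (l \<omega>)) =
        cpoly (polA 0 1 n' ?x ?y) - Polynomial.smult (\<i> * of_real (l \<omega>)) (cpoly (polB 0 1 n' ?x ?y))"
        using elim(3) unfolding n' by (rule char_poly_rank_one_perturbation)
      show ?case using sk
      proof
        assume "n \<le> m \<and> s = 0 \<and> Suc k = n"
        then show ?thesis unfolding eigenvalues_mset_def cp by (simp add: p_def perturbed_poly_def n')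
      next
        assume a: "m < n \<and> s = 1 \<and> k = m"
        \<comment> \<open>Of the \<open>e + 1\<close> vanishing diagonal entries one is encoded by
          \<open>s = 1\<close>; each of the other \<open>e\<close> gives an eigenvalue 0.\<close>
        define e where "e = n' - m"
        have e: "n' = m + e" using a n' by (simp add: e_def)
        have "polA 0 1 (m + e) ?x ?y = monom 1 e * polA 1 1 m ?x ?y \<and> polB 0 1 (m + e) ?x ?y = monom 1 e * polB 1 1 m ?x ?y"
          by (rule polAB_zero_tail) (use elim(1,2) n' e in auto)
        then have "char_poly (rank_one_perturbation n (J \<omega>) (l \<omega>)) = monom 1 e * p \<omega>"
          unfolding cp p_def perturbed_poly_def e using a by (simp add: cpoly_mult right_diff_distrib of_real_hom.map_poly_hom_monom)
        moreover have "p \<omega> \<noteq> 0" using perturbed_poly_monic(2) unfolding p_def by (metis coeff_0 degree_0 zero_neq_one)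
        ultimately show ?thesis unfolding eigenvalues_mset_def using a n' by (simp add: proots_monom_mult e_def add.commute)
      qed
    qed
  qed
  moreover have "(\<integral>\<^sup>+\<omega>. G (p \<omega>) \<partial>M) =
      (\<integral>\<^sup>+u. \<integral>\<^sup>+v. \<integral>\<^sup>+t. ?x u *
         ?y v *
         (ennreal (F t) * indicator {0<..} t) * G (perturbed_poly s k u v t) \<partial>lborel \<partial>LL Y \<partial>LL X)"
    if G[measurable]: "G \<in> borel_measurable polyM" for G
  proof -
    define H where "H z t = G (perturbed_poly s k (\<lambda>j. z (Inl j)) (\<lambda>j. z (Inr j)) t)" for z t
    have zc: "(\<lambda>q. fst q t) \<in> borel_measurable ((\<Pi>\<^sub>M t\<in>I. borel) \<Otimes>\<^sub>M (borel :: real measure))" if "t \<in> I" for t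
      by (rule measurable_compose[OF measurable_fst measurable_component_singleton[OF that]])
    have [measurable]: "(\<lambda>q. polA s 1 k (\<lambda>j. fst q (Inl j)) (\<lambda>j. fst q (Inr j))) \<in> (\<Pi>\<^sub>M t\<in>I. borel) \<Otimes>\<^sub>M (borel :: real measure) \<rightarrow>\<^sub>M polyM"
      "(\<lambda>q. polB s 1 k (\<lambda>j. fst q (Inl j)) (\<lambda>j. fst q (Inr j))) \<in> (\<Pi>\<^sub>M t\<in>I. borel) \<Otimes>\<^sub>M (borel :: real measure) \<rightarrow>\<^sub>M polyM"
    proof -
      have 1: "(\<lambda>q. fst q (Inl j)) \<in> borel_measurable ((\<Pi>\<^sub>M t\<in>I. borel) \<Otimes>\<^sub>M (borel :: real measure))" if "1 \<le> j" "j < 1 + Suc k - s" for j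
        by (rule zc) (use that in \<open>auto simp: I_def X_def\<close>)
      have 2: "(\<lambda>q. fst q (Inr j)) \<in> borel_measurable ((\<Pi>\<^sub>M t\<in>I. borel) \<Otimes>\<^sub>M (borel :: real measure))" if "1 \<le> j" "j < 1 + k" for j
        by (rule zc) (use that in \<open>auto simp: I_def Y_def\<close>)
      show "(\<lambda>q. polA s 1 k (\<lambda>j. fst q (Inl j)) (\<lambda>j. fst q (Inr j))) \<in> (\<Pi>\<^sub>M t\<in>I. borel) \<Otimes>\<^sub>M (borel :: real measure) \<rightarrow>\<^sub>M polyM"
        "(\<lambda>q. polB s 1 k (\<lambda>j. fst q (Inl j)) (\<lambda>j. fst q (Inr j))) \<in> (\<Pi>\<^sub>M t\<in>I. borel) \<Otimes>\<^sub>M (borel :: real measure) \<rightarrow>\<^sub>M polyM"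
        using measurable_polAB[where f = "\<lambda>q j. fst q (Inl j)" and g = "\<lambda>q j. fst q (Inr j)" and i = 1, OF 1 2 s1] by simp_all
    qed
    have H: "case_prod H \<in> borel_measurable ((\<Pi>\<^sub>M t\<in>I. borel) \<Otimes>\<^sub>M borel)"
      unfolding H_def perturbed_poly_def case_prod_beta by measurable
    have lm: "l \<in> borel_measurable M" using distributed_measurable[OF dl] by simp
    have Hz: "(\<lambda>t. H z t) \<in> borel_measurable borel" if "z \<in> space (\<Pi>\<^sub>M t\<in>I. borel)" for z
      using measurable_compose[OF measurable_Pair1'[OF that] H] by simp
    define h where "h z = (\<integral>\<^sup>+t. (ennreal (F t) * indicator {0<..} t) * H z t \<partial>lborel)" for z
    have Fm[measurable]: "(\<lambda>t. ennreal (F t) * indicator {0<..} t) \<in> borel_measurable borel"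
      using distributed_borel_measurable[OF dl] by simp
    have dd: "distr M borel l = density lborel (\<lambda>t. ennreal (F t) * indicator {0<..} t)"
      using distributed_distr_eq_density[OF dl] by (simp cong: distr_cong)
    have Hd: "(\<integral>\<^sup>+t. H z t \<partial>distr M borel l) = h z" if "z \<in> space (\<Pi>\<^sub>M t\<in>I. borel)" for z
      unfolding dd h_def using Hz[OF that] by (subst nn_integral_density) auto
    have hm: "h \<in> borel_measurable (\<Pi>\<^sub>M t\<in>I. borel)"
      unfolding h_def by (intro lborel.borel_measurable_nn_integral) (use H in \<open>simp add: case_prod_beta\<close>)
    have pH: "G (p \<omega>) = H (Z \<omega>) (l \<omega>)" for \<omega>
      unfolding p_def H_def by (intro arg_cong[where f = G] perturbed_poly_cong s1) (auto simp: Z_def I_def X_def Y_def)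
    have "(\<integral>\<^sup>+\<omega>. G (p \<omega>) \<partial>M) = (\<integral>\<^sup>+\<omega>. \<integral>\<^sup>+t. H (Z \<omega>) t \<partial>distr M borel l \<partial>M)"
      unfolding pH
      by (rule nn_integral_indep_AE_eq[where X = Jv and Z = Z and g = g and H = H and l = l and
          S = "\<Pi>\<^sub>M p\<in>{..<n} \<times> {..<n}. borel" and T = borel and R = "\<Pi>\<^sub>M t\<in>I. borel"])
        (use ind gm Zg H in \<open>auto simp: Jv_def[abs_def] space_PiM\<close>)
    also have "\<dots> = (\<integral>\<^sup>+\<omega>. h (Z \<omega>) \<partial>M)"
      by (intro nn_integral_cong Hd measurable_space[OF Zm])
    also have "\<dots> = (\<integral>\<^sup>+u. \<integral>\<^sup>+v. (\<Prod>j\<in>X. f (Inl j) (u j)) * (\<Prod>j\<in>Y. f (Inr j) (v j)) * h (\<lambda>t\<in>I. case_sum u v t) \<partial>LL Y \<partial>LL X)"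
      by (rule ZH[OF hm])
    also have "\<dots> = (\<integral>\<^sup>+u. \<integral>\<^sup>+v. \<integral>\<^sup>+t. ?x u *
         ?y v *
         (ennreal (F t) * indicator {0<..} t) * G (perturbed_poly s k u v t) \<partial>lborel \<partial>LL Y \<partial>LL X)"
    proof (intro nn_integral_cong)
      fix u v :: "nat \<Rightarrow> real"
      let ?c = "(\<Prod>j\<in>X. f (Inl j) (u j)) * (\<Prod>j\<in>Y. f (Inr j) (v j))"
      have sp: "(\<lambda>t\<in>I. case_sum u v t) \<in> space (\<Pi>\<^sub>M t\<in>I. borel)" by (simp add: space_PiM)
      have HG: "H (\<lambda>t\<in>I. case_sum u v t) t = G (perturbed_poly s k u v t)" for t
        unfolding H_def by (intro arg_cong[where f = G] perturbed_poly_cong s1) (auto simp: I_def X_def Y_def)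
      have "?c * h (\<lambda>t\<in>I. case_sum u v t) = (\<integral>\<^sup>+t. ?c * ((ennreal (F t) * indicator {0<..} t) * H (\<lambda>t\<in>I. case_sum u v t) t) \<partial>lborel)"
        unfolding h_def using Hz[OF sp] by (intro nn_integral_cmult[symmetric]) auto
      then show "?c * h (\<lambda>t\<in>I. case_sum u v t) = (\<integral>\<^sup>+t. ?x u *
         ?y v *
         (ennreal (F t) * indicator {0<..} t) * G (perturbed_poly s k u v t) \<partial>lborel)"
        unfolding HG by (simp add: f_def mult.assoc)
    qed
    finally show ?thesis .
  qed
  ultimately show ?thesis by blast
qed

section \<open>The hypersurface where the arguments sum to a right angle\<close>

lemma measurable_Arg [measurable]: "Arg \<in> borel_measurable borel"
proof -
  have "Arg = (\<lambda>z. if z = 0 then 0 else Im (Ln z))"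
    by (auto simp: fun_eq_iff Arg_eq_Im_Ln Arg_zero)
  moreover have [measurable]: "Ln \<in> borel_measurable borel" by (rule Ln_measurable)
  then have "(\<lambda>z. if z = 0 then 0 else Im (Ln z)) \<in> borel_measurable borel" by measurable
  ultimately show ?thesis by simp
qed

lemma prod_rcis: "(\<Prod>j\<in>I. rcis (r j) (\<phi> j)) = rcis (\<Prod>j\<in>I. r j) (\<Sum>j\<in>I. \<phi> j)"
  by (induction I rule: infinite_finite_induct) (auto simp: rcis_mult)

text \<open>If the arguments of the \<open>z\<^sub>j\<close> sum to nearly \<open>\<pi>/2\<close>, this is the amount by which they exceed \<open>\<pi>/2\<close>.\<close>
definition arg_defect :: "nat \<Rightarrow> (nat \<Rightarrow> complex) \<Rightarrow> real" where
  "arg_defect N z = Arg (- \<i> * (\<Prod>j = 1..N. z j))"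

text \<open>All \<open>N\<close> points turn by the same angle, so that the angles lose the defect
  in total while moduli and mutual distances stay the same.\<close>

definition rotate_roots :: "nat \<Rightarrow> (nat \<Rightarrow> complex) \<Rightarrow> nat \<Rightarrow> complex" where
  "rotate_roots N z = (\<lambda>j\<in>{1..N}. z j * cis (- arg_defect N z / real N))"

definition slice_dom :: "nat \<Rightarrow> (nat \<Rightarrow> complex) set" where
  "slice_dom N = {z. (\<forall>j\<in>{1..N}. 0 < Im (z j)) \<and> (\<Sum>j = 1..N. Arg (z j)) = pi / 2}"

lemma measurable_arg_defect [measurable]: "arg_defect N \<in> borel_measurable (CC {1..N})"
proof -
  have "(\<lambda>z. \<Prod>j = 1..N. z j) \<in> borel_measurable (CC {1..N})"
    by (intro borel_measurable_prod measurable_CC_component)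
  then show ?thesis unfolding arg_defect_def by measurable
qed

lemma measurable_rotate_roots [measurable]: "rotate_roots N \<in> CC {1..N} \<rightarrow>\<^sub>M CC {1..N}"
  unfolding rotate_roots_def
proof (rule measurable_restrict)
  fix i assume i: "i \<in> {1..N}"
  note [measurable] = measurable_CC_component[OF i]
  have [measurable]: "cis \<in> borel_measurable borel"
    by (intro borel_measurable_continuous_onI continuous_intros)
  have "(\<lambda>z. z i * cis (- arg_defect N z / real N)) \<in> borel_measurable (CC {1..N})" by measurable
  then show "(\<lambda>z. z i * cis (- arg_defect N z / real N)) \<in> CC {1..N} \<rightarrow>\<^sub>M lborel"
    by (simp only: measurable_lborel1)
qed

lemma measurable_slice_dom [measurable]: "Measurable.pred (CC {1..N}) (\<lambda>z. z \<in> slice_dom N)"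
proof -
  have "Measurable.pred (CC {1..N}) (\<lambda>z. \<forall>j\<in>{1..N}. 0 < Im (z j))"
  proof (rule pred_intros_finite)
    fix j assume "j \<in> {1..N}"
    note [measurable] = measurable_CC_component[OF this]
    show "Measurable.pred (CC {1..N}) (\<lambda>z. 0 < Im (z j))" by measurable
  qed simp
  moreover have "(\<lambda>z. \<Sum>j = 1..N. Arg (z j)) \<in> borel_measurable (CC {1..N})"
    by (intro borel_measurable_sum measurable_compose[OF measurable_CC_component measurable_Arg])
  ultimately show ?thesis unfolding slice_dom_def mem_Collect_eq by measurable
qed

text \<open>The fibre formula for a polynomial of degree 1.\<close>

lemma nn_integral_unit_mult:
  fixes f :: "complex \<Rightarrow> ennreal"
  assumes [measurable]: "f \<in> borel_measurable borel" and u: "cmod u = 1"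
  shows "(\<integral>\<^sup>+y. f y \<partial>lborel) = (\<integral>\<^sup>+y. f (u * y) \<partial>lborel)"
proof -
  have u0: "u \<noteq> 0" using u by auto
  have "(\<integral>\<^sup>+ w. ennreal ((cmod (poly (pderiv [:0, u:]) w))\<^sup>2) * f (poly [:0, u:] w) \<partial>lborel) =
    of_nat (degree [:0, u:]) * (\<integral>\<^sup>+ c. f c \<partial>lborel)"
    by (rule nn_integral_poly_fibres) (use u0 in auto)
  then show ?thesis using u u0 by (simp add: pderiv_pCons mult.commute)
qed

context
  fixes m :: nat and K :: "(nat \<Rightarrow> complex) \<Rightarrow> ennreal"
  assumes Km[measurable]: "K \<in> borel_measurable (CC {1..Suc m})"
begin

text \<open>A function on the hypersurface, extended to an open neighbourhood along the common rotations of all points.\<close>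
definition slice_integrand :: "(nat \<Rightarrow> complex) \<Rightarrow> ennreal" where
  "slice_integrand z = (if \<bar>arg_defect (Suc m) z\<bar> < 1 \<and> rotate_roots (Suc m) z \<in> slice_dom (Suc m) then K (rotate_roots (Suc m) z) else 0)"

lemma measurable_slice_integrand [measurable]: "slice_integrand \<in> borel_measurable (CC {1..Suc m})"
proof -
  have [measurable]: "Measurable.pred (CC {1..Suc m}) (\<lambda>z. rotate_roots (Suc m) z \<in> slice_dom (Suc m))"
    by (rule measurable_compose[OF measurable_rotate_roots measurable_slice_dom])
  have [measurable]: "(\<lambda>z. K (rotate_roots (Suc m) z)) \<in> borel_measurable (CC {1..Suc m})"
    by (rule measurable_compose[OF measurable_rotate_roots Km])
  show ?thesis unfolding slice_integrand_def by measurable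
qed

text \<open>\<open>arg_defect\<close> knows the total angle only modulo \<open>2 * pi\<close>.
  Positive angles that sum to \<open>pi / 2\<close> are each at most \<open>pi / 2\<close>, and for
  a defect below 1 the inequality \<open>pi / 2 + 1 < pi\<close> leaves no room for another branch.
  The conditions can therefore be stated in the angles \<open>\<phi>\<close> themselves.\<close>

lemma slice_integrand_polar:
  fixes r \<phi> :: "nat \<Rightarrow> real"
  assumes r: "\<And>j. j \<in> {1..Suc m} \<Longrightarrow> r j > 0"
  defines "t \<equiv> (\<Sum>j = 1..Suc m. \<phi> j) - pi / 2"
  defines "\<gamma> \<equiv> \<lambda>j. \<phi> j - t / real (Suc m)"
  shows "(if \<forall>j\<in>{1..Suc m}. -pi < \<phi> j \<and> \<phi> j < pi then slice_integrand (\<lambda>j\<in>{1..Suc m}. rcis (r j) (\<phi> j)) else 0) =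
    (if \<bar>t\<bar> < 1 \<and> (\<forall>j\<in>{1..Suc m}. 0 < \<gamma> j \<and> \<gamma> j < pi) then K (\<lambda>j\<in>{1..Suc m}. rcis (r j) (\<gamma> j)) else 0)"
proof -
  let ?N = "Suc m"
  note [simp del] = One_nat_def of_nat_Suc sum.cl_ivl_Suc
  define z where "z = (\<lambda>j\<in>{1..?N}. rcis (r j) (\<phi> j))"
  define R where "R = (\<Prod>j = 1..?N. r j)"
  have R: "R > 0" unfolding R_def by (intro prod_pos r) auto
  have "(\<Prod>j = 1..?N. z j) = (\<Prod>j = 1..?N. rcis (r j) (\<phi> j))" by (intro prod.cong) (auto simp: z_def)
  then have pz: "(\<Prod>j = 1..?N. z j) = rcis R (\<Sum>j = 1..?N. \<phi> j)" by (simp only: prod_rcis R_def)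
  have sph: "(\<Sum>j = 1..?N. \<phi> j) = t + pi / 2" by (simp add: t_def)
  have "- \<i> * rcis R (t + pi / 2) = rcis R t"
    by (simp add: complex_eq_iff sin_add cos_add)
  then have tz: "arg_defect ?N z = Arg (rcis R t)" unfolding arg_defect_def pz sph by simp
  define T where "T = arg_defect ?N z"
  have rot: "rotate_roots ?N z = (\<lambda>j\<in>{1..?N}. rcis (r j) (\<phi> j - T / ?N))"
    unfolding rotate_roots_def T_def[symmetric] by (intro restrict_ext) (simp add: z_def rcis_def cis_mult mult.assoc)
  have sum\<gamma>: "(\<Sum>j = 1..?N. \<phi> j - T / real ?N) = t - T + pi / 2" for T
    using sph by (simp add: sum_subtractf del: of_nat_Suc)
  show ?thesis
  proof (cases "\<bar>t\<bar> < 1 \<and> (\<forall>j\<in>{1..?N}. 0 < \<gamma> j \<and> \<gamma> j < pi)")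
    case True
    then have g: "0 < \<gamma> j" "\<gamma> j < pi" if "j \<in> {1..?N}" for j using that by auto
    have s\<gamma>: "(\<Sum>j = 1..?N. \<gamma> j) = pi / 2" unfolding \<gamma>_def using sum\<gamma>[of t] by simp
    have le: "\<gamma> j \<le> pi / 2" if "j \<in> {1..?N}" for j
      using member_le_sum[of j "{1..?N}" \<gamma>] that g s\<gamma> by (simp add: less_imp_le)
    have tN: "\<bar>t / real ?N\<bar> < 1" using True by (auto simp: abs_less_iff field_simps)
    have ph: "-pi < \<phi> j \<and> \<phi> j < pi" if "j \<in> {1..?N}" for j
      using g[OF that] le[OF that] tN pi_gt3 unfolding \<gamma>_def abs_less_iff by linarith
    have "T = t" unfolding T_def tz using True R pi_gt3 by (intro Arg_rcis) auto
    then have rz: "rotate_roots ?N z = (\<lambda>j\<in>{1..?N}. rcis (r j) (\<gamma> j))" unfolding rot \<gamma>_def by simp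
    have A: "Arg (rcis (r j) (\<gamma> j)) = \<gamma> j" if "j \<in> {1..?N}" for j
      using g[OF that] r[OF that] by (intro Arg_rcis) auto
    have "rotate_roots ?N z \<in> slice_dom ?N"
      unfolding slice_dom_def rz using g r s\<gamma> A by (auto intro!: mult_pos_pos sin_gt_zero)
    then have "slice_integrand z = K (\<lambda>j\<in>{1..?N}. rcis (r j) (\<gamma> j))"
      unfolding slice_integrand_def using True \<open>T = t\<close> rz by (simp add: T_def[symmetric])
    then show ?thesis using True ph by (simp add: z_def[symmetric])
  next
    case False
    have "slice_integrand z = 0" if ph: "\<forall>j\<in>{1..?N}. -pi < \<phi> j \<and> \<phi> j < pi"
    proof (rule ccontr)
      assume "slice_integrand z \<noteq> 0"
      then have T1: "\<bar>T\<bar> < 1" and D: "rotate_roots ?N z \<in> slice_dom ?N"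
        unfolding slice_integrand_def T_def by (auto split: if_splits)
      define \<psi> where "\<psi> j = \<phi> j - T / ?N" for j
      have im: "Im (rcis (r j) (\<psi> j)) > 0" if "j \<in> {1..?N}" for j
        using D that unfolding slice_dom_def rot \<psi>_def by auto
      have sA: "(\<Sum>j = 1..?N. Arg (rcis (r j) (\<psi> j))) = pi / 2"
        using D unfolding slice_dom_def rot \<psi>_def by (auto intro!: sum.cong)
      have Apos: "Arg (rcis (r j) (\<psi> j)) > 0" if "j \<in> {1..?N}" for j
        using im[OF that] Arg_lt_pi by blast
      have Ale: "Arg (rcis (r j) (\<psi> j)) \<le> pi / 2" if "j \<in> {1..?N}" for j
        using member_le_sum[of j "{1..?N}" "\<lambda>j. Arg (rcis (r j) (\<psi> j))"] that Apos sA by (simp add: less_imp_le)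
      have TN: "\<bar>T / real ?N\<bar> < 1" using T1 by (auto simp: abs_less_iff field_simps)
      have A\<psi>: "Arg (rcis (r j) (\<psi> j)) = \<psi> j" if j: "j \<in> {1..?N}" for j
      proof -
        have b: "- pi - 1 < \<psi> j" "\<psi> j < pi + 1" using bspec[OF ph j] TN unfolding \<psi>_def abs_less_iff by linarith+
        \<comment> \<open>Beyond \<open>pi\<close> the imaginary part would be negative; at or below
          \<open>- pi\<close> the argument would exceed \<open>pi - 1\<close>, and so
          \<open>pi / 2\<close>.\<close>
        have "\<not> \<psi> j > pi"
        proof
          assume "\<psi> j > pi"
          then have "sin (\<psi> j - pi) > 0" using b pi_gt3 by (intro sin_gt_zero) auto
          then have "sin (\<psi> j) < 0" by (simp add: sin_diff)
          then show False using im[OF j] r[OF j] by (simp add: zero_less_mult_iff)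
        qed
        moreover have "\<not> \<psi> j \<le> - pi"
        proof
          assume "\<psi> j \<le> - pi"
          have "rcis (r j) (\<psi> j) = rcis (r j) (\<psi> j + 2 * pi)" by (simp add: rcis_def complex_eq_iff)
          moreover have "Arg (rcis (r j) (\<psi> j + 2 * pi)) = \<psi> j + 2 * pi"
            using \<open>\<psi> j \<le> - pi\<close> b r[OF j] pi_gt3 by (intro Arg_rcis) auto
          ultimately show False using Ale[OF j] b pi_gt3 by simp
        qed
        ultimately show ?thesis using r[OF j] by (intro Arg_rcis) auto
      qed
      have "(\<Sum>j = 1..?N. \<psi> j) = pi / 2" using sA A\<psi> by simp
      then have "T = t" using sum\<gamma>[of T] unfolding \<psi>_def by linarith
      then have "\<psi> = \<gamma>" by (auto simp: \<psi>_def \<gamma>_def)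
      have "\<gamma> j < pi" if "j \<in> {1..?N}" for j using Ale[OF that] A\<psi>[OF that] pi_gt_zero unfolding \<open>\<psi> = \<gamma>\<close> by linarith
      then show False using False T1 \<open>T = t\<close> Apos A\<psi> unfolding \<open>\<psi> = \<gamma>\<close> by auto
    qed
    then show ?thesis using False by (simp add: z_def[symmetric] del: de_Morgan_conj)
  qed
qed

end

section \<open>Moduli and free angles as coordinates of the hypersurface\<close>

lemma measurable_shear:
  "(\<lambda>\<phi>. \<lambda>j\<in>I. \<phi> j - ((\<Sum>j\<in>I. \<phi> j) - c) / d) \<in> LL I \<rightarrow>\<^sub>M LL I"
proof (rule measurable_restrict)
  fix j assume j: "j \<in> I"
  have [measurable]: "(\<lambda>\<phi>. \<Sum>j\<in>I. \<phi> j) \<in> borel_measurable (LL I)"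
    by (intro borel_measurable_sum) measurable
  show "(\<lambda>\<phi>. \<phi> j - ((\<Sum>j\<in>I. \<phi> j) - c) / d) \<in> LL I \<rightarrow>\<^sub>M lborel" using j by simp
qed

lemma measurable_complete_angles:
  assumes j: "j \<in> {1..Suc m}"
  shows "(\<lambda>\<theta>. complete_angles m \<theta> j) \<in> borel_measurable (LL {1..m})"
proof (cases "j = Suc m")
  case True
  have "(\<lambda>\<theta>. pi / 2 - (\<Sum>j = 1..m. \<theta> j)) \<in> borel_measurable (LL {1..m})"
    by (intro borel_measurable_diff borel_measurable_const borel_measurable_sum) measurable
  then show ?thesis using True by (simp add: complete_angles_def)
next
  case False
  then have "j \<in> {1..m}" using j by auto
  then show ?thesis using False by (simp add: complete_angles_def)
qed

lemma measurable_polar_point [measurable]: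
  "polar_point m \<in> LL {1..Suc m} \<Otimes>\<^sub>M LL {1..m} \<rightarrow>\<^sub>M CC {1..Suc m}"
  unfolding polar_point_def case_prod_beta Suc_eq_plus1[symmetric]
proof (rule measurable_restrict)
  fix j assume j: "j \<in> {1..Suc m}"
  have [measurable]: "(\<lambda>p. complete_angles m (snd p) j) \<in> borel_measurable (LL {1..Suc m} \<Otimes>\<^sub>M LL {1..m})"
    by (rule measurable_compose[OF measurable_snd measurable_complete_angles[OF j]])
  have [measurable]: "(\<lambda>p. fst p j) \<in> borel_measurable (LL {1..Suc m} \<Otimes>\<^sub>M LL {1..m})"
    using measurable_compose[OF measurable_fst, of "\<lambda>p. p j" "LL {1..Suc m}" borel] j by simp
  show "(\<lambda>p. rcis (fst p j) (complete_angles m (snd p) j)) \<in> LL {1..Suc m} \<Otimes>\<^sub>M LL {1..m} \<rightarrow>\<^sub>M lborel"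
    unfolding rcis_def cis_conv_exp measurable_lborel1 by measurable
qed

lemma pred_polar_domain [measurable]:
  "Measurable.pred (LL {1..Suc m} \<Otimes>\<^sub>M LL {1..m}) (\<lambda>p. p \<in> polar_domain m)"
  unfolding polar_domain_def case_prod_beta mem_Collect_eq Suc_eq_plus1[symmetric]
proof (rule pred_intros_finite)
  fix j assume j: "j \<in> {1..Suc m}"
  have [measurable]: "(\<lambda>p. complete_angles m (snd p) j) \<in> borel_measurable (LL {1..Suc m} \<Otimes>\<^sub>M LL {1..m})"
    by (rule measurable_compose[OF measurable_snd measurable_complete_angles[OF j]])
  have [measurable]: "(\<lambda>p. fst p j) \<in> borel_measurable (LL {1..Suc m} \<Otimes>\<^sub>M LL {1..m})"
    using measurable_compose[OF measurable_fst, of "\<lambda>p. p j" "LL {1..Suc m}" borel] j by simp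
  show "Measurable.pred (LL {1..Suc m} \<Otimes>\<^sub>M LL {1..m})
    (\<lambda>p. 0 < fst p j \<and> 0 < complete_angles m (snd p) j \<and> complete_angles m (snd p) j < pi)"
    by measurable
qed simp

text \<open>The last angle is replaced by the defect \<open>t\<close>. Translating the first
  \<open>m\<close> angles by \<open>t / real (Suc m)\<close> then undoes the common rotation, the
  integrand no longer depends on \<open>t\<close>, and the interval of admissible defects
  contributes its length 2.\<close>

lemma nn_integral_shear_slice:
  fixes \<Gamma> :: "(nat \<Rightarrow> real) \<Rightarrow> ennreal"
  assumes \<Gamma>: "\<Gamma> \<in> borel_measurable (LL {1..Suc m})"
  shows "(\<integral>\<^sup>+\<phi>. indicator {-1<..<1} ((\<Sum>j = 1..Suc m. \<phi> j) - c) *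
      \<Gamma> (\<lambda>j\<in>{1..Suc m}. \<phi> j - ((\<Sum>j = 1..Suc m. \<phi> j) - c) / real (Suc m)) \<partial>LL {1..Suc m}) =
    2 * (\<integral>\<^sup>+\<theta>. \<Gamma> (\<lambda>j\<in>{1..Suc m}. (\<theta>(Suc m := c - (\<Sum>j = 1..m. \<theta> j))) j) \<partial>LL {1..m})"
proof -
  let ?N = "Suc m"
  note [simp del] = One_nat_def of_nat_Suc sum.cl_ivl_Suc
  interpret product_sigma_finite "\<lambda>_::nat. lborel :: real measure" by standard
  interpret sm: sigma_finite_measure "LL {1..m}" by (rule sigma_finite_PiM_lborel) simp
  define F where "F \<phi> = indicator {-1<..<1::real} ((\<Sum>j = 1..?N. \<phi> j) - c) *
      \<Gamma> (\<lambda>j\<in>{1..?N}. \<phi> j - ((\<Sum>j = 1..?N. \<phi> j) - c) / real ?N)" for \<phi> :: "nat \<Rightarrow> real"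
  have S[measurable]: "(\<lambda>\<phi>. \<Sum>j = 1..?N. \<phi> j) \<in> borel_measurable (LL {1..?N})"
    by (intro borel_measurable_sum) measurable
  have T: "(\<lambda>\<phi>. \<lambda>j\<in>{1..?N}. \<phi> j - ((\<Sum>j = 1..?N. \<phi> j) - c) / real ?N) \<in> LL {1..?N} \<rightarrow>\<^sub>M LL {1..?N}"
    by (rule measurable_shear)
  have F[measurable]: "F \<in> borel_measurable (LL {1..?N})"
    unfolding F_def using measurable_compose[OF T \<Gamma>] by measurable
  have ins: "{1..?N} = insert ?N {1..m}" by auto
  define s where "s \<theta> = (\<Sum>j = 1..m. \<theta> j)" for \<theta> :: "nat \<Rightarrow> real"
  have s[measurable]: "s \<in> borel_measurable (LL {1..m})"
    unfolding s_def by (intro borel_measurable_sum) measurable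
  define G where "G t \<theta> = (\<lambda>j\<in>{1..?N}. (\<theta>(?N := c - s \<theta> + t)) j - t / real ?N)" for t \<theta>
  have G[measurable]: "case_prod G \<in> lborel \<Otimes>\<^sub>M LL {1..m} \<rightarrow>\<^sub>M LL {1..?N}"
    unfolding G_def case_prod_beta
  proof (intro measurable_restrict)
    fix j assume "j \<in> {1..?N}"
    then consider "j = ?N" | "j \<noteq> ?N" "j \<in> {1..m}" by force
    then show "(\<lambda>p. ((snd p)(?N := c - s (snd p) + fst p)) j - fst p / real ?N) \<in> lborel \<Otimes>\<^sub>M LL {1..m} \<rightarrow>\<^sub>M lborel"
    proof cases
      case 1 then show ?thesis by simp
    next
      case 2
      have [measurable]: "(\<lambda>p. snd p j) \<in> borel_measurable (lborel \<Otimes>\<^sub>M LL {1..m})" using 2 by measurable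
      show ?thesis using 2 by simp
    qed
  qed
  have \<Gamma>G[measurable]: "(\<lambda>p. \<Gamma> (G (fst p) (snd p))) \<in> borel_measurable (lborel \<Otimes>\<^sub>M LL {1..m})"
    using measurable_compose[OF G \<Gamma>] by (simp add: case_prod_beta)
  have "(\<integral>\<^sup>+\<phi>. F \<phi> \<partial>LL {1..?N}) = (\<integral>\<^sup>+\<theta>. \<integral>\<^sup>+y. F (\<theta>(?N := y)) \<partial>lborel \<partial>LL {1..m})"
    using F unfolding ins by (intro product_nn_integral_insert) auto
  also have "\<dots> = (\<integral>\<^sup>+\<theta>. \<integral>\<^sup>+t. indicator {-1<..<1} t * \<Gamma> (G t \<theta>) \<partial>lborel \<partial>LL {1..m})"
  proof (rule nn_integral_cong)
    fix \<theta> assume \<theta>: "\<theta> \<in> space (LL {1..m})"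
    have "(\<lambda>y. \<theta>(?N := y)) \<in> lborel \<rightarrow>\<^sub>M LL (insert ?N {1..m})"
      using \<theta> by (intro measurable_fun_upd[where J="{1..m}"]) auto
    then have [measurable]: "(\<lambda>y. F (\<theta>(?N := y))) \<in> borel_measurable borel"
      using F unfolding ins[symmetric] by simp
    have E: "F (\<theta>(?N := t + (c - s \<theta>))) = indicator {-1<..<1} t * \<Gamma> (G t \<theta>)" for t
    proof -
      have "(\<Sum>j = 1..m. (\<theta>(?N := t + (c - s \<theta>))) j) = s \<theta>" unfolding s_def by (intro sum.cong) auto
      then have "(\<Sum>j = 1..?N. (\<theta>(?N := t + (c - s \<theta>))) j) - c = t" unfolding ins by simp
      then show ?thesis unfolding F_def G_def by (simp add: add.commute)
    qed
    have "(\<integral>\<^sup>+y. F (\<theta>(?N := y)) \<partial>lborel) = (\<integral>\<^sup>+t. F (\<theta>(?N := t + (c - s \<theta>))) \<partial>lborel)"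
      by (rule nn_integral_lborel_translate[symmetric]) measurable
    then show "(\<integral>\<^sup>+y. F (\<theta>(?N := y)) \<partial>lborel) = (\<integral>\<^sup>+t. indicator {-1<..<1} t * \<Gamma> (G t \<theta>) \<partial>lborel)"
      unfolding E .
  qed
  also have "\<dots> = (\<integral>\<^sup>+t. \<integral>\<^sup>+\<theta>. indicator {-1<..<1} t * \<Gamma> (G t \<theta>) \<partial>LL {1..m} \<partial>lborel)"
  proof (rule nn_integral_swap[symmetric])
    have "(\<lambda>p. indicator {-1<..<1} (fst p) * \<Gamma> (G (fst p) (snd p))) \<in> borel_measurable (lborel \<Otimes>\<^sub>M LL {1..m})"
      by measurable
    then show "(\<lambda>(t, \<theta>). indicator {-1<..<1} t * \<Gamma> (G t \<theta>)) \<in> borel_measurable (lborel \<Otimes>\<^sub>M LL {1..m})"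
      by (simp add: case_prod_beta)
  qed (simp_all add: sigma_finite_lborel sigma_finite_PiM_lborel)
  also have "\<dots> = (\<integral>\<^sup>+t. indicator {-1<..<1} (t::real) * (\<integral>\<^sup>+\<theta>. \<Gamma> (G 0 \<theta>) \<partial>LL {1..m}) \<partial>lborel)"
  proof (rule nn_integral_cong)
    fix t :: real
    have [measurable]: "(\<lambda>\<theta>. \<Gamma> (G u \<theta>)) \<in> borel_measurable (LL {1..m})" for u
      using measurable_compose[OF measurable_Pair1'[of u lborel "LL {1..m}"] \<Gamma>G] by simp
    have "(\<integral>\<^sup>+\<theta>. \<Gamma> (G t \<theta>) \<partial>LL {1..m}) =
      (\<integral>\<^sup>+\<theta>. (\<Prod>j = 1..m. 1) * \<Gamma> (G t (\<lambda>j\<in>{1..m}. \<theta> j + t / real ?N)) \<partial>LL {1..m})"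
      by (rule nn_integral_PiM_substitution)
        (auto simp: nn_integral_lborel_translate sigma_finite_lborel)
    also have "\<dots> = (\<integral>\<^sup>+\<theta>. \<Gamma> (G 0 \<theta>) \<partial>LL {1..m})"
    proof (rule nn_integral_cong)
      fix \<theta> :: "nat \<Rightarrow> real"
      have "s (\<lambda>j\<in>{1..m}. \<theta> j + t / real ?N) = s \<theta> + real m * (t / real ?N)"
        unfolding s_def by (simp add: sum.distrib)
      \<comment> \<open>The \<open>m\<close> translations use up \<open>t - t / real ?N\<close>,
        which is exactly the shift of the last angle.\<close>
      moreover have "real m * (t / real ?N) = t - t / real ?N"
        by (simp add: field_simps of_nat_Suc)
      ultimately have "G t (\<lambda>j\<in>{1..m}. \<theta> j + t / real ?N) = G 0 \<theta>"
        unfolding G_def by (intro restrict_ext) auto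
      then show "(\<Prod>j = 1..m. 1) * \<Gamma> (G t (\<lambda>j\<in>{1..m}. \<theta> j + t / real ?N)) = \<Gamma> (G 0 \<theta>)" by simp
    qed
    finally show "(\<integral>\<^sup>+\<theta>. indicator {-1<..<1} t * \<Gamma> (G t \<theta>) \<partial>LL {1..m}) =
      indicator {-1<..<1} t * (\<integral>\<^sup>+\<theta>. \<Gamma> (G 0 \<theta>) \<partial>LL {1..m})"
      by (simp add: nn_integral_cmult)
  qed
  also have "\<dots> = 2 * (\<integral>\<^sup>+\<theta>. \<Gamma> (G 0 \<theta>) \<partial>LL {1..m})"
    by (subst nn_integral_multc) auto
  finally show ?thesis unfolding F_def G_def s_def by simp
qed

text \<open>Polar coordinates in every point give the factors \<open>r j\<close>, and integrating
  out the common defect gives the factor 2.\<close>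

lemma nn_integral_slice:
  fixes K :: "(nat \<Rightarrow> complex) \<Rightarrow> ennreal"
  assumes K[measurable]: "K \<in> borel_measurable (CC {1..Suc m})"
  shows "(\<integral>\<^sup>+z. slice_integrand m K z \<partial>CC {1..Suc m}) =
    2 * (\<integral>\<^sup>+r. \<integral>\<^sup>+\<theta>. indicator (polar_domain m) (r, \<theta>) * (ennreal (\<Prod>j = 1..Suc m. r j) * K (polar_point m (r, \<theta>)))
      \<partial>LL {1..m} \<partial>LL {1..Suc m})"
proof -
  let ?N = "Suc m"
  let ?t = "\<lambda>\<phi>. (\<Sum>j = 1..?N. \<phi> j) - pi / 2"
  let ?I = "\<lambda>r \<theta>. indicator (polar_domain m) (r, \<theta>) * (ennreal (\<Prod>j = 1..?N. r j) * K (polar_point m (r, \<theta>)))"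
  let ?Q = "\<lambda>r \<phi>. \<Prod>j = 1..?N. ennreal (r j) * indicator {0<..} (r j) * indicator {-pi<..<pi} (\<phi> j)"
  note [simp del] = One_nat_def of_nat_Suc sum.cl_ivl_Suc prod.cl_ivl_Suc
  interpret product_sigma_finite "\<lambda>_::nat. lborel :: real measure" by standard
  have rc[measurable]: "(\<lambda>p. rcis (fst p) (snd p)) \<in> borel_measurable (lborel \<Otimes>\<^sub>M (lborel :: real measure))"
    unfolding rcis_def cis_conv_exp by measurable
  define \<Gamma> where "\<Gamma> r \<gamma> = (if \<forall>j\<in>{1..?N}. 0 < \<gamma> j \<and> \<gamma> j < pi then K (\<lambda>j\<in>{1..?N}. rcis (r j) (\<gamma> j)) else 0)" for r \<gamma> :: "nat \<Rightarrow> real"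
  have \<Gamma>: "\<Gamma> r \<in> borel_measurable (LL {1..?N})" for r
  proof -
    have [measurable]: "(\<lambda>\<gamma>. \<lambda>j\<in>{1..?N}. rcis (r j) (\<gamma> j)) \<in> LL {1..?N} \<rightarrow>\<^sub>M CC {1..?N}"
      by (intro measurable_restrict) (simp add: rcis_def cis_conv_exp)
    show ?thesis unfolding \<Gamma>_def by measurable
  qed
  have "(\<integral>\<^sup>+z. slice_integrand m K z \<partial>CC {1..?N}) =
    (\<integral>\<^sup>+r. \<integral>\<^sup>+\<phi>. ?Q r \<phi> *
      slice_integrand m K (\<lambda>j\<in>{1..?N}. rcis (r j) (\<phi> j)) \<partial>LL {1..?N} \<partial>LL {1..?N})"
    using rc by (intro nn_integral_PiM_substitution2 measurable_slice_integrand[OF K])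
      (auto simp: sigma_finite_lborel case_prod_beta intro!: nn_integral_complex_polar)
  also have "\<dots> = (\<integral>\<^sup>+r. 2 * (\<integral>\<^sup>+\<theta>. ?I r \<theta>
      \<partial>LL {1..m}) \<partial>LL {1..?N})"
  proof (rule nn_integral_cong)
    fix r :: "nat \<Rightarrow> real"
    show "(\<integral>\<^sup>+\<phi>. ?Q r \<phi> *
        slice_integrand m K (\<lambda>j\<in>{1..?N}. rcis (r j) (\<phi> j)) \<partial>LL {1..?N}) =
      2 * (\<integral>\<^sup>+\<theta>. ?I r \<theta> \<partial>LL {1..m})"
    proof (cases "\<forall>j\<in>{1..?N}. r j > 0")
      case True
      then have r: "j \<in> {1..?N} \<Longrightarrow> r j > 0" for j by blast
      let ?R = "ennreal (\<Prod>j = 1..?N. r j)"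
      have 1: "?Q r \<phi> *
          slice_integrand m K (\<lambda>j\<in>{1..?N}. rcis (r j) (\<phi> j)) =
        ?R * (indicator {-1<..<1} (?t \<phi>) *
          \<Gamma> r (\<lambda>j\<in>{1..?N}. \<phi> j - ?t \<phi> / real ?N))" (is "_ * ?s = _") for \<phi>
      proof -
        have ra: "(\<lambda>j\<in>{1..?N}. rcis (r j) ((\<lambda>j\<in>{1..?N}. \<phi> j - ?t \<phi> / real ?N) j)) =
          (\<lambda>j\<in>{1..?N}. rcis (r j) (\<phi> j - ?t \<phi> / real ?N))"
          by (rule restrict_ext) simp
        have "?Q r \<phi> = (\<Prod>j = 1..?N. ennreal (r j) * indicator {-pi<..<pi} (\<phi> j))"
          using r by (intro prod.cong) auto
        also have "\<dots> = ?R * (\<Prod>j = 1..?N. indicator {-pi<..<pi} (\<phi> j))"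
          by (subst prod_ennreal[symmetric]) (use r in \<open>auto simp: prod.distrib less_imp_le\<close>)
        also have "(\<Prod>j = 1..?N. indicator {-pi<..<pi} (\<phi> j) :: ennreal) = (if \<forall>j\<in>{1..?N}. -pi < \<phi> j \<and> \<phi> j < pi then 1 else 0)"
          by (auto simp: indicator_def)
        finally have "?Q r \<phi> * ?s = ?R * (if \<forall>j\<in>{1..?N}. -pi < \<phi> j \<and> \<phi> j < pi then ?s else 0)" by simp
        also have "(if \<forall>j\<in>{1..?N}. -pi < \<phi> j \<and> \<phi> j < pi then ?s else 0) =
          (if \<bar>?t \<phi>\<bar> < 1 \<and>
            (\<forall>j\<in>{1..?N}. 0 < \<phi> j - ?t \<phi> / real ?N \<and> \<phi> j - ?t \<phi> / real ?N < pi)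
           then K (\<lambda>j\<in>{1..?N}. rcis (r j) (\<phi> j - ?t \<phi> / real ?N)) else 0)"
          by (rule slice_integrand_polar[OF K r])
        also have "\<dots> = indicator {-1<..<1} (?t \<phi>) *
          \<Gamma> r (\<lambda>j\<in>{1..?N}. \<phi> j - ?t \<phi> / real ?N)"
          unfolding \<Gamma>_def ra indicator_def abs_less_iff greaterThanLessThan_iff
          by (cases "- 1 < (?t \<phi>) \<and> (?t \<phi>) < 1") auto
        finally show ?thesis .
      qed
      have 2: "(\<lambda>\<theta>. \<Gamma> r (\<lambda>j\<in>{1..?N}. (\<theta>(?N := pi / 2 - (\<Sum>j = 1..m. \<theta> j))) j)) \<in> borel_measurable (LL {1..m})"
      proof (rule measurable_compose[OF _ \<Gamma>], rule measurable_restrict)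
        fix j assume "j \<in> {1..?N}"
        from measurable_complete_angles[OF this, unfolded Suc_eq_plus1[symmetric]]
        show "(\<lambda>\<theta>. (\<theta>(?N := pi / 2 - (\<Sum>j = 1..m. \<theta> j))) j) \<in> LL {1..m} \<rightarrow>\<^sub>M lborel"
          by (simp add: complete_angles_def flip: Suc_eq_plus1)
      qed
      have 3: "indicator (polar_domain m) (r, \<theta>) * (?R * K (polar_point m (r, \<theta>))) =
        ?R * \<Gamma> r (\<lambda>j\<in>{1..?N}. (\<theta>(?N := pi / 2 - (\<Sum>j = 1..m. \<theta> j))) j)" for \<theta>
      proof -
        define c where "c = (\<lambda>j\<in>{1..?N}. (\<theta>(?N := pi / 2 - (\<Sum>j = 1..m. \<theta> j))) j)"
        have c: "c j = complete_angles m \<theta> j" if "j \<in> {1..?N}" for j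
          using that unfolding c_def complete_angles_def by simp
        have "(\<lambda>j\<in>{1..?N}. rcis (r j) (c j)) = polar_point m (r, \<theta>)"
          unfolding polar_point_def using c by (auto intro!: restrict_ext)
        moreover have "(r, \<theta>) \<in> polar_domain m \<longleftrightarrow> (\<forall>j\<in>{1..?N}. 0 < c j \<and> c j < pi)"
          using True c unfolding polar_domain_def by auto
        ultimately show ?thesis unfolding c_def[symmetric] \<Gamma>_def indicator_def by auto
      qed
      have 4: "(\<lambda>\<phi>. indicator {-1<..<1} (?t \<phi>) *
          \<Gamma> r (\<lambda>j\<in>{1..?N}. \<phi> j - ?t \<phi> / real ?N)) \<in> borel_measurable (LL {1..?N})"
      proof -
        have [measurable]: "(\<lambda>\<phi>. \<Sum>j = 1..?N. \<phi> j) \<in> borel_measurable (LL {1..?N})"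
          by (intro borel_measurable_sum) measurable
        have [measurable]: "(\<lambda>\<phi>. \<Gamma> r (\<lambda>j\<in>{1..?N}. \<phi> j - ?t \<phi> / real ?N)) \<in> borel_measurable (LL {1..?N})"
          by (rule measurable_compose[OF measurable_shear \<Gamma>])
        show ?thesis by measurable
      qed
      show ?thesis unfolding 1 3 nn_integral_cmult[OF 4] nn_integral_cmult[OF 2] nn_integral_shear_slice[OF \<Gamma>]
        by (simp add: mult_ac)
    next
      case False
      then obtain j where j: "j \<in> {1..?N}" "\<not> r j > 0" by blast
      have Z: "?Q r \<phi> = 0" for \<phi>
        using j by (intro prod_zero bexI[of _ j]) auto
      have "(r, \<theta>) \<notin> polar_domain m" for \<theta> using j unfolding polar_domain_def by auto
      then show ?thesis unfolding Z by simp
    qed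
  qed
  also have "\<dots> = 2 * (\<integral>\<^sup>+r. \<integral>\<^sup>+\<theta>. ?I r \<theta>
      \<partial>LL {1..m} \<partial>LL {1..?N})"
  proof (rule nn_integral_cmult)
    interpret sm: sigma_finite_measure "LL {1..m}" by (rule sigma_finite_PiM_lborel) simp
    have [measurable]: "(\<lambda>r. \<Prod>j = 1..?N. r j) \<in> borel_measurable (LL {1..?N})"
      by (intro borel_measurable_prod) measurable
    have [measurable]: "(\<lambda>p. K (polar_point m p)) \<in> borel_measurable (LL {1..?N} \<Otimes>\<^sub>M LL {1..m})"
      by (rule measurable_compose[OF measurable_polar_point K])
    have "(\<lambda>p. indicator (polar_domain m) p * (ennreal (\<Prod>j = 1..?N. fst p j) * K (polar_point m p)))
      \<in> borel_measurable (LL {1..?N} \<Otimes>\<^sub>M LL {1..m})"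
      by measurable
    then have "case_prod (\<lambda>r \<theta>. ?I r \<theta>)
      \<in> borel_measurable (LL {1..?N} \<Otimes>\<^sub>M LL {1..m})" by (simp add: case_prod_beta)
    then show "(\<lambda>r. \<integral>\<^sup>+\<theta>. ?I r \<theta>
      \<partial>LL {1..m}) \<in> borel_measurable (LL {1..?N})"
      by (rule sm.borel_measurable_nn_integral)
  qed
  finally show ?thesis .
qed

section \<open>Integration over the sector\<close>

text \<open>For a monic polynomial of degree \<open>k + 1\<close> this is a condition on the roots (\<open>sector_iff\<close>); the form
  chosen here is measurable in the coefficients.\<close>
definition sector :: "nat \<Rightarrow> nat \<Rightarrow> complex poly \<Rightarrow> bool" where
  "sector s k p \<longleftrightarrow> Im (coeff p k) < 0 \<and>
     stieltjes_signs s (Suc k) (mpoly 0 (Suc k) (\<lambda>i. Re (coeff p i)))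
       (Polynomial.smult (1 / Im (coeff p k)) (mpoly 0 (Suc k) (\<lambda>i. Im (coeff p i)) - monom 1 (Suc k)))"

lemma measurable_mpoly_coeff:
  assumes "\<And>i. s \<le> i \<Longrightarrow> i < k \<Longrightarrow> (\<lambda>\<omega>. f \<omega> i) \<in> borel_measurable N"
  shows "(\<lambda>\<omega>. mpoly s k (f \<omega>)) \<in> N \<rightarrow>\<^sub>M polyM"
proof (rule measurable_polyM)
  fix i
  show "(\<lambda>\<omega>. coeff (mpoly s k (f \<omega>)) i) \<in> borel_measurable N"
    using assms by (cases "i = k"; cases "s \<le> i"; cases "i < k") (auto simp: coeff_mpoly)
qed

lemma pred_sector [measurable]: "Measurable.pred polyM (sector s k)"
proof -
  have [measurable]: "(\<lambda>p :: complex poly. mpoly 0 (Suc k) (\<lambda>i. Re (coeff p i))) \<in> polyM \<rightarrow>\<^sub>M polyM"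
    "(\<lambda>p :: complex poly. mpoly 0 (Suc k) (\<lambda>i. Im (coeff p i))) \<in> polyM \<rightarrow>\<^sub>M polyM"
    by (rule measurable_mpoly_coeff; measurable)+
  show ?thesis unfolding sector_def by measurable
qed

lemma mpoly_minus_monom: "degree (mpoly 0 (Suc k) c - monom 1 (Suc k)) \<le> k"
  by (intro degree_le) (auto simp: coeff_mpoly coeff_monom)

text \<open>Splitting the coefficients into real and imaginary parts brings \<open>p\<close> into
  the form of \<open>roots_in_sector_iff\<close>. The value \<open>s = 0\<close> asks for a sum
  strictly below \<open>pi / 2\<close>, and \<open>s = 1\<close> for equality.\<close>

lemma sector_iff:
  assumes p: "degree p = Suc k" "lead_coeff p = 1"
  shows "sector s k p \<longleftrightarrow> (\<forall>z\<in>#proots p. Im z > 0) \<and> sumarg (proots p) 0 \<le> pi / 2 \<and>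
    (sumarg (proots p) 0 = pi / 2 \<longleftrightarrow> s \<noteq> 0)"
proof -
  define A where "A = mpoly 0 (Suc k) (\<lambda>i. Re (coeff p i))"
  define Q where "Q = mpoly 0 (Suc k) (\<lambda>i. Im (coeff p i)) - monom 1 (Suc k)"
  have e: "cpoly A + Polynomial.smult \<i> (cpoly Q) = p"
  proof (rule poly_eqI)
    fix i
    show "coeff (cpoly A + Polynomial.smult \<i> (cpoly Q)) i = coeff p i"
      using p by (cases "i \<le> k"; cases "i = Suc k")
        (auto simp: A_def Q_def coeff_mpoly complex_eq_iff coeff_eq_0)
  qed
  have A: "lead_coeff A = 1" "degree A = Suc k" unfolding A_def by (auto simp: coeff_mpoly)
  have Q: "degree Q \<le> k" unfolding Q_def by (rule mpoly_minus_monom)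
  have l: "coeff Q k = Im (coeff p k)" by (simp add: Q_def coeff_mpoly)
  show ?thesis
    using roots_in_sector_iff[OF A Q, of s] unfolding e l
    by (simp add: sector_def A_def Q_def)
qed

text \<open>\<open>mpoly\<close> carries a leading 1, which the subtracted monomial removes from the
  imaginary part. For \<open>s = 1\<close> the constant coefficient is purely imaginary, so the
  parameter space has one real dimension less.\<close>

definition ripoly :: "nat \<Rightarrow> nat \<Rightarrow> (nat \<Rightarrow> real) \<Rightarrow> (nat \<Rightarrow> real) \<Rightarrow> complex poly" where
  "ripoly s k a c = cpoly (mpoly s (Suc k) a) + Polynomial.smult \<i> (cpoly (mpoly 0 (Suc k) c - monom 1 (Suc k)))"

lemma coeff_ripoly:
  "coeff (ripoly s k a c) i = (if i = Suc k then 1 else if i \<le> k then Complex (if s \<le> i then a i else 0) (c i) else 0)"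
  by (auto simp: ripoly_def coeff_mpoly complex_eq_iff)

lemma measurable_ripoly:
  "(\<lambda>q. ripoly s k (fst q) (snd q)) \<in> LL {s..<Suc k} \<Otimes>\<^sub>M LL {0..<Suc k} \<rightarrow>\<^sub>M polyM"
  unfolding ripoly_def
  by (intro measurable_poly_add measurable_cpoly measurable_poly_smult measurable_poly_diff
      measurable_compose[OF measurable_fst measurable_mpoly'] measurable_compose[OF measurable_snd measurable_mpoly']
      measurable_const) (auto intro: measurable_polyM)

lemma sector_ripoly:
  "sector s k (ripoly s k a c) \<longleftrightarrow> c k < 0 \<and>
    stieltjes_signs s (Suc k) (mpoly s (Suc k) a) (Polynomial.smult (1 / c k) (mpoly 0 (Suc k) c - monom 1 (Suc k)))"
proof -
  have "mpoly 0 (Suc k) (\<lambda>i. Re (coeff (ripoly s k a c) i)) = mpoly s (Suc k) a"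
    "mpoly 0 (Suc k) (\<lambda>i. Im (coeff (ripoly s k a c) i)) = mpoly 0 (Suc k) c"
    by (auto intro!: poly_eqI simp: coeff_mpoly coeff_ripoly)
  moreover have "Im (coeff (ripoly s k a c) k) = c k" by (simp add: coeff_ripoly)
  ultimately show ?thesis unfolding sector_def by simp
qed

lemma measurable_perturbed_poly [measurable]:
  assumes "s \<le> 1"
  shows "(\<lambda>q. perturbed_poly s k (fst q) (fst (snd q)) (snd (snd q))) \<in>
    LL {1..<1 + Suc k - s} \<Otimes>\<^sub>M (LL {1..<1 + k} \<Otimes>\<^sub>M lborel) \<rightarrow>\<^sub>M polyM"
proof -
  have m: "(\<lambda>q. (fst q, fst (snd q))) \<in> LL {1..<1 + Suc k - s} \<Otimes>\<^sub>M (LL {1..<1 + k} \<Otimes>\<^sub>M lborel) \<rightarrow>\<^sub>M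
    LL {1..<1 + Suc k - s} \<Otimes>\<^sub>M LL {1..<1 + k}" by measurable
  note p = measurable_compose[OF m measurable_polAB'(1)[OF assms], unfolded fst_conv snd_conv]
    measurable_compose[OF m measurable_polAB'(2)[OF assms], unfolded fst_conv snd_conv]
  show ?thesis unfolding perturbed_poly_def
    by (intro measurable_poly_diff measurable_poly_smult measurable_cpoly p) measurable
qed

text \<open>The imaginary part of the coefficients is \<open>- t B\<close> with \<open>B\<close>
  monic; splitting off \<open>t\<close> scales the \<open>k\<close> free coefficients of
  \<open>B\<close>, which accounts for \<open>t ^ k\<close>. What remains is an integral over pairs
  \<open>(A, B)\<close> in Jacobi coordinates.\<close>

theorem nn_integral_sector:
  fixes K :: "complex poly \<Rightarrow> ennreal"
  assumes K[measurable]: "K \<in> borel_measurable polyM" and s: "s \<le> 1"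
  shows "(\<integral>\<^sup>+a. \<integral>\<^sup>+c. (if sector s k (ripoly s k a c) then K (ripoly s k a c) else 0) \<partial>LL {0..<Suc k} \<partial>LL {s..<Suc k}) =
    (\<integral>\<^sup>+x. \<integral>\<^sup>+y. \<integral>\<^sup>+t. Wx s 1 k x * Wy 1 k y * (indicator {0<..} t * ennreal (t ^ k) * K (perturbed_poly s k x y t))
      \<partial>lborel \<partial>LL {1..<1 + k} \<partial>LL {1..<1 + Suc k - s})"
proof -
  let ?N = "Suc k" and ?X = "LL {1..<1 + Suc k - s}" and ?Y = "LL {1..<1 + k}"
  have sX: "sigma_finite_measure ?X" and sY: "sigma_finite_measure ?Y"
    and sA: "sigma_finite_measure (LL {s..<Suc k})" and sB: "sigma_finite_measure (LL {0..<k})"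
    by (rule sigma_finite_PiM_lborel, simp)+
  interpret sY: sigma_finite_measure ?Y by (rule sY)
  interpret sB: sigma_finite_measure "LL {0..<k}" by (rule sB)
  define G where "G v A B = indicator {0<..} v * ennreal (v ^ k) * K (cpoly A - Polynomial.smult (\<i> * of_real v) (cpoly B))" for v A B
  have Gm[measurable (raw)]: "(\<lambda>\<omega>. G (f \<omega>) (g \<omega>) (h \<omega>)) \<in> borel_measurable N"
    if [measurable]: "f \<in> borel_measurable N" "g \<in> N \<rightarrow>\<^sub>M polyM" "h \<in> N \<rightarrow>\<^sub>M polyM" for f g h and N :: "'z measure"
  proof -
    have [measurable]: "(\<lambda>\<omega>. K (cpoly (g \<omega>) - Polynomial.smult (\<i> * of_real (f \<omega>)) (cpoly (h \<omega>)))) \<in> borel_measurable N"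
      by (rule measurable_compose[OF _ K]) measurable
    show ?thesis unfolding G_def by measurable
  qed
  define H where "H a v b = (if stieltjes_signs s ?N (mpoly s ?N a) (mpoly 0 k b) then G v (mpoly s ?N a) (mpoly 0 k b) else 0)" for a v b
  have inner: "(\<integral>\<^sup>+c. (if sector s k (ripoly s k a c) then K (ripoly s k a c) else 0) \<partial>LL {0..<?N}) =
    (\<integral>\<^sup>+v. \<integral>\<^sup>+b. H a v b \<partial>LL {0..<k} \<partial>lborel)" for a
  proof -
    define A where "A = mpoly s ?N a"
    \<comment> \<open>With the monomial as the fixed polynomial, the step for monic polynomials
      writes \<open>Q - R\<close> as \<open>- v B\<close>.\<close>
    define R where "R = (monom 1 ?N :: real poly)"
    define g where "g Q = (if stieltjes_signs s ?N A (Polynomial.smult (1 / coeff Q k) (Q - R))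
      then K (cpoly A + Polynomial.smult \<i> (cpoly (Q - R))) else 0)" for Q
    have [measurable]: "(\<lambda>_. A) \<in> N \<rightarrow>\<^sub>M polyM" "(\<lambda>_. R) \<in> N \<rightarrow>\<^sub>M polyM" for N :: "real poly measure"
      by (auto intro: measurable_polyM)
    have [measurable]: "(\<lambda>Q. K (cpoly A + Polynomial.smult \<i> (cpoly (Q - R)))) \<in> borel_measurable polyM"
      by (rule measurable_compose[OF _ K]) measurable
    have g: "g \<in> borel_measurable polyM"
      unfolding g_def by measurable
    have "(\<integral>\<^sup>+c. (if sector s k (ripoly s k a c) then K (ripoly s k a c) else 0) \<partial>LL {0..<?N}) =
      (\<integral>\<^sup>+c. indicator {0<..} (coeff R k - c k) * g (mpoly 0 ?N c) \<partial>LL {0..<?N})"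
    proof (rule nn_integral_cong)
      fix c :: "nat \<Rightarrow> real"
      have "coeff (mpoly 0 ?N c) k = c k" by (simp add: coeff_mpoly)
      then show "(if sector s k (ripoly s k a c) then K (ripoly s k a c) else 0) =
        indicator {0<..} (coeff R k - c k) * g (mpoly 0 ?N c)"
        unfolding sector_ripoly by (simp add: g_def R_def A_def indicator_def ripoly_def)
    qed
    also have "\<dots> = (\<integral>\<^sup>+v. indicator {0<..} v * (\<integral>\<^sup>+b. ennreal (v ^ (k - 0)) * g (R - Polynomial.smult v (mpoly 0 k b)) \<partial>LL {0..<k}) \<partial>lborel)"
      by (rule nn_integral_mpoly_step[OF g]) (auto simp: R_def degree_monom_eq)
    also have "\<dots> = (\<integral>\<^sup>+v. \<integral>\<^sup>+b. H a v b \<partial>LL {0..<k} \<partial>lborel)"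
    proof (rule nn_integral_cong)
      fix v :: real
      show "indicator {0<..} v * (\<integral>\<^sup>+b. ennreal (v ^ (k - 0)) * g (R - Polynomial.smult v (mpoly 0 k b)) \<partial>LL {0..<k}) =
        (\<integral>\<^sup>+b. H a v b \<partial>LL {0..<k})"
      proof (cases "v > 0")
        case True
        have "ennreal (v ^ k) * g (R - Polynomial.smult v (mpoly 0 k b)) = H a v b" for b
        proof -
          have "coeff (R - Polynomial.smult v (mpoly 0 k b)) k = - v" by (simp add: R_def coeff_mpoly)
          then show ?thesis using True unfolding g_def H_def G_def A_def by simp
        qed
        then show ?thesis using True by simp
      next
        case False
        then have "H a v b = 0" for b by (simp add: H_def G_def)
        then show ?thesis using False by simp
      qed
    qed
    finally show ?thesis .
  qed
  have Hm: "(\<lambda>q. H (fst (fst q)) (snd (fst q)) (snd q)) \<in> borel_measurable ((LL {s..<?N} \<Otimes>\<^sub>M lborel) \<Otimes>\<^sub>M LL {0..<k})"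
    unfolding H_def by measurable
  define \<Phi> where "\<Phi> x y t = Wx s 1 k x * Wy 1 k y * (indicator {0<..} t * ennreal (t ^ k) * K (perturbed_poly s k x y t))" for x y t
  have "(\<lambda>q. \<Phi> (fst q) (fst (snd q)) (snd (snd q))) \<in> borel_measurable (?X \<Otimes>\<^sub>M (?Y \<Otimes>\<^sub>M lborel))"
  proof -
    have [measurable]: "(\<lambda>q. K (perturbed_poly s k (fst q) (fst (snd q)) (snd (snd q)))) \<in> borel_measurable (?X \<Otimes>\<^sub>M (?Y \<Otimes>\<^sub>M lborel))"
      by (rule measurable_compose[OF measurable_perturbed_poly[OF s] K])
    show ?thesis unfolding \<Phi>_def by measurable
  qed
  then have \<Phi>m: "(\<lambda>\<omega>. \<Phi> (f \<omega>) (g \<omega>) (h \<omega>)) \<in> borel_measurable N"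
    if "f \<in> N \<rightarrow>\<^sub>M ?X" "g \<in> N \<rightarrow>\<^sub>M ?Y" "h \<in> N \<rightarrow>\<^sub>M lborel" for f g h and N :: "'z measure"
    using measurable_compose[OF measurable_Pair[OF that(1) measurable_Pair[OF that(2,3)]],
        of "\<lambda>q. \<Phi> (fst q) (fst (snd q)) (snd (snd q))"] by simp
  have "(\<integral>\<^sup>+a. \<integral>\<^sup>+c. (if sector s k (ripoly s k a c) then K (ripoly s k a c) else 0) \<partial>LL {0..<?N} \<partial>LL {s..<?N}) =
    (\<integral>\<^sup>+a. \<integral>\<^sup>+v. \<integral>\<^sup>+b. H a v b \<partial>LL {0..<k} \<partial>lborel \<partial>LL {s..<?N})"
    unfolding inner ..
  also have "\<dots> = (\<integral>\<^sup>+v. \<integral>\<^sup>+a. \<integral>\<^sup>+b. H a v b \<partial>LL {0..<k} \<partial>LL {s..<?N} \<partial>lborel)"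
    using sB.borel_measurable_nn_integral[of "\<lambda>q. H (fst q) (snd q)" "LL {s..<?N} \<Otimes>\<^sub>M lborel"] Hm
    by (intro nn_integral_swap sA sigma_finite_lborel) (simp add: case_prod_beta')
  also have "\<dots> = (\<integral>\<^sup>+v. \<integral>\<^sup>+x. \<integral>\<^sup>+y. \<Phi> x y v \<partial>?Y \<partial>?X \<partial>lborel)"
  proof (rule nn_integral_cong)
    fix v :: real
    have "(\<lambda>(A, B). G v A B) \<in> borel_measurable (polyM \<Otimes>\<^sub>M polyM)" by measurable
    from nn_integral_jacobi_coordinates[OF this s, of k 1]
    show "(\<integral>\<^sup>+a. \<integral>\<^sup>+b. H a v b \<partial>LL {0..<k} \<partial>LL {s..<?N}) = (\<integral>\<^sup>+x. \<integral>\<^sup>+y. \<Phi> x y v \<partial>?Y \<partial>?X)"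
      unfolding H_def G_def perturbed_poly_def \<Phi>_def by (simp only: mult.assoc)
  qed
  also have "\<dots> = (\<integral>\<^sup>+x. \<integral>\<^sup>+v. \<integral>\<^sup>+y. \<Phi> x y v \<partial>?Y \<partial>lborel \<partial>?X)"
    using sY.borel_measurable_nn_integral[of "\<lambda>q y. \<Phi> (snd q) y (fst q)" "lborel \<Otimes>\<^sub>M ?X"]
    by (intro nn_integral_swap sX sigma_finite_lborel) (simp add: case_prod_beta' \<Phi>m)
  also have "\<dots> = (\<integral>\<^sup>+x. \<integral>\<^sup>+y. \<integral>\<^sup>+v. \<Phi> x y v \<partial>lborel \<partial>?Y \<partial>?X)"
    by (intro nn_integral_cong nn_integral_swap sY sigma_finite_lborel)
      (simp add: case_prod_beta' \<Phi>m)
  finally show ?thesis unfolding \<Phi>_def .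
qed

section \<open>Complex coefficients in terms of their real and imaginary parts\<close>

lemma measurable_Complex:
  "(\<lambda>(x, y). Complex x y) \<in> lborel \<Otimes>\<^sub>M lborel \<rightarrow>\<^sub>M (lborel :: complex measure)"
proof -
  have "(\<lambda>p. of_real (fst p) + \<i> * of_real (snd p)) \<in> borel_measurable (lborel \<Otimes>\<^sub>M (lborel :: real measure))" by measurable
  then show ?thesis by (simp add: case_prod_beta' Complex_eq)
qed

lemma nn_integral_CC_Complex:
  assumes I: "finite I" and F: "F \<in> borel_measurable (CC I)"
  shows "(\<integral>\<^sup>+q. F q \<partial>CC I) = (\<integral>\<^sup>+a. \<integral>\<^sup>+c. F (\<lambda>i\<in>I. Complex (a i) (c i)) \<partial>LL I \<partial>LL I)"
proof -
  have "(\<integral>\<^sup>+q. F q \<partial>CC I) = (\<integral>\<^sup>+a. \<integral>\<^sup>+c. (\<Prod>i\<in>I. 1) * F (\<lambda>i\<in>I. Complex (a i) (c i)) \<partial>LL I \<partial>LL I)"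
    by (rule nn_integral_PiM_substitution2[OF sigma_finite_lborel sigma_finite_lborel
        sigma_finite_lborel I measurable_Complex _ _ F])
      (simp_all add: nn_integral_complex)
  then show ?thesis by simp
qed

lemma nn_integral_ripoly_0:
  fixes G :: "complex poly \<Rightarrow> ennreal"
  assumes G: "G \<in> borel_measurable polyM"
  shows "(\<integral>\<^sup>+a. \<integral>\<^sup>+c. G (ripoly 0 k a c) \<partial>LL {0..<Suc k} \<partial>LL {0..<Suc k}) = (\<integral>\<^sup>+q. G (mpoly 0 (Suc k) q) \<partial>CC {0..<Suc k})"
proof -
  have "mpoly 0 (Suc k) (\<lambda>i\<in>{0..<Suc k}. Complex (a i) (c i)) = ripoly 0 k a c" for a c
    by (intro poly_eqI) (simp add: coeff_mpoly coeff_ripoly)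
  moreover have "(\<lambda>q. G (mpoly 0 (Suc k) q)) \<in> borel_measurable (CC {0..<Suc k})"
    by (rule measurable_compose[OF measurable_mpoly' G])
  ultimately show ?thesis by (subst nn_integral_CC_Complex) simp_all
qed

text \<open>The constant coefficient keeps only its imaginary part \<open>t\<close>, while real and
  imaginary parts of the others pair up; the real parts start at index 1 and are shifted to
  match.\<close>

lemma nn_integral_ripoly_1:
  fixes G :: "complex poly \<Rightarrow> ennreal"
  assumes G: "G \<in> borel_measurable polyM"
  shows "(\<integral>\<^sup>+a. \<integral>\<^sup>+c. G (ripoly 1 m a c) \<partial>LL {0..<Suc m} \<partial>LL {1..<Suc m}) =
    (\<integral>\<^sup>+t. \<integral>\<^sup>+q. G (pCons (\<i> * of_real t) (mpoly 0 m q)) \<partial>CC {0..<m} \<partial>lborel)"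
proof -
  interpret product_sigma_finite "\<lambda>_::nat. lborel :: real measure" by standard
  note sf = sigma_finite_lborel
  have s0: "sigma_finite_measure (LL {0..<m})" and s1: "sigma_finite_measure (LL {1..<Suc m})"
    by (rule sigma_finite_PiM_lborel, simp)+
  interpret s0: sigma_finite_measure "LL {0..<m}" by (rule s0)
  let ?sh = "\<lambda>x :: nat \<Rightarrow> real. \<lambda>j\<in>{1..<Suc m}. x (inv_into {0..<m} Suc j)"
  have bij: "bij_betw Suc {0..<m} {1..<Suc m}" by (auto simp: bij_betw_def image_Suc_atLeastLessThan)
  have inv: "inv_into {0..<m} Suc (Suc i) = i" if "i < m" for i using that by (intro inv_into_f_eq) auto
  define \<Psi> where "\<Psi> a t c = G (pCons (\<i> * of_real t) (mpoly 0 m (\<lambda>i. Complex (a i) (c i))))" for a c :: "nat \<Rightarrow> real" and t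
  have \<Psi>m: "(\<lambda>q. \<Psi> (fst q) (fst (snd q)) (snd (snd q))) \<in> borel_measurable (LL {0..<m} \<Otimes>\<^sub>M (lborel \<Otimes>\<^sub>M LL {0..<m}))"
    unfolding \<Psi>_def
  proof (rule measurable_compose[OF _ G], rule measurable_pCons[OF _ measurable_mpoly_coeff])
    fix i assume "0 \<le> i" "i < m"
    then have "i \<in> {0..<m}" by simp
    then have c: "(\<lambda>x. x i) \<in> borel_measurable (LL {0..<m})" by measurable
    have [measurable]: "(\<lambda>q. fst q i) \<in> borel_measurable (LL {0..<m} \<Otimes>\<^sub>M (lborel \<Otimes>\<^sub>M LL {0..<m}))"
      "(\<lambda>q. snd (snd q) i) \<in> borel_measurable (LL {0..<m} \<Otimes>\<^sub>M (lborel \<Otimes>\<^sub>M LL {0..<m}))"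
      by (rule measurable_compose[OF measurable_fst c],
        rule measurable_compose[OF measurable_compose[OF measurable_snd measurable_snd] c])
    have "(\<lambda>q. complex_of_real (fst q i) + \<i> * of_real (snd (snd q) i)) \<in> borel_measurable (LL {0..<m} \<Otimes>\<^sub>M (lborel \<Otimes>\<^sub>M LL {0..<m}))"
      by measurable
    then show "(\<lambda>q. Complex (fst q i) (snd (snd q) i)) \<in> borel_measurable (LL {0..<m} \<Otimes>\<^sub>M (lborel \<Otimes>\<^sub>M LL {0..<m}))"
      by (simp only: Complex_eq)
  qed measurable
  have e: "ripoly 1 m (?sh a) ((?sh c)(0 := t)) = pCons (\<i> * of_real t) (mpoly 0 m (\<lambda>i. Complex (a i) (c i)))" for a c t
  proof (rule poly_eqI)
    fix i
    show "coeff (ripoly 1 m (?sh a) ((?sh c)(0 := t))) i = coeff (pCons (\<i> * of_real t) (mpoly 0 m (\<lambda>i. Complex (a i) (c i)))) i"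
      by (cases i) (auto simp: coeff_ripoly coeff_mpoly complex_eq_iff inv)
  qed
  define R where "R a c = G (ripoly 1 m a c)" for a c
  have Rm: "(\<lambda>q. R (fst q) (snd q)) \<in> borel_measurable (LL {1..<Suc m} \<Otimes>\<^sub>M LL {0..<Suc m})"
    unfolding R_def by (rule measurable_compose[OF measurable_ripoly G])
  have ins: "{0..<Suc m} = insert 0 {1..<Suc m}" by auto
  have "(\<integral>\<^sup>+a. \<integral>\<^sup>+c. R a c \<partial>LL {0..<Suc m} \<partial>LL {1..<Suc m}) =
    (\<integral>\<^sup>+a. \<integral>\<^sup>+c. R (?sh a) c \<partial>LL {0..<Suc m} \<partial>LL {0..<m})"
  proof (rule nn_integral_PiM_reindex[OF sf _ bij])
    interpret t: sigma_finite_measure "LL {0..<Suc m}" by (rule sigma_finite_PiM_lborel) simp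
    show "(\<lambda>a. \<integral>\<^sup>+c. R a c \<partial>LL {0..<Suc m}) \<in> borel_measurable (LL {1..<Suc m})"
      using Rm by (intro t.borel_measurable_nn_integral) (simp add: case_prod_beta')
  qed simp
  also have "\<dots> = (\<integral>\<^sup>+a. \<integral>\<^sup>+t. \<integral>\<^sup>+c. \<Psi> a t c \<partial>LL {0..<m} \<partial>lborel \<partial>LL {0..<m})"
  proof (rule nn_integral_cong)
    fix a :: "nat \<Rightarrow> real" assume a: "a \<in> space (LL {0..<m})"
    have "?sh a \<in> space (LL {1..<Suc m})" by (auto simp: space_PiM)
    then have Ra: "R (?sh a) \<in> borel_measurable (LL {0..<Suc m})"
      using measurable_compose[OF measurable_Pair1' Rm] by simp
    have "(\<integral>\<^sup>+c. R (?sh a) c \<partial>LL {0..<Suc m}) = (\<integral>\<^sup>+t. \<integral>\<^sup>+c. R (?sh a) (c(0 := t)) \<partial>LL {1..<Suc m} \<partial>lborel)"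
      using Ra unfolding ins by (intro product_nn_integral_insert_rev) auto
    also have "\<dots> = (\<integral>\<^sup>+t. \<integral>\<^sup>+c. R (?sh a) ((?sh c)(0 := t)) \<partial>LL {0..<m} \<partial>lborel)"
    proof (intro nn_integral_cong nn_integral_PiM_reindex[OF sf _ bij])
      fix t :: real
      have "(\<lambda>c. c(0 := t)) \<in> LL {1..<Suc m} \<rightarrow>\<^sub>M LL (insert 0 {1..<Suc m})"
        by (rule measurable_fun_upd[where J = "{1..<Suc m}"]) auto
      then show "(\<lambda>c. R (?sh a) (c(0 := t))) \<in> borel_measurable (LL {1..<Suc m})"
        using Ra unfolding ins by (rule measurable_compose)
    qed simp
    finally show "(\<integral>\<^sup>+c. R (?sh a) c \<partial>LL {0..<Suc m}) = (\<integral>\<^sup>+t. \<integral>\<^sup>+c. \<Psi> a t c \<partial>LL {0..<m} \<partial>lborel)"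
      unfolding R_def e \<Psi>_def .
  qed
  also have "\<dots> = (\<integral>\<^sup>+t. \<integral>\<^sup>+a. \<integral>\<^sup>+c. \<Psi> a t c \<partial>LL {0..<m} \<partial>LL {0..<m} \<partial>lborel)"
  proof (rule nn_integral_swap[OF s0 sf])
    have "(\<lambda>q. \<Psi> (fst (fst q)) (snd (fst q)) (snd q)) \<in> borel_measurable ((LL {0..<m} \<Otimes>\<^sub>M lborel) \<Otimes>\<^sub>M LL {0..<m})"
      using measurable_compose[OF _ \<Psi>m, of "\<lambda>q. (fst (fst q), (snd (fst q), snd q))" "(LL {0..<m} \<Otimes>\<^sub>M lborel) \<Otimes>\<^sub>M LL {0..<m}"]
      by simp
    then show "(\<lambda>(a, t). \<integral>\<^sup>+c. \<Psi> a t c \<partial>LL {0..<m}) \<in> borel_measurable (LL {0..<m} \<Otimes>\<^sub>M lborel)"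
      using s0.borel_measurable_nn_integral[of "\<lambda>q c. \<Psi> (fst q) (snd q) c" "LL {0..<m} \<Otimes>\<^sub>M lborel"]
      by (simp add: case_prod_beta')
  qed
  also have "\<dots> = (\<integral>\<^sup>+t. \<integral>\<^sup>+q. G (pCons (\<i> * of_real t) (mpoly 0 m q)) \<partial>CC {0..<m} \<partial>lborel)"
  proof (rule nn_integral_cong)
    fix t :: real
    have "(\<lambda>q. G (pCons (\<i> * of_real t) (mpoly 0 m q))) \<in> borel_measurable (CC {0..<m})"
      by (rule measurable_compose[OF _ G]) measurable
    moreover have "mpoly 0 m (\<lambda>i\<in>{0..<m}. Complex (a i) (c i)) = mpoly 0 m (\<lambda>i. Complex (a i) (c i))" for a c
      by (intro poly_eqI) (simp add: coeff_mpoly)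
    ultimately show "(\<integral>\<^sup>+a. \<integral>\<^sup>+c. \<Psi> a t c \<partial>LL {0..<m} \<partial>LL {0..<m}) = (\<integral>\<^sup>+q. G (pCons (\<i> * of_real t) (mpoly 0 m q)) \<partial>CC {0..<m})"
      unfolding \<Psi>_def by (subst nn_integral_CC_Complex) simp_all
  qed
  finally show ?thesis unfolding R_def .
qed

text \<open>Arguments that sum to \<open>pi / 2\<close> make the product of the roots
  \<open>\<i>\<close> times a positive number.\<close>

lemma sector_coeff_0:
  assumes "degree p = Suc k" "lead_coeff p = 1" "sector 1 k p"
  shows "coeff p 0 = \<i> * (-1) ^ Suc k * of_real (\<Prod>z\<in>#proots p. cmod z)" "(\<Prod>z\<in>#proots p. cmod z) > 0"
proof -
  have s: "\<forall>z\<in>#proots p. Im z > 0" "sumarg (proots p) 0 = pi / 2"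
    using assms(3) unfolding sector_iff[OF assms(1,2)] by auto
  have "(-1) ^ Suc k * coeff p 0 = of_real (\<Prod>z\<in>#proots p. cmod z) * \<i>"
    using monic_poly_polar[OF assms(2,1), of 0] s(2) by (simp add: poly_0_coeff_0)
  then have "(-1) ^ Suc k * ((-1) ^ Suc k * coeff p 0) = (-1) ^ Suc k * (of_real (\<Prod>z\<in>#proots p. cmod z) * \<i>)"
    by (rule arg_cong)
  then show "coeff p 0 = \<i> * (-1) ^ Suc k * of_real (\<Prod>z\<in>#proots p. cmod z)"
    by (simp only: mult.assoc[symmetric] power_mult_distrib[symmetric]) (simp add: mult_ac)
  show "(\<Prod>z\<in>#proots p. cmod z) > 0" using prod_mset_norm_pos[OF s(1), of 0] by simp
qed

text \<open>For \<open>u \<noteq> 0\<close> and monic \<open>p\<close> of degree \<open>N\<close>,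
  the monic polynomial whose roots are those of \<open>p\<close> multiplied by
  \<open>u\<close>.\<close>

definition rotate_poly :: "complex \<Rightarrow> nat \<Rightarrow> complex poly \<Rightarrow> complex poly" where
  "rotate_poly u N p = Polynomial.smult (u ^ N) (pcompose p [:0, inverse u:])"

lemma coeff_rotate_poly: "coeff (rotate_poly u N p) i = u ^ N * inverse u ^ i * coeff p i"
  by (simp add: rotate_poly_def coeff_pcompose_linear)

lemma rotate_poly_rootpoly:
  assumes "u \<noteq> 0"
  shows "rotate_poly u N (rootpoly N z) = rootpoly N (\<lambda>j. z j * u)"
proof -
  have "rotate_poly u N (rootpoly N z) = (\<Prod>j = 1..N. Polynomial.smult u (pcompose [:- z j, 1:] [:0, inverse u:]))"
    unfolding rotate_poly_def rootpoly_def pcompose_prod prod_smult by simp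
  also have "\<dots> = rootpoly N (\<lambda>j. z j * u)"
    unfolding rootpoly_def using assms by (intro prod.cong) (auto simp: pcompose_pCons)
  finally show ?thesis .
qed

lemma coeff_0_rootpoly: "coeff (rootpoly n z) 0 = (-1) ^ n * (\<Prod>j = 1..n. z j)"
proof -
  have "poly (rootpoly n z) 0 = (\<Prod>j = 1..n. (-1) * z j)" unfolding rootpoly_def poly_prod by simp
  also have "\<dots> = (-1) ^ n * (\<Prod>j = 1..n. z j)" by (simp only: prod.distrib) simp
  finally show ?thesis by (simp add: poly_0_coeff_0)
qed

lemma slice_dom_iff_sector: "z \<in> slice_dom (Suc m) \<longleftrightarrow> sector 1 m (rootpoly (Suc m) z)"
  unfolding slice_dom_def sector_iff[OF rootpoly_monic(1,2)] proots_rootpoly sumarg_def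
  by (auto simp: sum_unfold_sum_mset image_mset.compositionality o_def)

lemma ennreal_mult_inverse_real: "x > 0 \<Longrightarrow> ennreal x * ennreal (1 / x) = 1"
  by (simp add: ennreal_mult[symmetric])

lemma vandermonde_mult:
  assumes "cmod u = 1"
  shows "vandermonde N (\<lambda>j. z j * u) = vandermonde N z"
  unfolding vandermonde_def by (simp add: left_diff_distrib[symmetric] norm_mult assms)

lemma vandermonde_cong: "(\<And>j. 1 \<le> j \<Longrightarrow> j \<le> n \<Longrightarrow> z j = z' j) \<Longrightarrow> vandermonde n z = vandermonde n z'"
  unfolding vandermonde_def by (intro prod.cong) auto

lemma measurable_rotate_poly [measurable (raw)]:
  "f \<in> borel_measurable N \<Longrightarrow> g \<in> N \<rightarrow>\<^sub>M polyM \<Longrightarrow> (\<lambda>\<omega>. rotate_poly (f \<omega>) k (g \<omega>)) \<in> N \<rightarrow>\<^sub>M polyM"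
  by (intro measurable_polyM) (simp add: coeff_rotate_poly)

lemma measurable_cis [measurable]: "cis \<in> borel_measurable borel"
  by (intro borel_measurable_continuous_onI continuous_intros)

text \<open>One integral over the thickened hypersurface is computed twice: in the roots it is twice
  the left side, and through the coefficients, with polar coordinates for the constant one, it is
  twice the right side. Both factors 2 are the length of the interval of defects.\<close>

theorem nn_integral_polar_sector:
  fixes G :: "complex poly \<Rightarrow> ennreal"
  assumes G[measurable]: "G \<in> borel_measurable polyM"
  shows "(\<integral>\<^sup>+r. \<integral>\<^sup>+\<theta>. indicator (polar_domain m) (r, \<theta>) *
      (ennreal (vandermonde (Suc m) (polar_point m (r, \<theta>))) * G (rootpoly (Suc m) (polar_point m (r, \<theta>)))) \<partial>LL {1..m} \<partial>LL {1..Suc m}) =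
    ennreal (fact (Suc m)) * (\<integral>\<^sup>+a. \<integral>\<^sup>+c. (if sector 1 m (ripoly 1 m a c) then G (ripoly 1 m a c) else 0) \<partial>LL {0..<Suc m} \<partial>LL {1..<Suc m})"
    (is "?L = _ * ?R")
proof -
  let ?N = "Suc m"
  let ?z = "\<lambda>r \<theta>. polar_point m (r, \<theta>)"
  note [simp del] = One_nat_def of_nat_Suc prod.cl_ivl_Suc fact_Suc power_Suc
  \<comment> \<open>Normalises the constant coefficient: the argument of
    \<open>\<eta> * coeff p 0\<close> is the defect, so on the hypersurface this number is
    positive.\<close>
  define \<eta> :: complex where "\<eta> = - \<i> * (-1) ^ ?N"
  have \<eta>: "cmod \<eta> = 1" "\<eta> * (\<i> * (-1) ^ ?N) = 1"
    by (simp_all add: \<eta>_def norm_mult norm_power mult_ac power_mult_distrib[symmetric])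
  define S where "S p = (if sector 1 m p then G p else 0)" for p
  have S[measurable]: "S \<in> borel_measurable polyM" unfolding S_def by measurable
  \<comment> \<open>The modulus of the constant coefficient is the product of the moduli of the
    roots, so this weight cancels the factors \<open>r j\<close> in the one computation and the
    radius of the constant coefficient in the other.\<close>
  define W where "W p = ennreal (1 / cmod (coeff p 0)) * S p" for p
  have W[measurable]: "W \<in> borel_measurable polyM" unfolding W_def by measurable
  define K where "K z = ennreal (vandermonde ?N z) * (ennreal (1 / cmod (coeff (rootpoly ?N z) 0)) * G (rootpoly ?N z))" for z
  have K[measurable]: "K \<in> borel_measurable (CC {1..?N})"
    unfolding K_def by measurable
  define U where "U p = cis (- Arg (\<eta> * coeff p 0) / real ?N)" for p
  have U[measurable]: "U \<in> borel_measurable polyM" unfolding U_def by measurable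
  define H where "H p = (if \<bar>Arg (\<eta> * coeff p 0)\<bar> < 1 then W (rotate_poly (U p) ?N p) else 0)" for p
  have H[measurable]: "H \<in> borel_measurable polyM"
  proof -
    have [measurable]: "(\<lambda>p. W (rotate_poly (U p) ?N p)) \<in> borel_measurable polyM"
      by (rule measurable_compose[OF _ W]) measurable
    show ?thesis unfolding H_def by measurable
  qed
  have slice: "slice_integrand m K z = ennreal (vandermonde ?N z) * H (rootpoly ?N z)" for z
  proof -
    have "\<eta> * coeff (rootpoly ?N z) 0 = - \<i> * (\<Prod>j = 1..?N. z j)"
      unfolding coeff_0_rootpoly \<eta>_def by (simp add: mult.assoc power_mult_distrib[symmetric] flip: mult.assoc[of "(-1) ^ ?N"])
    then have t: "Arg (\<eta> * coeff (rootpoly ?N z) 0) = arg_defect ?N z" by (simp add: arg_defect_def)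
    define u where "u = U (rootpoly ?N z)"
    have u: "u = cis (- arg_defect ?N z / real ?N)" unfolding u_def U_def t ..
    have "rootpoly ?N (rotate_roots ?N z) = rootpoly ?N (\<lambda>j. z j * u)"
      unfolding rotate_roots_def u by (intro rootpoly_cong) auto
    also have "\<dots> = rotate_poly u ?N (rootpoly ?N z)" by (intro rotate_poly_rootpoly[symmetric]) (simp add: u)
    finally have r: "rootpoly ?N (rotate_roots ?N z) = rotate_poly u ?N (rootpoly ?N z)" .
    have "vandermonde ?N (rotate_roots ?N z) = vandermonde ?N (\<lambda>j. z j * u)"
      unfolding rotate_roots_def u by (intro vandermonde_cong) auto
    then have v: "vandermonde ?N (rotate_roots ?N z) = vandermonde ?N z" by (simp add: vandermonde_mult u)
    show ?thesis unfolding slice_integrand_def[OF K] H_def t slice_dom_iff_sector K_def W_def S_def v r u_def by simp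
  qed
  have PD: "indicator (polar_domain m) (r, \<theta>) * (ennreal (\<Prod>j = 1..?N. r j) * K (?z r \<theta>)) =
    indicator (polar_domain m) (r, \<theta>) * (ennreal (vandermonde ?N (?z r \<theta>)) * G (rootpoly ?N (?z r \<theta>)))" for r \<theta>
  proof (cases "(r, \<theta>) \<in> polar_domain m")
    case True
    then have r: "\<And>j. j \<in> {1..?N} \<Longrightarrow> r j > 0" unfolding polar_domain_def by auto
    have "cmod (\<Prod>j = 1..?N. ?z r \<theta> j) = (\<Prod>j = 1..?N. r j)"
      unfolding prod_norm[symmetric] using r by (intro prod.cong) (auto simp: polar_point_def abs_of_pos)
    then have c: "cmod (coeff (rootpoly ?N (?z r \<theta>)) 0) = (\<Prod>j = 1..?N. r j)"
      unfolding coeff_0_rootpoly by (simp add: norm_mult norm_power)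
    have R: "(\<Prod>j = 1..?N. r j) > 0" by (intro prod_pos r) simp
    have RR: "ennreal (\<Prod>j = 1..?N. r j) * ennreal (1 / (\<Prod>j = 1..?N. r j)) = 1"
      by (rule ennreal_mult_inverse_real[OF R])
    have "ennreal (\<Prod>j = 1..?N. r j) * K (?z r \<theta>) =
      (ennreal (\<Prod>j = 1..?N. r j) * ennreal (1 / (\<Prod>j = 1..?N. r j))) *
      (ennreal (vandermonde ?N (?z r \<theta>)) * G (rootpoly ?N (?z r \<theta>)))"
      unfolding K_def c by (simp only: mult_ac)
    then show ?thesis unfolding RR by simp
  qed simp
  have "2 * ?L = (\<integral>\<^sup>+z. slice_integrand m K z \<partial>CC {1..?N})"
    unfolding nn_integral_slice[OF K] PD ..
  also have "\<dots> = ennreal (fact ?N) * (\<integral>\<^sup>+p. H (mpoly 0 ?N p) \<partial>CC {0..<?N})"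
    unfolding slice by (rule nn_integral_roots_coefficients[OF H])
  also have "(\<integral>\<^sup>+p. H (mpoly 0 ?N p) \<partial>CC {0..<?N}) = (\<integral>\<^sup>+q. \<integral>\<^sup>+c. H (pCons c (mpoly 0 m q)) \<partial>lborel \<partial>CC {0..<m})"
    by (rule nn_integral_mpoly_pCons[OF H])
  also have "\<dots> = (\<integral>\<^sup>+c. \<integral>\<^sup>+q. H (pCons c (mpoly 0 m q)) \<partial>CC {0..<m} \<partial>lborel)"
  proof (rule nn_integral_swap)
    have "(\<lambda>p. H (pCons (snd p) (mpoly 0 m (fst p)))) \<in> borel_measurable (CC {0..<m} \<Otimes>\<^sub>M lborel)"
      by (rule measurable_compose[OF _ H]) measurable
    then show "(\<lambda>(q, c). H (pCons c (mpoly 0 m q))) \<in> borel_measurable (CC {0..<m} \<Otimes>\<^sub>M lborel)"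
      by (simp add: case_prod_beta')
  qed (simp_all add: sigma_finite_PiM_lborel sigma_finite_lborel)
  also have "\<dots> = 2 * (\<integral>\<^sup>+t. \<integral>\<^sup>+q. S (pCons (\<i> * of_real t) (mpoly 0 m q)) \<partial>CC {0..<m} \<partial>lborel)"
  proof -
    interpret sq: sigma_finite_measure "CC {0..<m}" by (rule sigma_finite_PiM_lborel) simp
    define P where "P \<rho> q = pCons (\<i> * (-1) ^ ?N * complex_of_real \<rho>) (mpoly 0 m q)" for \<rho> :: real and q
    define \<Psi> where "\<Psi> \<rho> = (\<integral>\<^sup>+q. W (P \<rho> q) \<partial>CC {0..<m})" for \<rho>
    define \<Xi> where "\<Xi> \<rho> = (\<integral>\<^sup>+q. S (P \<rho> q) \<partial>CC {0..<m})" for \<rho>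
    have P: "(\<lambda>x. P (fst x) (snd x)) \<in> borel \<Otimes>\<^sub>M CC {0..<m} \<rightarrow>\<^sub>M polyM" unfolding P_def by measurable
    have P': "P \<rho> \<in> CC {0..<m} \<rightarrow>\<^sub>M polyM" for \<rho> unfolding P_def by measurable
    have \<Psi>[measurable]: "\<Psi> \<in> borel_measurable borel"
      unfolding \<Psi>_def using measurable_compose[OF P W] by (intro sq.borel_measurable_nn_integral) (simp add: case_prod_beta')
    have \<Xi>[measurable]: "\<Xi> \<in> borel_measurable borel"
      unfolding \<Xi>_def using measurable_compose[OF P S] by (intro sq.borel_measurable_nn_integral) (simp add: case_prod_beta')
    \<comment> \<open>For a fixed constant coefficient \<open>c\<close> the integral over the other
      coefficients depends on \<open>c\<close> only through its modulus, as long as the defect is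
      small.\<close>
    have c: "(\<integral>\<^sup>+q. H (pCons c (mpoly 0 m q)) \<partial>CC {0..<m}) = (if \<bar>Arg (\<eta> * c)\<bar> < 1 then \<Psi> (cmod (\<eta> * c)) else 0)" for c
    proof -
      define u where "u = cis (- Arg (\<eta> * c) / real ?N)"
      have u: "cmod u = 1" "u \<noteq> 0" by (simp_all add: u_def)
      have 1: "u ^ ?N = cis (- Arg (\<eta> * c))" by (simp add: u_def Complex.DeMoivre del: of_nat_Suc)
      have 2: "\<eta> * c = of_real (cmod (\<eta> * c)) * cis (Arg (\<eta> * c))"
        using rcis_cmod_Arg[of "\<eta> * c"] by (simp add: rcis_def)
      have "u ^ ?N * (\<eta> * c) = cis (- Arg (\<eta> * c)) * (of_real (cmod (\<eta> * c)) * cis (Arg (\<eta> * c)))"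
        by (rule arg_cong2[where f = "(*)", OF 1 2])
      also have "\<dots> = of_real (cmod (\<eta> * c)) * (cis (- Arg (\<eta> * c)) * cis (Arg (\<eta> * c)))" by (simp only: mult_ac)
      also have "\<dots> = of_real (cmod (\<eta> * c))" unfolding cis_mult by simp
      finally have "(u ^ ?N * (\<eta> * c)) * (\<i> * (-1) ^ ?N) = of_real (cmod (\<eta> * c)) * (\<i> * (-1) ^ ?N)" by (rule arg_cong)
      then have "u ^ ?N * c * (\<eta> * (\<i> * (-1) ^ ?N)) = \<i> * (-1) ^ ?N * of_real (cmod (\<eta> * c))"
        by (simp only: mult_ac)
      then have uc: "u ^ ?N * c = \<i> * (-1) ^ ?N * of_real (cmod (\<eta> * c))"
        unfolding \<eta>(2) by simp
      \<comment> \<open>The rotation brings the constant coefficient to its normal phase and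
        multiplies the others by unit numbers, which preserves Lebesgue measure.\<close>
      have e: "rotate_poly u ?N (pCons c (mpoly 0 m q)) = P (cmod (\<eta> * c)) (\<lambda>i\<in>{0..<m}. u ^ ?N * inverse u ^ Suc i * q i)" for q
      proof (rule poly_eqI)
        fix i
        show "coeff (rotate_poly u ?N (pCons c (mpoly 0 m q))) i = coeff (P (cmod (\<eta> * c)) (\<lambda>i\<in>{0..<m}. u ^ ?N * inverse u ^ Suc i * q i)) i"
          unfolding coeff_rotate_poly P_def using uc u(2)
          by (cases i) (auto simp: coeff_mpoly power_inverse)
      qed
      have "(\<integral>\<^sup>+q. W (P (cmod (\<eta> * c)) (\<lambda>i\<in>{0..<m}. u ^ ?N * inverse u ^ Suc i * q i)) \<partial>CC {0..<m}) = \<Psi> (cmod (\<eta> * c))"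
      proof -
        have "\<Psi> (cmod (\<eta> * c)) = (\<integral>\<^sup>+q. (\<Prod>i\<in>{0..<m}. 1) * W (P (cmod (\<eta> * c)) (\<lambda>i\<in>{0..<m}. u ^ ?N * inverse u ^ Suc i * q i)) \<partial>CC {0..<m})"
          unfolding \<Psi>_def
          by (rule nn_integral_PiM_substitution[OF _ _ _ _ _ _ measurable_compose[OF P' W]])
            (auto simp: sigma_finite_lborel norm_mult norm_power norm_inverse u intro!: nn_integral_unit_mult)
        then show ?thesis by simp
      qed
      moreover have "U (pCons c (mpoly 0 m q)) = u" for q by (simp add: U_def u_def)
      ultimately show ?thesis unfolding H_def by (simp add: e)
    qed
    define f where "f w = (if \<bar>Arg w\<bar> < 1 then \<Psi> (cmod w) else 0)" for w
    have f[measurable]: "f \<in> borel_measurable borel" unfolding f_def by measurable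
    have "(\<integral>\<^sup>+c. \<integral>\<^sup>+q. H (pCons c (mpoly 0 m q)) \<partial>CC {0..<m} \<partial>lborel) = (\<integral>\<^sup>+c. f (\<eta> * c) \<partial>lborel)"
      unfolding c f_def ..
    also have "\<dots> = (\<integral>\<^sup>+w. f w \<partial>lborel)" by (rule nn_integral_unit_mult[OF f \<eta>(1), symmetric])
    also have "\<dots> = (\<integral>\<^sup>+r. \<integral>\<^sup>+t. ennreal r * indicator {0<..} r * indicator {-pi<..<pi} t * f (rcis r t) \<partial>lborel \<partial>lborel)"
      by (rule nn_integral_complex_polar[OF f])
    also have "\<dots> = (\<integral>\<^sup>+r. 2 * (indicator {0<..} r * \<Xi> r) \<partial>lborel)"
    proof (rule nn_integral_cong)
      fix r :: real
      show "(\<integral>\<^sup>+t. ennreal r * indicator {0<..} r * indicator {-pi<..<pi} t * f (rcis r t) \<partial>lborel) = 2 * (indicator {0<..} r * \<Xi> r)"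
      proof (cases "r > 0")
        case True
        have "ennreal r * indicator {0<..} r * indicator {-pi<..<pi} t * f (rcis r t) = (ennreal r * \<Psi> r) * indicator {-1<..<1} t" for t
        proof (cases "-pi < t \<and> t < pi")
          case True
          then have "Arg (rcis r t) = t" using \<open>r > 0\<close> by (intro Arg_rcis) auto
          then show ?thesis using True \<open>r > 0\<close> by (auto simp: f_def indicator_def)
        next
          case False
          then have "\<not> (-1 < t \<and> t < 1)" using pi_gt3 by auto
          then show ?thesis using False by (auto simp: indicator_def)
        qed
        moreover have "(\<integral>\<^sup>+t. (ennreal r * \<Psi> r) * indicator {-1<..<1::real} t \<partial>lborel) = (ennreal r * \<Psi> r) * 2"
          by (subst nn_integral_cmult_indicator) auto
        moreover have "ennreal r * \<Psi> r = \<Xi> r"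
        proof -
          have "\<Psi> r = (\<integral>\<^sup>+q. ennreal (1 / r) * S (P r q) \<partial>CC {0..<m})"
            unfolding \<Psi>_def W_def using True by (intro nn_integral_cong) (simp add: P_def norm_mult norm_power)
          also have "\<dots> = ennreal (1 / r) * \<Xi> r"
            unfolding \<Xi>_def by (rule nn_integral_cmult) (rule measurable_compose[OF P' S])
          finally have "ennreal r * \<Psi> r = (ennreal r * ennreal (1 / r)) * \<Xi> r" by (simp only: mult.assoc)
          then show ?thesis using True by (simp add: ennreal_mult[symmetric])
        qed
        ultimately show ?thesis using True by (simp add: mult.commute)
      qed simp
    qed
    also have "\<dots> = 2 * (\<integral>\<^sup>+r. indicator {0<..} r * \<Xi> r \<partial>lborel)"
      by (rule nn_integral_cmult) measurable
    also have "(\<integral>\<^sup>+r. indicator {0<..} r * \<Xi> r \<partial>lborel) = (\<integral>\<^sup>+t. \<integral>\<^sup>+q. S (pCons (\<i> * of_real t) (mpoly 0 m q)) \<partial>CC {0..<m} \<partial>lborel)"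
    proof -
      define \<epsilon> :: real where "\<epsilon> = (-1) ^ ?N"
      have \<epsilon>: "\<epsilon> = 1 \<or> \<epsilon> = -1" "\<epsilon> * \<epsilon> = 1" unfolding \<epsilon>_def by (auto simp: minus_one_power_iff)
      have Pe: "P r q = pCons (\<i> * of_real (\<epsilon> * r)) (mpoly 0 m q)" for r q
        by (simp add: P_def \<epsilon>_def mult_ac)
      \<comment> \<open>For polynomials in the sector the constant coefficient has a definite sign,
        so the integral over positive \<open>r\<close> is one over the whole line.\<close>
      have z: "S (P r q) = 0" if "\<not> r > 0" for r q
      proof (rule ccontr)
        assume "S (P r q) \<noteq> 0"
        then have s: "sector 1 m (P r q)" by (auto simp: S_def split: if_splits)
        have d: "degree (P r q) = ?N" "lead_coeff (P r q) = 1" by (auto simp: P_def coeff_mpoly)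
        have "\<i> * (-1) ^ ?N * complex_of_real r = \<i> * (-1) ^ ?N * of_real (\<Prod>z\<in>#proots (P r q). cmod z)"
          using sector_coeff_0(1)[OF d s] by (simp add: P_def)
        then have "r = (\<Prod>z\<in>#proots (P r q). cmod z)" by (simp only: mult_cancel_left of_real_eq_iff) simp
        then show False using sector_coeff_0(2)[OF d s] that by simp
      qed
      then have "(\<integral>\<^sup>+r. indicator {0<..} r * \<Xi> r \<partial>lborel) = (\<integral>\<^sup>+r. \<Xi> r \<partial>lborel)"
        by (intro nn_integral_cong) (auto simp: indicator_def \<Xi>_def)
      also have "\<dots> = (\<integral>\<^sup>+t. \<Xi> (\<epsilon> * t) \<partial>lborel)"
        using \<epsilon>(1) nn_integral_real_affine[OF \<Xi>, of \<epsilon> 0] by auto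
      also have "\<dots> = (\<integral>\<^sup>+t. \<integral>\<^sup>+q. S (pCons (\<i> * of_real t) (mpoly 0 m q)) \<partial>CC {0..<m} \<partial>lborel)"
        unfolding \<Xi>_def Pe by (simp only: mult.assoc[symmetric] \<epsilon>(2) mult_1)
      finally show ?thesis .
    qed
    finally show ?thesis .
  qed
  also have "(\<integral>\<^sup>+t. \<integral>\<^sup>+q. S (pCons (\<i> * of_real t) (mpoly 0 m q)) \<partial>CC {0..<m} \<partial>lborel) =
      (\<integral>\<^sup>+a. \<integral>\<^sup>+c. S (ripoly 1 m a c) \<partial>LL {0..<Suc m} \<partial>LL {1..<Suc m})"
    by (rule nn_integral_ripoly_1[OF S, symmetric])
  finally have "2 * ?L = 2 * (ennreal (fact ?N) * ?R)" unfolding S_def by (simp only: mult.left_commute)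
  then show ?thesis by (simp add: ennreal_mult_cancel_left)
qed

section \<open>Resultants and the density\<close>

lemma coeff_polA_subleading:
  assumes "s \<le> 1"
  shows "coeff (polA s i k x y) k = - ((\<Sum>j\<in>{i..<i + Suc k - s}. (x j)\<^sup>2) + (\<Sum>j\<in>{i..<i + k}. (y j)\<^sup>2))"
proof (induction k arbitrary: i)
  case 0
  show ?case using assms by (cases "s = 0") (auto simp: polAB_0)
next
  case (Suc k)
  have X: "{i..<i + Suc (Suc k) - s} = insert i {Suc i..<Suc i + Suc k - s}"
    and Y: "{i..<i + Suc k} = insert i {Suc i..<Suc i + k}" using assms by auto
  have "coeff (polA s i (Suc k) x y) (Suc k) = coeff (polA s (Suc i) k x y) k - (y i)\<^sup>2 - (x i)\<^sup>2"
    using polAB_monic[of s "Suc i" k x y] by (simp add: polA_Suc polB_Suc)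
  then show ?case unfolding Suc.IH X Y by simp
qed

lemma coeff_polA_0: "coeff (polA 0 i k x y) 0 = (-1) ^ Suc k * (\<Prod>j\<in>{i..<i + Suc k}. (x j)\<^sup>2)"
proof (induction k arbitrary: i)
  case (Suc k)
  have X: "{i..<i + Suc (Suc k)} = insert i {Suc i..<Suc i + Suc k}" by auto
  show ?case unfolding X by (simp add: polA_Suc Suc.IH del: prod.op_ivl_Suc)
qed (simp add: polAB_0)

lemma coeff_polAB_1_0: "coeff (polA 1 i k x y) 0 = 0 \<and> coeff (polB 1 i k x y) 0 = (-1) ^ k * (\<Prod>j\<in>{i..<i + k}. (y j)\<^sup>2)"
proof (induction k arbitrary: i)
  case (Suc k)
  have Y: "{i..<i + Suc k} = insert i {Suc i..<Suc i + k}" by auto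
  show ?case unfolding Y using Suc.IH[of "Suc i"] by (simp add: polA_Suc polB_Suc del: prod.op_ivl_Suc)
qed (simp add: polAB_0)

text \<open>For monic \<open>p\<close> this is the modulus of the resultant of \<open>p\<close> and \<open>q\<close>.\<close>
definition res_norm :: "complex poly \<Rightarrow> complex poly \<Rightarrow> real" where
  "res_norm p q = (\<Prod>z\<in>#proots p. cmod (poly q z))"

text \<open>Both sides are the product of \<open>cmod (z - w)\<close> over all pairs of a root of
  \<open>p\<close> and a root of \<open>q\<close>.\<close>

lemma res_norm_commute:
  assumes "lead_coeff p = 1" "lead_coeff q = 1"
  shows "res_norm p q = res_norm q p"
proof -
  have e: "cmod (poly q z) = (\<Prod>w\<in>#proots q. cmod (z - w))" if "lead_coeff q = 1" for q z
  proof -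
    have "poly q z = (\<Prod>w\<in>#proots q. z - w)"
      by (subst monic_eq_prod_proots[OF that]) (rule poly_prod_mset_linear')
    moreover have "cmod (\<Prod>w\<in>#M. z - w) = (\<Prod>w\<in>#M. cmod (z - w))" for M
      by (induction M) (auto simp: norm_mult)
    ultimately show ?thesis by simp
  qed
  have s: "(\<Prod>z\<in>#M. \<Prod>w\<in>#L. f z w) = (\<Prod>w\<in>#L. \<Prod>z\<in>#M. f z w)" for f :: "complex \<Rightarrow> complex \<Rightarrow> real" and M L
    by (induction M) (auto simp: prod_mset.distrib)
  show ?thesis unfolding res_norm_def e[OF assms(1)] e[OF assms(2)]
    by (subst s) (simp add: norm_minus_commute)
qed

text \<open>Only the values of \<open>q\<close> at the roots of \<open>p\<close> enter: a Euclidean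
  step for resultants.\<close>

lemma res_norm_reduce:
  assumes "\<And>z. poly p z = 0 \<Longrightarrow> poly q z = c * poly r z" and p: "lead_coeff p = 1"
  shows "res_norm p q = cmod c ^ degree p * res_norm p r"
proof -
  have "image_mset (\<lambda>z. cmod (poly q z)) (proots p) = image_mset (\<lambda>z. cmod c * cmod (poly r z)) (proots p)"
    using assms monic_proots_iff[OF p] by (intro image_mset_cong) (simp add: norm_mult)
  then have "res_norm p q = (\<Prod>z\<in>#proots p. cmod c * cmod (poly r z))" unfolding res_norm_def by simp
  also have "\<dots> = cmod c ^ size (proots p) * res_norm p r"
    by (simp add: prod_mset.distrib res_norm_def)
  finally show ?thesis by (simp add: size_proots_complex)
qed

lemma lead_coeff_cpoly: "degree A = k \<Longrightarrow> coeff A k = 1 \<Longrightarrow> lead_coeff (cpoly A) = 1"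
  by simp

text \<open>Euclid along the recursion: at the roots of the outer \<open>polB\<close> the outer
  \<open>polA\<close> is \<open>- (x i)\<^sup>2\<close> times the inner one, and at the roots of the
  inner \<open>polA\<close> the outer \<open>polB\<close> is \<open>- (y i)\<^sup>2\<close> times
  the inner one. Both reductions run over \<open>Suc k\<close> roots, so \<open>x i\<close> and
  \<open>y i\<close> receive the same power.\<close>

lemma res_norm_polAB:
  "res_norm (cpoly (polB s i k x y)) (cpoly (polA s i k x y)) = (\<Prod>j\<in>{i..<i + k}. (x j * y j) ^ (2 * (k + i - j)))"
proof (induction k arbitrary: i)
  case 0
  show ?case by (simp add: polAB_0 res_norm_def)
next
  case (Suc k)
  let ?A = "cpoly (polA s i (Suc k) x y)" and ?B = "cpoly (polB s i (Suc k) x y)"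
    and ?A' = "cpoly (polA s (Suc i) k x y)" and ?B' = "cpoly (polB s (Suc i) k x y)"
  note l = lead_coeff_cpoly[OF polAB_monic(1,2)] lead_coeff_cpoly[OF polAB_monic(3,4)]
  have "res_norm ?B ?A = cmod (- of_real ((x i)\<^sup>2)) ^ degree ?B * res_norm ?B ?A'"
    by (rule res_norm_reduce[OF _ l(2)]) (simp add: polA_Suc)
  also have "res_norm ?B ?A' = res_norm ?A' ?B" by (rule res_norm_commute[OF l(2,1)])
  also have "\<dots> = cmod (- of_real ((y i)\<^sup>2)) ^ degree ?A' * res_norm ?A' ?B'"
    by (rule res_norm_reduce[OF _ l(1)]) (simp add: polB_Suc)
  also have "res_norm ?A' ?B' = res_norm ?B' ?A'" by (rule res_norm_commute[OF l])
  also have "\<dots> = (\<Prod>j\<in>{Suc i..<Suc i + k}. (x j * y j) ^ (2 * (k + Suc i - j)))" by (rule Suc.IH)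
  finally have e: "res_norm ?B ?A = cmod (- of_real ((x i)\<^sup>2)) ^ degree ?B * (cmod (- of_real ((y i)\<^sup>2)) ^ degree ?A' *
    (\<Prod>j\<in>{Suc i..<Suc i + k}. (x j * y j) ^ (2 * (k + Suc i - j))))" .
  have d: "degree ?B = Suc k" "degree ?A' = Suc k" by (simp_all add: polAB_monic)
  have n: "cmod (- of_real (a\<^sup>2)) = a\<^sup>2" for a :: real by (simp flip: of_real_power)
  have "((x i)\<^sup>2) ^ Suc k * (((y i)\<^sup>2) ^ Suc k * c) = (x i * y i) ^ (2 * Suc k) * c" for c
    by (simp only: power_mult[symmetric] power_mult_distrib mult.assoc)
  note e = e[unfolded d n this]
  have Y: "{i..<i + Suc k} = insert i {Suc i..<Suc i + k}" by auto
  have "(\<Prod>j\<in>{i..<i + Suc k}. (x j * y j) ^ (2 * (Suc k + i - j))) =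
    (x i * y i) ^ (2 * Suc k) * (\<Prod>j\<in>{Suc i..<Suc i + k}. (x j * y j) ^ (2 * (k + Suc i - j)))"
    unfolding Y by (subst prod.insert) auto
  then show ?case by (simp only: e)
qed

text \<open>Each of the \<open>Suc k\<close> roots contributes one factor \<open>2 * t\<close>. At
  the roots of \<open>polB\<close> the perturbed polynomial agrees with \<open>polA\<close>, so the
  remaining resultant no longer involves \<open>t\<close>.\<close>

lemma cmod_roots_minus_cnj:
  assumes z: "rootpoly (Suc k) z = perturbed_poly s k x y t" and t: "t > 0"
  shows "(\<Prod>j = 1..Suc k. \<Prod>i = 1..Suc k. cmod (z j - cnj (z i))) =
    (2 * t) ^ Suc k * (\<Prod>j\<in>{1..<1 + k}. (x j * y j) ^ (2 * (Suc k - j)))"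
proof -
  let ?p = "rootpoly (Suc k) z" and ?A = "cpoly (polA s 1 k x y)" and ?B = "cpoly (polB s 1 k x y)"
  have lp: "lead_coeff ?p = 1" "degree ?p = Suc k" by (rule rootpoly_monic)+
  have pp: "poly ?p w = poly ?A w - \<i> * of_real t * poly ?B w" for w
    unfolding z perturbed_poly_def by simp
  have prod_eq: "(\<Prod>j = 1..Suc k. f (z j)) = (\<Prod>w\<in>#proots ?p. f w)" for f :: "complex \<Rightarrow> real"
    by (simp add: proots_rootpoly prod_unfold_prod_mset image_mset.compositionality o_def)
  have e: "(\<Prod>i = 1..Suc k. cmod (w - cnj (z i))) = 2 * t * cmod (poly ?B w)" if w: "poly ?p w = 0" for w
  proof -
    have "(\<Prod>i = 1..Suc k. w - cnj (z i)) = cnj (\<Prod>i = 1..Suc k. cnj w - z i)" by simp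
    also have "(\<Prod>i = 1..Suc k. cnj w - z i) = poly ?p (cnj w)" by (simp add: rootpoly_def poly_prod del: prod.cl_ivl_Suc)
    also have "cnj (poly ?p (cnj w)) = poly ?A w + \<i> * of_real t * poly ?B w" unfolding pp by (simp add: cpoly_cnj)
    also have "\<dots> = 2 * \<i> * of_real t * poly ?B w" using w unfolding pp by (simp add: algebra_simps)
    finally have "(\<Prod>i = 1..Suc k. w - cnj (z i)) = 2 * \<i> * of_real t * poly ?B w" .
    then show ?thesis using t by (simp add: prod_norm norm_mult del: prod.cl_ivl_Suc)
  qed
  have "(\<Prod>j = 1..Suc k. \<Prod>i = 1..Suc k. cmod (z j - cnj (z i))) = (\<Prod>w\<in>#proots ?p. \<Prod>i = 1..Suc k. cmod (w - cnj (z i)))"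
    by (rule prod_eq)
  also have "\<dots> = (\<Prod>w\<in>#proots ?p. 2 * t * cmod (poly ?B w))"
    using e monic_proots_iff[OF lp(1)] by (intro arg_cong[of _ _ prod_mset] image_mset_cong) simp
  also have "\<dots> = (2 * t) ^ Suc k * res_norm ?p ?B"
    by (simp add: prod_mset.distrib size_proots_complex lp res_norm_def)
  also have "res_norm ?p ?B = res_norm ?B ?p"
    by (intro res_norm_commute lp lead_coeff_cpoly[OF polAB_monic(3,4)])
  also have "\<dots> = cmod 1 ^ degree ?B * res_norm ?B ?A"
    by (rule res_norm_reduce[OF _ lead_coeff_cpoly[OF polAB_monic(3,4)]]) (simp add: pp)
  finally show ?thesis using res_norm_polAB[of s 1 k x y] by simp
qed

lemma sum_roots_perturbed_poly:
  assumes z: "rootpoly (Suc k) z = perturbed_poly s k x y t" and s: "s \<le> 1"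
  shows "(\<Sum>j = 1..Suc k. Im (z j)) = t"
    "(\<Sum>j = 1..Suc k. Re (z j)) = (\<Sum>j\<in>{1..<1 + Suc k - s}. (x j)\<^sup>2) + (\<Sum>j\<in>{1..<1 + k}. (y j)\<^sup>2)"
proof -
  let ?M = "image_mset z (mset_set {1..Suc k})"
  have r: "rootpoly (Suc k) z = (\<Prod>w\<in>#?M. [:- w, 1:])"
    unfolding rootpoly_def prod_unfold_prod_mset by (simp add: image_mset.compositionality o_def)
  have "coeff (rootpoly (Suc k) z) k = - \<Sum>\<^sub># ?M"
    unfolding r by (rule prod_mset_linear_factors(3)) simp
  then have "(\<Sum>j = 1..Suc k. z j) = - coeff (perturbed_poly s k x y t) k"
    unfolding z[symmetric] by (simp add: sum_unfold_sum_mset)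
  also have "\<dots> = of_real ((\<Sum>j\<in>{1..<1 + Suc k - s}. (x j)\<^sup>2) + (\<Sum>j\<in>{1..<1 + k}. (y j)\<^sup>2)) + \<i> * of_real t"
    unfolding perturbed_poly_def by (simp add: coeff_polA_subleading[OF s] polAB_monic)
  finally have e: "(\<Sum>j = 1..Suc k. z j) = of_real ((\<Sum>j\<in>{1..<1 + Suc k - s}. (x j)\<^sup>2) + (\<Sum>j\<in>{1..<1 + k}. (y j)\<^sup>2)) + \<i> * of_real t" .
  show "(\<Sum>j = 1..Suc k. Im (z j)) = t"
    unfolding Im_sum[symmetric] e by (simp del: of_real_add)
  show "(\<Sum>j = 1..Suc k. Re (z j)) = (\<Sum>j\<in>{1..<1 + Suc k - s}. (x j)\<^sup>2) + (\<Sum>j\<in>{1..<1 + k}. (y j)\<^sup>2)"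
    unfolding Re_sum[symmetric] e by (simp del: of_real_add)
qed

text \<open>At 0 the perturbation contributes an imaginary number only, so the real part is up to
  sign the constant coefficient of \<open>polA\<close>, a determinant.\<close>

lemma Re_prod_roots_perturbed_poly:
  assumes z: "rootpoly (Suc k) z = perturbed_poly 0 k x y t"
  shows "Re (\<Prod>j = 1..Suc k. z j) = (\<Prod>j\<in>{1..<1 + Suc k}. (x j)\<^sup>2)"
proof -
  have "(-1) ^ Suc k * (\<Prod>j = 1..Suc k. z j) = coeff (perturbed_poly 0 k x y t) 0"
    unfolding z[symmetric] coeff_0_rootpoly ..
  then have "Re ((-1) ^ Suc k * (\<Prod>j = 1..Suc k. z j)) = coeff (polA 0 1 k x y) 0"
    unfolding perturbed_poly_def by simp
  then have "(-1) ^ Suc k * Re (\<Prod>j = 1..Suc k. z j) = (-1) ^ Suc k * (\<Prod>j\<in>{1..<1 + Suc k}. (x j)\<^sup>2)"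
    unfolding coeff_polA_0 by (simp add: minus_one_power_iff del: prod.op_ivl_Suc prod.cl_ivl_Suc split: if_splits)
  then show ?thesis by (simp only: mult_cancel_left) simp
qed

text \<open>Here \<open>polA\<close> vanishes at 0 and the product of the roots stems from the
  perturbation alone, whence the factor \<open>t\<close>.\<close>

lemma cmod_prod_roots_perturbed_poly:
  assumes z: "rootpoly (Suc k) z = perturbed_poly 1 k x y t" and t: "t > 0"
  shows "(\<Prod>j = 1..Suc k. cmod (z j)) = t * (\<Prod>j\<in>{1..<1 + k}. (y j)\<^sup>2)"
proof -
  have "(-1) ^ Suc k * (\<Prod>j = 1..Suc k. z j) = coeff (perturbed_poly 1 k x y t) 0"
    unfolding z[symmetric] coeff_0_rootpoly ..
  also have "\<dots> = - (\<i> * of_real t * of_real ((-1) ^ k * (\<Prod>j\<in>{1..<1 + k}. (y j)\<^sup>2)))"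
    unfolding perturbed_poly_def using coeff_polAB_1_0[of 1 k x y] by simp
  finally have "cmod ((-1) ^ Suc k * (\<Prod>j = 1..Suc k. z j)) = cmod (- (\<i> * of_real t * of_real ((-1) ^ k * (\<Prod>j\<in>{1..<1 + k}. (y j)\<^sup>2))))"
    by (rule arg_cong)
  then have "cmod (\<Prod>j = 1..Suc k. z j) = t * \<bar>\<Prod>j\<in>{1..<1 + k}. (y j)\<^sup>2\<bar>"
    using t by (simp add: norm_mult norm_power abs_mult del: prod.op_ivl_Suc prod.cl_ivl_Suc of_real_prod)
  moreover have "(\<Prod>j\<in>{1..<1 + k}. (y j)\<^sup>2) \<ge> 0" by (intro prod_nonneg) simp
  ultimately show ?thesis by (simp only: prod_norm abs_of_nonneg)
qed

section \<open>Gamma values and the normalising constants\<close>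

text \<open>By \<open>Gamma (1 + c) = c * Gamma c\<close> the ratio for index \<open>j\<close>,
  times \<open>Gamma (\<beta> / 2)\<close>, is \<open>j\<close> times a Gamma value. The factors
  \<open>j\<close> collect into the factorial that later cancels the number of orderings of the
  roots.\<close>

lemma prod_Gamma_shift:
  assumes "\<beta> > 0"
  shows "(\<Prod>j = 1..N. Gamma (1 + \<beta> * real j / 2) / Gamma (1 + \<beta> / 2)) * Gamma (\<beta> / 2) ^ N =
    fact N * (\<Prod>j = 1..N. Gamma (\<beta> * real j / 2))"
proof (induction N)
  case (Suc N)
  have g: "Gamma (1 + c) = c * Gamma c" if "c > 0" for c :: real
    using Gamma_plus1[of c] that nonpos_Ints_nonpos[of c] by (force simp: add.commute)
  have b: "Gamma (\<beta> / 2) \<noteq> 0" using Gamma_real_pos[of "\<beta> / 2"] assms by linarith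
  have "Gamma (1 + \<beta> * real (Suc N) / 2) / Gamma (1 + \<beta> / 2) * Gamma (\<beta> / 2) = real (Suc N) * Gamma (\<beta> * real (Suc N) / 2)"
  proof -
    have "Gamma (1 + \<beta> * real (Suc N) / 2) = \<beta> * real (Suc N) / 2 * Gamma (\<beta> * real (Suc N) / 2)"
      using assms by (intro g) simp
    moreover have "Gamma (1 + \<beta> / 2) = \<beta> / 2 * Gamma (\<beta> / 2)"
      using assms by (intro g) simp
    ultimately show ?thesis using b assms by (simp only:) simp
  qed
  then have "(\<Prod>j = 1..N. Gamma (1 + \<beta> * real j / 2) / Gamma (1 + \<beta> / 2)) * Gamma (\<beta> / 2) ^ N *
      (Gamma (1 + \<beta> * real (Suc N) / 2) / Gamma (1 + \<beta> / 2) * Gamma (\<beta> / 2)) =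
    fact N * (\<Prod>j = 1..N. Gamma (\<beta> * real j / 2)) * (real (Suc N) * Gamma (\<beta> * real (Suc N) / 2))"
    by (simp only: Suc.IH)
  then show ?case by (simp add: mult_ac)
qed simp

lemma prod_reverse: "(\<Prod>j = 1..N. f (N + 1 - j)) = (\<Prod>j = 1..N. f j)" for f :: "nat \<Rightarrow> real"
  by (rule prod.reindex_bij_witness[of _ "\<lambda>j. N + 1 - j" "\<lambda>j. N + 1 - j"]) auto

text \<open>The term \<open>- 2 / \<beta>\<close> in \<open>a\<close> cancels the 1 in the arguments
  of Gamma; reversing the product brings these arguments into the order of the chi
  parameters.\<close>

lemma l_const_eq:
  assumes "\<beta> > 0" "a = \<delta> + 1 - 2 / \<beta>"
  shows "l_const \<beta> N a * Gamma (\<beta> / 2) ^ N =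
    2 powr (real N * (\<beta> * (\<delta> + real N) / 2)) * fact N *
      (\<Prod>j = 1..N. Gamma (\<beta> * real j / 2)) * (\<Prod>j = 1..N. Gamma (\<beta> * (\<delta> + real N + 1 - real j) / 2))"
proof -
  have "(\<Prod>j = 1..N. Gamma (1 + \<beta> * a / 2 + \<beta> * (real j - 1) / 2)) = (\<Prod>j = 1..N. Gamma (\<beta> * (\<delta> + real j) / 2))"
    using assms(1) unfolding assms(2) by (intro prod.cong refl arg_cong[of _ _ Gamma]) (simp add: field_simps)
  also have "\<dots> = (\<Prod>j = 1..N. Gamma (\<beta> * (\<delta> + real (N + 1 - j)) / 2))"
    by (rule prod_reverse[symmetric])
  also have "\<dots> = (\<Prod>j = 1..N. Gamma (\<beta> * (\<delta> + real N + 1 - real j) / 2))"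
    by (intro prod.cong refl arg_cong[of _ _ Gamma]) (auto simp: of_nat_diff)
  finally have 1: "(\<Prod>j = 1..N. Gamma (1 + \<beta> * a / 2 + \<beta> * (real j - 1) / 2)) = \<dots>" .
  have 2: "real N * (a * \<beta> / 2 + 1 + (real N - 1) * \<beta> / 2) = real N * (\<beta> * (\<delta> + real N) / 2)"
    using assms(1) unfolding assms(2) by (simp add: field_simps)
  have "(\<Prod>j = 1..N. Gamma (1 + \<beta> * real j / 2) * Gamma (1 + \<beta> * a / 2 + \<beta> * (real j - 1) / 2) / Gamma (1 + \<beta> / 2)) =
    (\<Prod>j = 1..N. Gamma (1 + \<beta> * real j / 2) / Gamma (1 + \<beta> / 2)) * (\<Prod>j = 1..N. Gamma (1 + \<beta> * a / 2 + \<beta> * (real j - 1) / 2))"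
    by (simp add: prod.distrib[symmetric] mult_ac)
  then have "l_const \<beta> N a * Gamma (\<beta> / 2) ^ N = 2 powr (real N * (\<beta> * (\<delta> + real N) / 2)) *
    ((\<Prod>j = 1..N. Gamma (1 + \<beta> * real j / 2) / Gamma (1 + \<beta> / 2)) * Gamma (\<beta> / 2) ^ N) *
    (\<Prod>j = 1..N. Gamma (\<beta> * (\<delta> + real N + 1 - real j) / 2))"
    unfolding l_const_def 1 2 by (simp only: mult_ac)
  then show ?thesis unfolding prod_Gamma_shift[OF assms(1)] by (simp only: mult_ac)
qed

text \<open>The denominator of \<open>c_const\<close> removes the factor \<open>j = Suc k\<close>
  from a product of Gamma values and leaves one for each off-diagonal entry.\<close>

lemma q_const_eq:
  assumes "\<beta> > 0" "Suc k \<le> m"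
  shows "q_const \<beta> (Suc k) (param_a \<beta> m (Suc k)) =
    2 powr (real (Suc k) * (\<beta> / 2 - 1)) * 2 powr (real (Suc k) * (\<beta> * real m / 2)) * fact (Suc k) *
      (\<Prod>j = 1..Suc k. Gamma (\<beta> * (real m - real j + 1) / 2)) * (\<Prod>j = 1..k. Gamma (\<beta> * (real (Suc k) - real j) / 2))"
proof -
  have a: "param_a \<beta> m (Suc k) = (real m - real (Suc k)) + 1 - 2 / \<beta>" using assms(2) by (simp add: param_a_def)
  have r: "(\<Prod>j = 1..k. Gamma (\<beta> * (real (Suc k) - real j) / 2)) = (\<Prod>j = 1..k. Gamma (\<beta> * real j / 2))"
    by (subst prod_reverse[of _ k, symmetric]) (intro prod.cong refl arg_cong[of _ _ Gamma], auto simp: of_nat_diff)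
  have "Gamma (\<beta> * real (Suc k) / 2) > 0" using assms(1) by (intro Gamma_real_pos) simp
  then show ?thesis unfolding q_const_def c_const_def r
    using l_const_eq[OF assms(1) a, of "Suc k"] by (simp add: field_simps del: fact_Suc of_nat_Suc)
qed

text \<open>The Gamma values of \<open>l_const\<close> run over \<open>n + 1 - j\<close>, those of
  the chi densities over \<open>n - j\<close>; the quotient in \<open>d_const\<close> shifts the
  range by one, which is the telescoping identity \<open>e\<close>. The factor
  \<open>real m + 1\<close> completes the factorial.\<close>

lemma t_const_eq:
  assumes "\<beta> > 0" "0 < m" "m < n"
  shows "t_const \<beta> m n =
    2 powr ((real m + 1) * (\<beta> / 2 - 1)) * 2 powr (real m * (\<beta> * real n / 2)) * fact (Suc m) *
      (\<Prod>j = 1..m. Gamma (\<beta> * (real m - real j + 1) / 2)) * (\<Prod>j = 1..m. Gamma (\<beta> * (real n - real j) / 2))"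
proof -
  have a: "param_a \<beta> m n = (real n - real m) + 1 - 2 / \<beta>" using assms(3) by (simp add: param_a_def)
  have r: "(\<Prod>j = 1..m. Gamma (\<beta> * (real m - real j + 1) / 2)) = (\<Prod>j = 1..m. Gamma (\<beta> * real j / 2))"
    by (subst prod_reverse[of _ m, symmetric]) (intro prod.cong refl arg_cong[of _ _ Gamma], auto simp: of_nat_diff)
  have e: "(\<Prod>j = 1..k. Gamma (\<beta> * (real n + 1 - real j) / 2)) * Gamma (\<beta> * (real n - real k) / 2) =
     Gamma (\<beta> * real n / 2) * (\<Prod>j = 1..k. Gamma (\<beta> * (real n - real j) / 2))" for k
  proof (induction k)
    case (Suc k)
    then have "(\<Prod>j = 1..k. Gamma (\<beta> * (real n + 1 - real j) / 2)) * Gamma (\<beta> * (real n - real k) / 2) * Gamma (\<beta> * (real n - real (Suc k)) / 2) =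
     Gamma (\<beta> * real n / 2) * (\<Prod>j = 1..k. Gamma (\<beta> * (real n - real j) / 2)) * Gamma (\<beta> * (real n - real (Suc k)) / 2)" by simp
    then show ?case by (simp add: mult_ac)
  qed simp
  have g: "Gamma (\<beta> * real n / 2) > 0" using assms by (intro Gamma_real_pos) simp
  have "t_const \<beta> m n = (real m + 1) * 2 powr ((real m + 1) * (\<beta> / 2 - 1)) *
    (l_const \<beta> m (param_a \<beta> m n) * Gamma (\<beta> / 2) ^ m) * Gamma (\<beta> * (real n - real m) / 2) / Gamma (\<beta> * real n / 2)"
    unfolding t_const_def d_const_def by simp
  also have "\<dots> = (real m + 1) * 2 powr ((real m + 1) * (\<beta> / 2 - 1)) *
    (2 powr (real m * (\<beta> * real n / 2)) * fact m * (\<Prod>j = 1..m. Gamma (\<beta> * real j / 2))) *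
    ((\<Prod>j = 1..m. Gamma (\<beta> * (real n + 1 - real j) / 2)) * Gamma (\<beta> * (real n - real m) / 2)) / Gamma (\<beta> * real n / 2)"
    unfolding l_const_eq[OF assms(1) a] by (simp add: mult_ac)
  finally show ?thesis unfolding e r using g by (simp add: mult_ac)
qed

lemma prod_chi_density:
  assumes "finite I" "\<And>j. j \<in> I \<Longrightarrow> x j > 0"
  shows "(\<Prod>j\<in>I. chi_density (\<beta> * c j) (x j)) =
    2 powr (real (card I) - \<beta> * (\<Sum>j\<in>I. c j) / 2) / (\<Prod>j\<in>I. Gamma (\<beta> * c j / 2)) *
    (\<Prod>j\<in>I. x j powr (\<beta> * c j - 1)) * exp (- (1 / 2) * (\<Sum>j\<in>I. (x j)\<^sup>2))"
proof -
  have "(\<Prod>j\<in>I. chi_density (\<beta> * c j) (x j)) =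
    (\<Prod>j\<in>I. 2 powr (1 - \<beta> * c j / 2) / Gamma (\<beta> * c j / 2) * x j powr (\<beta> * c j - 1) * exp (- (x j)\<^sup>2 / 2))"
    using assms by (intro prod.cong) (auto simp: chi_density_def)
  also have "\<dots> = (\<Prod>j\<in>I. 2 powr (1 - \<beta> * c j / 2)) / (\<Prod>j\<in>I. Gamma (\<beta> * c j / 2)) *
    (\<Prod>j\<in>I. x j powr (\<beta> * c j - 1)) * (\<Prod>j\<in>I. exp (- (x j)\<^sup>2 / 2))"
    by (simp add: prod.distrib prod_dividef)
  also have "(\<Prod>j\<in>I. exp (- (x j)\<^sup>2 / 2)) = exp (- (1 / 2) * (\<Sum>j\<in>I. (x j)\<^sup>2))"
    using assms(1) by (simp add: exp_sum[symmetric] sum_distrib_left sum_negf sum_divide_distrib)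
  also have "(\<Prod>j\<in>I. 2 powr (1 - \<beta> * c j / 2)) = 2 powr (real (card I) - \<beta> * (\<Sum>j\<in>I. c j) / 2)"
    using assms(1) by (simp add: powr_sum[symmetric] sum_subtractf sum_distrib_left sum_divide_distrib)
  finally show ?thesis .
qed

lemma power_powr: "x > 0 \<Longrightarrow> (x ^ e) powr a = x powr (real e * a)" for x :: real
  by (simp add: powr_powr flip: powr_realpow)

lemma prod_powr': "finite I \<Longrightarrow> (\<And>j. j \<in> I \<Longrightarrow> f j > 0) \<Longrightarrow> (\<Prod>j\<in>I. f j) powr a = (\<Prod>j\<in>I. f j powr a)" for f :: "nat \<Rightarrow> real"
  by (induction I rule: finite_induct) (auto simp: powr_mult prod_pos less_imp_le)

text \<open>Collects the powers coming from the resultant, from the product of the roots and from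
  the Jacobian into a single exponent for each variable.\<close>

lemma prod_power_powr:
  fixes x :: "nat \<Rightarrow> real"
  assumes I: "finite I" and x: "\<And>j. j \<in> I \<Longrightarrow> x j > 0"
    and e: "\<And>j. j \<in> I \<Longrightarrow> real (p j) * b + real (q j) * c + real (e j) = d j"
  shows "(\<Prod>j\<in>I. x j ^ p j) powr b * (\<Prod>j\<in>I. x j ^ q j) powr c * (\<Prod>j\<in>I. x j ^ e j) = (\<Prod>j\<in>I. x j powr d j)"
proof -
  have "(\<Prod>j\<in>I. x j ^ p j) powr b = (\<Prod>j\<in>I. (x j ^ p j) powr b)" "(\<Prod>j\<in>I. x j ^ q j) powr c = (\<Prod>j\<in>I. (x j ^ q j) powr c)"
    by (rule prod_powr'[OF I], intro zero_less_power x, assumption)+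
  then have "(\<Prod>j\<in>I. x j ^ p j) powr b * (\<Prod>j\<in>I. x j ^ q j) powr c * (\<Prod>j\<in>I. x j ^ e j) =
    (\<Prod>j\<in>I. (x j ^ p j) powr b * (x j ^ q j) powr c * x j ^ e j)"
    by (simp only: prod.distrib)
  also have "\<dots> = (\<Prod>j\<in>I. x j powr d j)"
  proof (intro prod.cong refl)
    fix j assume j: "j \<in> I"
    show "(x j ^ p j) powr b * (x j ^ q j) powr c * x j ^ e j = x j powr d j"
      unfolding e[OF j, symmetric] powr_realpow[OF x[OF j], symmetric] by (simp only: powr_powr powr_add)
  qed
  finally show ?thesis .
qed

text \<open>The chi parameters divided by \<open>\<beta>\<close>, added up; the total decides the
  power of 2 in the normalisation.\<close>

lemma sum_le_interval:
  "(\<Sum>j\<in>{1..<1 + k}. real m - real j + 1) + (\<Sum>j\<in>{1..<1 + k}. real n - real j) = real k * (real m + real n - real k)"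
  by (induction k) (simp_all add: field_simps)

text \<open>Once \<open>fact n\<close> has cancelled against the constant, the two sides are
  compared separately in the powers of each \<open>x j\<close>, of each \<open>y j\<close>, of
  \<open>t\<close> and of 2. The power of \<open>t\<close> vanishes because of the denominator
  \<open>t powr (\<beta> * real n / 2 - 1)\<close>, which explains its presence in the
  density.\<close>

lemma density_matching_full:
  fixes x y :: "nat \<Rightarrow> real"
  assumes b: "\<beta> > 0" and m: "Suc k \<le> m" and t: "t > 0"
    and x: "\<And>j. j \<in> {1..<1 + Suc k} \<Longrightarrow> x j > 0" and y: "\<And>j. j \<in> {1..<1 + k} \<Longrightarrow> y j > 0"
  defines "n \<equiv> Suc k" and "X \<equiv> {1..<1 + Suc k}" and "Y \<equiv> {1..<1 + k}"
  shows "fact n * (1 / q_const \<beta> n (param_a \<beta> m n) *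
      ((2 * t) ^ n * (\<Prod>j\<in>Y. (x j * y j) ^ (2 * (n - j)))) powr (\<beta> / 2 - 1) *
      exp (- (1 / 2) * ((\<Sum>j\<in>X. (x j)\<^sup>2) + (\<Sum>j\<in>Y. (y j)\<^sup>2))) *
      (\<Prod>j\<in>X. (x j)\<^sup>2) powr (\<beta> * param_a \<beta> m n / 2) * (f / t powr (\<beta> * real n / 2 - 1))) *
    (\<Prod>j\<in>X. 2 * x j ^ (2 * (k + 1 - 0 - j) + 1)) * (\<Prod>j\<in>Y. 2 * y j ^ (2 * (k + 1 - 1 - j) + 1)) * t ^ k =
    (\<Prod>j\<in>X. chi_density (\<beta> * (real m - real j + 1)) (x j)) * (\<Prod>j\<in>Y. chi_density (\<beta> * (real n - real j)) (y j)) * f"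
proof -
  let ?wx = "\<Prod>j\<in>X. 2 * x j ^ (2 * (k + 1 - 0 - j) + 1)"
  let ?wy = "\<Prod>j\<in>Y. 2 * y j ^ (2 * (k + 1 - 1 - j) + 1)"
  let ?cx = "\<Prod>j\<in>X. chi_density (\<beta> * (real m - real j + 1)) (x j)"
  let ?cy = "\<Prod>j\<in>Y. chi_density (\<beta> * (real n - real j)) (y j)"
  let ?gx = "\<Prod>j\<in>X. Gamma (\<beta> * (real m - real j + 1) / 2)"
  let ?gy = "\<Prod>j\<in>Y. Gamma (\<beta> * (real n - real j) / 2)"
  let ?sx = "\<Sum>j\<in>X. real m - real j + 1"
  let ?sy = "\<Sum>j\<in>Y. real n - real j"
  let ?px = "\<Prod>j\<in>X. x j ^ (2 * (n - j))"
  let ?py = "\<Prod>j\<in>Y. y j ^ (2 * (n - j))"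
  let ?vx = "\<Prod>j\<in>X. x j ^ (2 * (k + 1 - 0 - j) + 1)"
  let ?vy = "\<Prod>j\<in>Y. y j ^ (2 * (k + 1 - 1 - j) + 1)"
  have fX: "finite X" and fY: "finite Y" and YX: "Y \<subseteq> X" by (auto simp: X_def Y_def)
  have cX: "card X = n" and cY: "card Y = k" by (auto simp: X_def Y_def n_def)
  have x': "\<And>j. j \<in> X \<Longrightarrow> x j > 0" and y': "\<And>j. j \<in> Y \<Longrightarrow> y j > 0" using x y by (auto simp: X_def Y_def)
  let ?b = "\<beta> / 2 - 1" and ?a = "param_a \<beta> m n"
  have a: "\<beta> * ?a = \<beta> * (real m - real n + 1) - 2" using m b by (simp add: param_a_def n_def field_simps)
  have XY: "X = insert n Y" "n \<notin> Y" by (auto simp: X_def Y_def n_def)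
  define PX where "PX = (\<Prod>j\<in>X. x j powr (\<beta> * (real m - real j + 1) - 1))"
  define PY where "PY = (\<Prod>j\<in>Y. y j powr (\<beta> * (real n - real j) - 1))"
  have px: "?px powr ?b * (\<Prod>j\<in>X. (x j)\<^sup>2) powr (\<beta> * ?a / 2) * ?vx = PX"
    unfolding PX_def
  proof (rule prod_power_powr[OF fX x'])
    fix j assume "j \<in> X"
    then have "real (n - j) = real n - real j" "k + 1 - 0 - j = n - j" by (auto simp: X_def n_def of_nat_diff)
    then show "real (2 * (n - j)) * ?b + real 2 * (\<beta> * ?a / 2) + real (2 * (k + 1 - 0 - j) + 1) = \<beta> * (real m - real j + 1) - 1"
      using a by (simp add: field_simps)
  qed
  have py: "?py powr ?b * ?vy = PY"
  proof -
    have "?py powr ?b * (\<Prod>j\<in>Y. y j ^ 0) powr 1 * ?vy = PY"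
      unfolding PY_def
    proof (rule prod_power_powr[OF fY y'])
      fix j assume "j \<in> Y"
      then have r: "real (n - j) = real n - real j" "real (k + 1 - 1 - j) = real n - 1 - real j" by (auto simp: Y_def n_def of_nat_diff)
      show "real (2 * (n - j)) * ?b + real 0 * 1 + real (2 * (k + 1 - 1 - j) + 1) = \<beta> * (real n - real j) - 1"
        unfolding of_nat_mult of_nat_add r by (simp add: field_simps)
    qed
    then show ?thesis by simp
  qed
  have pt: "((2 * t) ^ n) powr ?b / t powr (\<beta> * real n / 2 - 1) * t ^ k = 2 powr (real n * ?b)"
  proof -
    have "((2 * t) ^ n) powr ?b / t powr (\<beta> * real n / 2 - 1) * t ^ k =
      2 powr (real n * ?b) * t powr (real n * ?b - (\<beta> * real n / 2 - 1) + real k)"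
      using t by (subst power_powr) (auto simp: powr_mult powr_add powr_diff powr_realpow)
    also have "real n * ?b - (\<beta> * real n / 2 - 1) + real k = 0" by (simp add: n_def field_simps)
    finally show ?thesis using t by simp
  qed
  \<comment> \<open>The exponent is 0 at \<open>j = n\<close>, so the missing index can be
    added.\<close>
  have XX: "(\<Prod>j\<in>Y. x j ^ (2 * (n - j))) = ?px"
    unfolding XY(1) using XY(2) fY by simp
  have xyp: "((2 * t) ^ n * (\<Prod>j\<in>Y. (x j * y j) ^ (2 * (n - j)))) powr ?b =
    ((2 * t) ^ n) powr ?b * (?px powr ?b * ?py powr ?b)"
  proof -
    have "0 < (2 * t) ^ n" "0 < (\<Prod>j\<in>Y. x j ^ (2 * (n - j)))" "0 < ?py"
      using t x' y' YX by (auto intro!: prod_pos zero_less_power)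
    then show ?thesis unfolding XX[symmetric] power_mult_distrib[of "x _" "y _"] prod.distrib
      by (simp only: powr_mult less_imp_le mult_pos_pos mult_nonneg_nonneg)
  qed
  have two: "?wx = 2 ^ n * ?vx"
    "?wy = 2 ^ k * ?vy"
    by (simp_all add: prod.distrib cX cY del: power_Suc)
  let ?E = "exp (- (1 / 2) * ((\<Sum>j\<in>X. (x j)\<^sup>2) + (\<Sum>j\<in>Y. (y j)\<^sup>2)))"
  have "fact n * (1 / q_const \<beta> n ?a * ((2 * t) ^ n * (\<Prod>j\<in>Y. (x j * y j) ^ (2 * (n - j)))) powr ?b * ?E *
      (\<Prod>j\<in>X. (x j)\<^sup>2) powr (\<beta> * ?a / 2) * (f / t powr (\<beta> * real n / 2 - 1))) *
    ?wx * ?wy * t ^ k =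
    fact n / q_const \<beta> n ?a * (((2 * t) ^ n) powr ?b / t powr (\<beta> * real n / 2 - 1) * t ^ k) * 2 ^ n * 2 ^ k *
    (?px powr ?b * (\<Prod>j\<in>X. (x j)\<^sup>2) powr (\<beta> * ?a / 2) * ?vx) *
    (?py powr ?b * ?vy) * ?E * f"
    unfolding xyp two by (simp only: divide_inverse mult_ac mult_1_left)
  also have "\<dots> = (fact n / q_const \<beta> n ?a * 2 powr (real n * ?b) * 2 ^ n * 2 ^ k) * PX * PY * ?E * f"
    unfolding px py pt by (simp only: mult_ac)
  also have "fact n / q_const \<beta> n ?a * 2 powr (real n * ?b) * 2 ^ n * 2 ^ k =
    (2 powr (real n - \<beta> * ?sx / 2) / ?gx) *
    (2 powr (real k - \<beta> * ?sy / 2) / ?gy)"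
  proof -
    have i: "X = {1..Suc k}" "Y = {1..k}" by (auto simp: X_def Y_def)
    have s: "?sx + ?sy = real n * real m"
    proof -
      have "?sx = (\<Sum>j\<in>Y. real m - real j + 1) + (real m - real n + 1)"
        unfolding XY(1) using XY(2) fY by simp
      then show ?thesis using sum_le_interval[of m k n] unfolding Y_def[symmetric] by (simp add: n_def algebra_simps)
    qed
    have s': "2 powr (real n - \<beta> * ?sx / 2) * 2 powr (real k - \<beta> * ?sy / 2) =
      2 ^ n * 2 ^ k / 2 powr (real n * (\<beta> * real m / 2))"
    proof -
      have e: "real n - \<beta> * u / 2 + (real k - \<beta> * v / 2) = real n + real k - \<beta> / 2 * (u + v)" for u v
        by (simp add: distrib_left)
      have "real n + real k - \<beta> / 2 * (real n * real m) = real n + real k - real n * (\<beta> * real m / 2)" by simp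
      then show ?thesis unfolding powr_add[symmetric] e s
        by (simp add: powr_diff powr_add powr_realpow mult_ac del: power_Suc)
    qed
    have q: "q_const \<beta> n ?a = 2 powr (real n * ?b) * 2 powr (real n * (\<beta> * real m / 2)) * fact n *
      ?gx * ?gy"
      unfolding n_def i by (rule q_const_eq[OF b m])
    show ?thesis unfolding q times_divide_times_eq s'
      by (simp add: field_simps n_def del: fact_Suc power_Suc of_nat_Suc)
  qed
  also have "(2 powr (real n - \<beta> * ?sx / 2) / ?gx) *
    (2 powr (real k - \<beta> * ?sy / 2) / ?gy) * PX * PY * ?E * f =
    ?cx * ?cy * f"
  proof -
    have 1: "?E = exp (- (1 / 2) * (\<Sum>j\<in>X. (x j)\<^sup>2)) * exp (- (1 / 2) * (\<Sum>j\<in>Y. (y j)\<^sup>2))"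
      by (simp add: exp_add[symmetric] algebra_simps)
    have 2: "?cx =
      2 powr (real n - \<beta> * ?sx / 2) / ?gx *
      PX * exp (- (1 / 2) * (\<Sum>j\<in>X. (x j)\<^sup>2))"
      unfolding PX_def cX[symmetric] by (rule prod_chi_density[OF fX x'])
    have 3: "?cy =
      2 powr (real k - \<beta> * ?sy / 2) / ?gy *
      PY * exp (- (1 / 2) * (\<Sum>j\<in>Y. (y j)\<^sup>2))"
      unfolding PY_def cY[symmetric] by (rule prod_chi_density[OF fY y'])
    show ?thesis unfolding 1 2 3 by (simp only: mult_ac)
  qed
  finally show ?thesis .
qed

text \<open>The comparison is the one for full rank, except that the product of the moduli also
  contains \<open>t\<close>: its exponent, the \<open>Suc m\<close> factors from the resultant and
  the Jacobian \<open>t ^ m\<close> together make up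
  \<open>\<beta> * real n / 2 - 1\<close>.\<close>

lemma density_matching_deficient:
  fixes x y :: "nat \<Rightarrow> real"
  assumes b: "\<beta> > 0" and m: "0 < m" "m < n" and t: "t > 0"
    and x: "\<And>j. j \<in> {1..<1 + m} \<Longrightarrow> x j > 0" and y: "\<And>j. j \<in> {1..<1 + m} \<Longrightarrow> y j > 0"
  defines "Y \<equiv> {1..<1 + m}"
  shows "fact (Suc m) * (1 / t_const \<beta> m n *
      ((2 * t) ^ Suc m * (\<Prod>j\<in>Y. (x j * y j) ^ (2 * (Suc m - j)))) powr (\<beta> / 2 - 1) *
      exp (- (1 / 2) * ((\<Sum>j\<in>Y. (x j)\<^sup>2) + (\<Sum>j\<in>Y. (y j)\<^sup>2))) *
      (t * (\<Prod>j\<in>Y. (y j)\<^sup>2)) powr (\<beta> * (real n - real m - 1) / 2) * (f / t powr (\<beta> * real n / 2 - 1))) *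
    (\<Prod>j\<in>Y. 2 * x j ^ (2 * (m + 1 - 1 - j) + 1)) * (\<Prod>j\<in>Y. 2 * y j ^ (2 * (m + 1 - 1 - j) + 1)) * t ^ m =
    (\<Prod>j\<in>Y. chi_density (\<beta> * (real m - real j + 1)) (x j)) * (\<Prod>j\<in>Y. chi_density (\<beta> * (real n - real j)) (y j)) * f"
proof -
  let ?wx = "\<Prod>j\<in>Y. 2 * x j ^ (2 * (m + 1 - 1 - j) + 1)"
  let ?wy = "\<Prod>j\<in>Y. 2 * y j ^ (2 * (m + 1 - 1 - j) + 1)"
  let ?cx = "\<Prod>j\<in>Y. chi_density (\<beta> * (real m - real j + 1)) (x j)"
  let ?cy = "\<Prod>j\<in>Y. chi_density (\<beta> * (real n - real j)) (y j)"
  let ?gx = "\<Prod>j\<in>Y. Gamma (\<beta> * (real m - real j + 1) / 2)"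
  let ?gy = "\<Prod>j\<in>Y. Gamma (\<beta> * (real n - real j) / 2)"
  let ?sx = "\<Sum>j\<in>Y. real m - real j + 1"
  let ?sy = "\<Sum>j\<in>Y. real n - real j"
  let ?px = "\<Prod>j\<in>Y. x j ^ (2 * (Suc m - j))"
  let ?py = "\<Prod>j\<in>Y. y j ^ (2 * (Suc m - j))"
  let ?vx = "\<Prod>j\<in>Y. x j ^ (2 * (m + 1 - 1 - j) + 1)"
  let ?vy = "\<Prod>j\<in>Y. y j ^ (2 * (m + 1 - 1 - j) + 1)"
  have fY: "finite Y" and cY: "card Y = m" by (auto simp: Y_def)
  have x': "\<And>j. j \<in> Y \<Longrightarrow> x j > 0" and y': "\<And>j. j \<in> Y \<Longrightarrow> y j > 0" using x y by (auto simp: Y_def)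
  let ?b = "\<beta> / 2 - 1" and ?c = "\<beta> * (real n - real m - 1) / 2"
  define PX where "PX = (\<Prod>j\<in>Y. x j powr (\<beta> * (real m - real j + 1) - 1))"
  define PY where "PY = (\<Prod>j\<in>Y. y j powr (\<beta> * (real n - real j) - 1))"
  have r: "real (Suc m - j) = real m + 1 - real j" "real (m + 1 - 1 - j) = real m - real j" if "j \<in> Y" for j
    using that by (auto simp: Y_def of_nat_diff)
  have px: "?px powr ?b * ?vx = PX"
  proof -
    have "?px powr ?b * (\<Prod>j\<in>Y. x j ^ 0) powr 1 * ?vx = PX"
      unfolding PX_def
    proof (rule prod_power_powr[OF fY x'])
      fix j assume j: "j \<in> Y"
      show "real (2 * (Suc m - j)) * ?b + real 0 * 1 + real (2 * (m + 1 - 1 - j) + 1) = \<beta> * (real m - real j + 1) - 1"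
        unfolding of_nat_mult of_nat_add[of "2 * _"] r[OF j] by (simp add: field_simps)
    qed
    then show ?thesis by simp
  qed
  have py: "?py powr ?b * (\<Prod>j\<in>Y. (y j)\<^sup>2) powr ?c * ?vy = PY"
    unfolding PY_def
  proof (rule prod_power_powr[OF fY y'])
    fix j assume j: "j \<in> Y"
    show "real (2 * (Suc m - j)) * ?b + real 2 * ?c + real (2 * (m + 1 - 1 - j) + 1) = \<beta> * (real n - real j) - 1"
      unfolding of_nat_mult of_nat_add[of "2 * _"] r[OF j] by (simp add: field_simps)
  qed
  have pt: "((2 * t) ^ Suc m) powr ?b * t powr ?c / t powr (\<beta> * real n / 2 - 1) * t ^ m = 2 powr (real (Suc m) * ?b)"
  proof -
    have "((2 * t) ^ Suc m) powr ?b * t powr ?c / t powr (\<beta> * real n / 2 - 1) * t ^ m =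
      2 powr (real (Suc m) * ?b) * t powr (real (Suc m) * ?b + ?c - (\<beta> * real n / 2 - 1) + real m)"
    proof -
      have "((2 * t) ^ Suc m) powr ?b = (2 * t) powr (real (Suc m) * ?b)" by (rule power_powr) (use t in simp)
      also have "\<dots> = 2 powr (real (Suc m) * ?b) * t powr (real (Suc m) * ?b)" by (rule powr_mult)
      finally show ?thesis unfolding powr_add powr_diff powr_realpow[OF t] by (simp only: divide_inverse mult_ac)
    qed
    also have "real (Suc m) * ?b + ?c - (\<beta> * real n / 2 - 1) + real m = 0" by (simp add: field_simps)
    finally show ?thesis using t by simp
  qed
  have xyp: "((2 * t) ^ Suc m * (\<Prod>j\<in>Y. (x j * y j) ^ (2 * (Suc m - j)))) powr ?b =
    ((2 * t) ^ Suc m) powr ?b * (?px powr ?b * ?py powr ?b)"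
  proof -
    have "0 < (2 * t) ^ Suc m" "0 < ?px" "0 < ?py"
      using t x' y' by (auto intro!: prod_pos zero_less_power)
    then show ?thesis unfolding power_mult_distrib[of "x _" "y _"] prod.distrib
      by (simp only: powr_mult less_imp_le mult_pos_pos mult_nonneg_nonneg)
  qed
  have ty: "(t * (\<Prod>j\<in>Y. (y j)\<^sup>2)) powr ?c = t powr ?c * (\<Prod>j\<in>Y. (y j)\<^sup>2) powr ?c"
    by (rule powr_mult)
  have two: "?wx = 2 ^ m * ?vx"
    "?wy = 2 ^ m * ?vy"
    by (simp_all add: prod.distrib cY del: power_Suc)
  let ?E = "exp (- (1 / 2) * ((\<Sum>j\<in>Y. (x j)\<^sup>2) + (\<Sum>j\<in>Y. (y j)\<^sup>2)))"
  have "fact (Suc m) * (1 / t_const \<beta> m n * ((2 * t) ^ Suc m * (\<Prod>j\<in>Y. (x j * y j) ^ (2 * (Suc m - j)))) powr ?b * ?E *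
      (t * (\<Prod>j\<in>Y. (y j)\<^sup>2)) powr ?c * (f / t powr (\<beta> * real n / 2 - 1))) *
    ?wx * ?wy * t ^ m =
    fact (Suc m) / t_const \<beta> m n * (((2 * t) ^ Suc m) powr ?b * t powr ?c / t powr (\<beta> * real n / 2 - 1) * t ^ m) * 2 ^ m * 2 ^ m *
    (?px powr ?b * ?vx) *
    (?py powr ?b * (\<Prod>j\<in>Y. (y j)\<^sup>2) powr ?c * ?vy) * ?E * f"
    unfolding xyp ty two by (simp only: divide_inverse mult_ac mult_1_left)
  also have "\<dots> = (fact (Suc m) / t_const \<beta> m n * 2 powr (real (Suc m) * ?b) * 2 ^ m * 2 ^ m) * PX * PY * ?E * f"
    unfolding px py pt by (simp only: mult_ac)
  also have "fact (Suc m) / t_const \<beta> m n * 2 powr (real (Suc m) * ?b) * 2 ^ m * 2 ^ m =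
    (2 powr (real m - \<beta> * ?sx / 2) / ?gx) *
    (2 powr (real m - \<beta> * ?sy / 2) / ?gy)"
  proof -
    have i: "Y = {1..m}" by (auto simp: Y_def)
    have s: "?sx + ?sy = real m * real n"
      using sum_le_interval[of m m n] unfolding Y_def[symmetric] by simp
    have s': "2 powr (real m - \<beta> * ?sx / 2) * 2 powr (real m - \<beta> * ?sy / 2) =
      2 ^ m * 2 ^ m / 2 powr (real m * (\<beta> * real n / 2))"
    proof -
      have e: "real m - \<beta> * u / 2 + (real m - \<beta> * v / 2) = real m + real m - \<beta> / 2 * (u + v)" for u v
        by (simp add: distrib_left)
      have "real m + real m - \<beta> / 2 * (real m * real n) = real m + real m - real m * (\<beta> * real n / 2)" by simp
      then show ?thesis unfolding powr_add[symmetric] e s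
        by (simp only: powr_diff powr_add powr_realpow zero_less_numeral)
    qed
    have q: "t_const \<beta> m n = 2 powr (real (Suc m) * ?b) * 2 powr (real m * (\<beta> * real n / 2)) * fact (Suc m) *
      ?gx * ?gy"
      unfolding i t_const_eq[OF b m] by (simp add: add.commute)
    show ?thesis unfolding q times_divide_times_eq s'
      by (simp add: field_simps del: fact_Suc power_Suc of_nat_Suc)
  qed
  also have "(2 powr (real m - \<beta> * ?sx / 2) / ?gx) *
    (2 powr (real m - \<beta> * ?sy / 2) / ?gy) * PX * PY * ?E * f =
    ?cx * ?cy * f"
  proof -
    have 1: "?E = exp (- (1 / 2) * (\<Sum>j\<in>Y. (x j)\<^sup>2)) * exp (- (1 / 2) * (\<Sum>j\<in>Y. (y j)\<^sup>2))"
      by (simp add: exp_add[symmetric] algebra_simps)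
    have 2: "?cx =
      2 powr (real (card Y) - \<beta> * ?sx / 2) / ?gx *
      PX * exp (- (1 / 2) * (\<Sum>j\<in>Y. (x j)\<^sup>2))"
      unfolding PX_def by (rule prod_chi_density[OF fY x'])
    have 3: "?cy =
      2 powr (real (card Y) - \<beta> * ?sy / 2) / ?gy *
      PY * exp (- (1 / 2) * (\<Sum>j\<in>Y. (y j)\<^sup>2))"
      unfolding PY_def by (rule prod_chi_density[OF fY y'])
    show ?thesis unfolding 1 2 3 cY by (simp only: mult_ac)
  qed
  finally show ?thesis .
qed

section \<open>The eigenvalue laws\<close>

text \<open>The densities of both cases without the Vandermonde factor; \<open>h\<close> is the modulus or real part of a
  product of roots.\<close>
definition weight :: "real \<Rightarrow> real \<Rightarrow> nat \<Rightarrow> real \<Rightarrow> ((nat \<Rightarrow> complex) \<Rightarrow> real) \<Rightarrow> real \<Rightarrow> (real \<Rightarrow> real) \<Rightarrow> (nat \<Rightarrow> complex) \<Rightarrow> real" where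
  "weight \<beta> d N c h e F z = c * (\<Prod>j = 1..N. \<Prod>k = 1..N. cmod (z j - cnj (z k))) powr (\<beta> / 2 - 1) *
     exp (- (1 / 2) * (\<Sum>j = 1..N. Re (z j))) * h z powr e *
     (F (\<Sum>j = 1..N. Im (z j)) / (\<Sum>j = 1..N. Im (z j)) powr (\<beta> * d / 2 - 1))"

lemma prod_powr_real: "(\<Prod>j\<in>I. f j powr a) = (\<Prod>j\<in>I. f j) powr a" for f :: "'a \<Rightarrow> real"
  by (induction I rule: infinite_finite_induct) (auto simp: powr_mult)

lemma density_full_weight:
  "density_full \<beta> n a F z = vandermonde n z * weight \<beta> n n (1 / q_const \<beta> n a) (\<lambda>z. Re (\<Prod>j = 1..n. z j)) (\<beta> * a / 2) F z"
  unfolding density_full_def weight_def vandermonde_def Let_def prod_powr_real by (simp only: mult_ac)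

lemma density_deficient_weight:
  "density_deficient \<beta> m n F z = vandermonde (Suc m) z *
    weight \<beta> n (Suc m) (1 / t_const \<beta> m n) (\<lambda>z. \<Prod>j = 1..Suc m. cmod (z j)) (\<beta> * (real n - real m - 1) / 2) F z"
  unfolding density_deficient_def weight_def vandermonde_def Let_def prod_powr_real Suc_eq_plus1[symmetric] by (simp only: mult_ac)

lemma measurable_weight:
  assumes [measurable]: "F \<in> borel_measurable borel" "h \<in> borel_measurable (CC {1..N})"
  shows "weight \<beta> d N c h e F \<in> borel_measurable (CC {1..N})"
proof -
  note c = measurable_CC_component
  have [measurable]: "(\<lambda>z. \<Prod>j = 1..N. \<Prod>k = 1..N. cmod (z j - cnj (z k))) \<in> borel_measurable (CC {1..N})"
  proof (intro borel_measurable_prod)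
    fix j k assume "j \<in> {1..N}" "k \<in> {1..N}"
    note [measurable] = c[OF this(1)] c[OF this(2)]
    have [measurable]: "cnj \<in> borel_measurable borel" by (intro borel_measurable_continuous_onI continuous_intros)
    show "(\<lambda>z. cmod (z j - cnj (z k))) \<in> borel_measurable (CC {1..N})" by measurable
  qed
  have [measurable]: "(\<lambda>z. \<Sum>j = 1..N. Re (z j)) \<in> borel_measurable (CC {1..N})"
    "(\<lambda>z. \<Sum>j = 1..N. Im (z j)) \<in> borel_measurable (CC {1..N})"
    by (intro borel_measurable_sum measurable_compose[OF c borel_measurable_Re] measurable_compose[OF c borel_measurable_Im]; assumption)+
  show ?thesis unfolding weight_def by measurable
qed

lemma rootpoly_image_mset:
  "rootpoly n z = rootpoly n z' \<longleftrightarrow> image_mset z (mset_set {1..n}) = image_mset z' (mset_set {1..n})"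
proof
  assume "image_mset z (mset_set {1..n}) = image_mset z' (mset_set {1..n})"
  moreover have "rootpoly n u = (\<Prod>x\<in>#image_mset u (mset_set {1..n}). [:- x, 1:])" for u
    unfolding rootpoly_def prod_unfold_prod_mset by (simp add: image_mset.compositionality o_def)
  ultimately show "rootpoly n z = rootpoly n z'" by simp
next
  assume "rootpoly n z = rootpoly n z'"
  then have "proots (rootpoly n z) = proots (rootpoly n z')" by simp
  then show "image_mset z (mset_set {1..n}) = image_mset z' (mset_set {1..n})" unfolding proots_rootpoly .
qed

lemma prod_roots_cong:
  assumes "rootpoly n z = rootpoly n z'"
  shows "(\<Prod>j = 1..n. f (z j)) = (\<Prod>j = 1..n. f (z' j))"
proof -
  have "(\<Prod>j = 1..n. f (u j)) = (\<Prod>x\<in>#image_mset u (mset_set {1..n}). f x)" for u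
    by (simp add: prod_unfold_prod_mset image_mset.compositionality o_def)
  then show ?thesis using assms[unfolded rootpoly_image_mset] by simp
qed

lemma sum_roots_cong:
  assumes "rootpoly n z = rootpoly n z'"
  shows "(\<Sum>j = 1..n. f (z j)) = (\<Sum>j = 1..n. f (z' j))"
proof -
  have "(\<Sum>j = 1..n. f (u j)) = (\<Sum>x\<in>#image_mset u (mset_set {1..n}). f x)" for u
    by (simp add: sum_unfold_sum_mset image_mset.compositionality o_def)
  then show ?thesis using assms[unfolded rootpoly_image_mset] by simp
qed

text \<open>The weight depends on the multiset of roots only and may be evaluated at any listing of
  them, in particular at the measurable one given by \<open>root_vec\<close>.\<close>

lemma weight_cong:
  assumes "rootpoly N z = rootpoly N z'" "h z = h z'"
  shows "weight \<beta> d N c h e F z = weight \<beta> d N c h e F z'"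
proof -
  have "(\<Prod>j = 1..N. \<Prod>k = 1..N. cmod (z j - cnj (z k))) = (\<Prod>j = 1..N. \<Prod>k = 1..N. cmod (z j - cnj (z' k)))"
    by (intro prod.cong refl prod_roots_cong[OF assms(1)])
  also have "\<dots> = (\<Prod>j = 1..N. \<Prod>k = 1..N. cmod (z' j - cnj (z' k)))"
    by (rule prod_roots_cong[OF assms(1)])
  finally show ?thesis unfolding weight_def assms(2) by (simp only: sum_roots_cong[OF assms(1)])
qed

text \<open>Running over ordered pairs of distinct indices absorbs the square and makes the
  invariance under permutations visible.\<close>

lemma vandermonde_offdiagonal: "vandermonde n z = (\<Prod>j\<in>{1..n}. \<Prod>k\<in>{1..n} - {j}. cmod (z j - z k))"
proof (induction n)
  case (Suc n)
  have "(\<Prod>k\<in>{1..Suc n} - {j}. cmod (z j - z k)) = (\<Prod>k\<in>{1..n} - {j}. cmod (z j - z k)) * cmod (z j - z (Suc n))"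
    if "j \<in> {1..n}" for j
  proof -
    have "{1..Suc n} - {j} = insert (Suc n) ({1..n} - {j})" using that by auto
    then show ?thesis by simp
  qed
  then have "(\<Prod>j\<in>{1..n}. \<Prod>k\<in>{1..Suc n} - {j}. cmod (z j - z k)) =
    (\<Prod>j\<in>{1..n}. (\<Prod>k\<in>{1..n} - {j}. cmod (z j - z k)) * cmod (z j - z (Suc n)))"
    by (intro prod.cong refl)
  moreover have "{1..Suc n} - {Suc n} = {1..n}" by auto
  moreover have "(\<Prod>j\<in>{1..Suc n}. f j) = (\<Prod>j\<in>{1..n}. f j) * f (Suc n)" for f :: "nat \<Rightarrow> real" by simp
  ultimately have "(\<Prod>j\<in>{1..Suc n}. \<Prod>k\<in>{1..Suc n} - {j}. cmod (z j - z k)) =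
    (\<Prod>j\<in>{1..n}. (\<Prod>k\<in>{1..n} - {j}. cmod (z j - z k)) * cmod (z j - z (Suc n))) * (\<Prod>k\<in>{1..n}. cmod (z (Suc n) - z k))"
    by (simp only:)
  also have "\<dots> = vandermonde n z * ((\<Prod>j\<in>{1..n}. cmod (z j - z (Suc n))) * (\<Prod>k\<in>{1..n}. cmod (z (Suc n) - z k)))"
    unfolding Suc.IH prod.distrib by (simp only: mult.assoc)
  also have "\<dots> = vandermonde (Suc n) z"
  proof -
    have "vandermonde (Suc n) z = vandermonde n z * (\<Prod>j\<in>{1..n}. (cmod (z j - z (Suc n)))\<^sup>2)"
      by (simp add: vandermonde_def atLeastLessThanSuc_atLeastAtMost)
    then show ?thesis
      by (simp only: power2_eq_square prod.distrib norm_minus_commute[of "z (Suc n)"])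
  qed
  finally show ?case ..
qed (simp add: vandermonde_def)

lemma vandermonde_permute:
  assumes "\<sigma> permutes {1..n}"
  shows "vandermonde n (\<lambda>j. z (\<sigma> j)) = vandermonde n z"
proof -
  have "(\<Prod>k\<in>{1..n} - {j}. cmod (z (\<sigma> j) - z (\<sigma> k))) = (\<Prod>k\<in>{1..n} - {\<sigma> j}. cmod (z (\<sigma> j) - z k))" for j
  proof (rule prod.reindex_bij_betw)
    show "bij_betw \<sigma> ({1..n} - {j}) ({1..n} - {\<sigma> j})"
      using permutes_imp_bij[OF assms] permutes_inj[OF assms]
      by (auto simp: bij_betw_def inj_on_def inj_def permutes_image[OF assms] image_set_diff)
  qed
  then have "vandermonde n (\<lambda>j. z (\<sigma> j)) = (\<Prod>j\<in>{1..n}. \<Prod>k\<in>{1..n} - {\<sigma> j}. cmod (z (\<sigma> j) - z k))"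
    unfolding vandermonde_offdiagonal by simp
  also have "\<dots> = vandermonde n z"
    unfolding vandermonde_offdiagonal by (rule prod.reindex_bij_betw[OF permutes_imp_bij[OF assms]])
  finally show ?thesis .
qed

lemma rootpoly_permute:
  assumes "\<sigma> permutes {1..n}"
  shows "rootpoly n (\<lambda>j. z (\<sigma> j)) = rootpoly n z"
  unfolding rootpoly_def by (rule prod.reindex_bij_betw[OF permutes_imp_bij[OF assms]])

lemma chi_density_nonneg: "k > 0 \<Longrightarrow> 0 \<le> chi_density k x"
  using Gamma_real_pos[of "k / 2"] by (simp add: chi_density_def)

text \<open>Reduces both cases to the pointwise identity \<open>match\<close>: the claimed density
  of one ordering, times the number of orderings and the Jacobians, is the joint density of the
  entries and of \<open>l\<close>. Evaluating \<open>w\<close> at \<open>root_vec\<close> makes it a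
  function of the polynomial.\<close>

lemma jacobi_law:
  fixes G :: "complex poly \<Rightarrow> ennreal" and w :: "(nat \<Rightarrow> complex) \<Rightarrow> real"
  assumes G[measurable]: "G \<in> borel_measurable polyM" and w[measurable]: "w \<in> borel_measurable (CC {1..Suc k})" and s: "s \<le> 1"
    and a: "\<And>j. j \<in> {1..<1 + Suc k - s} \<Longrightarrow> a j > 0" and b: "\<And>j. j \<in> {1..<1 + k} \<Longrightarrow> b j > 0"
    and match: "\<And>x y t z. \<lbrakk>\<And>j. j \<in> {1..<1 + Suc k - s} \<Longrightarrow> x j > 0; \<And>j. j \<in> {1..<1 + k} \<Longrightarrow> y j > 0; t > 0;
        rootpoly (Suc k) z = perturbed_poly s k x y t\<rbrakk> \<Longrightarrow>
      fact (Suc k) * w z * (\<Prod>j\<in>{1..<1 + Suc k - s}. 2 * x j ^ (2 * (k + 1 - s - j) + 1)) *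
        (\<Prod>j\<in>{1..<1 + k}. 2 * y j ^ (2 * (k + 1 - 1 - j) + 1)) * t ^ k =
      (\<Prod>j\<in>{1..<1 + Suc k - s}. chi_density (a j) (x j)) * (\<Prod>j\<in>{1..<1 + k}. chi_density (b j) (y j)) * F t"
  shows "ennreal (fact (Suc k)) * (\<integral>\<^sup>+a. \<integral>\<^sup>+c. (if sector s k (ripoly s k a c)
        then ennreal (w (root_vec (Suc k) (ripoly s k a c))) * G (ripoly s k a c) else 0) \<partial>LL {0..<Suc k} \<partial>LL {s..<Suc k}) =
    (\<integral>\<^sup>+x. \<integral>\<^sup>+y. \<integral>\<^sup>+t. (\<Prod>j\<in>{1..<1 + Suc k - s}. ennreal (chi_density (a j) (x j))) *
       (\<Prod>j\<in>{1..<1 + k}. ennreal (chi_density (b j) (y j))) *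
       (ennreal (F t) * indicator {0<..} t) * G (perturbed_poly s k x y t) \<partial>lborel \<partial>LL {1..<1 + k} \<partial>LL {1..<1 + Suc k - s})"
proof -
  let ?N = "Suc k" and ?X = "{1..<1 + Suc k - s}" and ?Y = "{1..<1 + k}"
  define K where "K p = ennreal (fact ?N) * (ennreal (w (root_vec ?N p)) * G p)" for p
  have [measurable]: "(\<lambda>p. w (root_vec ?N p)) \<in> borel_measurable polyM"
    by (rule measurable_compose[OF measurable_root_vec w])
  have K: "K \<in> borel_measurable polyM" unfolding K_def by measurable
  define H where "H p = (if sector s k p then ennreal (w (root_vec ?N p)) * G p else 0)" for p
  have H: "H \<in> borel_measurable polyM" unfolding H_def by measurable
  interpret sc: sigma_finite_measure "LL {0..<?N}" by (rule sigma_finite_PiM_lborel) simp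
  have Hr: "(\<lambda>q. H (ripoly s k (fst q) (snd q))) \<in> borel_measurable (LL {s..<?N} \<Otimes>\<^sub>M LL {0..<?N})"
    by (rule measurable_compose[OF measurable_ripoly H])
  have "ennreal (fact ?N) * (\<integral>\<^sup>+a. \<integral>\<^sup>+c. H (ripoly s k a c) \<partial>LL {0..<?N} \<partial>LL {s..<?N}) =
    (\<integral>\<^sup>+a. ennreal (fact ?N) * (\<integral>\<^sup>+c. H (ripoly s k a c) \<partial>LL {0..<?N}) \<partial>LL {s..<?N})"
    using Hr by (intro nn_integral_cmult[symmetric] sc.borel_measurable_nn_integral) (simp add: case_prod_beta')
  also have "\<dots> = (\<integral>\<^sup>+a. \<integral>\<^sup>+c. ennreal (fact ?N) * H (ripoly s k a c) \<partial>LL {0..<?N} \<partial>LL {s..<?N})"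
    using measurable_compose[OF measurable_Pair1' Hr] by (intro nn_integral_cong nn_integral_cmult[symmetric]) simp
  also have "\<dots> = (\<integral>\<^sup>+a. \<integral>\<^sup>+c. (if sector s k (ripoly s k a c) then K (ripoly s k a c) else 0) \<partial>LL {0..<?N} \<partial>LL {s..<?N})"
    by (intro nn_integral_cong) (simp add: H_def K_def)
  also have "\<dots> = (\<integral>\<^sup>+x. \<integral>\<^sup>+y. \<integral>\<^sup>+t. Wx s 1 k x * Wy 1 k y * (indicator {0<..} t * ennreal (t ^ k) * K (perturbed_poly s k x y t))
      \<partial>lborel \<partial>LL ?Y \<partial>LL ?X)"
    by (rule nn_integral_sector[OF K s])
  also have "\<dots> = (\<integral>\<^sup>+x. \<integral>\<^sup>+y. \<integral>\<^sup>+t. (\<Prod>j\<in>?X. ennreal (chi_density (a j) (x j))) * (\<Prod>j\<in>?Y. ennreal (chi_density (b j) (y j))) *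
       (ennreal (F t) * indicator {0<..} t) * G (perturbed_poly s k x y t) \<partial>lborel \<partial>LL ?Y \<partial>LL ?X)"
  proof (intro nn_integral_cong)
    fix x y :: "nat \<Rightarrow> real" and t :: real
    show "Wx s 1 k x * Wy 1 k y * (indicator {0<..} t * ennreal (t ^ k) * K (perturbed_poly s k x y t)) =
      (\<Prod>j\<in>?X. ennreal (chi_density (a j) (x j))) * (\<Prod>j\<in>?Y. ennreal (chi_density (b j) (y j))) *
       (ennreal (F t) * indicator {0<..} t) * G (perturbed_poly s k x y t)"
    proof (cases "(\<forall>j\<in>?X. x j > 0) \<and> (\<forall>j\<in>?Y. y j > 0) \<and> t > 0")
      case True
      let ?z = "root_vec ?N (perturbed_poly s k x y t)"
      let ?wx = "\<Prod>j\<in>?X. 2 * x j ^ (2 * (k + 1 - s - j) + 1)" and ?wy = "\<Prod>j\<in>?Y. 2 * y j ^ (2 * (k + 1 - 1 - j) + 1)"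
      let ?cx = "\<Prod>j\<in>?X. chi_density (a j) (x j)" and ?cy = "\<Prod>j\<in>?Y. chi_density (b j) (y j)"
      have z: "rootpoly ?N ?z = perturbed_poly s k x y t" by (rule rootpoly_root_vec[OF perturbed_poly_monic])
      have px: "0 \<le> 2 * x j ^ e" if "j \<in> ?X" for j e using True that by (simp add: less_imp_le)
      have py: "0 \<le> 2 * y j ^ e" if "j \<in> ?Y" for j e using True that by (simp add: less_imp_le)
      have pos: "?wx \<ge> 0" "?wy \<ge> 0" "?cx \<ge> 0" "?cy \<ge> 0"
        by (rule prod_nonneg, rule px, assumption) (rule prod_nonneg, rule py, assumption,
          rule prod_nonneg, rule chi_density_nonneg, rule a, assumption,
          rule prod_nonneg, rule chi_density_nonneg, rule b, assumption)
      have Wx: "Wx s 1 k x = ennreal ?wx"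
      proof -
        have "Wx s 1 k x = (\<Prod>j\<in>?X. ennreal (2 * x j ^ (2 * (k + 1 - s - j) + 1)))"
          unfolding Wx_def using True by (intro prod.cong refl) simp
        also have "\<dots> = ennreal ?wx" by (rule prod_ennreal, rule px, assumption)
        finally show ?thesis .
      qed
      have Wy: "Wy 1 k y = ennreal ?wy"
      proof -
        have "Wy 1 k y = (\<Prod>j\<in>?Y. ennreal (2 * y j ^ (2 * (k + 1 - 1 - j) + 1)))"
          unfolding Wy_def using True by (intro prod.cong refl) simp
        also have "\<dots> = ennreal ?wy" by (rule prod_ennreal, rule py, assumption)
        finally show ?thesis .
      qed
      have cx: "(\<Prod>j\<in>?X. ennreal (chi_density (a j) (x j))) = ennreal ?cx"
        using a by (intro prod_ennreal chi_density_nonneg) auto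
      have cy: "(\<Prod>j\<in>?Y. ennreal (chi_density (b j) (y j))) = ennreal ?cy"
        using b by (intro prod_ennreal chi_density_nonneg) auto
      have "Wx s 1 k x * Wy 1 k y * (ennreal (t ^ k) * (ennreal (fact ?N) * ennreal (w ?z))) =
        ennreal (?wx * (?wy * (t ^ k * (fact ?N * w ?z))))"
        unfolding Wx Wy using pos True by (simp add: ennreal_mult' mult.assoc del: fact_Suc)
      also have "?wx * (?wy * (t ^ k * (fact ?N * w ?z))) = ?cx * (?cy * F t)"
        using match[of x y t ?z] True z by (simp only: mult_ac)
      also have "ennreal (?cx * (?cy * F t)) = ennreal ?cx * (ennreal ?cy * ennreal (F t))"
        using pos by (simp add: ennreal_mult')
      finally have "Wx s 1 k x * Wy 1 k y * (ennreal (t ^ k) * (ennreal (fact ?N) * ennreal (w ?z))) * G (perturbed_poly s k x y t) =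
        ennreal ?cx * (ennreal ?cy * ennreal (F t)) * G (perturbed_poly s k x y t)" by simp
      then show ?thesis using True unfolding cx cy K_def by (simp add: mult_ac del: fact_Suc)
    next
      \<comment> \<open>Off the positive orthant both sides vanish, by the indicator of
        \<open>t\<close> or by a factor of the Jacobians and of the chi densities.\<close>
      case False
      consider "t \<le> 0" | j where "j \<in> ?X" "\<not> x j > 0" | j where "j \<in> ?Y" "\<not> y j > 0" using False by fastforce
      then show ?thesis
      proof cases
        case 1
        then show ?thesis by simp
      next
        case 2
        have "Wx s 1 k x = 0" unfolding Wx_def using 2 by (intro prod_zero bexI[of _ j]) auto
        moreover have "(\<Prod>j\<in>?X. ennreal (chi_density (a j) (x j))) = 0"
          using 2 by (intro prod_zero bexI[of _ j]) (auto simp: chi_density_def)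
        ultimately show ?thesis by simp
      next
        case 3
        have "Wy 1 k y = 0" unfolding Wy_def using 3 by (intro prod_zero bexI[of _ j]) auto
        moreover have "(\<Prod>j\<in>?Y. ennreal (chi_density (b j) (y j))) = 0"
          using 3 by (intro prod_zero bexI[of _ j]) (auto simp: chi_density_def)
        ultimately show ?thesis by simp
      qed
    qed
  qed
  finally show ?thesis unfolding H_def .
qed

section \<open>Invariance under permutations of the roots\<close>

definition perm_vec :: "nat \<Rightarrow> (nat \<Rightarrow> nat) \<Rightarrow> (nat \<Rightarrow> complex) \<Rightarrow> nat \<Rightarrow> complex" where
  "perm_vec n \<sigma> z = (\<lambda>j\<in>{1..n}. z (\<sigma> j))"

lemma measurable_perm_vec:
  assumes "\<sigma> permutes {1..n}"
  shows "perm_vec n \<sigma> \<in> CC {1..n} \<rightarrow>\<^sub>M CC {1..n}"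
  unfolding perm_vec_def
proof (rule measurable_restrict)
  fix j assume "j \<in> {1..n}"
  then have "\<sigma> j \<in> {1..n}" by (simp only: permutes_in_image[OF assms])
  then show "(\<lambda>z. z (\<sigma> j)) \<in> CC {1..n} \<rightarrow>\<^sub>M lborel" by measurable
qed

lemma nn_integral_perm_vec:
  assumes \<sigma>: "\<sigma> permutes {1..n}" and F: "F \<in> borel_measurable (CC {1..n})"
  shows "(\<integral>\<^sup>+z. F (perm_vec n \<sigma> z) \<partial>CC {1..n}) = (\<integral>\<^sup>+z. F z \<partial>CC {1..n})"
proof -
  let ?\<tau> = "Hilbert_Choice.inv \<sigma>"
  have \<tau>: "?\<tau> permutes {1..n}" by (rule permutes_inv[OF \<sigma>])
  have "inv_into {1..n} ?\<tau> j = \<sigma> j" if "j \<in> {1..n}" for j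
  proof (rule inv_into_f_eq)
    show "inj_on ?\<tau> {1..n}" by (rule permutes_inj_on[OF \<tau>])
    show "\<sigma> j \<in> {1..n}" using that by (simp only: permutes_in_image[OF \<sigma>])
    show "?\<tau> (\<sigma> j) = j" by (rule permutes_inverses(2)[OF \<sigma>])
  qed
  then have "(\<lambda>j\<in>{1..n}. z (inv_into {1..n} ?\<tau> j)) = perm_vec n \<sigma> z" for z
    unfolding perm_vec_def by (intro restrict_ext) (simp only:)
  then show ?thesis
    using nn_integral_PiM_reindex[OF sigma_finite_lborel finite_atLeastAtMost permutes_imp_bij[OF \<tau>] F]
    by simp
qed

lemma rootpoly_perm_vec: "\<sigma> permutes {1..n} \<Longrightarrow> rootpoly n (perm_vec n \<sigma> z) = rootpoly n z"
  using rootpoly_cong[of n "perm_vec n \<sigma> z" "\<lambda>j. z (\<sigma> j)"] rootpoly_permute[of \<sigma> n z] by (simp add: perm_vec_def)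

lemma vandermonde_perm_vec: "\<sigma> permutes {1..n} \<Longrightarrow> vandermonde n (perm_vec n \<sigma> z) = vandermonde n z"
  using vandermonde_cong[of n "perm_vec n \<sigma> z" "\<lambda>j. z (\<sigma> j)"] vandermonde_permute[of \<sigma> n z] by (simp add: perm_vec_def)

text \<open>The coordinates \<open>(r, \<theta>)\<close> eliminate one angle and thereby hide the
  symmetry of the law. The thickened integrand treats all points alike, since the defect depends
  only on their product.\<close>

lemma slice_integrand_perm_vec:
  assumes \<sigma>: "\<sigma> permutes {1..Suc m}" and K: "K \<in> borel_measurable (CC {1..Suc m})"
  shows "slice_integrand m (\<lambda>z. K (perm_vec (Suc m) \<sigma> z)) z = slice_integrand m K (perm_vec (Suc m) \<sigma> z)"
proof -
  let ?N = "Suc m" and ?p = "perm_vec (Suc m) \<sigma>"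
  have K': "(\<lambda>z. K (?p z)) \<in> borel_measurable (CC {1..?N})"
    by (rule measurable_compose[OF measurable_perm_vec[OF \<sigma>] K])
  have "(\<Prod>j = 1..?N. ?p z j) = (\<Prod>j = 1..?N. z (\<sigma> j))"
    unfolding perm_vec_def by (intro prod.cong) auto
  also have "\<dots> = (\<Prod>j = 1..?N. z j)"
    by (rule prod.reindex_bij_betw[OF permutes_imp_bij[OF \<sigma>]])
  finally have t: "arg_defect ?N (?p z) = arg_defect ?N z" unfolding arg_defect_def by simp
  have "\<sigma> j \<in> {1..?N}" if "j \<in> {1..?N}" for j using that by (simp only: permutes_in_image[OF \<sigma>])
  then have r: "rotate_roots ?N (?p z) = ?p (rotate_roots ?N z)"
    unfolding rotate_roots_def t unfolding perm_vec_def by (intro restrict_ext) simp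
  show ?thesis
    unfolding slice_integrand_def[OF K] slice_integrand_def[OF K'] t r slice_dom_iff_sector rootpoly_perm_vec[OF \<sigma>] ..
qed

lemma domain_full_iff_sector: "z \<in> domain_full (Suc k) \<longleftrightarrow> sector 0 k (rootpoly (Suc k) z)"
  unfolding domain_full_def sector_iff[OF rootpoly_monic(1,2)] proots_rootpoly sumarg_def
  by (auto simp: sum_unfold_sum_mset image_mset.compositionality o_def)

lemma measurable_Re_prod: "(\<lambda>z. Re (\<Prod>j = 1..n. z j)) \<in> borel_measurable (CC {1..n})"
  by (intro measurable_compose[OF _ borel_measurable_Re] borel_measurable_prod measurable_CC_component)

lemma measurable_prod_cmod: "(\<lambda>z. \<Prod>j = 1..n. cmod (z j)) \<in> borel_measurable (CC {1..n})"
proof (rule borel_measurable_prod)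
  fix j assume "j \<in> {1..n}"
  note [measurable] = measurable_CC_component[OF this]
  show "(\<lambda>z. cmod (z j)) \<in> borel_measurable (CC {1..n})" by measurable
qed

text \<open>The values of \<open>F\<close> are controlled at positive arguments only; a Borel
  function that agrees with \<open>F\<close> there makes the weight measurable on the whole space of
  roots.\<close>

lemma borel_version:
  fixes F :: "real \<Rightarrow> real"
  assumes "\<forall>t>0. 0 \<le> F t" "(\<lambda>t. ennreal (F t) * indicator {0<..} t) \<in> borel_measurable lborel"
  obtains F' where "F' \<in> borel_measurable borel" "\<And>t. t > 0 \<Longrightarrow> F' t = F t"
proof
  show "(\<lambda>t. enn2real (ennreal (F t) * indicator {0<..} t)) \<in> borel_measurable borel" using assms(2) by simp
  show "enn2real (ennreal (F t) * indicator {0<..} t) = F t" if "t > 0" for t using assms(1) that by simp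
qed

lemma weight_F_cong:
  assumes "(\<Sum>j = 1..N. Im (z j)) > 0" "\<And>t. t > 0 \<Longrightarrow> F' t = F t"
  shows "weight \<beta> d N c h e F' z = weight \<beta> d N c h e F z"
  using assms unfolding weight_def by simp

lemma law_full_random_order:
  fixes M :: "'w measure" and J :: "'w \<Rightarrow> real mat" and l :: "'w \<Rightarrow> real" and F :: "real \<Rightarrow> real"
  assumes b: "0 < \<beta>" and mn: "0 < m" "0 < n" and M: "prob_space M" and ens: "laguerre_beta_ensemble M \<beta> m n J"
    and F: "\<forall>t>0. 0 \<le> F t" and dl: "distributed M lborel l (\<lambda>t. ennreal (F t) * indicator {0<..} t)"
    and ind: "prob_space.indep_set M
           (sets (vimage_algebra (space M) (\<lambda>\<omega>. \<lambda>p\<in>{..<n} \<times> {..<n}. J \<omega> $$ p)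
              (\<Pi>\<^sub>M p\<in>{..<n} \<times> {..<n}. borel)))
           (sets (vimage_algebra (space M) l borel))"
    and nm: "n \<le> m"
  shows "random_order_law M (\<lambda>\<omega>. eigenvalues_mset (rank_one_perturbation n (J \<omega>) (l \<omega>))) n (law_full \<beta> n (param_a \<beta> m n) F)"
proof -
  obtain k where n: "n = Suc k" using mn(2) by (cases n) auto
  let ?a = "param_a \<beta> m n" and ?h = "\<lambda>z :: nat \<Rightarrow> complex. Re (\<Prod>j = 1..n. z j)"
  obtain F' where F'[measurable]: "F' \<in> borel_measurable borel" and FF': "\<And>t. t > 0 \<Longrightarrow> F' t = F t"
    using borel_version[OF F distributed_borel_measurable[OF dl]] by blast
  \<comment> \<open>The density without its Vandermonde factor, which the passage from roots to
    coefficients supplies.\<close>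
  define w where "w = weight \<beta> n n (1 / q_const \<beta> n ?a) ?h (\<beta> * ?a / 2) F'"
  have w[measurable]: "w \<in> borel_measurable (CC {1..n})"
    unfolding w_def by (intro measurable_weight measurable_Re_prod F')
  have wc: "w z = w z'" if "rootpoly n z = rootpoly n z'" for z z'
    unfolding w_def using prod_roots_cong[OF that, of "\<lambda>x. x"] by (intro weight_cong that) simp
  define f where "f z = ennreal (vandermonde n z) * (if sector 0 k (rootpoly n z) then ennreal (w z) else 0)" for z
  have [measurable]: "Measurable.pred (CC {1..n}) (\<lambda>z. sector 0 k (rootpoly n z))"
    by (rule measurable_compose[OF measurable_rootpoly pred_sector])
  have f[measurable]: "f \<in> borel_measurable (CC {1..n})"
    unfolding f_def by measurable
  have dom: "z \<in> domain_full n \<longleftrightarrow> sector 0 k (rootpoly n z)" for z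
    unfolding n by (rule domain_full_iff_sector)
  have "ennreal (density_full \<beta> n ?a F z) * indicator (domain_full n) z = f z" for z
  proof (cases "z \<in> domain_full n")
    case True
    have "(\<Sum>j = 1..n. Im (z j)) > 0" using True mn(2) unfolding domain_full_def by (intro sum_pos) auto
    from weight_F_cong[OF this FF']
    have "w z = weight \<beta> n n (1 / q_const \<beta> n ?a) ?h (\<beta> * ?a / 2) F z" unfolding w_def .
    then have "density_full \<beta> n ?a F z = vandermonde n z * w z" by (simp only: density_full_weight)
    then show ?thesis using True unfolding f_def dom by (simp add: dom ennreal_mult' vandermonde_nonneg)
  next
    case False
    then show ?thesis unfolding f_def by (simp add: dom)
  qed
  then have \<mu>: "law_full \<beta> n ?a F = density (CC {1..n}) f" unfolding law_full_def by simp
  have sets: "sets (density (CC {1..n}) f) = sets (\<Pi>\<^sub>M j\<in>{1..n}. borel)"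
    by (simp cong: sets_PiM_cong)
  have mb: "borel_measurable (\<Pi>\<^sub>M j\<in>{1..n}. borel) = borel_measurable (CC {1..n})"
    by (intro measurable_cong_sets) (simp_all cong: sets_PiM_cong)
  obtain p where p: "\<And>\<omega>. degree (p \<omega>) = Suc k" "\<And>\<omega>. lead_coeff (p \<omega>) = 1"
    and E: "AE \<omega> in M. eigenvalues_mset (rank_one_perturbation n (J \<omega>) (l \<omega>)) = proots (p \<omega>) + replicate_mset (n - Suc k) 0"
    and L: "\<And>G. G \<in> borel_measurable polyM \<Longrightarrow> (\<integral>\<^sup>+\<omega>. G (p \<omega>) \<partial>M) =
      (\<integral>\<^sup>+x. \<integral>\<^sup>+y. \<integral>\<^sup>+t. (\<Prod>j\<in>{1..<1 + Suc k - 0}. ennreal (chi_density (\<beta> * (real m - real j + 1)) (x j))) *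
         (\<Prod>j\<in>{1..<1 + k}. ennreal (chi_density (\<beta> * (real n - real j)) (y j))) *
         (ennreal (F t) * indicator {0<..} t) * G (perturbed_poly 0 k x y t) \<partial>lborel \<partial>LL {1..<1 + k} \<partial>LL {1..<1 + Suc k - 0})"
    using ensemble_law[OF mn M ens dl ind, of 0 k] nm n by blast
  show ?thesis unfolding \<mu>
  proof (rule random_order_lawI[OF sets])
    show "degree (p \<omega>) = n" "lead_coeff (p \<omega>) = 1" for \<omega> using p n by auto
    show "AE \<omega> in M. eigenvalues_mset (rank_one_perturbation n (J \<omega>) (l \<omega>)) = proots (p \<omega>)" using E n by simp
    fix G :: "complex poly \<Rightarrow> ennreal" assume G[measurable]: "G \<in> borel_measurable polyM"
    define H where "H q = (if sector 0 k q then ennreal (w (root_vec n q)) * G q else 0)" for q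
    have [measurable]: "(\<lambda>q. w (root_vec n q)) \<in> borel_measurable polyM"
      by (rule measurable_compose[OF measurable_root_vec w])
    have H[measurable]: "H \<in> borel_measurable polyM" unfolding H_def by measurable
    have Gr: "(\<lambda>z. G (rootpoly n z)) \<in> borel_measurable (CC {1..n})"
      by (rule measurable_compose[OF measurable_rootpoly G])
    have "(\<integral>\<^sup>+z. G (rootpoly n z) \<partial>density (CC {1..n}) f) = (\<integral>\<^sup>+z. f z * G (rootpoly n z) \<partial>CC {1..n})"
      by (rule nn_integral_density[OF f Gr])
    also have "\<dots> = (\<integral>\<^sup>+z. ennreal (vandermonde n z) * H (rootpoly n z) \<partial>CC {1..n})"
    proof (rule nn_integral_cong)
      fix z
      have "w (root_vec n (rootpoly n z)) = w z" by (intro wc rootpoly_root_vec rootpoly_monic)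
      then show "f z * G (rootpoly n z) = ennreal (vandermonde n z) * H (rootpoly n z)"
        by (simp add: f_def H_def mult.assoc)
    qed
    also have "\<dots> = ennreal (fact n) * (\<integral>\<^sup>+q. H (mpoly 0 n q) \<partial>CC {0..<n})"
      by (rule nn_integral_roots_coefficients[OF H])
    also have "(\<integral>\<^sup>+q. H (mpoly 0 n q) \<partial>CC {0..<n}) = (\<integral>\<^sup>+a. \<integral>\<^sup>+c. H (ripoly 0 k a c) \<partial>LL {0..<Suc k} \<partial>LL {0..<Suc k})"
      unfolding n by (rule nn_integral_ripoly_0[OF H, symmetric])
    also have "ennreal (fact n) * \<dots> = (\<integral>\<^sup>+\<omega>. G (p \<omega>) \<partial>M)"
      unfolding L[OF G] H_def n
    proof (rule jacobi_law[OF G])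
      show "w \<in> borel_measurable (CC {1..Suc k})" using w n by simp
      show "\<beta> * (real m - real j + 1) > 0" if "j \<in> {1..<1 + Suc k - 0}" for j using that nm n b by simp
      show "\<beta> * (real (Suc k) - real j) > 0" if "j \<in> {1..<1 + k}" for j using that b by simp
      fix x y :: "nat \<Rightarrow> real" and t :: real and z
      assume x: "\<And>j. j \<in> {1..<1 + Suc k - 0} \<Longrightarrow> x j > 0" and y: "\<And>j. j \<in> {1..<1 + k} \<Longrightarrow> y j > 0" and t: "t > 0"
        and z: "rootpoly (Suc k) z = perturbed_poly 0 k x y t"
      have ws: "w z = 1 / q_const \<beta> (Suc k) (param_a \<beta> m (Suc k)) *
        ((2 * t) ^ Suc k * (\<Prod>j\<in>{1..<1 + k}. (x j * y j) ^ (2 * (Suc k - j)))) powr (\<beta> / 2 - 1) *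
        exp (- (1 / 2) * ((\<Sum>j\<in>{1..<1 + Suc k}. (x j)\<^sup>2) + (\<Sum>j\<in>{1..<1 + k}. (y j)\<^sup>2))) *
        (\<Prod>j\<in>{1..<1 + Suc k}. (x j)\<^sup>2) powr (\<beta> * param_a \<beta> m (Suc k) / 2) * (F t / t powr (\<beta> * real (Suc k) / 2 - 1))"
        unfolding w_def weight_def n cmod_roots_minus_cnj[OF z t] sum_roots_perturbed_poly[OF z zero_le] Re_prod_roots_perturbed_poly[OF z]
          FF'[OF t] diff_zero ..
      show "fact (Suc k) * w z * (\<Prod>j\<in>{1..<1 + Suc k - 0}. 2 * x j ^ (2 * (k + 1 - 0 - j) + 1)) *
          (\<Prod>j\<in>{1..<1 + k}. 2 * y j ^ (2 * (k + 1 - 1 - j) + 1)) * t ^ k =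
        (\<Prod>j\<in>{1..<1 + Suc k - 0}. chi_density (\<beta> * (real m - real j + 1)) (x j)) *
          (\<Prod>j\<in>{1..<1 + k}. chi_density (\<beta> * (real (Suc k) - real j)) (y j)) * F t"
        using density_matching_full[OF b _ t, of k m x y "F t"] nm n x y unfolding ws by simp
    qed simp
    finally show "(\<integral>\<^sup>+\<omega>. G (p \<omega>) \<partial>M) = (\<integral>\<^sup>+z. G (rootpoly n z) \<partial>density (CC {1..n}) f)" by (rule sym)
  next
    fix \<sigma> A assume \<sigma>: "\<sigma> permutes {1..n}" and A: "A \<in> sets (\<Pi>\<^sub>M j\<in>{1..n}. (borel :: complex measure))"
    then have A': "A \<in> sets (CC {1..n})" by (simp cong: sets_PiM_cong)
    have i: "indicator A \<in> borel_measurable (CC {1..n})" using A' by measurable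
    have ip: "(\<lambda>z. indicator A (perm_vec n \<sigma> z) :: ennreal) \<in> borel_measurable (CC {1..n})"
      by (rule measurable_compose[OF measurable_perm_vec[OF \<sigma>] i])
    \<comment> \<open>Vandermonde factor, sector and weight are functions of the multiset of
      points.\<close>
    have fp: "f (perm_vec n \<sigma> z) = f z" for z
      unfolding f_def using wc[OF rootpoly_perm_vec[OF \<sigma>]] by (simp add: rootpoly_perm_vec[OF \<sigma>] vandermonde_perm_vec[OF \<sigma>])
    have "(\<integral>\<^sup>+z. indicator A (perm_vec n \<sigma> z) \<partial>density (CC {1..n}) f) = (\<integral>\<^sup>+z. f (perm_vec n \<sigma> z) * indicator A (perm_vec n \<sigma> z) \<partial>CC {1..n})"
      unfolding fp by (rule nn_integral_density[OF f ip])
    also have "\<dots> = (\<integral>\<^sup>+z. f z * indicator A z \<partial>CC {1..n})"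
      by (intro nn_integral_perm_vec[OF \<sigma>, of "\<lambda>z. f z * indicator A z"] borel_measurable_times_ennreal f i)
    also have "\<dots> = emeasure (density (CC {1..n}) f) A"
      by (rule emeasure_density[OF f A', symmetric])
    finally show "(\<integral>\<^sup>+z. indicator A (\<lambda>j\<in>{1..n}. z (\<sigma> j)) \<partial>density (CC {1..n}) f) = emeasure (density (CC {1..n}) f) A"
      unfolding perm_vec_def .
  qed
qed

text \<open>The law is an image under \<open>polar_point\<close>, so its integrals are taken over
  \<open>(r, \<theta>)\<close>; \<open>nn_integral_polar_sector\<close> translates them into
  integrals over coefficients. Exchangeability has to be shown in the thickened form, where all
  angles are free.\<close>

lemma law_deficient_random_order:
  fixes M :: "'w measure" and J :: "'w \<Rightarrow> real mat" and l :: "'w \<Rightarrow> real" and F :: "real \<Rightarrow> real"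
  assumes b: "0 < \<beta>" and mn: "0 < m" "0 < n" and M: "prob_space M" and ens: "laguerre_beta_ensemble M \<beta> m n J"
    and F: "\<forall>t>0. 0 \<le> F t" and dl: "distributed M lborel l (\<lambda>t. ennreal (F t) * indicator {0<..} t)"
    and ind: "prob_space.indep_set M
           (sets (vimage_algebra (space M) (\<lambda>\<omega>. \<lambda>p\<in>{..<n} \<times> {..<n}. J \<omega> $$ p)
              (\<Pi>\<^sub>M p\<in>{..<n} \<times> {..<n}. borel)))
           (sets (vimage_algebra (space M) l borel))"
    and nm: "m < n"
  shows "\<exists>Z. (AE \<omega> in M. eigenvalues_mset (rank_one_perturbation n (J \<omega>) (l \<omega>)) = Z \<omega> + replicate_mset (n - (m + 1)) 0) \<and>
    random_order_law M Z (m + 1) (law_deficient \<beta> m n F)"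
proof -
  let ?N = "Suc m" and ?P = "LL {1..Suc m} \<Otimes>\<^sub>M LL {1..m}"
  let ?z = "\<lambda>r \<theta>. polar_point m (r, \<theta>)"
  let ?q = "\<lambda>p. polar_point m p"
  let ?e = "\<beta> * (real n - real m - 1) / 2" and ?h = "\<lambda>z :: nat \<Rightarrow> complex. \<Prod>j = 1..Suc m. cmod (z j)"
  interpret sm: sigma_finite_measure "LL {1..m}" by (rule sigma_finite_PiM_lborel) simp
  obtain F' where F'[measurable]: "F' \<in> borel_measurable borel" and FF': "\<And>t. t > 0 \<Longrightarrow> F' t = F t"
    using borel_version[OF F distributed_borel_measurable[OF dl]] by blast
  define w where "w = weight \<beta> n ?N (1 / t_const \<beta> m n) ?h ?e F'"
  have w[measurable]: "w \<in> borel_measurable (CC {1..?N})"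
    unfolding w_def by (intro measurable_weight measurable_prod_cmod F')
  have wc: "w z = w z'" if "rootpoly ?N z = rootpoly ?N z'" for z z'
    unfolding w_def using prod_roots_cong[OF that, of cmod] by (intro weight_cong that)
  define f where "f p = indicator (polar_domain m) p * (ennreal (vandermonde ?N (?q p)) * ennreal (w (?q p)))" for p
  have vp: "(\<lambda>p. vandermonde ?N (?q p)) \<in> borel_measurable ?P"
    and wp: "(\<lambda>p. w (?q p)) \<in> borel_measurable ?P"
    by (rule measurable_compose[OF measurable_polar_point measurable_vandermonde], rule measurable_compose[OF measurable_polar_point w])
  have f[measurable]: "f \<in> borel_measurable ?P"
    using vp wp unfolding f_def by measurable
  have "ennreal (density_deficient \<beta> m n F (?q p)) * indicator (polar_domain m) p = f p" for p
  proof (cases "p \<in> polar_domain m")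
    case True
    have "(\<Sum>j = 1..?N. Im (?q p j)) > 0"
    proof (rule sum_pos)
      fix j assume j: "j \<in> {1..?N}"
      obtain r \<theta> where p: "p = (r, \<theta>)" by fastforce
      show "Im (?q p j) > 0"
        using True j unfolding p polar_domain_def polar_point_def by (auto intro!: mult_pos_pos sin_gt_zero)
    qed auto
    from weight_F_cong[OF this FF']
    have "w (?q p) = weight \<beta> n ?N (1 / t_const \<beta> m n) ?h ?e F (?q p)" unfolding w_def .
    then have "density_deficient \<beta> m n F (?q p) = vandermonde ?N (?q p) * w (?q p)"
      by (simp only: density_deficient_weight)
    then show ?thesis using True unfolding f_def by (simp add: ennreal_mult' vandermonde_nonneg)
  next
    case False
    then show ?thesis unfolding f_def by simp
  qed
  then have \<mu>: "law_deficient \<beta> m n F = distr (density ?P f) (\<Pi>\<^sub>M j\<in>{1..?N}. borel) (polar_point m)"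
    unfolding law_deficient_def Suc_eq_plus1[symmetric] by simp
  let ?\<mu> = "distr (density ?P f) (\<Pi>\<^sub>M j\<in>{1..?N}. borel) (polar_point m)"
  have sets_eq: "sets (CC {1..?N}) = sets (\<Pi>\<^sub>M j\<in>{1..?N}. borel)" by (intro sets_PiM_cong) simp_all
  have pm: "polar_point m \<in> density ?P f \<rightarrow>\<^sub>M (\<Pi>\<^sub>M j\<in>{1..?N}. borel)"
    unfolding measurable_cong_sets[OF sets_density sets_eq[symmetric]] by (rule measurable_polar_point)
  have int: "(\<integral>\<^sup>+z. g z \<partial>?\<mu>) = (\<integral>\<^sup>+r. \<integral>\<^sup>+\<theta>. indicator (polar_domain m) (r, \<theta>) *
      (ennreal (vandermonde ?N (?z r \<theta>)) * (ennreal (w (?z r \<theta>)) * g (?z r \<theta>))) \<partial>LL {1..m} \<partial>LL {1..?N})"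
    if g: "g \<in> borel_measurable (CC {1..?N})" for g
  proof -
    have gp: "(\<lambda>p. g (?q p)) \<in> borel_measurable ?P"
      by (rule measurable_compose[OF measurable_polar_point g])
    have "(\<integral>\<^sup>+z. g z \<partial>?\<mu>) = (\<integral>\<^sup>+p. g (?q p) \<partial>density ?P f)"
      using g pm by (intro nn_integral_distr) (simp_all only: measurable_distr_eq1 measurable_cong_sets[OF sets_eq refl])
    also have "\<dots> = (\<integral>\<^sup>+p. f p * g (?q p) \<partial>?P)"
      by (rule nn_integral_density[OF f gp])
    also have "\<dots> = (\<integral>\<^sup>+r. \<integral>\<^sup>+\<theta>. f (r, \<theta>) * g (?z r \<theta>) \<partial>LL {1..m} \<partial>LL {1..?N})"
      using f gp by (intro sm.nn_integral_fst[symmetric] borel_measurable_times_ennreal)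
    finally show ?thesis unfolding f_def by (simp only: mult.assoc)
  qed
  obtain p where p: "\<And>\<omega>. degree (p \<omega>) = Suc m" "\<And>\<omega>. lead_coeff (p \<omega>) = 1"
    and E: "AE \<omega> in M. eigenvalues_mset (rank_one_perturbation n (J \<omega>) (l \<omega>)) = proots (p \<omega>) + replicate_mset (n - Suc m) 0"
    and L: "\<And>G. G \<in> borel_measurable polyM \<Longrightarrow> (\<integral>\<^sup>+\<omega>. G (p \<omega>) \<partial>M) =
      (\<integral>\<^sup>+x. \<integral>\<^sup>+y. \<integral>\<^sup>+t. (\<Prod>j\<in>{1..<1 + Suc m - 1}. ennreal (chi_density (\<beta> * (real m - real j + 1)) (x j))) *
         (\<Prod>j\<in>{1..<1 + m}. ennreal (chi_density (\<beta> * (real n - real j)) (y j))) *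
         (ennreal (F t) * indicator {0<..} t) * G (perturbed_poly 1 m x y t) \<partial>lborel \<partial>LL {1..<1 + m} \<partial>LL {1..<1 + Suc m - 1})"
    using ensemble_law[OF mn M ens dl ind, of 1 m] nm by blast
  have "random_order_law M (\<lambda>\<omega>. proots (p \<omega>)) ?N ?\<mu>"
  proof (rule random_order_lawI)
    show "sets ?\<mu> = sets (\<Pi>\<^sub>M j\<in>{1..?N}. borel)" by (rule sets_distr)
    show "degree (p \<omega>) = ?N" "lead_coeff (p \<omega>) = 1" for \<omega> using p by auto
    show "AE \<omega> in M. proots (p \<omega>) = proots (p \<omega>)" by simp
    fix G :: "complex poly \<Rightarrow> ennreal" assume G[measurable]: "G \<in> borel_measurable polyM"
    have [measurable]: "(\<lambda>q. w (root_vec ?N q)) \<in> borel_measurable polyM"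
      by (rule measurable_compose[OF measurable_root_vec w])
    have H: "(\<lambda>q. ennreal (w (root_vec ?N q)) * G q) \<in> borel_measurable polyM" by measurable
    have wr: "w (root_vec ?N (rootpoly ?N z)) = w z" for z by (intro wc rootpoly_root_vec rootpoly_monic)
    have "(\<integral>\<^sup>+z. G (rootpoly ?N z) \<partial>?\<mu>) = (\<integral>\<^sup>+r. \<integral>\<^sup>+\<theta>. indicator (polar_domain m) (r, \<theta>) *
      (ennreal (vandermonde ?N (?z r \<theta>)) * (ennreal (w (?z r \<theta>)) * G (rootpoly ?N (?z r \<theta>)))) \<partial>LL {1..m} \<partial>LL {1..?N})"
      by (rule int[OF measurable_compose[OF measurable_rootpoly G]])
    also have "\<dots> = ennreal (fact ?N) * (\<integral>\<^sup>+a. \<integral>\<^sup>+c. (if sector 1 m (ripoly 1 m a c)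
        then ennreal (w (root_vec ?N (ripoly 1 m a c))) * G (ripoly 1 m a c) else 0) \<partial>LL {0..<?N} \<partial>LL {1..<?N})"
      using nn_integral_polar_sector[OF H, of m] unfolding wr .
    also have "\<dots> = (\<integral>\<^sup>+\<omega>. G (p \<omega>) \<partial>M)"
      unfolding L[OF G]
    proof (rule jacobi_law[OF G w])
      show "\<beta> * (real m - real j + 1) > 0" if "j \<in> {1..<1 + Suc m - 1}" for j using that b by simp
      show "\<beta> * (real n - real j) > 0" if "j \<in> {1..<1 + m}" for j using that nm b by simp
      fix x y :: "nat \<Rightarrow> real" and t :: real and z
      assume x: "\<And>j. j \<in> {1..<1 + Suc m - 1} \<Longrightarrow> x j > 0" and y: "\<And>j. j \<in> {1..<1 + m} \<Longrightarrow> y j > 0" and t: "t > 0"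
        and z: "rootpoly ?N z = perturbed_poly 1 m x y t"
      have i: "{1..<1 + Suc m - 1} = {1..<1 + m}" by simp
      have ws: "w z = 1 / t_const \<beta> m n *
        ((2 * t) ^ Suc m * (\<Prod>j\<in>{1..<1 + m}. (x j * y j) ^ (2 * (Suc m - j)))) powr (\<beta> / 2 - 1) *
        exp (- (1 / 2) * ((\<Sum>j\<in>{1..<1 + m}. (x j)\<^sup>2) + (\<Sum>j\<in>{1..<1 + m}. (y j)\<^sup>2))) *
        (t * (\<Prod>j\<in>{1..<1 + m}. (y j)\<^sup>2)) powr ?e * (F t / t powr (\<beta> * real n / 2 - 1))"
        unfolding w_def weight_def cmod_roots_minus_cnj[OF z t] sum_roots_perturbed_poly[OF z order_refl] cmod_prod_roots_perturbed_poly[OF z t]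
          FF'[OF t] i ..
      show "fact ?N * w z * (\<Prod>j\<in>{1..<1 + Suc m - 1}. 2 * x j ^ (2 * (m + 1 - 1 - j) + 1)) *
          (\<Prod>j\<in>{1..<1 + m}. 2 * y j ^ (2 * (m + 1 - 1 - j) + 1)) * t ^ m =
        (\<Prod>j\<in>{1..<1 + Suc m - 1}. chi_density (\<beta> * (real m - real j + 1)) (x j)) *
          (\<Prod>j\<in>{1..<1 + m}. chi_density (\<beta> * (real n - real j)) (y j)) * F t"
        unfolding ws i by (rule density_matching_deficient[OF b mn(1) nm t x[unfolded i] y])
    qed simp
    finally show "(\<integral>\<^sup>+\<omega>. G (p \<omega>) \<partial>M) = (\<integral>\<^sup>+z. G (rootpoly ?N z) \<partial>?\<mu>)" by (rule sym)
  next
    fix \<sigma> A assume \<sigma>: "\<sigma> permutes {1..?N}" and A: "A \<in> sets (\<Pi>\<^sub>M j\<in>{1..?N}. (borel :: complex measure))"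
    then have A': "A \<in> sets (CC {1..?N})" unfolding sets_eq by simp
    define g :: "(nat \<Rightarrow> complex) \<Rightarrow> ennreal" where "g = indicator A"
    have g: "g \<in> borel_measurable (CC {1..?N})" unfolding g_def using A' by measurable
    have gp: "(\<lambda>z. g (perm_vec ?N \<sigma> z)) \<in> borel_measurable (CC {1..?N})"
      by (rule measurable_compose[OF measurable_perm_vec[OF \<sigma>] g])
    \<comment> \<open>Dividing by the product of the moduli compensates the radial factors of
      \<open>nn_integral_slice\<close>, so that twice an integral against the law is a thickened
      integral on which permutations act.\<close>
    define K where "K g z = ennreal (1 / (\<Prod>j = 1..?N. cmod (z j))) * (ennreal (vandermonde ?N z) * (ennreal (w z) * g z))" for g z
    have K: "K g \<in> borel_measurable (CC {1..?N})" if "g \<in> borel_measurable (CC {1..?N})" for g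
      using that measurable_prod_cmod[of ?N] unfolding K_def by measurable
    have slice: "2 * (\<integral>\<^sup>+z. g z \<partial>?\<mu>) = (\<integral>\<^sup>+z. slice_integrand m (K g) z \<partial>CC {1..?N})"
      if g: "g \<in> borel_measurable (CC {1..?N})" for g
    proof -
      have "indicator (polar_domain m) (r, \<theta>) * (ennreal (\<Prod>j = 1..?N. r j) * K g (?z r \<theta>)) =
        indicator (polar_domain m) (r, \<theta>) * (ennreal (vandermonde ?N (?z r \<theta>)) *
          (ennreal (w (?z r \<theta>)) * g (?z r \<theta>)))" for r \<theta>
      proof (cases "(r, \<theta>) \<in> polar_domain m")
        case True
        then have r: "\<And>j. j \<in> {1..?N} \<Longrightarrow> r j > 0" unfolding polar_domain_def by auto
        have c: "(\<Prod>j = 1..?N. cmod (?z r \<theta> j)) = (\<Prod>j = 1..?N. r j)"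
          using r by (intro prod.cong) (auto simp: polar_point_def abs_of_pos)
        have "(\<Prod>j = 1..?N. r j) > 0" by (intro prod_pos r) simp
        from ennreal_mult_inverse_real[OF this] show ?thesis unfolding K_def c by (simp only: mult.assoc[symmetric] mult_1_right)
      qed simp
      then show ?thesis unfolding int[OF g] nn_integral_slice[OF K[OF g]] by simp
    qed
    have Kp: "K (\<lambda>z. g (perm_vec ?N \<sigma> z)) = (\<lambda>z. K g (perm_vec ?N \<sigma> z))"
    proof
      fix z
      have "(\<Prod>j = 1..?N. cmod (perm_vec ?N \<sigma> z j)) = (\<Prod>j = 1..?N. cmod (z j))"
        by (rule prod_roots_cong[OF rootpoly_perm_vec[OF \<sigma>]])
      then show "K (\<lambda>z. g (perm_vec ?N \<sigma> z)) z = K g (perm_vec ?N \<sigma> z)"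
        unfolding K_def vandermonde_perm_vec[OF \<sigma>] wc[OF rootpoly_perm_vec[OF \<sigma>]] by (simp only:)
    qed
    have "2 * (\<integral>\<^sup>+z. g (perm_vec ?N \<sigma> z) \<partial>?\<mu>) = (\<integral>\<^sup>+z. slice_integrand m (K g) (perm_vec ?N \<sigma> z) \<partial>CC {1..?N})"
      unfolding slice[OF gp] Kp slice_integrand_perm_vec[OF \<sigma> K[OF g]] ..
    also have "\<dots> = 2 * (\<integral>\<^sup>+z. g z \<partial>?\<mu>)"
      unfolding slice[OF g] by (rule nn_integral_perm_vec[OF \<sigma> measurable_slice_integrand[OF K[OF g]]])
    finally have "(\<integral>\<^sup>+z. g (perm_vec ?N \<sigma> z) \<partial>?\<mu>) = (\<integral>\<^sup>+z. g z \<partial>?\<mu>)"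
      by (simp add: ennreal_mult_cancel_left)
    also have "\<dots> = emeasure ?\<mu> A" unfolding g_def using A by (intro nn_integral_indicator) (simp only: sets_distr)
    finally show "(\<integral>\<^sup>+z. indicator A (\<lambda>j\<in>{1..?N}. z (\<sigma> j)) \<partial>?\<mu>) = emeasure ?\<mu> A"
      unfolding g_def perm_vec_def .
  qed
  then show ?thesis using E unfolding \<mu> Suc_eq_plus1[symmetric]
    by (intro exI[of _ "\<lambda>\<omega>. proots (p \<omega>)"] conjI)
qed

theorem theorem3:
  fixes \<beta> :: real and m n :: nat
    and M :: "'w measure" and J :: "'w \<Rightarrow> real mat" and l :: "'w \<Rightarrow> real" and F :: "real \<Rightarrow> real"
  assumes "0 < \<beta>" and "0 < m" and "0 < n"
    and "prob_space M"
    and "laguerre_beta_ensemble M \<beta> m n J"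
    and "\<forall>t>0. 0 \<le> F t"
    and "distributed M lborel l (\<lambda>t. ennreal (F t) * indicator {0<..} t)"
    and "prob_space.indep_set M
           (sets (vimage_algebra (space M) (\<lambda>\<omega>. \<lambda>p\<in>{..<n} \<times> {..<n}. J \<omega> $$ p)
              (\<Pi>\<^sub>M p\<in>{..<n} \<times> {..<n}. borel)))
           (sets (vimage_algebra (space M) l borel))"
  shows "(n \<le> m \<longrightarrow>
            random_order_law M (\<lambda>\<omega>. eigenvalues_mset (rank_one_perturbation n (J \<omega>) (l \<omega>))) n
              (law_full \<beta> n (param_a \<beta> m n) F)) \<and>
         (m \<le> n - 1 \<longrightarrow>
            (\<exists>Z. (AE \<omega> in M. eigenvalues_mset (rank_one_perturbation n (J \<omega>) (l \<omega>)) =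
                              Z \<omega> + replicate_mset (n - (m + 1)) 0) \<and>
                 random_order_law M Z (m + 1) (law_deficient \<beta> m n F)))"
proof (intro conjI impI)
  assume "n \<le> m"
  then show "random_order_law M (\<lambda>\<omega>. eigenvalues_mset (rank_one_perturbation n (J \<omega>) (l \<omega>))) n (law_full \<beta> n (param_a \<beta> m n) F)"
    by (rule law_full_random_order[OF assms])
next
  assume "m \<le> n - 1"
  \<comment> \<open>\<open>n - 1\<close> is a truncated difference of natural numbers, so the strict
    inequality uses \<open>0 < n\<close>.\<close>
  then have "m < n" using \<open>0 < n\<close> by linarith
  then show "\<exists>Z. (AE \<omega> in M. eigenvalues_mset (rank_one_perturbation n (J \<omega>) (l \<omega>)) = Z \<omega> + replicate_mset (n - (m + 1)) 0) \<and>
      random_order_law M Z (m + 1) (law_deficient \<beta> m n F)"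
    by (rule law_deficient_random_order[OF assms])
qed

end
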